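(* Let $U\cong\mathbb{R}^d$, $\Lambda\subseteq U$ a lattice, and $X=(x_1,\dots,x_N)\subseteq\Lambda$ a finite list spanning $U$ with $0$ not in the convex hull of $X$. Then $$\mathcal{P}^{\mathrm{per}}_-(X)=\{p\in\mathcal{P}^{\mathrm{per}}(X): p(D)T_X\text{ is continuous at every point of }\Lambda\}.$$
   Context: **Basic setup.** Lists may contain repetitions. $V=U^*$. Via a basis of $\Lambda$, identify $\mathrm{Sym}(U)=\mathbb{R}[s_1,\dots,s_d]$ and $\mathrm{Sym}(V)=\mathbb{R}[t_1,\dots,t_d]$. Elements $q\in\mathrm{Sym}(U_{\mathbb{C}})$ act on polynomials as constant-coefficient differential operators $q(D)$ ($s_i\mapsto\partial/\partial t_i$). For $\eta\in V$, $D_\eta$ denotes the derivation of $\mathrm{Sym}(U)$ extending $u\mapsto\eta(u)$. For $u\in U$, $p_u$ is the corresponding linear form, and $p_Y=\prod_{y\in Y}p_y$. **Central periodic $\mathcal{P}$-space.** For $Y$ spanning $U$, $\mathcal{P}(Y)=\operatorname{span}\{p_Z:Z\subseteq Y,\ Y\setminus Z\text{ spans }U\}$. Let $T(\Lambda)=\mathrm{Hom}(\Lambda,S^1)$ and $\mathcal{V}(X)=\{e_\phi\in T(\Lambda): e_\phi(b)=1\ \forall b\in B$ for some basis $B\subseteq X$ of $U\}$, and let $X_\phi=(x\in X:e_\phi(x)=1)$. Then $$\mathcal{P}^{\mathrm{per}}(X)=\bigoplus_{e_\phi\in\mathcal{V}(X)}e_\phi\,p_{X\setminus X_\phi}\mathcal{P}(X_\phi).$$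 For $p=\sum_\phi e_\phi q_\phi$ and $\lambda\in\Lambda$, $p(\lambda,\cdot)=\sum_\phi e_\phi(\lambda)q_\phi\in\mathrm{Sym}(U_{\mathbb{C}})$. **Internal periodic $\mathcal{P}$-space.** Let $\mathcal{H}(X)$ be the set of hyperplanes of $U$ spanned by sublists of $X$. For $H\in\mathcal{H}(X)$, let $\eta_H\in V$ be a nonzero normal vector (vanishing on $H$) and $m(H)=|\{x\in X:x\notin H\}|$. Then $$\mathcal{P}^{\mathrm{per}}_-(X)=\{p\in\mathcal{P}^{\mathrm{per}}(X): D_{\eta_H}^{m(H)-1}p(\lambda,\cdot)=0\text{ for all }H\in\mathcal{H}(X),\ \lambda\in H\cap\Lambda\}.$$ **Spline and alcoves.** $T_X(u)=\det(XX^T)^{-1/2}\mathrm{vol}_{N-d}\{w\in\mathbb{R}^N_{\ge0}:Xw=u\}$. An alcove is a connected component of the complement of the union of all translates by $\Lambda$ of hyperplanes spanned by sublists of $X$. $T_X$ agrees with a polynomial $T_X^{\mathfrak c}$ on each alcove $\mathfrak c$. **Continuity.** $p(D)T_X$ is continuous at $\lambda\in\Lambda$ if $(p(\lambda,\cdot)(D)T_X^{\mathfrak c})(\lambda)$ takes the same value for all alcoves $\mathfrak c$ whose closure contains $\lambda$. *)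

theory Defs
  imports "HOL-Analysis.Analysis" "HOL-Library.Poly_Mapping"
begin

section \<open>Lattices and coordinates\<close>

definition lattice_basis :: "'a::euclidean_space set \<Rightarrow> ('n::finite \<Rightarrow> 'a) \<Rightarrow> bool" where
  "lattice_basis \<Lambda> b \<longleftrightarrow>
     inj b \<and> independent (range b) \<and> span (range b) = UNIV \<and>
     \<Lambda> = {\<Sum>i\<in>UNIV. of_int (z i) *\<^sub>R b i | z :: 'n \<Rightarrow> int. True}"

definition coord :: "('n \<Rightarrow> 'a::euclidean_space) \<Rightarrow> 'a \<Rightarrow> 'n \<Rightarrow> real" where
  "coord b u i = representation (range b) u (b i)"

section \<open>The symmetric algebras as polynomial rings\<close>

text \<open>Both \<open>Sym (U\<^sub>\<complex>)\<close>, with variables \<open>s\<^sub>i\<close> corresponding to the lattice basis vectors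
  \<open>b i\<close>, and \<open>Sym (V\<^sub>\<complex>)\<close>, with variables \<open>t\<^sub>i\<close> corresponding to the dual basis, are
  represented by the following polynomial ring; its multiplication is the convolution
  product provided by the library on finitely supported functions.\<close>

type_synonym 'n cpoly = "('n \<Rightarrow>\<^sub>0 nat) \<Rightarrow>\<^sub>0 complex"

definition const :: "complex \<Rightarrow> 'n cpoly" where
  "const c = Poly_Mapping.single 0 c"

definition var :: "'n \<Rightarrow> 'n cpoly" where
  "var i = Poly_Mapping.single (Poly_Mapping.single i 1) 1"

abbreviation cspan :: "'n cpoly set \<Rightarrow> 'n cpoly set" where
  "cspan \<equiv> module.span (\<lambda>c q. const c * q)"

text \<open>\<open>pdiff m\<close> is the iterated partial derivative with exponent vector \<open>m\<close>: a monomial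
  with exponent vector \<open>k\<close> is sent to the product of the falling factorials
  \<open>k\<^sub>i (k\<^sub>i - 1) \<dots> (k\<^sub>i - m\<^sub>i + 1)\<close> times the monomial with exponent vector \<open>k - m\<close>. The
  subtraction of exponents truncates only where the coefficient vanishes.\<close>

definition pdiff :: "('n::finite \<Rightarrow>\<^sub>0 nat) \<Rightarrow> 'n cpoly \<Rightarrow> 'n cpoly" where
  "pdiff m f =
     (\<Sum>k\<in>Poly_Mapping.keys f.
        Poly_Mapping.single (k - m)
          (Poly_Mapping.lookup f k *
           (\<Prod>i\<in>UNIV. \<Prod>j<Poly_Mapping.lookup m i.
              of_nat (Poly_Mapping.lookup k i) - of_nat j)))"

text \<open>\<open>q(D)\<close>, obtained from \<open>q \<in> Sym (U\<^sub>\<complex>)\<close> by substituting \<open>\<partial>/\<partial>t\<^sub>i\<close> for \<open>s\<^sub>i\<close>.\<close>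

definition diff_op :: "'n::finite cpoly \<Rightarrow> 'n cpoly \<Rightarrow> 'n cpoly" where
  "diff_op q f = (\<Sum>m\<in>Poly_Mapping.keys q. const (Poly_Mapping.lookup q m) * pdiff m f)"

definition peval :: "('n::finite \<Rightarrow> 'a::euclidean_space) \<Rightarrow> 'n cpoly \<Rightarrow> 'a \<Rightarrow> complex" where
  "peval b f u =
     (\<Sum>m\<in>Poly_Mapping.keys f. Poly_Mapping.lookup f m *
        (\<Prod>i\<in>UNIV. complex_of_real (coord b u i) ^ Poly_Mapping.lookup m i))"

definition lin_form :: "('n::finite \<Rightarrow> 'a::euclidean_space) \<Rightarrow> 'a \<Rightarrow> 'n cpoly" where
  "lin_form b u = (\<Sum>i\<in>UNIV. const (of_real (coord b u i)) * var i)"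

text \<open>The derivation \<open>D\<^sub>\<eta>\<close> of \<open>Sym U\<close>: since the variable \<open>s\<^sub>i\<close> is the vector \<open>b i\<close>, the
  derivation extending \<open>\<eta>\<close> is the sum of the \<open>\<eta> (b i) \<partial>/\<partial>s\<^sub>i\<close>
  (see \<open>dir_deriv_mult\<close> and \<open>dir_deriv_lin_form\<close> below).\<close>

definition dir_deriv ::
    "('n::finite \<Rightarrow> 'a::euclidean_space) \<Rightarrow> ('a \<Rightarrow> real) \<Rightarrow> 'n cpoly \<Rightarrow> 'n cpoly" where
  "dir_deriv b \<eta> q =
     (\<Sum>i\<in>UNIV. const (of_real (\<eta> (b i))) * pdiff (Poly_Mapping.single i 1) q)"

section \<open>Periodic P-spaces\<close>

text \<open>Sublists of the list \<open>X\<close> are represented by sets of positions, so that repeated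
  entries are kept apart.\<close>

definition entries :: "'a list \<Rightarrow> nat set \<Rightarrow> 'a set" where
  "entries X I = (\<lambda>j. X ! j) ` I"

definition prod_form ::
    "('n::finite \<Rightarrow> 'a::euclidean_space) \<Rightarrow> 'a list \<Rightarrow> nat set \<Rightarrow> 'n cpoly" where
  "prod_form b X I = (\<Prod>j\<in>I. lin_form b (X ! j))"

definition central_P ::
    "('n::finite \<Rightarrow> 'a::euclidean_space) \<Rightarrow> 'a list \<Rightarrow> nat set \<Rightarrow> 'n cpoly set" where
  "central_P b X I = cspan {prod_form b X Z | Z. Z \<subseteq> I \<and> span (entries X (I - Z)) = UNIV}"

text \<open>The characters of \<open>\<Lambda>\<close> are extensional functions (undefined off \<open>\<Lambda>\<close>), so that
  characters agreeing on \<open>\<Lambda>\<close> are equal.\<close>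

definition torus :: "'a::euclidean_space set \<Rightarrow> ('a \<Rightarrow> complex) set" where
  "torus \<Lambda> = {e \<in> \<Lambda> \<rightarrow>\<^sub>E sphere 0 1. \<forall>x\<in>\<Lambda>. \<forall>y\<in>\<Lambda>. e (x + y) = e x * e y}"

definition toric_vertices :: "'a::euclidean_space set \<Rightarrow> 'a list \<Rightarrow> ('a \<Rightarrow> complex) set" where
  "toric_vertices \<Lambda> X =
     {e \<in> torus \<Lambda>. \<exists>B \<subseteq> set X. independent B \<and> span B = UNIV \<and> (\<forall>x\<in>B. e x = 1)}"

definition fixed_positions :: "'a list \<Rightarrow> ('a \<Rightarrow> complex) \<Rightarrow> nat set" where
  "fixed_positions X e = {j. j < length X \<and> e (X ! j) = 1}"

text \<open>An element \<open>\<Sum>\<phi>. e\<^sub>\<phi> q\<^sub>\<phi>\<close> of the direct sum of copies of \<open>Sym (U\<^sub>\<complex>)\<close> indexed by the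
  characters is the finitely supported map sending \<open>e\<^sub>\<phi>\<close> to \<open>q\<^sub>\<phi>\<close>.\<close>

type_synonym ('a, 'n) per_poly = "('a \<Rightarrow> complex) \<Rightarrow>\<^sub>0 'n cpoly"

definition periodic_P ::
    "'a::euclidean_space set \<Rightarrow> ('n::finite \<Rightarrow> 'a) \<Rightarrow> 'a list \<Rightarrow> ('a, 'n) per_poly set" where
  "periodic_P \<Lambda> b X =
     {p. Poly_Mapping.keys p \<subseteq> toric_vertices \<Lambda> X \<and>
         (\<forall>e\<in>toric_vertices \<Lambda> X.
            Poly_Mapping.lookup p e \<in>
              (\<lambda>q. prod_form b X ({..<length X} - fixed_positions X e) * q)
                ` central_P b X (fixed_positions X e))}"

definition local_part :: "('a, 'n) per_poly \<Rightarrow> 'a \<Rightarrow> 'n cpoly" where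
  "local_part p u = (\<Sum>e\<in>Poly_Mapping.keys p. const (e u) * Poly_Mapping.lookup p e)"

definition hyperplanes :: "'a::euclidean_space list \<Rightarrow> 'a set set" where
  "hyperplanes X = {H. dim H = DIM('a) - 1 \<and> (\<exists>Y \<subseteq> set X. H = span Y)}"

definition mult_off :: "'a list \<Rightarrow> 'a set \<Rightarrow> nat" where
  "mult_off X H = card {j. j < length X \<and> X ! j \<notin> H}"

text \<open>The normal functional of a hyperplane is unique up to a nonzero factor, which does not
  affect the condition; hence quantifying over all normals amounts to fixing one.\<close>

definition internal_periodic_P ::
    "'a::euclidean_space set \<Rightarrow> ('n::finite \<Rightarrow> 'a) \<Rightarrow> 'a list \<Rightarrow> ('a, 'n) per_poly set" where
  "internal_periodic_P \<Lambda> b X =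
     {p \<in> periodic_P \<Lambda> b X.
        \<forall>H\<in>hyperplanes X. \<forall>\<eta>. linear \<eta> \<and> \<eta> \<noteq> (\<lambda>_. 0) \<and> (\<forall>h\<in>H. \<eta> h = 0) \<longrightarrow>
          (\<forall>u\<in>H \<inter> \<Lambda>. (dir_deriv b \<eta> ^^ (mult_off X H - 1)) (local_part p u) = 0)}"

section \<open>The multivariate spline\<close>

text \<open>The \<open>k\<close>-dimensional volume of a subset \<open>S\<close> of a \<open>k\<close>-dimensional affine subspace of
  \<open>\<real>\<^sup>N\<close>: \<open>S\<close> is pulled back to \<open>\<real>\<^sup>k\<close> along an affine isometric embedding whose image
  contains \<open>S\<close>. The result does not depend on the embedding. Vectors in \<open>\<real>\<^sup>N\<close> are functions on
  \<open>{..<N}\<close>, extended by \<open>undefined\<close>. For \<open>k = 0\<close> this is counting measure.\<close>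

definition affine_emb ::
    "nat \<Rightarrow> nat \<Rightarrow> (nat \<Rightarrow> real) \<Rightarrow> (nat \<Rightarrow> nat \<Rightarrow> real) \<Rightarrow> (nat \<Rightarrow> real) \<Rightarrow> (nat \<Rightarrow> real)" where
  "affine_emb N k a v c = (\<lambda>l\<in>{..<N}. a l + (\<Sum>i<k. c i * v i l))"

definition orthonormal :: "nat \<Rightarrow> nat \<Rightarrow> (nat \<Rightarrow> nat \<Rightarrow> real) \<Rightarrow> bool" where
  "orthonormal N k v \<longleftrightarrow>
     (\<forall>i<k. \<forall>j<k. (\<Sum>l<N. v i l * v j l) = (if i = j then 1 else 0))"

definition affine_vol :: "nat \<Rightarrow> nat \<Rightarrow> (nat \<Rightarrow> real) set \<Rightarrow> real" where
  "affine_vol N k S =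
     (let (a, v) = (SOME (a, v). orthonormal N k v \<and> S \<subseteq> range (affine_emb N k a v))
      in measure (PiM {..<k} (\<lambda>_. lborel))
           {c \<in> {..<k} \<rightarrow>\<^sub>E UNIV. affine_emb N k a v c \<in> S})"

definition gram :: "('n::finite \<Rightarrow> 'a::euclidean_space) \<Rightarrow> 'a list \<Rightarrow> real ^ 'n ^ 'n" where
  "gram b X = (\<chi> i k. \<Sum>j<length X. coord b (X ! j) i * coord b (X ! j) k)"

text \<open>In \<open>det (X X\<^sup>T)\<close> the list \<open>X\<close> is the matrix of coordinates with respect to \<open>b\<close>.\<close>

definition spline :: "('n::finite \<Rightarrow> 'a::euclidean_space) \<Rightarrow> 'a list \<Rightarrow> 'a \<Rightarrow> real" where
  "spline b X u =
     affine_vol (length X) (length X - DIM('a))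
       {w \<in> {..<length X} \<rightarrow>\<^sub>E {0..}. (\<Sum>j<length X. w j *\<^sub>R X ! j) = u}
     / sqrt (det (gram b X))"

definition alcoves :: "'a::euclidean_space set \<Rightarrow> 'a list \<Rightarrow> 'a set set" where
  "alcoves \<Lambda> X = components (- (\<Union>H\<in>hyperplanes X. \<Union>x\<in>\<Lambda>. (+) x ` H))"

definition local_spline ::
    "('n::finite \<Rightarrow> 'a::euclidean_space) \<Rightarrow> 'a list \<Rightarrow> 'a set \<Rightarrow> 'n cpoly" where
  "local_spline b X C = (THE f. \<forall>u\<in>C. peval b f u = of_real (spline b X u))"

definition spline_continuous_at ::
    "'a::euclidean_space set \<Rightarrow> ('n::finite \<Rightarrow> 'a) \<Rightarrow> 'a list \<Rightarrow> ('a, 'n) per_poly \<Rightarrow> 'a \<Rightarrow> bool"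
  where
  "spline_continuous_at \<Lambda> b X p u \<longleftrightarrow>
     (\<exists>c. \<forall>C\<in>alcoves \<Lambda> X. u \<in> closure C \<longrightarrow>
        peval b (diff_op (local_part p u) (local_spline b X C)) u = c)"

section \<open>Basic properties\<close>

lemma vector_space_cpoly: "vector_space (\<lambda>c (q :: 'n cpoly). const c * q)"
  by unfold_locales
    (simp_all add: const_def algebra_simps single_add mult_single flip: mult.assoc)

lemma pdiff_eq:
  assumes "finite S" "Poly_Mapping.keys f \<subseteq> S"
  shows "pdiff m f = (\<Sum>k\<in>S. Poly_Mapping.single (k - m)
          (Poly_Mapping.lookup f k *
           (\<Prod>i\<in>UNIV. \<Prod>j<Poly_Mapping.lookup m i.
              of_nat (Poly_Mapping.lookup k i) - of_nat j)))"
  unfolding pdiff_def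
  by (rule sum.mono_neutral_left) (use assms in \<open>auto simp: in_keys_iff\<close>)

lemma pdiff_add: "pdiff m (f + g) = pdiff m f + pdiff m g"
proof -
  let ?S = "Poly_Mapping.keys f \<union> Poly_Mapping.keys g"
  show ?thesis
    using Poly_Mapping.keys_add[of f g]
    by (simp add: pdiff_eq[of ?S] lookup_add distrib_right single_add sum.distrib)
qed

lemma pdiff_zero [simp]: "pdiff m 0 = 0"
  by (simp add: pdiff_def)

lemma pdiff_single:
  "pdiff m (Poly_Mapping.single k c) = Poly_Mapping.single (k - m)
     (c * (\<Prod>i\<in>UNIV. \<Prod>j<Poly_Mapping.lookup m i.
              of_nat (Poly_Mapping.lookup k i) - of_nat j))"
  by (subst pdiff_eq[of "{k}"]) auto

lemma pdiff_var:
  "pdiff (Poly_Mapping.single i 1) (Poly_Mapping.single k c) =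
     Poly_Mapping.single (k - Poly_Mapping.single i 1) (c * of_nat (Poly_Mapping.lookup k i))"
proof -
  have "(\<Prod>i'\<in>UNIV. \<Prod>j<Poly_Mapping.lookup (Poly_Mapping.single i (1::nat)) i'.
          of_nat (Poly_Mapping.lookup k i') - of_nat j :: complex)
      = (\<Prod>i'\<in>UNIV. if i' = i then of_nat (Poly_Mapping.lookup k i') else 1)"
    by (intro prod.cong refl) (auto simp: lookup_single when_def)
  then show ?thesis by (simp add: pdiff_single)
qed

lemma poly_mapping_single_induct [case_names zero single add]:
  fixes f :: "'k \<Rightarrow>\<^sub>0 'b::comm_monoid_add"
  assumes "P 0" "\<And>k c. P (Poly_Mapping.single k c)" "\<And>f g. P f \<Longrightarrow> P g \<Longrightarrow> P (f + g)"
  shows "P f"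
proof (induction f rule: update_induct)
  case const
  then show ?case by (rule assms(1))
next
  case (update f k c)
  have "Poly_Mapping.update k c f = f + Poly_Mapping.single k c"
    using update by (intro poly_mapping_eqI)
      (auto simp: lookup_update lookup_add lookup_single when_def in_keys_iff)
  then show ?case using assms(2,3) update by metis
qed

lemma pdiff_mult:
  "pdiff (Poly_Mapping.single i 1) (f * g) =
     pdiff (Poly_Mapping.single i 1) f * g + f * pdiff (Poly_Mapping.single i 1) g"
proof (induction f rule: poly_mapping_single_induct)
  case (single k c)
  let ?e = "Poly_Mapping.single i (1::nat)"
  show ?case
  proof (induction g rule: poly_mapping_single_induct)
    case (single l d)
    have 1: "Poly_Mapping.single (k + l - ?e) (c * d * of_nat (Poly_Mapping.lookup k i)) =
        Poly_Mapping.single (k - ?e + l) (c * d * of_nat (Poly_Mapping.lookup k i))"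
    proof (cases "Poly_Mapping.lookup k i = 0")
      case False
      then have "k + l - ?e = k - ?e + l"
        by (intro poly_mapping_eqI)
          (auto simp: lookup_add lookup_minus lookup_single when_def)
      then show ?thesis by simp
    qed simp
    have 2: "Poly_Mapping.single (k + l - ?e) (c * d * of_nat (Poly_Mapping.lookup l i)) =
        Poly_Mapping.single (k + (l - ?e)) (c * d * of_nat (Poly_Mapping.lookup l i))"
    proof (cases "Poly_Mapping.lookup l i = 0")
      case False
      then have "k + l - ?e = k + (l - ?e)"
        by (intro poly_mapping_eqI)
          (auto simp: lookup_add lookup_minus lookup_single when_def)
      then show ?thesis by simp
    qed simp
    have "pdiff ?e (Poly_Mapping.single k c * Poly_Mapping.single l d) =
        Poly_Mapping.single (k + l - ?e) (c * d * of_nat (Poly_Mapping.lookup k i)) +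
        Poly_Mapping.single (k + l - ?e) (c * d * of_nat (Poly_Mapping.lookup l i))"
      by (simp only: mult_single pdiff_var lookup_add of_nat_add distrib_left single_add)
    then show ?case
      unfolding 1 2 by (simp only: mult_single pdiff_var ac_simps)
  qed (simp_all add: pdiff_add distrib_left add_ac)
qed (simp_all add: pdiff_add distrib_right add_ac)

lemma dir_deriv_add: "dir_deriv b \<eta> (f + g) = dir_deriv b \<eta> f + dir_deriv b \<eta> g"
  by (simp add: dir_deriv_def pdiff_add distrib_left sum.distrib)

lemma dir_deriv_mult: "dir_deriv b \<eta> (f * g) = dir_deriv b \<eta> f * g + f * dir_deriv b \<eta> g"
  unfolding dir_deriv_def pdiff_mult
  by (simp add: distrib_left sum.distrib sum_distrib_left sum_distrib_right mult_ac)

lemma dir_deriv_const: "dir_deriv b \<eta> (const c) = 0"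
  by (simp add: dir_deriv_def const_def pdiff_var[unfolded One_nat_def])

lemma sum_coord:
  fixes b :: "'n::finite \<Rightarrow> 'a::euclidean_space"
  assumes "lattice_basis \<Lambda> b"
  shows "(\<Sum>i\<in>UNIV. coord b u i *\<^sub>R b i) = u"
proof -
  have inj: "inj b" and ind: "independent (range b)" and sp: "span (range b) = UNIV"
    using assms by (auto simp: lattice_basis_def)
  have "(\<Sum>i\<in>UNIV. coord b u i *\<^sub>R b i) = (\<Sum>x\<in>range b. representation (range b) u x *\<^sub>R x)"
    using inj by (simp add: sum.reindex coord_def)
  also have "\<dots> = u"
    using real_vector.sum_representation_eq[OF ind, of u "range b"] sp by simp
  finally show ?thesis .
qed

lemma dir_deriv_lin_form:
  fixes b :: "'n::finite \<Rightarrow> 'a::euclidean_space"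
  assumes b: "lattice_basis \<Lambda> b" and "linear \<eta>"
  shows "dir_deriv b \<eta> (lin_form b u) = const (of_real (\<eta> u))"
proof -
  have *: "pdiff (Poly_Mapping.single k 1) (lin_form b u) = const (of_real (coord b u k))"
    for k
  proof -
    have sums: "pdiff m (sum h A) = (\<Sum>i\<in>A. pdiff m (h i))"
      if "finite A" for m :: "'n \<Rightarrow>\<^sub>0 nat" and h and A :: "'n set"
      using that by induction (simp_all add: pdiff_add)
    have "pdiff (Poly_Mapping.single k 1) (lin_form b u) =
        (\<Sum>i\<in>UNIV. if i = k then const (of_real (coord b u k)) else 0)"
      unfolding lin_form_def sums[OF finite] const_def var_def mult_single pdiff_var
      by (intro sum.cong refl) (simp_all add: lookup_single)
    then show ?thesis by simp
  qed
  have "\<eta> u = \<eta> (\<Sum>i\<in>UNIV. coord b u i *\<^sub>R b i)"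
    using sum_coord[OF b] by simp
  also have "\<dots> = (\<Sum>i\<in>UNIV. coord b u i * \<eta> (b i))"
    using \<open>linear \<eta>\<close> by (simp add: linear_sum linear_cmul)
  finally have eta: "\<eta> u = (\<Sum>i\<in>UNIV. \<eta> (b i) * coord b u i)"
    by (simp add: mult.commute)
  have csum: "const (sum h A) = (\<Sum>i\<in>A. const (h i))" if "finite A" for h and A :: "'n set"
    using that by induction (simp_all add: const_def single_add)
  show ?thesis
    unfolding dir_deriv_def * eta of_real_sum csum[OF finite]
    by (simp add: const_def mult_single)
qed

end

theory Submission
  imports Defs
begin

text \<open>Write \<open>T\<close> for the spline, \<open>q = p(\<nu>,\<cdot>)\<close>, and let \<open>H = (\<eta> = 0)\<close> be a wall through the
  lattice point \<open>\<nu>\<close> with \<open>m = m(H)\<close>. Since \<open>D\<^sub>x T\<^sub>X = T\<^bsub>X - x\<^esub>\<close>, and \<open>T\<^sub>X\<close> is continuous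
  across \<open>H\<close> when \<open>m \<ge> 2\<close>, the jump of the local polynomials of \<open>T\<close> across \<open>H\<close> has the form
  \<open>\<eta>\<^bsup>m - 1\<^esup> g\<close>. As multiplication by \<open>\<eta>\<close> is adjoint to \<open>D\<^sub>\<eta>\<close> at \<open>\<nu>\<close>, \<open>D\<^sub>\<eta>\<^bsup>m - 1\<^esup> q = 0\<close>
  makes the jump of \<open>q(D)T\<close> at \<open>\<nu>\<close> vanish.

  Conversely, \<open>\<nu> \<mapsto> p(\<nu>,\<cdot>)\<close> is periodic, so continuity at the points of a coset of a lattice
  in \<open>H\<close> makes the jump of \<open>q(D)T\<close> vanish on all of \<open>H\<close>. Write \<open>q = \<Sum> c\<^sub>Z p\<^sub>Z\<close> with
  \<open>X - Z\<close> spanning; then \<open>q(D)T = \<Sum> c\<^sub>Z T\<^bsub>X - Z\<^esub>\<close>, and only the \<open>Z\<close> for which a single vector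
  \<open>x\<close> of \<open>X - Z\<close> lies off \<open>H\<close> contribute to the jump, namely \<open>1 / \<eta>(x)\<close> times the spline of
  \<open>(X - Z) \<inter> H\<close>. The Laplace transform turns the vanishing of this combination of splines
  into \<open>D\<^sub>\<eta>\<^bsup>m - 1\<^esup> q = 0\<close>.\<close>

section \<open>Polynomials as an algebra of differential operators\<close>

text \<open>\<open>spline\<close> is defined through a chosen isometric embedding, which is known to
  parametrise the whole solution space only where the fibre has full dimension. The development
  therefore works with the density \<open>W I\<close> of the image of Lebesgue measure on the
  orthant, for every spanning index set \<open>I\<close>, and identifies the two at generic points
  up to one nonzero constant, to which continuity is indifferent. Since \<open>W\<close> need not be
  differentiable, the relation between \<open>X\<close> and \<open>X - x\<close> is used in
  integrated form, as a formula for increments.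

  Two difficulties shape the converse. Continuity compares values only at lattice points; but the
  pieces of \<open>W\<close> are polynomial on cones, so lattice points far out on \<open>H\<close>
  can be rescaled to a chosen wall point, and infinitely many of them on a ray force a polynomial to
  vanish. And the splines of \<open>(X - Z) \<inter> H\<close> live on a proper subspace: adjoining
  one fixed vector \<open>X ! i0\<close> off \<open>H\<close> replaces them by full-dimensional
  splines with the same linear relation, to which Laplace transforms over the whole space
  apply.\<close>

lemma const_0 [simp]: "const 0 = 0"
  by (simp add: const_def)

lemma const_1 [simp]: "const 1 = 1"
  by (simp add: const_def)

lemma const_add: "const (x + y) = const x + const y"
  by (simp add: const_def single_add)

lemma const_mult: "const (x * y) = const x * const y"
  by (simp add: const_def mult_single)

lemma const_mult_single: "const c * Poly_Mapping.single k d = Poly_Mapping.single k (c * d)"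
  by (simp add: const_def mult_single)

lemma single_eq_const_mult: "Poly_Mapping.single k c = const c * Poly_Mapping.single k 1"
  by (simp add: const_mult_single)

lemma var_power: "var i ^ k = Poly_Mapping.single (Poly_Mapping.single i k) 1"
proof (induction k)
  case (Suc k)
  have "Poly_Mapping.single i (Suc k) = Poly_Mapping.single i 1 + Poly_Mapping.single i k"
    by (simp flip: single_add)
  with Suc show ?case
    by (simp add: mult_single var_def)
qed simp

text \<open>The ring is generated by constants and variables, so a property that respects sums and
  products need only be checked on these; this suits operators that obey a product rule.\<close>

lemma cpoly_induct [case_names const var add mult]:
  fixes f :: "'n cpoly"
  assumes "\<And>c. P (const c)" "\<And>i. P (var i)"
    and "\<And>f g. P f \<Longrightarrow> P g \<Longrightarrow> P (f + g)" "\<And>f g. P f \<Longrightarrow> P g \<Longrightarrow> P (f * g)"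
  shows "P f"
proof (induction f rule: poly_mapping_single_induct)
  case zero
  then show ?case using assms(1)[of 0] by simp
next
  case (single k c)
  have pow: "P (var i ^ n)" for i n
  proof (induction n)
    case 0
    then show ?case using assms(1)[of 1] by simp
  next
    case (Suc n)
    then show ?case using assms(2,4) by simp
  qed
  have "P (Poly_Mapping.single k 1)"
  proof (induction k rule: poly_mapping_single_induct)
    case zero
    then show ?case using assms(1)[of 1] by simp
  next
    case (single i n)
    then show ?case using pow[of i n] by (simp add: var_power)
  next
    case (add k l)
    have "Poly_Mapping.single (k + l) 1 = Poly_Mapping.single k 1 * Poly_Mapping.single l
        (1::complex)"
      by (simp add: mult_single)
    with add show ?case using assms(4) by metis
  qed
  then show ?case using assms(1,4) by (metis single_eq_const_mult)
qed (rule assms(3))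

lemma peval_eq:
  assumes "finite S" "Poly_Mapping.keys f \<subseteq> S"
  shows "peval b f u = (\<Sum>m\<in>S. Poly_Mapping.lookup f m *
        (\<Prod>i\<in>UNIV. complex_of_real (coord b u i) ^ Poly_Mapping.lookup m i))"
  unfolding peval_def by (rule sum.mono_neutral_left) (use assms in \<open>auto simp: in_keys_iff\<close>)

lemma peval_add: "peval b (f + g) u = peval b f u + peval b g u"
proof -
  let ?S = "Poly_Mapping.keys f \<union> Poly_Mapping.keys g"
  show ?thesis
    using Poly_Mapping.keys_add[of f g]
    by (simp add: peval_eq[of ?S] lookup_add distrib_right sum.distrib)
qed

lemma peval_single: "peval b (Poly_Mapping.single m c) u =
    c * (\<Prod>i\<in>UNIV. complex_of_real (coord b u i) ^ Poly_Mapping.lookup m i)"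
  by (subst peval_eq[of "{m}"]) auto

lemma peval_0 [simp]: "peval b 0 u = 0"
  by (simp add: peval_def)

lemma peval_mult: "peval b (f * g) u = peval b f u * peval b g u"
proof (induction f rule: poly_mapping_single_induct)
  case (single k c)
  show ?case
    by (induction g rule: poly_mapping_single_induct)
      (simp_all add: mult_single peval_single lookup_add power_add prod.distrib peval_add
        distrib_left)
qed (simp_all add: distrib_right peval_add)

lemma peval_const [simp]: "peval b (const c) u = c"
  by (simp add: const_def peval_single)

lemma peval_1 [simp]: "peval b 1 u = 1"
  using peval_const[of b 1 u] by simp

lemma peval_var [simp]: "peval b (var i) u = of_real (coord b u i)"
proof -
  have "(\<Prod>j\<in>UNIV. complex_of_real (coord b u j) ^ Poly_Mapping.lookup (Poly_Mapping.single i 1) j)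
      = (\<Prod>j\<in>UNIV. if j = i then complex_of_real (coord b u j) else 1)"
    by (intro prod.cong) (auto simp: lookup_single)
  then show ?thesis by (simp add: var_def peval_single)
qed

lemma peval_sum: "peval b (sum f A) u = (\<Sum>i\<in>A. peval b (f i) u)"
  by (induction A rule: infinite_finite_induct) (simp_all add: peval_add)

lemma peval_prod: "peval b (prod f A) u = (\<Prod>i\<in>A. peval b (f i) u)"
  by (induction A rule: infinite_finite_induct) (simp_all add: peval_mult)

lemma peval_power: "peval b (f ^ k) u = peval b f u ^ k"
  by (induction k) (simp_all add: peval_mult)

lemma peval_uminus: "peval b (- f) u = - peval b f u"
  using peval_add[of b f "- f" u] by (simp add: add_eq_0_iff)

lemma peval_diff: "peval b (f - g) u = peval b f u - peval b g u"
  using peval_add[of b f "- g" u] by (simp add: peval_uminus)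

lemma diff_op_eq:
  assumes "finite S" "Poly_Mapping.keys q \<subseteq> S"
  shows "diff_op q f = (\<Sum>m\<in>S. const (Poly_Mapping.lookup q m) * pdiff m f)"
  unfolding diff_op_def by (rule sum.mono_neutral_left) (use assms in \<open>auto simp: in_keys_iff\<close>)

lemma diff_op_add_left: "diff_op (p + q) f = diff_op p f + diff_op q f"
proof -
  let ?S = "Poly_Mapping.keys p \<union> Poly_Mapping.keys q"
  show ?thesis
    using Poly_Mapping.keys_add[of p q]
    by (simp add: diff_op_eq[of ?S] lookup_add const_add distrib_right sum.distrib)
qed

lemma diff_op_add_right: "diff_op q (f + g) = diff_op q f + diff_op q g"
  by (simp add: diff_op_def pdiff_add distrib_left sum.distrib)

lemma diff_op_0_left [simp]: "diff_op 0 f = 0"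
  by (simp add: diff_op_def)

lemma diff_op_0_right [simp]: "diff_op q 0 = 0"
  by (simp add: diff_op_def)

lemma diff_op_single: "diff_op (Poly_Mapping.single m c) f = const c * pdiff m f"
  by (subst diff_op_eq[of "{m}"]) auto

lemma pdiff_const_mult: "pdiff m (const c * f) = const c * pdiff m f"
  by (induction f rule: poly_mapping_single_induct)
    (simp_all add: pdiff_single pdiff_add distrib_left const_mult_single mult.assoc)

lemma diff_op_const_mult_right: "diff_op q (const c * f) = const c * diff_op q f"
  by (simp add: diff_op_def pdiff_const_mult sum_distrib_left mult.left_commute)

lemma pdiff_0 [simp]: "pdiff 0 f = f"
  by (induction f rule: poly_mapping_single_induct) (simp_all add: pdiff_single pdiff_add)

lemma diff_op_const [simp]: "diff_op (const c) f = const c * f"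
  by (simp add: const_def[of c] diff_op_single)

text \<open>Splitting of the falling factorial, the coefficient in \<open>pdiff\<close>. With
  truncated \<open>k - n\<close> it also holds for \<open>n > k\<close>: then both sides contain the
  factor \<open>k - k\<close>.\<close>

lemma falling_add:
  fixes k m n :: nat
  shows "(\<Prod>j<m + n. of_nat k - of_nat j :: complex) =
    (\<Prod>j<n. of_nat k - of_nat j) * (\<Prod>j<m. of_nat (k - n) - of_nat j)"
proof (cases "n \<le> k")
  case True
  have "(\<Prod>j<m + n. of_nat k - of_nat j :: complex) =
      (\<Prod>j<n. of_nat k - of_nat j) * (\<Prod>j=n..<n + m. of_nat k - of_nat j)"
    by (simp add: lessThan_atLeast0 prod.atLeastLessThan_concat add.commute)
  also have "(\<Prod>j=n..<n + m. of_nat k - of_nat j :: complex) = (\<Prod>j<m. of_nat k - of_nat (j + n))"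
    using prod.shift_bounds_nat_ivl[of "\<lambda>j. of_nat k - of_nat j :: complex" 0 n m]
    by (simp add: lessThan_atLeast0 add.commute)
  also have "\<dots> = (\<Prod>j<m. of_nat (k - n) - of_nat j)"
    using True by (intro prod.cong) (simp_all add: of_nat_diff)
  finally show ?thesis .
next
  case False
  then have "(\<Prod>j<m + n. of_nat k - of_nat j :: complex) = 0"
      "(\<Prod>j<n. of_nat k - of_nat j :: complex) = 0"
    by (intro prod_zero; force)+
  then show ?thesis by (simp only: mult_zero_left)
qed

lemma pdiff_pdiff: "pdiff (m + n) f = pdiff m (pdiff n f)"
proof (induction f rule: poly_mapping_single_induct)
  case (single k c)
  have "k - (m + n) = k - n - m"
    by (intro poly_mapping_eqI) (simp add: lookup_minus lookup_add)
  then show ?case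
    by (simp add: pdiff_single lookup_add lookup_minus falling_add prod.distrib mult.assoc)
qed (simp_all add: pdiff_add)

text \<open>This makes \<open>diff_op\<close> an action of the polynomial ring, so that a product of
  linear forms can be applied one factor at a time.\<close>

lemma diff_op_mult: "diff_op (p * q) f = diff_op p (diff_op q f)"
proof (induction p rule: poly_mapping_single_induct)
  case (single k c)
  show ?case
  proof (induction q rule: poly_mapping_single_induct)
    case (single l d)
    then show ?case
      by (simp add: mult_single diff_op_single pdiff_const_mult pdiff_pdiff const_mult mult_ac)
  qed (simp_all add: distrib_left diff_op_add_left diff_op_add_right)
qed (simp_all add: distrib_right diff_op_add_left)

lemma diff_op_sum_left: "diff_op (sum q A) f = (\<Sum>i\<in>A. diff_op (q i) f)"
  by (induction A rule: infinite_finite_induct) (simp_all add: diff_op_add_left)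

lemma diff_op_diff_right: "diff_op q (f - g) = diff_op q f - diff_op q g"
  using diff_op_add_right[of q "f - g" g] by (simp add: algebra_simps)

lemma diff_op_var: "diff_op (var i) f = pdiff (Poly_Mapping.single i 1) f"
  by (simp add: var_def diff_op_single)

lemma diff_op_lin_form:
  "diff_op (lin_form b x) f =
    (\<Sum>i\<in>UNIV. const (of_real (coord b x i)) * pdiff (Poly_Mapping.single i 1) f)"
  by (simp add: lin_form_def diff_op_sum_left diff_op_mult diff_op_var del: One_nat_def)

lemma diff_op_lin_form_mult:
  "diff_op (lin_form b x) (f * g) = diff_op (lin_form b x) f * g + f * diff_op (lin_form b x) g"
  unfolding diff_op_lin_form pdiff_mult
  by (simp add: distrib_left sum.distrib sum_distrib_left sum_distrib_right mult_ac)

lemma diff_op_lin_form_const: "diff_op (lin_form b x) (const c) = 0"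
  by (simp add: diff_op_lin_form const_def pdiff_var[unfolded One_nat_def])

lemma pdiff_single_var:
  "pdiff (Poly_Mapping.single i 1) (var j) = (if i = j then 1 else 0)"
  unfolding var_def pdiff_var by (auto simp: lookup_single when_def)

lemma diff_op_lin_form_var: "diff_op (lin_form b x) (var j) = const (of_real (coord b x j))"
  unfolding diff_op_lin_form pdiff_single_var by (simp add: if_distrib cong: if_cong)

text \<open>The functional \<open>\<eta>\<close> as an element of \<open>Sym V\<close>: the
  variables are the basis dual to \<open>b\<close>, so its coefficients are the values
  \<open>\<eta> (b i)\<close>.\<close>

definition functional_poly :: "('n::finite \<Rightarrow> 'a::euclidean_space) \<Rightarrow> ('a \<Rightarrow> real) \<Rightarrow> 'n cpoly" where
  "functional_poly b \<eta> = (\<Sum>i\<in>UNIV. const (of_real (\<eta> (b i))) * var i)"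

lemma dir_deriv_var: "dir_deriv b \<eta> (var i) = const (of_real (\<eta> (b i)))"
  unfolding dir_deriv_def pdiff_single_var by (simp add: if_distrib cong: if_cong)

lemma pdiff_functional_poly:
  "pdiff (Poly_Mapping.single i 1) (functional_poly b \<eta>) = const (of_real (\<eta> (b i)))"
proof -
  have "pdiff m (sum h A) = (\<Sum>i\<in>A. pdiff m (h i))" for m :: "'a \<Rightarrow>\<^sub>0 nat" and h and A :: "'a set"
    by (induction A rule: infinite_finite_induct) (simp_all add: pdiff_add)
  then have "pdiff (Poly_Mapping.single i 1) (functional_poly b \<eta>) =
      (\<Sum>j\<in>UNIV. const (of_real (\<eta> (b j))) * pdiff (Poly_Mapping.single i 1) (var j))"
    by (simp add: functional_poly_def pdiff_const_mult)
  then show ?thesis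
    unfolding pdiff_single_var by (simp add: if_distrib cong: if_cong)
qed

text \<open>Multiplication by the linear form \<open>\<eta>\<close> on \<open>Sym V\<close> and the derivation \<open>D\<^sub>\<eta>\<close> on
  \<open>Sym U\<close> are adjoint up to the action at points where \<open>\<eta>\<close> does not vanish.\<close>

lemma diff_op_functional_mult:
  "diff_op q (functional_poly b \<eta> * f) =
    functional_poly b \<eta> * diff_op q f + diff_op (dir_deriv b \<eta> q) f"
proof (induction q arbitrary: f rule: cpoly_induct)
  case (const c)
  then show ?case by (simp add: dir_deriv_const mult_ac)
next
  case (var i)
  then show ?case
    unfolding diff_op_var pdiff_mult pdiff_functional_poly dir_deriv_var by simp
next
  case (add q r)
  then show ?case by (simp add: diff_op_add_left dir_deriv_add algebra_simps)
next
  case (mult q r)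
  have "diff_op (q * r) (functional_poly b \<eta> * f) =
      functional_poly b \<eta> * diff_op q (diff_op r f) + diff_op (dir_deriv b \<eta> q) (diff_op r f) +
      diff_op q (diff_op (dir_deriv b \<eta> r) f)"
    by (simp only: diff_op_mult mult diff_op_add_right)
  then show ?case
    by (simp only: diff_op_mult dir_deriv_mult diff_op_add_left add.assoc)
qed

lemma dir_deriv_0 [simp]: "dir_deriv b \<eta> 0 = 0"
  by (simp add: dir_deriv_def)

lemma dir_deriv_const_mult: "dir_deriv b \<eta> (const c * q) = const c * dir_deriv b \<eta> q"
  by (simp add: dir_deriv_mult dir_deriv_const)

lemma dir_deriv_pow_0 [simp]: "(dir_deriv b \<eta> ^^ k) 0 = 0"
  by (induction k) auto

lemma dir_deriv_pow_add:
  "(dir_deriv b \<eta> ^^ k) (f + g) = (dir_deriv b \<eta> ^^ k) f + (dir_deriv b \<eta> ^^ k) g"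
  by (induction k) (auto simp: dir_deriv_add)

lemma dir_deriv_pow_sum: "(dir_deriv b \<eta> ^^ k) (sum f A) = (\<Sum>i\<in>A. (dir_deriv b \<eta> ^^ k) (f i))"
  by (induction A rule: infinite_finite_induct) (simp_all add: dir_deriv_pow_add)

lemma dir_deriv_pow_const_mult:
  "(dir_deriv b \<eta> ^^ k) (const c * q) = const c * (dir_deriv b \<eta> ^^ k) q"
  by (induction k) (auto simp: dir_deriv_const_mult)

locale based_lattice =
  fixes \<Lambda> :: "'a::euclidean_space set" and b :: "'n::finite \<Rightarrow> 'a"
  assumes lattice_basis: "lattice_basis \<Lambda> b"
begin

lemma inj_basis: "inj b" and independent_basis: "independent (range b)"
  and span_basis: "span (range b) = UNIV"
  and lattice_eq: "\<Lambda> = {\<Sum>i\<in>UNIV. of_int (z i) *\<^sub>R b i | z. True}"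
  using lattice_basis by (auto simp: lattice_basis_def)

lemma basis_expansion: "(\<Sum>i\<in>UNIV. coord b u i *\<^sub>R b i) = u"
  by (rule sum_coord[OF lattice_basis])

lemma linear_coord: "linear (\<lambda>u. coord b u i)"
  unfolding coord_def
  by (rule linearI) (simp_all add: representation_add representation_scale independent_basis
      span_basis)

lemma bounded_linear_coord: "bounded_linear (\<lambda>u. coord b u i)"
  using linear_coord by (rule linear_conv_bounded_linear[THEN iffD1])

lemma coord_add: "coord b (u + v) i = coord b u i + coord b v i"
  and coord_scaleR: "coord b (t *\<^sub>R u) i = t * coord b u i"
  using linear_coord[of i] by (simp_all add: linear_iff)

lemma coord_sum_basis: "coord b (\<Sum>i\<in>UNIV. c i *\<^sub>R b i) j = c j"
proof -
  have *: "coord b (b i) j = (if i = j then 1 else 0)" for i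
    unfolding coord_def
    using representation_basis[OF independent_basis, of "b i"] inj_basis by (auto dest: injD)
  then show ?thesis
    by (simp add: linear_sum[OF linear_coord] coord_scaleR * if_distrib cong: if_cong)
qed

lemma linear_basis_expansion:
  assumes "linear \<eta>"
  shows "\<eta> u = (\<Sum>i\<in>UNIV. coord b u i *\<^sub>R \<eta> (b i))"
  by (subst basis_expansion[of u, symmetric]) (simp add: linear_sum[OF assms]
      linear_cmul[OF assms])

lemma peval_functional_poly:
  assumes "linear \<eta>"
  shows "peval b (functional_poly b \<eta>) u = of_real (\<eta> u)"
  by (simp add: functional_poly_def peval_sum peval_mult linear_basis_expansion[OF assms, of u]
      mult.commute)

text \<open>Iteration of the commutation rule: the summand that keeps a factor \<open>\<eta>\<close>
  outside vanishes at \<open>u\<close>, and each factor is traded for one derivation of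
  \<open>q\<close>. Hence a symbol killed by \<open>dir_deriv b \<eta> ^^ k\<close> gives zero at
  such points on multiples of the \<open>k\<close>-th power of \<open>\<eta>\<close>.\<close>

lemma peval_diff_op_functional_power:
  assumes "linear \<eta>" "\<eta> u = 0"
  shows "peval b (diff_op q (functional_poly b \<eta> ^ k * f)) u =
    peval b (diff_op ((dir_deriv b \<eta> ^^ k) q) f) u"
proof (induction k arbitrary: q)
  case (Suc k)
  have "peval b (diff_op q (functional_poly b \<eta> ^ Suc k * f)) u =
      peval b (diff_op (dir_deriv b \<eta> q) (functional_poly b \<eta> ^ k * f)) u"
    using assms by (simp add: mult.assoc diff_op_functional_mult peval_add peval_mult
        peval_functional_poly)
  also have "\<dots> = peval b (diff_op ((dir_deriv b \<eta> ^^ Suc k) q) f) u"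
    using Suc by (simp add: funpow_swap1)
  finally show ?case .
qed simp

lemma peval_has_vector_derivative:
  "((\<lambda>t. peval b f (u + t *\<^sub>R x)) has_vector_derivative
     peval b (diff_op (lin_form b x) f) (u + t *\<^sub>R x)) (at t)"
proof (induction f rule: cpoly_induct)
  case (const c)
  then show ?case by (simp add: diff_op_lin_form_const)
next
  case (var i)
  have "((\<lambda>t. coord b u i + t * coord b x i) has_real_derivative coord b x i) (at t)"
    by (auto intro!: derivative_eq_intros)
  then have "((\<lambda>t. complex_of_real (coord b u i + t * coord b x i)) has_vector_derivative
      of_real (coord b x i)) (at t)"
    by (intro has_vector_derivative_of_real) (simp add:
        has_real_derivative_iff_has_vector_derivative)
  then show ?case by (simp add: diff_op_lin_form_var coord_add coord_scaleR)
next
  case (add f g)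
  then show ?case
    by (auto simp: diff_op_add_right peval_add intro: has_vector_derivative_add)
next
  case (mult f g)
  have "((\<lambda>t. peval b f (u + t *\<^sub>R x) * peval b g (u + t *\<^sub>R x)) has_vector_derivative
      peval b f (u + t *\<^sub>R x) * peval b (diff_op (lin_form b x) g) (u + t *\<^sub>R x) +
      peval b (diff_op (lin_form b x) f) (u + t *\<^sub>R x) * peval b g (u + t *\<^sub>R x)) (at t)"
    by (rule has_vector_derivative_mult[OF mult.IH])
  then show ?case
    by (simp add: diff_op_lin_form_mult peval_add peval_mult add.commute)
qed

end

section \<open>Real polynomial functions\<close>

lemmas rpf_linear = real_polynomial_function.intros(1)
  and rpf_const = real_polynomial_function.intros(2)
  and rpf_add = real_polynomial_function.intros(3)
  and rpf_mult = real_polynomial_function.intros(4)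

text \<open>Expansion along a line with coefficients that are polynomial in the base point;
  primitives and derivatives of polynomial functions are read off from it. The clause
  \<open>c k u = 0\<close> beyond \<open>n\<close> is what the Cauchy product requires in the case
  of a product.\<close>

lemma rpf_expand:
  assumes "real_polynomial_function g"
  obtains n c where "\<And>k. real_polynomial_function (c k)" "\<And>k u. n < k \<Longrightarrow> c k u = 0"
    "\<And>u t. g (u + t *\<^sub>R x) = (\<Sum>k\<le>n. t ^ k * c k u)"
proof -
  have "\<exists>n c. (\<forall>k. real_polynomial_function (c k)) \<and> (\<forall>k u. n < k \<longrightarrow> c k u = 0) \<and>
    (\<forall>u t. g (u + t *\<^sub>R x) = (\<Sum>k\<le>n. t ^ k * c k u))"
    using assms
  proof induction
    case (linear f)
    note bl = linear
    interpret bounded_linear f by (rule bl)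
    let ?c = "\<lambda>k u. if k = 0 then f u else if k = Suc 0 then f x else 0"
    have "real_polynomial_function (?c k)" for k
      using rpf_linear[OF bl] rpf_const
      by (cases "k = 0"; cases "k = Suc 0") simp_all
    then show ?case
      by (intro exI[of _ "Suc 0"] exI[of _ ?c]) (auto simp: add scale)
  next
    case (const c)
    let ?c = "\<lambda>k u. if k = 0 then c else 0"
    have "real_polynomial_function (?c k)" for k
      using rpf_const by (cases "k = 0") simp_all
    then show ?case
      by (intro exI[of _ 0] exI[of _ ?c]) auto
  next
    case (add f g)
    then obtain n c m d where c: "\<And>k. real_polynomial_function (c k)" "\<And>k u. n < k \<Longrightarrow> c k u = 0"
        "\<And>u t. f (u + t *\<^sub>R x) = (\<Sum>k\<le>n. t ^ k * c k u)"
      and d: "\<And>k. real_polynomial_function (d k)" "\<And>k u. m < k \<Longrightarrow> d k u = 0"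
        "\<And>u t. g (u + t *\<^sub>R x) = (\<Sum>k\<le>m. t ^ k * d k u)"
      by blast
    have "(\<Sum>k\<le>n. t ^ k * c k u) = (\<Sum>k\<le>n + m. t ^ k * c k u)"
      "(\<Sum>k\<le>m. t ^ k * d k u) = (\<Sum>k\<le>n + m. t ^ k * d k u)" for t u
      by (rule sum.mono_neutral_left; use c d in auto)+
    then show ?case using c d
      by (intro exI[of _ "n + m"] exI[of _ "\<lambda>k u. c k u + d k u"])
        (auto simp: algebra_simps sum.distrib)
  next
    case (mult f g)
    then obtain n c m d where c: "\<And>k. real_polynomial_function (c k)" "\<And>k u. n < k \<Longrightarrow> c k u = 0"
        "\<And>u t. f (u + t *\<^sub>R x) = (\<Sum>k\<le>n. t ^ k * c k u)"
      and d: "\<And>k. real_polynomial_function (d k)" "\<And>k u. m < k \<Longrightarrow> d k u = 0"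
        "\<And>u t. g (u + t *\<^sub>R x) = (\<Sum>k\<le>m. t ^ k * d k u)"
      by blast
    have "f (u + t *\<^sub>R x) * g (u + t *\<^sub>R x) =
        (\<Sum>k\<le>n + m. t ^ k * (\<Sum>i\<le>k. c i u * d (k - i) u))" for t u
      using polynomial_product[of n "\<lambda>k. c k u" m "\<lambda>k. d k u" t] c(2) d(2)
      by (simp add: c(3) d(3) mult.commute)
    moreover have "(\<Sum>i\<le>k. c i u * d (k - i) u) = 0" if "n + m < k" for k u
      by (rule sum.neutral) (use that c(2) d(2) in \<open>auto simp: not_less[symmetric]\<close>,
          metis add_le_mono le_add_diff_inverse not_le)
    ultimately show ?case using c d
      by (intro exI[of _ "n + m"] exI[of _ "\<lambda>k u. \<Sum>i\<le>k. c i u * d (k - i) u"])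
        (auto intro!: real_polynomial_function_sum)
  qed
  then show thesis using that by blast
qed

lemma rpf_line_zero:
  assumes "real_polynomial_function g" "infinite {t. g (u + t *\<^sub>R x) = 0}"
  shows "g (u + t *\<^sub>R x) = 0"
proof -
  obtain n c where "\<And>k. real_polynomial_function (c k)" "\<And>k u. n < k \<Longrightarrow> c k u = 0"
    and *: "\<And>u t. g (u + t *\<^sub>R x) = (\<Sum>k\<le>n. t ^ k * c k u)"
    using rpf_expand[OF assms(1), where x = x] by metis
  have inf: "infinite {t. (\<Sum>k\<le>n. c k u * t ^ k) = 0}"
    using assms(2) by (simp add: * mult.commute)
  then have "c k u = 0" if "k \<le> n" for k
    using polyfun_finite_roots[of "\<lambda>k. c k u" n] that by blast
  then show ?thesis by (simp add: *)
qed

lemma rpf_line_zero_ball: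
  assumes "real_polynomial_function g" "\<epsilon> > 0" "\<And>t. \<lbrakk>0 < t; t < \<epsilon>\<rbrakk> \<Longrightarrow> g (u + t *\<^sub>R x) = 0"
  shows "g (u + t *\<^sub>R x) = 0"
proof (rule rpf_line_zero[OF assms(1)])
  have "{0<..<\<epsilon>} \<subseteq> {t. g (u + t *\<^sub>R x) = 0}" using assms(3) by auto
  then show "infinite {t. g (u + t *\<^sub>R x) = 0}"
    using infinite_Ioo[OF assms(2)] by (rule infinite_super)
qed

lemma small_line_in_open:
  fixes u x :: "'a::real_normed_vector"
  assumes "open S" "u \<in> S"
  obtains \<epsilon> where "\<epsilon> > 0" "\<And>t. \<lbrakk>0 < t; t < \<epsilon>\<rbrakk> \<Longrightarrow> u + t *\<^sub>R x \<in> S"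
proof -
  have "((\<lambda>t. u + t *\<^sub>R x) \<longlongrightarrow> u + 0 *\<^sub>R x) (at_right 0)"
    by (intro tendsto_intros)
  then have "\<forall>\<^sub>F t in at_right 0. u + t *\<^sub>R x \<in> S"
    using assms by (auto dest: topological_tendstoD)
  then show thesis
    using that unfolding eventually_at_right_field by auto
qed

lemma rpf_zero_open:
  fixes g :: "'a::real_normed_vector \<Rightarrow> real"
  assumes g: "real_polynomial_function g" and "open S" "u \<in> S" "\<And>v. v \<in> S \<Longrightarrow> g v = 0"
  shows "g v = 0"
proof -
  obtain \<epsilon> where "\<epsilon> > 0" "\<And>t. \<lbrakk>0 < t; t < \<epsilon>\<rbrakk> \<Longrightarrow> u + t *\<^sub>R (v - u) \<in> S"
    using small_line_in_open[OF assms(2,3), where x = "v - u"] by blast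
  then have "g (u + 1 *\<^sub>R (v - u)) = 0"
    using assms(4) by (intro rpf_line_zero_ball[OF g, of \<epsilon> u "v - u" 1]) auto
  then show ?thesis by simp
qed

lemma rpf_eq_open:
  fixes f g :: "'a::real_normed_vector \<Rightarrow> real"
  assumes "real_polynomial_function f" "real_polynomial_function g" "open S" "S \<noteq> {}"
    "\<And>v. v \<in> S \<Longrightarrow> f v = g v"
  shows "f = g"
proof
  fix v
  have "f v - g v = 0"
    by (rule rpf_zero_open[where g = "\<lambda>v. f v - g v" and S = S and u = "SOME u. u \<in> S"])
      (use assms in \<open>auto simp: some_in_eq\<close>)
  then show "f v = g v" by simp
qed

lemma rpf_continuous: "real_polynomial_function g \<Longrightarrow> continuous_on S g"
  by (simp add: continuous_on_polymonial_function real_polynomial_function_eq)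

lemma polynomial_function_affine:
  assumes "bounded_linear L"
  shows "polynomial_function (\<lambda>u. a + L u)"
  using assms
  by (intro polynomial_function_add polynomial_function_const polynomial_function_bounded_linear)

lemma rpf_compose:
  assumes "real_polynomial_function g" "polynomial_function f"
  shows "real_polynomial_function (\<lambda>u. g (f u))"
  using real_polynomial_function_compose[OF assms(2,1)] by (simp add: o_def)

lemma polynomial_function_Pair:
  assumes "polynomial_function f" "polynomial_function g"
  shows "polynomial_function (\<lambda>u. (f u, g u))"
  unfolding polynomial_function_def
proof safe
  fix h :: "'b \<times> 'c \<Rightarrow> real" assume h: "bounded_linear h"
  have "bounded_linear (\<lambda>v. h (v, 0))" "bounded_linear (\<lambda>v. h (0, v))"
    by (intro bounded_linear_compose[OF h] bounded_linear_Pair bounded_linear_ident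
        bounded_linear_zero)+
  then have "real_polynomial_function (\<lambda>u. h (f u, 0) + h (0, g u))"
    using assms by (force simp: polynomial_function_def o_def)
  moreover have "h (f u, 0) + h (0, g u) = h (f u, g u)" for u
    using linear_add[OF bounded_linear.linear[OF h], of "(f u, 0)" "(0, g u)"] by simp
  ultimately show "real_polynomial_function (h \<circ> (\<lambda>u. (f u, g u)))"
    by (simp add: o_def)
qed

text \<open>Term by term, a primitive of \<open>t ^ m\<close> times a polynomial is divisible by
  \<open>t ^ Suc m\<close>. This gain of one power is the inductive step for the order of vanishing
  of the jumps. \<open>G\<close> is jointly polynomial so that \<open>u\<close> and \<open>t\<close>
  can later be functions of one point.\<close>

lemma rpf_primitive:
  fixes g :: "'a::real_normed_vector \<Rightarrow> real"
  assumes "real_polynomial_function g"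
  obtains G where "real_polynomial_function (\<lambda>(u, t). G u t)"
    "\<And>u t. ((\<lambda>t. t ^ Suc m * G u t) has_real_derivative t ^ m * g (u + t *\<^sub>R x)) (at t)"
proof -
  obtain n c where c: "\<And>k. real_polynomial_function (c k)"
    and "\<And>k u. n < k \<Longrightarrow> c k u = 0"
    and c_eq: "\<And>u t. g (u + t *\<^sub>R x) = (\<Sum>k\<le>n. t ^ k * c k u)"
    using rpf_expand[OF assms, where x = x] by metis
  define G where "G u t = (\<Sum>k\<le>n. t ^ k * (c k u / real (m + k + 1)))" for u t
  show thesis
  proof (rule that)
    have 1: "real_polynomial_function (\<lambda>z::'a \<times> real. snd z ^ k)" for k
      by (intro real_polynomial_function_power rpf_linear bounded_linear_snd)
    have 2: "real_polynomial_function (\<lambda>z::'a \<times> real. c k (fst z))" for k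
      by (rule rpf_compose[OF c]) (intro polynomial_function_bounded_linear bounded_linear_fst)
    show "real_polynomial_function (\<lambda>(u, t). G u t)"
      unfolding G_def case_prod_beta
      by (intro real_polynomial_function_sum rpf_mult
          real_polynomial_function_divide 1 2) auto
    fix u t
    have "t ^ Suc m * G u t = (\<Sum>k\<le>n. t ^ (m + k + 1) * (c k u / real (m + k + 1)))" for t
      by (simp add: G_def sum_distrib_left power_add mult_ac)
    moreover have "((\<lambda>t. \<Sum>k\<le>n. t ^ (m + k + 1) * (c k u / real (m + k + 1))) has_real_derivative
        (\<Sum>k\<le>n. t ^ (m + k) * c k u)) (at t)"
    proof (intro DERIV_sum)
      fix k
      have "((\<lambda>t. t ^ (m + k + 1) * (c k u / real (m + k + 1))) has_real_derivative
          (real (m + k + 1) * t ^ (m + k)) * (c k u / real (m + k + 1))) (at t)"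
        by (rule DERIV_cmult_right) (use DERIV_pow[of "m + k + 1" t] in simp)
      then show "((\<lambda>t. t ^ (m + k + 1) * (c k u / real (m + k + 1))) has_real_derivative
          t ^ (m + k) * c k u) (at t)"
        by (simp add: field_simps del: of_nat_Suc of_nat_add)
    qed
    moreover have "(\<Sum>k\<le>n. t ^ (m + k) * c k u) = t ^ m * g (u + t *\<^sub>R x)"
      by (simp add: c_eq sum_distrib_left power_add mult_ac)
    ultimately show "((\<lambda>t. t ^ Suc m * G u t) has_real_derivative t ^ m * g (u + t *\<^sub>R x)) (at t)"
      by simp
  qed
qed

lemma rpf_primitive':
  fixes g :: "'a::real_normed_vector \<Rightarrow> real"
  assumes "real_polynomial_function g"
  obtains G where "real_polynomial_function (\<lambda>(u, t). G u t)" "\<And>u. G u 0 = 0"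
    "\<And>u t. ((\<lambda>t. G u t) has_real_derivative g (u + t *\<^sub>R x)) (at t)"
proof -
  obtain G where G: "real_polynomial_function (\<lambda>(u, t). G u t)"
    "\<And>u t. ((\<lambda>t. t ^ Suc 0 * G u t) has_real_derivative t ^ 0 * g (u + t *\<^sub>R x)) (at t)"
    using rpf_primitive[OF assms, where m = 0 and x = x] by metis
  show thesis
  proof (rule that)
    have "real_polynomial_function (\<lambda>z::'a \<times> real. snd z * (\<lambda>(u, t). G u t) z)"
      by (intro rpf_mult rpf_linear bounded_linear_snd G)
    then show "real_polynomial_function (\<lambda>(u, t). t * G u t)"
      by (simp add: case_prod_unfold)
  qed (use G(2) in auto)
qed

text \<open>The derivative at the base point is the linear coefficient of the expansion; moving the
  base point along the line gives it at every \<open>t\<close>.\<close>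

lemma rpf_derivative:
  fixes g :: "'a::real_normed_vector \<Rightarrow> real"
  assumes "real_polynomial_function g"
  obtains d where "real_polynomial_function d"
    "\<And>u t. ((\<lambda>t. g (u + t *\<^sub>R x)) has_real_derivative d (u + t *\<^sub>R x)) (at t)"
proof -
  obtain n c where c: "\<And>k. real_polynomial_function (c k)" "\<And>k u. n < k \<Longrightarrow> c k u = 0"
    "\<And>u t. g (u + t *\<^sub>R x) = (\<Sum>k\<le>n. t ^ k * c k u)"
    using rpf_expand[OF assms, where x = x] by metis
  have 0: "((\<lambda>t. g (u + t *\<^sub>R x)) has_real_derivative c 1 u) (at 0)" for u
  proof -
    have "((\<lambda>t. \<Sum>k\<le>n. t ^ k * c k u) has_real_derivative
        (\<Sum>k\<le>n. (real k * 0 ^ (k - 1)) * c k u)) (at 0)"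
      by (intro DERIV_sum DERIV_cmult_right) (use DERIV_pow[of _ 0] in simp)
    moreover have "(\<Sum>k\<le>n. (real k * 0 ^ (k - 1)) * c k u) = (\<Sum>k\<le>n. if k = 1 then c 1 u else 0)"
      by (intro sum.cong) (auto simp: zero_power)
    moreover have "\<dots> = c 1 u"
      using c(2)[of 1 u] by (cases "1 \<le> n") auto
    ultimately show ?thesis by (simp add: c(3))
  qed
  show thesis
  proof (rule that[OF c(1)])
    fix u t
    have "g (u + (s + t) *\<^sub>R x) = g ((u + t *\<^sub>R x) + s *\<^sub>R x)" for s
      by (simp add: algebra_simps)
    with 0[of "u + t *\<^sub>R x"]
    have "((\<lambda>s. g (u + (s + t) *\<^sub>R x)) has_real_derivative c 1 (u + t *\<^sub>R x)) (at 0)"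
      by simp
    then show "((\<lambda>t. g (u + t *\<^sub>R x)) has_real_derivative c 1 (u + t *\<^sub>R x)) (at t)"
      using DERIV_shift[of "\<lambda>t. g (u + t *\<^sub>R x)" "c 1 (u + t *\<^sub>R x)" 0 t] by simp
  qed
qed

text \<open>A function whose increments along the vectors of a basis are locally polynomial is
  locally polynomial: move from \<open>u\<^sub>0\<close> to \<open>u\<close> along the coordinate directions.\<close>

lemma locally_rpf_of_increments:
  fixes f :: "'a::euclidean_space \<Rightarrow> real"
  assumes "r > 0" "finite J"
    and \<theta>: "\<And>j. j \<in> J \<Longrightarrow> bounded_linear (\<theta> j)"
    and expansion: "\<And>u. (\<Sum>j\<in>J. \<theta> j u *\<^sub>R x j) = u"
    and G: "\<And>j. j \<in> J \<Longrightarrow> real_polynomial_function (\<lambda>(u, t). G j u t)"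
    and incr: "\<And>j u t. \<lbrakk>j \<in> J; u \<in> ball u0 r; u + t *\<^sub>R x j \<in> ball u0 r\<rbrakk> \<Longrightarrow>
      f (u + t *\<^sub>R x j) - f u = G j u t"
  shows "\<exists>g. real_polynomial_function g \<and> (\<forall>\<^sub>F u in nhds u0. f u = g u)"
proof -
  \<comment> \<open>\<open>S K u\<close> starts at \<open>u0\<close> and adds the components of
    \<open>u - u0\<close> with index in \<open>K\<close>; it reaches \<open>u\<close> for
    \<open>K = J\<close>.\<close>
  define S where "S K u = u0 + (\<Sum>j\<in>K. \<theta> j (u - u0) *\<^sub>R x j)" for K u
  have bl: "bounded_linear (\<lambda>u. \<Sum>j\<in>K. \<theta> j u *\<^sub>R x j)" if "K \<subseteq> J" for K
    using that \<theta> by (intro bounded_linear_sum bounded_linear_scaleR_const) auto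
  have S_eq: "S K u = (u0 - (\<Sum>j\<in>K. \<theta> j u0 *\<^sub>R x j)) + (\<Sum>j\<in>K. \<theta> j u *\<^sub>R x j)" if "K \<subseteq> J" for K u
    using linear_diff[OF bounded_linear.linear[OF bl[OF that]], of u u0] by (simp add: S_def)
  have near: "\<forall>\<^sub>F u in nhds u0. S K u \<in> ball u0 r" if "K \<subseteq> J" for K
  proof -
    have "isCont (S K) u0"
      unfolding S_eq[OF that, abs_def]
      by (intro continuous_intros linear_continuous_at bl that)
    moreover have "S K u0 = u0"
      unfolding S_def using \<theta> that by (auto intro!: sum.neutral simp: linear_0
          bounded_linear.linear)
    ultimately have "\<forall>\<^sub>F u in at u0. S K u \<in> ball u0 r"
      unfolding isCont_def using \<open>r > 0\<close>
      by (auto dest: topological_tendstoD[of _ _ _ "ball u0 r"])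
    then show ?thesis
      using \<open>S K u0 = u0\<close> \<open>r > 0\<close> by (auto simp: eventually_nhds_conv_at)
  qed
  have "\<exists>g. real_polynomial_function g \<and> (\<forall>\<^sub>F u in nhds u0. f (S K u) = g u)" if "K \<subseteq> J" for K
    using finite_subset[OF that \<open>finite J\<close>] that
  proof induction
    case empty
    then show ?case by (intro exI[of _ "\<lambda>_. f u0"]) (auto simp: S_def)
  next
    case (insert j K)
    then obtain g where g: "real_polynomial_function g" "\<forall>\<^sub>F u in nhds u0. f (S K u) = g u"
      by auto
    have K: "K \<subseteq> J" "j \<in> J" using insert by auto
    have SS: "S (insert j K) u = S K u + \<theta> j (u - u0) *\<^sub>R x j" for u
      using insert by (simp add: S_def algebra_simps)
    have "polynomial_function (\<lambda>u. S K u)"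
      unfolding S_eq[OF K(1)] by (intro polynomial_function_affine bl K)
    moreover have "polynomial_function (\<lambda>u. \<theta> j (u - u0))"
      using polynomial_function_affine[OF \<theta>[OF K(2)], of "- \<theta> j u0"]
        linear_diff[OF bounded_linear.linear[OF \<theta>[OF K(2)]]] by simp
    ultimately have "polynomial_function (\<lambda>u. (S K u, \<theta> j (u - u0)))"
      by (rule polynomial_function_Pair)
    from rpf_compose[OF G[OF K(2)] this]
    have "real_polynomial_function (\<lambda>u. G j (S K u) (\<theta> j (u - u0)))" by simp
    with g(1) have "real_polynomial_function (\<lambda>u. g u + G j (S K u) (\<theta> j (u - u0)))"
      by (rule rpf_add)
    moreover have "\<forall>\<^sub>F u in nhds u0. f (S (insert j K) u) = g u + G j (S K u) (\<theta> j (u - u0))"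
      using g(2) near[OF K(1)] near[OF insert.prems]
    proof eventually_elim
      case (elim u)
      show ?case using incr[OF K(2) elim(2)[unfolded] elim(3)[unfolded SS]] elim(1) SS by simp
    qed
    ultimately show ?case by blast
  qed
  from this[OF subset_refl] show ?thesis
    by (simp add: S_def expansion)
qed

context based_lattice
begin

lemma rpf_peval_Re: "real_polynomial_function (\<lambda>u. Re (peval b f u)) \<and>
    real_polynomial_function (\<lambda>u. Im (peval b f u))"
proof (induction f rule: cpoly_induct)
  case (const c)
  then show ?case by (auto intro: rpf_const)
next
  case (var i)
  then show ?case
    by (auto intro: rpf_linear bounded_linear_coord rpf_const)
next
  case (add f g)
  then show ?case by (auto simp: peval_add)
next
  case (mult f g)
  then show ?case by (auto simp: peval_mult)
qed

lemma peval_at_0: "peval b f 0 = Poly_Mapping.lookup f 0"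
proof (induction f rule: poly_mapping_single_induct)
  case (single k c)
  have c0: "coord b 0 i = 0" for i
    using coord_scaleR[of 0 0 i] by simp
  have "(\<Prod>i\<in>UNIV. complex_of_real (coord b 0 i) ^ Poly_Mapping.lookup k i) =
      (if k = 0 then 1 else 0)"
  proof (cases "k = 0")
    case False
    then obtain i where "Poly_Mapping.lookup k i \<noteq> 0"
      by (metis lookup_zero poly_mapping_eqI)
    with False show ?thesis
      by (auto simp: c0 intro!: prod_zero bexI[of _ i])
  qed simp
  then show ?case by (simp add: peval_single lookup_single when_def)
qed (simp_all add: peval_add lookup_add)

lemma lookup_pdiff_0:
  "Poly_Mapping.lookup (pdiff m f) 0 =
    Poly_Mapping.lookup f m * (\<Prod>i\<in>UNIV. of_nat (fact (Poly_Mapping.lookup m i)))"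
proof (induction f rule: poly_mapping_single_induct)
  case (single k c)
  have fact_eq: "(\<Prod>j<n. of_nat n - of_nat j :: complex) = of_nat (fact n)" for n
  proof -
    have "(\<Prod>j<n. of_nat n - of_nat j :: complex) = (\<Prod>j<n. of_nat (n - j))"
      by (intro prod.cong) (simp_all add: of_nat_diff)
    also have "\<dots> = of_nat (fact n)"
      by (simp add: fact_prod_rev lessThan_atLeast0)
    finally show ?thesis .
  qed
  show ?case
  proof (cases "k = m")
    case True
    then show ?thesis by (simp add: pdiff_single fact_eq del: of_nat_fact)
  next
    case neq: False
    show ?thesis
    proof (cases "k - m = 0")
      case True
      have le: "Poly_Mapping.lookup k i \<le> Poly_Mapping.lookup m i" for i
        using arg_cong[OF True, of "\<lambda>f. Poly_Mapping.lookup f i"] by (simp add: lookup_minus)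
      obtain i where "Poly_Mapping.lookup k i \<noteq> Poly_Mapping.lookup m i"
        using neq by (metis poly_mapping_eqI)
      with le[of i] have "Poly_Mapping.lookup k i < Poly_Mapping.lookup m i" by simp
      then have "(\<Prod>j<Poly_Mapping.lookup m i. of_nat (Poly_Mapping.lookup k i) - of_nat j ::
          complex) = 0"
        by (intro prod_zero) force+
      then have "(\<Prod>i\<in>UNIV. \<Prod>j<Poly_Mapping.lookup m i.
          of_nat (Poly_Mapping.lookup k i) - of_nat j :: complex) = 0"
        by (intro prod_zero bexI[of _ i]) auto
      with neq show ?thesis by (simp add: pdiff_single lookup_single del: prod_zero_iff)
    next
      case False
      with neq show ?thesis by (simp add: pdiff_single lookup_single)
    qed
  qed
qed (simp_all add: pdiff_add lookup_add distrib_right)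

lemma diff_op_lin_form_basis: "diff_op (lin_form b (b i)) f = pdiff (Poly_Mapping.single i 1) f"
proof -
  have *: "coord b (b i) j = (if i = j then 1 else 0)" for j
    using coord_sum_basis[of "\<lambda>j. if i = j then 1 else 0" j]
    by (simp add: if_distrib[of "\<lambda>c. c *\<^sub>R _"] cong: if_cong)
  then show ?thesis
    unfolding diff_op_lin_form * by (simp add: if_distrib if_distribR cong: if_cong)
qed

text \<open>All derivatives of the zero function vanish, and by \<open>lookup_pdiff_0\<close> their
  values at \<open>0\<close> are the coefficients times nonzero factorials.\<close>

lemma peval_zero_imp_zero:
  assumes "\<And>u. peval b f u = 0"
  shows "f = 0"
proof -
  have one: "\<forall>u. peval b (pdiff (Poly_Mapping.single i 1) g) u = 0" if "\<forall>u. peval b g u =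
      0" for g i
  proof
    fix u
    have "((\<lambda>t. 0) has_vector_derivative peval b (pdiff (Poly_Mapping.single i 1) g) u) (at 0)"
      using peval_has_vector_derivative[of g u "b i" 0] that
      by (simp only: diff_op_lin_form_basis) simp
    then show "peval b (pdiff (Poly_Mapping.single i 1) g) u = 0"
      using vector_derivative_unique_at has_vector_derivative_const by blast
  qed
  have pow: "\<forall>u. peval b (pdiff (Poly_Mapping.single i n) g) u = 0" if "\<forall>u. peval b g u = 0"
      for g i n
  proof (induction n)
    case 0
    then show ?case using that by simp
  next
    case (Suc n)
    have "Poly_Mapping.single i (Suc n) = Poly_Mapping.single i 1 + Poly_Mapping.single i n"
      by (simp flip: single_add)
    then show ?case using one[OF Suc] by (simp add: pdiff_pdiff)
  qed
  have "\<forall>u. peval b (pdiff m g) u = 0" if "\<forall>u. peval b g u = 0" for m g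
    using that
    by (induction m arbitrary: g rule: poly_mapping_single_induct) (auto simp: pow pdiff_pdiff)
  then have "Poly_Mapping.lookup (pdiff m f) 0 = 0" for m
    using assms by (simp flip: peval_at_0)
  then show ?thesis
    by (intro poly_mapping_eqI) (simp add: lookup_pdiff_0)
qed

lemma peval_inj_open:
  assumes "open S" "S \<noteq> {}" "\<And>u. u \<in> S \<Longrightarrow> peval b f u = peval b g u"
  shows "f = g"
proof -
  obtain u0 where u0: "u0 \<in> S" using assms(2) by auto
  have "peval b (f - g) u = 0" for u
  proof -
    have "Re (peval b (f - g) u) = 0" "Im (peval b (f - g) u) = 0"
      using rpf_zero_open[OF conjunct1[OF rpf_peval_Re[of "f - g"]] assms(1) u0]
        rpf_zero_open[OF conjunct2[OF rpf_peval_Re[of "f - g"]] assms(1) u0] assms(3)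
      by (simp_all add: peval_diff)
    then show ?thesis by (simp add: complex_eq_iff)
  qed
  then show ?thesis using peval_zero_imp_zero[of "f - g"] by simp
qed

lemma rpf_imp_peval:
  assumes "real_polynomial_function g"
  obtains f where "\<And>u. peval b f u = of_real (g u)"
proof -
  have "\<exists>f. \<forall>u. peval b f u = of_real (g u)"
    using assms
  proof induction
    case (linear h)
    then show ?case using peval_functional_poly[of h] bounded_linear.linear by blast
  next
    case (const c)
    then show ?case by (metis peval_const)
  next
    case (add f g)
    then show ?case by (metis peval_add of_real_add)
  next
    case (mult f g)
    then show ?case by (metis peval_mult of_real_mult)
  qed
  then show thesis using that by blast
qed

end

section \<open>Lebesgue measure on products of lines\<close>

interpretation PiM_lborel: product_sigma_finite "\<lambda>_. lborel :: real measure"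
  by standard


lemma PiM_lborel_transform:
  fixes T :: "'i \<Rightarrow> real \<Rightarrow> real"
  assumes "finite I" and T: "\<And>i. i \<in> I \<Longrightarrow> T i \<in> borel_measurable borel"
    and inv: "\<And>i. i \<in> I \<Longrightarrow> distr lborel borel (T i) = (lborel :: real measure)"
    and f: "f \<in> borel_measurable (PiM I (\<lambda>_. lborel))"
  shows "(\<integral>\<^sup>+c. f (\<lambda>i\<in>I. T i (c i)) \<partial>PiM I (\<lambda>_. lborel)) = (\<integral>\<^sup>+c. f c \<partial>PiM I (\<lambda>_. lborel))"
proof -
  let ?P = "PiM I (\<lambda>_. lborel :: real measure)"
  have meas: "(\<lambda>c. \<lambda>i\<in>I. T i (c i)) \<in> measurable ?P ?P"
  proof (rule measurable_restrict)
    fix i assume "i \<in> I"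
    then have "(\<lambda>c. c i) \<in> measurable ?P borel" by simp
    from measurable_compose[OF this T[OF \<open>i \<in> I\<close>]]
    show "(\<lambda>c. T i (c i)) \<in> measurable ?P lborel" by simp
  qed
  have "distr ?P ?P (\<lambda>c. \<lambda>i\<in>I. T i (c i)) = ?P"
  proof (rule PiM_lborel.PiM_eqI[OF \<open>finite I\<close>])
    fix A assume A: "\<And>i. i \<in> I \<Longrightarrow> A i \<in> sets (lborel :: real measure)"
    have "emeasure (distr ?P ?P (\<lambda>c. \<lambda>i\<in>I. T i (c i))) (Pi\<^sub>E I A) =
        emeasure ?P ((\<lambda>c. \<lambda>i\<in>I. T i (c i)) -` (Pi\<^sub>E I A) \<inter> space ?P)"
      using A \<open>finite I\<close> by (intro emeasure_distr meas sets_PiM_I_finite) auto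
    also have "(\<lambda>c. \<lambda>i\<in>I. T i (c i)) -` (Pi\<^sub>E I A) \<inter> space ?P = Pi\<^sub>E I (\<lambda>i. T i -` A i)"
      by (auto simp: space_PiM PiE_iff extensional_def)
    also have "emeasure ?P \<dots> = (\<Prod>i\<in>I. emeasure lborel (T i -` A i))"
      using A T \<open>finite I\<close> by (intro PiM_lborel.emeasure_PiM) (auto dest: measurable_sets_borel)
    also have "\<dots> = (\<Prod>i\<in>I. emeasure lborel (A i))"
    proof (rule prod.cong)
      fix i assume "i \<in> I"
      then show "emeasure lborel (T i -` A i) = emeasure lborel (A i)"
        using A T by (subst (2) inv[symmetric, of i]) (auto simp: emeasure_distr)
    qed simp
    finally show "emeasure (distr ?P ?P (\<lambda>c. \<lambda>i\<in>I. T i (c i))) (Pi\<^sub>E I A) =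
      (\<Prod>i\<in>I. emeasure lborel (A i))" .
  qed simp
  then have "(\<integral>\<^sup>+c. f c \<partial>?P) = (\<integral>\<^sup>+c. f c \<partial>distr ?P ?P (\<lambda>c. \<lambda>i\<in>I. T i (c i)))" by simp
  also have "\<dots> = (\<integral>\<^sup>+c. f (\<lambda>i\<in>I. T i (c i)) \<partial>?P)"
    by (subst nn_integral_distr[OF meas]) (use f in simp_all)
  finally show ?thesis by simp
qed

lemma PiM_lborel_translate:
  assumes "finite I" "f \<in> borel_measurable (PiM I (\<lambda>_. lborel))"
  shows "(\<integral>\<^sup>+c. f (\<lambda>i\<in>I. c i + a i) \<partial>PiM I (\<lambda>_. lborel :: real measure)) =
      (\<integral>\<^sup>+c. f c \<partial>PiM I (\<lambda>_. lborel))"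
  using assms lborel_distr_plus
  by (intro PiM_lborel_transform[where T = "\<lambda>i t. t + a i"]) (auto simp: add.commute[of _ "a _"])

lemma PiM_lborel_reflect:
  assumes "finite I" "f \<in> borel_measurable (PiM I (\<lambda>_. lborel))"
  shows "(\<integral>\<^sup>+c. f (\<lambda>i\<in>I. a i - c i) \<partial>PiM I (\<lambda>_. lborel :: real measure)) =
      (\<integral>\<^sup>+c. f c \<partial>PiM I (\<lambda>_. lborel))"
proof -
  have "distr lborel borel (\<lambda>t. a i - t) = (lborel :: real measure)" for i
  proof -
    have "(lborel :: real measure) = distr (distr lborel borel uminus) borel ((+) (a i))"
      by (simp add: lborel_distr_uminus lborel_distr_plus)
    also have "\<dots> = distr lborel borel (\<lambda>t. a i - t)"
      by (subst distr_distr) (auto simp: o_def)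
    finally show ?thesis by simp
  qed
  with assms show ?thesis
    by (intro PiM_lborel_transform[where T = "\<lambda>i t. a i - t"]) auto
qed

definition lin_map :: "'j set \<Rightarrow> 'i set \<Rightarrow> ('j \<Rightarrow> 'i \<Rightarrow> real) \<Rightarrow> ('i \<Rightarrow> real) \<Rightarrow> ('j \<Rightarrow> real)" where
  "lin_map J I M c = (\<lambda>j\<in>J. \<Sum>i\<in>I. M j i * c i)"

lemma measurable_lin_map [measurable]:
  "lin_map J I M \<in> measurable (PiM I (\<lambda>_. lborel)) (PiM J (\<lambda>_. lborel))"
  unfolding lin_map_def by (rule measurable_restrict) measurable

lemma lin_map_diff:
  "lin_map J I M (\<lambda>i\<in>I. c i - d i) = (\<lambda>j\<in>J. lin_map J I M c j - lin_map J I M d j)"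
  by (auto simp: lin_map_def algebra_simps sum_subtractf)

text \<open>Uniqueness of Haar measure on \<open>\<real>\<^sup>J\<close>, for the image of Lebesgue measure under a linear
  isomorphism: compare with a fixed function \<open>h\<close> by integrating \<open>f (d + L c) h (L c)\<close> in both
  orders.\<close>

lemma PiM_lborel_Haar:
  fixes M :: "'j \<Rightarrow> 'i \<Rightarrow> real" and M' :: "'i \<Rightarrow> 'j \<Rightarrow> real"
  assumes fin: "finite I" "finite J"
    and LL': "\<And>d. d \<in> J \<rightarrow>\<^sub>E UNIV \<Longrightarrow> lin_map J I M (lin_map I J M' d) = d"
    and [measurable]: "f \<in> borel_measurable (PiM J (\<lambda>_. lborel))"
        "h \<in> borel_measurable (PiM J (\<lambda>_. lborel))"
  shows "(\<integral>\<^sup>+d. f d \<partial>PiM J (\<lambda>_. lborel)) * (\<integral>\<^sup>+c. h (lin_map J I M c) \<partial>PiM I (\<lambda>_. lborel)) =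
    (\<integral>\<^sup>+c. f (lin_map J I M c) \<partial>PiM I (\<lambda>_. lborel)) * (\<integral>\<^sup>+d. h d \<partial>PiM J (\<lambda>_. lborel))"
proof -
  let ?PI = "PiM I (\<lambda>_. lborel :: real measure)" and ?PJ = "PiM J (\<lambda>_. lborel :: real measure)"
  let ?L = "lin_map J I M" and ?L' = "lin_map I J M'"
  interpret pair_sigma_finite ?PJ ?PI
    by (intro pair_sigma_finite.intro PiM_lborel.sigma_finite fin)
  have [measurable]: "(\<lambda>(d, c). \<lambda>j\<in>J. d j + ?L c j) \<in> measurable (?PJ \<Otimes>\<^sub>M ?PI) ?PJ"
    "(\<lambda>(d, c). \<lambda>j\<in>J. ?L c j - d j) \<in> measurable (?PJ \<Otimes>\<^sub>M ?PI) ?PJ"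
    unfolding lin_map_def case_prod_beta
    by (rule measurable_restrict; simp; measurable)+
  have L_space: "?L c \<in> J \<rightarrow>\<^sub>E UNIV" for c by (simp add: lin_map_def)
  have "(\<integral>\<^sup>+d. f d \<partial>?PJ) * (\<integral>\<^sup>+c. h (?L c) \<partial>?PI) =
      (\<integral>\<^sup>+c. \<integral>\<^sup>+d. f (\<lambda>j\<in>J. d j + ?L c j) * h (?L c) \<partial>?PJ \<partial>?PI)"
    by (simp add: nn_integral_multc nn_integral_cmult PiM_lborel_translate fin)
  also have "\<dots> = (\<integral>\<^sup>+d. \<integral>\<^sup>+c. f (\<lambda>j\<in>J. d j + ?L c j) * h (?L c) \<partial>?PI \<partial>?PJ)"
    by (rule Fubini') measurable
  also have "\<dots> = (\<integral>\<^sup>+d. \<integral>\<^sup>+c. f (?L c) * h (\<lambda>j\<in>J. ?L c j - d j) \<partial>?PI \<partial>?PJ)"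
  proof (rule nn_integral_cong)
    fix d assume "d \<in> space ?PJ"
    then have d: "d \<in> J \<rightarrow>\<^sub>E UNIV" and [measurable]: "d \<in> space ?PJ" by (auto simp: space_PiM)
    have "(\<integral>\<^sup>+c. f (\<lambda>j\<in>J. d j + ?L c j) * h (?L c) \<partial>?PI) =
        (\<integral>\<^sup>+c. f (\<lambda>j\<in>J. d j + ?L (\<lambda>i\<in>I. c i + - ?L' d i) j) * h (?L (\<lambda>i\<in>I. c i + - ?L' d i))
            \<partial>?PI)"
      by (rule PiM_lborel_translate[symmetric, OF fin(1)]) measurable
    also have "\<dots> = (\<integral>\<^sup>+c. f (?L c) * h (\<lambda>j\<in>J. ?L c j - d j) \<partial>?PI)"
    proof (rule nn_integral_cong)
      fix c
      have "?L (\<lambda>i\<in>I. c i + - ?L' d i) = (\<lambda>j\<in>J. ?L c j - d j)"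
        using lin_map_diff[of J I M c "?L' d"] LL'[OF d] by simp
      moreover have "(\<lambda>j\<in>J. d j + (\<lambda>j\<in>J. ?L c j - d j) j) = ?L c"
        using L_space[of c] by (auto simp: fun_eq_iff PiE_iff extensional_def)
      ultimately show "f (\<lambda>j\<in>J. d j + ?L (\<lambda>i\<in>I. c i + - ?L' d i) j) * h
          (?L (\<lambda>i\<in>I. c i + - ?L' d i)) =
        f (?L c) * h (\<lambda>j\<in>J. ?L c j - d j)" by simp
    qed
    finally show "(\<integral>\<^sup>+c. f (\<lambda>j\<in>J. d j + ?L c j) * h (?L c) \<partial>?PI) =
      (\<integral>\<^sup>+c. f (?L c) * h (\<lambda>j\<in>J. ?L c j - d j) \<partial>?PI)" .
  qed
  also have "\<dots> = (\<integral>\<^sup>+c. \<integral>\<^sup>+d. f (?L c) * h (\<lambda>j\<in>J. ?L c j - d j) \<partial>?PJ \<partial>?PI)"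
    by (rule Fubini'[symmetric]) measurable
  also have "\<dots> = (\<integral>\<^sup>+c. f (?L c) * (\<integral>\<^sup>+d. h d \<partial>?PJ) \<partial>?PI)"
  proof (rule nn_integral_cong)
    fix c assume [measurable]: "c \<in> space ?PI"
    have "(\<integral>\<^sup>+d. f (?L c) * h (\<lambda>j\<in>J. ?L c j - d j) \<partial>?PJ) =
        f (?L c) * (\<integral>\<^sup>+d. h (\<lambda>j\<in>J. ?L c j - d j) \<partial>?PJ)"
      by (rule nn_integral_cmult) measurable
    then show "(\<integral>\<^sup>+d. f (?L c) * h (\<lambda>j\<in>J. ?L c j - d j) \<partial>?PJ) = f (?L c) * (\<integral>\<^sup>+d. h d \<partial>?PJ)"
      by (simp add: PiM_lborel_reflect fin)
  qed
  also have "\<dots> = (\<integral>\<^sup>+c. f (?L c) \<partial>?PI) * (\<integral>\<^sup>+d. h d \<partial>?PJ)"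
    by (rule nn_integral_multc) measurable
  finally show ?thesis .
qed

lemma emeasure_PiM_box:
  assumes "finite I" "r \<ge> 0"
  shows "emeasure (PiM I (\<lambda>_. lborel)) (I \<rightarrow>\<^sub>E {-r..r}) = ennreal ((2 * r) ^ card I)"
  using assms by (subst PiM_lborel.emeasure_PiM) (auto simp: ennreal_power prod_constant)

lemma lin_map_box:
  assumes "finite I" "finite J"
  obtains r where "r > 0" "\<And>c s. \<lbrakk>s \<ge> 0; c \<in> I \<rightarrow>\<^sub>E {-s..s}\<rbrakk> \<Longrightarrow>
      lin_map J I M c \<in> J \<rightarrow>\<^sub>E {-(s * r)..s * r}"
proof -
  define r where "r = 1 + (\<Sum>j\<in>J. \<Sum>i\<in>I. \<bar>M j i\<bar>)"
  have "r > 0" unfolding r_def by (intro add_pos_nonneg sum_nonneg) auto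
  moreover have "lin_map J I M c \<in> J \<rightarrow>\<^sub>E {-(s * r)..s * r}" if "s \<ge> 0" "c \<in> I \<rightarrow>\<^sub>E {-s..s}" for c s
  proof -
    have "\<bar>\<Sum>i\<in>I. M j i * c i\<bar> \<le> s * r" if "j \<in> J" for j
    proof -
      have "\<bar>\<Sum>i\<in>I. M j i * c i\<bar> \<le> (\<Sum>i\<in>I. \<bar>M j i\<bar> * s)"
        using \<open>c \<in> I \<rightarrow>\<^sub>E {-s..s}\<close>
        by (intro order_trans[OF sum_abs] sum_mono) (auto simp: abs_mult PiE_iff abs_le_iff
            intro!: mult_left_mono)
      also have "\<dots> = s * (\<Sum>i\<in>I. \<bar>M j i\<bar>)" by (simp add: sum_distrib_left mult.commute)
      also have "\<dots> \<le> s * (\<Sum>j\<in>J. \<Sum>i\<in>I. \<bar>M j i\<bar>)"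
        using \<open>j \<in> J\<close> \<open>s \<ge> 0\<close> assms
        by (intro mult_left_mono member_le_sum[of j J "\<lambda>j. \<Sum>i\<in>I. \<bar>M j i\<bar>"]) (auto intro:
            sum_nonneg)
      also have "\<dots> \<le> s * r" using \<open>s \<ge> 0\<close> by (auto simp: r_def intro!: mult_left_mono)
      finally show ?thesis .
    qed
    then show ?thesis by (auto simp: lin_map_def abs_le_iff minus_le_iff)
  qed
  ultimately show thesis by (rule that)
qed

text \<open>The Haar identity with \<open>h\<close> the indicator of a box yields the constant. It
  is positive because a small box is mapped into the box, and finite because the inverse maps the
  box into a large one. The two index sets may have different types, so no determinant is
  involved.\<close>

lemma PiM_lborel_linear_image:
  fixes M :: "'j \<Rightarrow> 'i \<Rightarrow> real" and M' :: "'i \<Rightarrow> 'j \<Rightarrow> real"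
  assumes fin: "finite I" "finite J"
    and LL': "\<And>d. d \<in> J \<rightarrow>\<^sub>E UNIV \<Longrightarrow> lin_map J I M (lin_map I J M' d) = d"
    and L'L: "\<And>c. c \<in> I \<rightarrow>\<^sub>E UNIV \<Longrightarrow> lin_map I J M' (lin_map J I M c) = c"
  obtains \<kappa> :: real where "\<kappa> > 0"
    "\<And>f. f \<in> borel_measurable (PiM J (\<lambda>_. lborel)) \<Longrightarrow>
      (\<integral>\<^sup>+c. f (lin_map J I M c) \<partial>PiM I (\<lambda>_. lborel)) =
          ennreal \<kappa> * (\<integral>\<^sup>+d. f d \<partial>PiM J (\<lambda>_. lborel))"
proof -
  let ?PI = "PiM I (\<lambda>_. lborel :: real measure)" and ?PJ = "PiM J (\<lambda>_. lborel :: real measure)"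
  let ?L = "lin_map J I M" and ?L' = "lin_map I J M'"
  let ?Q = "J \<rightarrow>\<^sub>E {-1..1::real}"
  define h :: "('j \<Rightarrow> real) \<Rightarrow> ennreal" where "h = indicator ?Q"
  have [measurable]: "h \<in> borel_measurable ?PJ" unfolding h_def using fin by measurable
  obtain r where r: "r > 0" "\<And>c s. \<lbrakk>s \<ge> 0; c \<in> I \<rightarrow>\<^sub>E {-s..s}\<rbrakk> \<Longrightarrow> ?L c \<in> J \<rightarrow>\<^sub>E {-(s * r)..s * r}"
    using lin_map_box[OF fin, of M] by blast
  obtain r' where r': "r' > 0" "\<And>c s. \<lbrakk>s \<ge> 0; c \<in> J \<rightarrow>\<^sub>E {-s..s}\<rbrakk> \<Longrightarrow>
      ?L' c \<in> I \<rightarrow>\<^sub>E {-(s * r')..s * r'}"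
    using lin_map_box[OF fin(2,1), of M'] by blast
  have hJ: "(\<integral>\<^sup>+d. h d \<partial>?PJ) = ennreal (2 ^ card J)"
    using emeasure_PiM_box[OF fin(2), of 1] fin by (simp add: h_def)
  have lower: "ennreal ((2 / r) ^ card I) \<le> (\<integral>\<^sup>+c. h (?L c) \<partial>?PI)"
  proof -
    have "ennreal ((2 / r) ^ card I) = (\<integral>\<^sup>+c. indicator (I \<rightarrow>\<^sub>E {-(1/r)..1/r}) c \<partial>?PI)"
      using emeasure_PiM_box[OF fin(1), of "1/r"] r(1) fin by simp
    also have "\<dots> \<le> (\<integral>\<^sup>+c. h (?L c) \<partial>?PI)"
      using r(2)[of "1/r"] r(1) by (intro nn_integral_mono) (auto simp: h_def indicator_def)
    finally show ?thesis .
  qed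
  have upper: "(\<integral>\<^sup>+c. h (?L c) \<partial>?PI) \<le> ennreal ((2 * r') ^ card I)"
  proof -
    have "(\<integral>\<^sup>+c. h (?L c) \<partial>?PI) \<le> (\<integral>\<^sup>+c. indicator (I \<rightarrow>\<^sub>E {-r'..r'}) c \<partial>?PI)"
    proof (rule nn_integral_mono)
      fix c assume "c \<in> space ?PI"
      then have "?L' (?L c) = c" by (intro L'L) (simp add: space_PiM)
      then show "h (?L c) \<le> indicator (I \<rightarrow>\<^sub>E {-r'..r'}) c"
        using r'(2)[of 1 "?L c"] by (auto simp: h_def indicator_def)
    qed
    also have "\<dots> = ennreal ((2 * r') ^ card I)"
      using emeasure_PiM_box[OF fin(1), of r'] r'(1) fin by simp
    finally show ?thesis .
  qed
  obtain w where w: "w > 0" "(\<integral>\<^sup>+c. h (?L c) \<partial>?PI) = ennreal w"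
  proof -
    have "(\<integral>\<^sup>+c. h (?L c) \<partial>?PI) < top" using upper
        by (auto simp: order.strict_trans1 ennreal_less_top)
    then obtain w where w: "w \<ge> 0" "(\<integral>\<^sup>+c. h (?L c) \<partial>?PI) = ennreal w"
      by (metis less_top_ennreal)
    have "(2 / r) ^ card I \<le> w" using lower w by (simp add: ennreal_le_iff)
    moreover have "(2 / r) ^ card I > 0" using r(1) by simp
    ultimately show thesis using that w by fastforce
  qed
  show thesis
  proof (rule that[of "w / 2 ^ card J"])
    fix f :: "('j \<Rightarrow> real) \<Rightarrow> ennreal" assume f: "f \<in> borel_measurable ?PJ"
    have "(\<integral>\<^sup>+d. f d \<partial>?PJ) * ennreal w = (\<integral>\<^sup>+c. f (?L c) \<partial>?PI) * ennreal (2 ^ card J)"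
      using PiM_lborel_Haar[OF fin LL' f, of h] by (simp add: w(2) hJ)
    then have "(\<integral>\<^sup>+d. f d \<partial>?PJ) * ennreal w * ennreal (1 / 2 ^ card J) =
        (\<integral>\<^sup>+c. f (?L c) \<partial>?PI) * (ennreal (2 ^ card J) * ennreal (1 / 2 ^ card J))"
      by (simp add: mult.assoc)
    also have "ennreal (2 ^ card J) * ennreal (1 / 2 ^ card J) = 1"
      by (simp flip: ennreal_mult)
    finally have "(\<integral>\<^sup>+c. f (?L c) \<partial>?PI) = (\<integral>\<^sup>+d. f d \<partial>?PJ) * (ennreal w * ennreal
        (1 / 2 ^ card J))"
      by (simp add: mult.assoc)
    also have "ennreal w * ennreal (1 / 2 ^ card J) = ennreal (w / 2 ^ card J)"
      using w(1) by (simp flip: ennreal_mult)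
    finally show "(\<integral>\<^sup>+c. f (?L c) \<partial>?PI) = ennreal (w / 2 ^ card J) * (\<integral>\<^sup>+d. f d \<partial>?PJ)"
      by (simp add: mult.commute)
  qed (use w(1) in simp)
qed

section \<open>Bases given by index sets, which keep repeated vectors apart\<close>

definition basis_on :: "('i \<Rightarrow> 'a::euclidean_space) \<Rightarrow> 'i set \<Rightarrow> bool" where
  "basis_on x J \<longleftrightarrow> finite J \<and> inj_on x J \<and> independent (x ` J) \<and> span (x ` J) = UNIV"

definition bcoord :: "('i \<Rightarrow> 'a::euclidean_space) \<Rightarrow> 'i set \<Rightarrow> 'i \<Rightarrow> 'a \<Rightarrow> real" where
  "bcoord x J j u = representation (x ` J) u (x j)"

lemma linear_bcoord: "basis_on x J \<Longrightarrow> linear (bcoord x J j)"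
  unfolding bcoord_def basis_on_def
  by (intro linearI) (simp_all add: representation_add representation_scale)

lemma bounded_linear_bcoord: "basis_on x J \<Longrightarrow> bounded_linear (bcoord x J j)"
  by (rule linear_conv_bounded_linear[THEN iffD1, OF linear_bcoord])

lemma bcoord_expansion:
  assumes "basis_on x J"
  shows "(\<Sum>j\<in>J. bcoord x J j u *\<^sub>R x j) = u"
proof -
  have "(\<Sum>j\<in>J. bcoord x J j u *\<^sub>R x j) = (\<Sum>v\<in>x ` J. representation (x ` J) u v *\<^sub>R v)"
    using assms by (simp add: sum.reindex bcoord_def basis_on_def)
  also have "\<dots> = u"
    using assms real_vector.sum_representation_eq[of "x ` J" u "x ` J"]
        by (simp add: basis_on_def)
  finally show ?thesis .
qed

lemma bcoord_basis:
  assumes "basis_on x J" "i \<in> J" "j \<in> J"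
  shows "bcoord x J j (x i) = (if i = j then 1 else 0)"
  using assms real_vector.representation_basis[of "x ` J" "x i"]
  by (auto simp: bcoord_def basis_on_def inj_on_eq_iff)

lemma bcoord_sum:
  assumes "basis_on x J" "j \<in> J"
  shows "bcoord x J j (\<Sum>i\<in>J. c i *\<^sub>R x i) = c j"
proof -
  have "bcoord x J j (\<Sum>i\<in>J. c i *\<^sub>R x i) = (\<Sum>i\<in>J. c i * bcoord x J j (x i))"
    using assms by (simp add: linear_sum[OF linear_bcoord] linear_cmul[OF linear_bcoord])
  also have "\<dots> = (\<Sum>i\<in>J. if i = j then c j else 0)"
    using assms by (intro sum.cong) (auto simp: bcoord_basis)
  also have "\<dots> = c j" using assms by (simp add: basis_on_def)
  finally show ?thesis .
qed

text \<open>\<open>lborel\<close> is the image of the product measure over \<open>Basis\<close>, so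
  the claim is the linear change of variables between coordinates over \<open>J\<close> and over
  \<open>Basis\<close>.\<close>

lemma comb_lborel_ex:
  fixes x :: "'i \<Rightarrow> 'a::euclidean_space"
  assumes "basis_on x J"
  shows "\<exists>\<kappa>::real. \<kappa> > 0 \<and> (\<forall>f\<in>borel_measurable borel.
      (\<integral>\<^sup>+c. f (\<Sum>j\<in>J. c j *\<^sub>R x j) \<partial>PiM J (\<lambda>_. lborel)) = ennreal \<kappa> * (\<integral>\<^sup>+u. f u \<partial>lborel))"
proof -
  let ?M = "\<lambda>b j. x j \<bullet> b" and ?M' = "\<lambda>j b. bcoord x J j b"
  let ?B = "Basis :: 'a set"
  have fin: "finite J" "finite ?B" using assms by (auto simp: basis_on_def)
  have L: "(\<Sum>b\<in>?B. lin_map ?B J ?M c b *\<^sub>R b) = (\<Sum>j\<in>J. c j *\<^sub>R x j)" for c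
  proof -
    have "(\<Sum>b\<in>?B. lin_map ?B J ?M c b *\<^sub>R b) = (\<Sum>b\<in>?B. ((\<Sum>j\<in>J. c j *\<^sub>R x j) \<bullet> b) *\<^sub>R b)"
      by (intro sum.cong) (auto simp: lin_map_def inner_sum_left mult.commute)
    then show ?thesis by (simp add: euclidean_representation)
  qed
  have L': "(\<Sum>j\<in>J. lin_map J ?B ?M' d j *\<^sub>R x j) = (\<Sum>b\<in>?B. d b *\<^sub>R b)" for d
  proof -
    have "(\<Sum>j\<in>J. lin_map J ?B ?M' d j *\<^sub>R x j) = (\<Sum>j\<in>J. bcoord x J j (\<Sum>b\<in>?B. d b *\<^sub>R b) *\<^sub>R x j)"
      by (intro sum.cong) (auto simp: lin_map_def linear_sum[OF linear_bcoord[OF assms]]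
        linear_cmul[OF linear_bcoord[OF assms]] mult.commute)
    then show ?thesis by (simp add: bcoord_expansion[OF assms])
  qed
  have LL': "lin_map ?B J ?M (lin_map J ?B ?M' d) = d" if "d \<in> ?B \<rightarrow>\<^sub>E UNIV" for d
  proof (rule ext)
    fix b
    show "lin_map ?B J ?M (lin_map J ?B ?M' d) b = d b"
    proof (cases "b \<in> ?B")
      case True
      then have "lin_map ?B J ?M (lin_map J ?B ?M' d) b =
          (\<Sum>b\<in>?B. lin_map ?B J ?M (lin_map J ?B ?M' d) b *\<^sub>R b) \<bullet> b"
        by simp
      also have "\<dots> = d b" unfolding L L' using True by simp
      finally show ?thesis .
    qed (use that in \<open>auto simp: lin_map_def PiE_iff extensional_def\<close>)
  qed
  have L'L: "lin_map J ?B ?M' (lin_map ?B J ?M c) = c" if "c \<in> J \<rightarrow>\<^sub>E UNIV" for c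
  proof (rule ext)
    fix j
    show "lin_map J ?B ?M' (lin_map ?B J ?M c) j = c j"
    proof (cases "j \<in> J")
      case True
      then have "lin_map J ?B ?M' (lin_map ?B J ?M c) j =
          bcoord x J j (\<Sum>j\<in>J. lin_map J ?B ?M' (lin_map ?B J ?M c) j *\<^sub>R x j)"
        by (simp add: bcoord_sum[OF assms])
      also have "\<dots> = c j" unfolding L L' using True by (simp add: bcoord_sum[OF assms])
      finally show ?thesis .
    qed (use that in \<open>auto simp: lin_map_def PiE_iff extensional_def\<close>)
  qed
  obtain \<kappa> :: real where \<kappa>: "\<kappa> > 0" "\<And>f. f \<in> borel_measurable (PiM ?B (\<lambda>_. lborel)) \<Longrightarrow>
      (\<integral>\<^sup>+c. f (lin_map ?B J ?M c) \<partial>PiM J (\<lambda>_. lborel)) =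
          ennreal \<kappa> * (\<integral>\<^sup>+d. f d \<partial>PiM ?B (\<lambda>_. lborel))"
    using PiM_lborel_linear_image[OF fin LL' L'L] by blast
  show ?thesis
  proof (intro exI[of _ \<kappa>] conjI ballI \<kappa>(1))
    fix f :: "'a \<Rightarrow> ennreal" assume f: "f \<in> borel_measurable borel"
    have m: "(\<lambda>d. \<Sum>b\<in>?B. d b *\<^sub>R b) \<in> measurable (PiM ?B (\<lambda>_. lborel)) borel" by measurable
    have "(\<integral>\<^sup>+c. f (\<Sum>j\<in>J. c j *\<^sub>R x j) \<partial>PiM J (\<lambda>_. lborel)) =
        (\<integral>\<^sup>+c. f (\<Sum>b\<in>?B. lin_map ?B J ?M c b *\<^sub>R b) \<partial>PiM J (\<lambda>_. lborel))"
      by (simp add: L)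
    also have "\<dots> = ennreal \<kappa> * (\<integral>\<^sup>+d. f (\<Sum>b\<in>?B. d b *\<^sub>R b) \<partial>PiM ?B (\<lambda>_. lborel))"
      using \<kappa>(2)[OF measurable_compose[OF m f]] .
    also have "(\<integral>\<^sup>+d. f (\<Sum>b\<in>?B. d b *\<^sub>R b) \<partial>PiM ?B (\<lambda>_. lborel)) = (\<integral>\<^sup>+u. f u \<partial>lborel)"
      unfolding lborel_eq[where 'a = 'a] by (rule nn_integral_distr[OF m, symmetric])
          (use f in simp)
    finally show "(\<integral>\<^sup>+c. f (\<Sum>j\<in>J. c j *\<^sub>R x j) \<partial>PiM J (\<lambda>_. lborel)) =
        ennreal \<kappa> * (\<integral>\<^sup>+u. f u \<partial>lborel)" .
  qed
qed

section \<open>The density of the image of the orthant\<close>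

lemma borel_measurable_bcoord [measurable]:
  assumes "basis_on x J"
  shows "bcoord x J j \<in> borel_measurable borel"
  by (intro borel_measurable_continuous_onI linear_continuous_on bounded_linear_bcoord assms)

lemma basis_on_subset_ex:
  assumes "finite I" "span (x ` I) = UNIV"
  obtains J where "J \<subseteq> I" "basis_on x J"
proof -
  obtain B where B: "B \<subseteq> x ` I" "independent B" "x ` I \<subseteq> span B"
    using maximal_independent_subset by blast
  then obtain J where J: "J \<subseteq> I" "inj_on x J" "B = x ` J"
    by (auto simp: subset_image_inj)
  have "span B = UNIV"
    using B(3) assms(2) by (metis span_minimal subspace_span UNIV_I top.extremum_uniqueI)
  then show thesis
    using that[of J] J B finite_subset[OF J(1) assms(1)] by (simp add: basis_on_def)
qed

text \<open>The reciprocal of the absolute determinant of the basis indexed by \<open>J\<close>,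
  characterised by its effect on integrals.\<close>

definition dens_factor :: "('i \<Rightarrow> 'a::euclidean_space) \<Rightarrow> 'i set \<Rightarrow> real" where
  "dens_factor x J = (SOME \<kappa>. \<kappa> > 0 \<and> (\<forall>f\<in>borel_measurable borel.
      (\<integral>\<^sup>+c. f (\<Sum>j\<in>J. c j *\<^sub>R x j) \<partial>PiM J (\<lambda>_. lborel)) = ennreal \<kappa> * (\<integral>\<^sup>+u. f u \<partial>lborel)))"

lemma dens_factor:
  assumes "basis_on x J"
  shows "dens_factor x J > 0"
    and "f \<in> borel_measurable borel \<Longrightarrow>
      (\<integral>\<^sup>+c. f (\<Sum>j\<in>J. c j *\<^sub>R x j) \<partial>PiM J (\<lambda>_. lborel)) = ennreal (dens_factor x J) * (\<integral>\<^sup>+u. f u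
          \<partial>lborel)"
  using someI_ex[OF comb_lborel_ex[OF assms]] by (auto simp: dens_factor_def)

definition orthant :: "'i set \<Rightarrow> ('i \<Rightarrow> real) set" where
  "orthant K = {c. \<forall>i\<in>K. 0 \<le> c i}"

definition cone_on :: "('i \<Rightarrow> 'a::euclidean_space) \<Rightarrow> 'i set \<Rightarrow> 'a set" where
  "cone_on x J = {u. \<forall>j\<in>J. 0 \<le> bcoord x J j u}"

lemma indicator_orthant: "finite K \<Longrightarrow> indicator (orthant K) c =
    (\<Prod>i\<in>K. indicator {0..} (c i) :: ennreal)"
  by (induction K rule: finite_induct) (auto simp: orthant_def indicator_def)

lemma borel_measurable_orthant [measurable]:
  "finite K \<Longrightarrow> (indicator (orthant K) :: _ \<Rightarrow> ennreal) \<in> borel_measurable (PiM K (\<lambda>_. lborel ::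
      real measure) )"
proof -
  assume K: "finite K"
  have "(\<lambda>c. \<Prod>i\<in>K. indicator {0..} (c i) :: ennreal) \<in> borel_measurable (PiM K (\<lambda>_. lborel ::
      real measure))"
    by measurable
  then show "(indicator (orthant K) :: _ \<Rightarrow> ennreal) \<in> borel_measurable (PiM K (\<lambda>_. lborel ::
      real measure) )"
    by (simp add: indicator_orthant[OF K, abs_def])
qed

lemma sets_cone_on [measurable]:
  assumes "basis_on x J"
  shows "cone_on x J \<in> sets borel"
proof -
  have [measurable]: "finite J" using assms by (simp add: basis_on_def)
  note borel_measurable_bcoord[OF assms, measurable]
  have "{u \<in> space borel. \<forall>j\<in>J. 0 \<le> bcoord x J j u} \<in> sets borel"
    by measurable
  then show ?thesis by (simp add: cone_on_def)
qed

definition fibre_vol :: "('i \<Rightarrow> 'a::euclidean_space) \<Rightarrow> 'i set \<Rightarrow> 'i set \<Rightarrow> 'a \<Rightarrow> ennreal" where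
  "fibre_vol x I J u = (\<integral>\<^sup>+c. indicator (orthant (I - J)) c *
     indicator (cone_on x J) (u - (\<Sum>i\<in>I - J. c i *\<^sub>R x i)) \<partial>PiM (I - J) (\<lambda>_. lborel))"

text \<open>The density of the image of Lebesgue measure on the orthant of \<open>\<real>\<^sup>I\<close> under the map
  \<open>w \<mapsto> \<Sum> w\<^sub>i x\<^sub>i\<close>; the fibre is parametrised by the coordinates outside of a basis \<open>J\<close>.\<close>

definition dens :: "('i \<Rightarrow> 'a::euclidean_space) \<Rightarrow> 'i set \<Rightarrow> 'i set \<Rightarrow> 'a \<Rightarrow> ennreal" where
  "dens x I J u = ennreal (dens_factor x J) * fibre_vol x I J u"

lemma fibre_vol_pair_measurable [measurable]:
  assumes "finite I" "basis_on x J"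
  shows "(\<lambda>(u, c). indicator (orthant (I - J)) c * indicator (cone_on x J)
      (u - (\<Sum>i\<in>I - J. c i *\<^sub>R x i)) :: ennreal)
    \<in> borel_measurable (borel \<Otimes>\<^sub>M PiM (I - J) (\<lambda>_. lborel))"
proof -
  note sets_cone_on[OF assms(2), measurable] borel_measurable_orthant[of "I - J", measurable]
  have [measurable]: "finite (I - J)" using assms by simp
  show ?thesis
    unfolding case_prod_beta
    by measurable
qed

lemma borel_measurable_fibre_vol [measurable]:
  assumes "finite I" "basis_on x J"
  shows "fibre_vol x I J \<in> borel_measurable borel"
proof -
  interpret sigma_finite_measure "PiM (I - J) (\<lambda>_. lborel :: real measure)"
    using assms by (intro PiM_lborel.sigma_finite) auto
  have "(\<lambda>u. \<integral>\<^sup>+c. indicator (orthant (I - J)) c *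
     indicator (cone_on x J) (u - (\<Sum>i\<in>I - J. c i *\<^sub>R x i)) \<partial>PiM (I - J) (\<lambda>_. lborel)) \<in>
         borel_measurable borel"
    by (rule borel_measurable_nn_integral) (rule fibre_vol_pair_measurable[OF assms])
  then show ?thesis by (simp add: fibre_vol_def[abs_def])
qed

lemma borel_measurable_dens [measurable]:
  assumes "finite I" "basis_on x J"
  shows "dens x I J \<in> borel_measurable borel"
  using borel_measurable_fibre_vol[OF assms] unfolding dens_def by measurable

lemma nn_integral_exp_ray:
  fixes s :: real
  assumes "s > 0"
  shows "(\<integral>\<^sup>+t. ennreal (exp (- (t * s))) * indicator {0..} t \<partial>lborel) = ennreal (1 / s)"
proof -
  have "((\<lambda>t. - exp (- (t * s)) / s) \<longlongrightarrow> 0) at_top"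
  proof -
    have "filterlim (\<lambda>t. t * s) at_top at_top"
      using filterlim_tendsto_pos_mult_at_top[OF tendsto_const assms filterlim_ident]
          by (simp add: mult.commute)
    then have "filterlim (\<lambda>t. - (t * s)) at_bot at_top"
      by (simp add: filterlim_uminus_at_bot)
    then have "((\<lambda>t. exp (- (t * s))) \<longlongrightarrow> 0) at_top"
      by (rule filterlim_compose[OF exp_at_bot])
    then have "((\<lambda>t. - exp (- (t * s)) / s) \<longlongrightarrow> - 0 / s) at_top"
      using assms by (intro tendsto_intros) auto
    then show ?thesis by simp
  qed
  then have "(\<integral>\<^sup>+t. ennreal (exp (- (t * s))) * indicator {0..} t \<partial>lborel) =
      0 - (- exp (- (0 * s)) / s)"
    using assms by (intro nn_integral_FTC_atLeast) (auto intro!: derivative_eq_intros)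
  then show ?thesis by simp
qed

lemma nn_integral_exp_orthant:
  assumes "finite K" "\<And>i. i \<in> K \<Longrightarrow> s i > 0"
  shows "(\<integral>\<^sup>+c. ennreal (exp (- (\<Sum>i\<in>K. c i * s i))) * indicator (orthant K) c \<partial>PiM K
      (\<lambda>_. lborel)) =
    (\<Prod>i\<in>K. ennreal (1 / s i))"
proof -
  have "ennreal (exp (- (\<Sum>i\<in>K. c i * s i))) * indicator (orthant K) c =
      (\<Prod>i\<in>K. ennreal (exp (- (c i * s i))) * indicator {0..} (c i))" for c
    using assms(1) by (simp add: indicator_orthant prod.distrib prod_ennreal exp_sum flip:
        sum_negf)
  then have "(\<integral>\<^sup>+c. ennreal (exp (- (\<Sum>i\<in>K. c i * s i))) * indicator (orthant K) c \<partial>PiM K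
      (\<lambda>_. lborel)) =
      (\<integral>\<^sup>+c. (\<Prod>i\<in>K. ennreal (exp (- (c i * s i))) * indicator {0..} (c i)) \<partial>PiM K (\<lambda>_. lborel))"
    by simp
  also have "\<dots> = (\<Prod>i\<in>K. \<integral>\<^sup>+t. ennreal (exp (- (t * s i))) * indicator {0..} t \<partial>lborel)"
    using assms(1) by (intro PiM_lborel.product_nn_integral_prod) auto
  also have "\<dots> = (\<Prod>i\<in>K. ennreal (1 / s i))"
    using assms by (intro prod.cong nn_integral_exp_ray) auto
  finally show ?thesis .
qed

lemma nn_integral_lborel_translate:
  fixes a :: "'a::euclidean_space"
  assumes "f \<in> borel_measurable borel"
  shows "(\<integral>\<^sup>+u. f (u + a) \<partial>lborel) = (\<integral>\<^sup>+u. f u \<partial>lborel)"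
proof -
  have "(\<integral>\<^sup>+u. f u \<partial>lborel) = (\<integral>\<^sup>+u. f u \<partial>distr lborel borel ((+) a))"
    by (simp add: lborel_distr_plus)
  also have "\<dots> = (\<integral>\<^sup>+u. f (u + a) \<partial>lborel)"
    by (subst nn_integral_distr) (use assms in \<open>auto simp: add.commute\<close>)
  finally show ?thesis by simp
qed

text \<open>Exchanging the integrals and translating by the contribution of \<open>I - J\<close>
  separates the two groups of coordinates. \<open>dens_factor\<close> turns the integral over the
  cone into one over the orthant of \<open>J\<close>, and every coordinate then contributes the
  integral of an exponential over the half-line. In \<open>ennreal\<close> no integrability has to
  be shown beforehand.\<close>

lemma dens_Laplace:
  fixes x :: "'i \<Rightarrow> 'a::euclidean_space"
  assumes fin: "finite I" and J: "J \<subseteq> I" "basis_on x J" and pos: "\<And>i. i \<in> I \<Longrightarrow> \<sigma> \<bullet> x i > 0"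
  shows "(\<integral>\<^sup>+u. ennreal (exp (- (\<sigma> \<bullet> u))) * dens x I J u \<partial>lborel) =
      (\<Prod>i\<in>I. ennreal (1 / (\<sigma> \<bullet> x i)))"
proof -
  let ?K = "I - J" and ?P = "PiM (I - J) (\<lambda>_. lborel :: real measure)"
  let ?comb = "\<lambda>c. \<Sum>i\<in>I - J. c i *\<^sub>R x i"
  note [measurable] = sets_cone_on[OF J(2)] fibre_vol_pair_measurable[OF fin J(2)]
    borel_measurable_fibre_vol[OF fin J(2)]
  have finJ: "finite J" "finite ?K" using fin J by (auto intro: finite_subset)
  note [measurable] = borel_measurable_orthant[OF finJ(2)]
  interpret pair_sigma_finite ?P "lborel :: 'a measure"
    using finJ by (intro pair_sigma_finite.intro PiM_lborel.sigma_finite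
        lborel.sigma_finite_measure_axioms)
  have cone: "ennreal (dens_factor x J) * (\<integral>\<^sup>+u. ennreal (exp (- (\<sigma> \<bullet> u))) * indicator
      (cone_on x J) u \<partial>lborel) =
      (\<Prod>i\<in>J. ennreal (1 / (\<sigma> \<bullet> x i)))"
  proof -
    have "ennreal (dens_factor x J) * (\<integral>\<^sup>+u. ennreal (exp (- (\<sigma> \<bullet> u))) * indicator (cone_on x J)
        u \<partial>lborel) =
        (\<integral>\<^sup>+c. ennreal (exp (- (\<sigma> \<bullet> (\<Sum>j\<in>J. c j *\<^sub>R x j)))) * indicator (cone_on x J)
            (\<Sum>j\<in>J. c j *\<^sub>R x j) \<partial>PiM J (\<lambda>_. lborel))"
      by (rule dens_factor(2)[OF J(2), symmetric]) measurable
    also have "\<dots> = (\<integral>\<^sup>+c. ennreal (exp (- (\<Sum>j\<in>J. c j * (\<sigma> \<bullet> x j)))) * indicator (orthant J) c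
        \<partial>PiM J (\<lambda>_. lborel))"
      by (intro nn_integral_cong) (auto simp: inner_sum_right cone_on_def orthant_def
          indicator_def bcoord_sum[OF J(2)])
    also have "\<dots> = (\<Prod>i\<in>J. ennreal (1 / (\<sigma> \<bullet> x i)))"
      using finJ J pos by (intro nn_integral_exp_orthant) auto
    finally show ?thesis .
  qed
  have "(\<integral>\<^sup>+u. ennreal (exp (- (\<sigma> \<bullet> u))) * dens x I J u \<partial>lborel) =
      ennreal (dens_factor x J) * (\<integral>\<^sup>+u. ennreal (exp (- (\<sigma> \<bullet> u))) * fibre_vol x I J u \<partial>lborel)"
    unfolding dens_def by (subst nn_integral_cmult[symmetric]) (auto simp: mult_ac)
  also have "(\<integral>\<^sup>+u. ennreal (exp (- (\<sigma> \<bullet> u))) * fibre_vol x I J u \<partial>lborel) =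
      (\<integral>\<^sup>+u. \<integral>\<^sup>+c. ennreal (exp (- (\<sigma> \<bullet> u))) *
        (indicator (orthant ?K) c * indicator (cone_on x J) (u - ?comb c)) \<partial>?P \<partial>lborel)"
    unfolding fibre_vol_def by (intro nn_integral_cong nn_integral_cmult[symmetric]) measurable
  also have "\<dots> = (\<integral>\<^sup>+c. \<integral>\<^sup>+u. ennreal (exp (- (\<sigma> \<bullet> u))) *
        (indicator (orthant ?K) c * indicator (cone_on x J) (u - ?comb c)) \<partial>lborel \<partial>?P)"
    by (rule Fubini') measurable
  also have "\<dots> = (\<integral>\<^sup>+c. (ennreal (exp (- (\<Sum>i\<in>?K. c i * (\<sigma> \<bullet> x i)))) * indicator (orthant ?K) c) *
        (\<integral>\<^sup>+u. ennreal (exp (- (\<sigma> \<bullet> u))) * indicator (cone_on x J) u \<partial>lborel) \<partial>?P)"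
  proof (rule nn_integral_cong)
    fix c
    have "(\<integral>\<^sup>+u. ennreal (exp (- (\<sigma> \<bullet> u))) * (indicator (orthant ?K) c * indicator (cone_on x J)
        (u - ?comb c)) \<partial>lborel) =
        (\<integral>\<^sup>+u. ennreal (exp (- (\<sigma> \<bullet> (u + ?comb c)))) * (indicator (orthant ?K) c * indicator
            (cone_on x J) (u + ?comb c - ?comb c)) \<partial>lborel)"
      by (rule nn_integral_lborel_translate[symmetric]) measurable
    also have "\<dots> = (\<integral>\<^sup>+u. (ennreal (exp (- (\<Sum>i\<in>?K. c i * (\<sigma> \<bullet> x i)))) * indicator
        (orthant ?K) c) *
        (ennreal (exp (- (\<sigma> \<bullet> u))) * indicator (cone_on x J) u) \<partial>lborel)"
      by (intro nn_integral_cong) (simp add: inner_add_right inner_sum_right exp_add exp_diff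
          divide_inverse ennreal_mult mult_ac flip: exp_minus)
    also have "\<dots> = (ennreal (exp (- (\<Sum>i\<in>?K. c i * (\<sigma> \<bullet> x i)))) * indicator (orthant ?K) c) *
        (\<integral>\<^sup>+u. ennreal (exp (- (\<sigma> \<bullet> u))) * indicator (cone_on x J) u \<partial>lborel)"
      by (rule nn_integral_cmult) measurable
    finally show "(\<integral>\<^sup>+u. ennreal (exp (- (\<sigma> \<bullet> u))) * (indicator (orthant ?K) c * indicator
        (cone_on x J) (u - ?comb c)) \<partial>lborel) =
      (ennreal (exp (- (\<Sum>i\<in>?K. c i * (\<sigma> \<bullet> x i)))) * indicator (orthant ?K) c) *
        (\<integral>\<^sup>+u. ennreal (exp (- (\<sigma> \<bullet> u))) * indicator (cone_on x J) u \<partial>lborel)" .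
  qed
  also have "\<dots> = (\<integral>\<^sup>+c. ennreal (exp (- (\<Sum>i\<in>?K. c i * (\<sigma> \<bullet> x i)))) * indicator (orthant ?K)
      c \<partial>?P) *
        (\<integral>\<^sup>+u. ennreal (exp (- (\<sigma> \<bullet> u))) * indicator (cone_on x J) u \<partial>lborel)"
    by (rule nn_integral_multc) measurable
  also have "(\<integral>\<^sup>+c. ennreal (exp (- (\<Sum>i\<in>?K. c i * (\<sigma> \<bullet> x i)))) * indicator (orthant ?K) c \<partial>?P) =
      (\<Prod>i\<in>?K. ennreal (1 / (\<sigma> \<bullet> x i)))"
    using finJ pos by (intro nn_integral_exp_orthant) auto
  finally have "(\<integral>\<^sup>+u. ennreal (exp (- (\<sigma> \<bullet> u))) * dens x I J u \<partial>lborel) =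
      (\<Prod>i\<in>?K. ennreal (1 / (\<sigma> \<bullet> x i))) * (\<Prod>i\<in>J. ennreal (1 / (\<sigma> \<bullet> x i)))"
    by (simp only: mult.left_commute[of "ennreal (dens_factor x J)"] cone)
  also have "\<dots> = (\<Prod>i\<in>I. ennreal (1 / (\<sigma> \<bullet> x i)))"
    by (rule prod.subset_diff[OF J(1) fin, symmetric])
  finally show ?thesis .
qed

text \<open>The point of the solution space over \<open>u\<close> whose coordinates outside
  \<open>J\<close> are \<open>c\<close>; those in \<open>J\<close> are solved for. For
  \<open>u = 0\<close> these points are the linear relations among the vectors.\<close>

definition lift :: "('i \<Rightarrow> 'a::euclidean_space) \<Rightarrow> 'i set \<Rightarrow> 'i set \<Rightarrow> 'a \<Rightarrow> ('i \<Rightarrow> real) \<Rightarrow> 'i \<Rightarrow>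
    real" where
  "lift x I J u c = (\<lambda>i\<in>I. if i \<in> J then bcoord x J i (u - (\<Sum>k\<in>I - J. c k *\<^sub>R x k)) else c i)"

lemma lift_comb:
  assumes "finite I" "J \<subseteq> I" "basis_on x J"
  shows "(\<Sum>i\<in>I. lift x I J u c i *\<^sub>R x i) = u"
proof -
  have "(\<Sum>i\<in>I. lift x I J u c i *\<^sub>R x i) =
      (\<Sum>i\<in>I - J. lift x I J u c i *\<^sub>R x i) + (\<Sum>i\<in>J. lift x I J u c i *\<^sub>R x i)"
    by (rule sum.subset_diff[OF assms(2,1)])
  also have "(\<Sum>i\<in>I - J. lift x I J u c i *\<^sub>R x i) = (\<Sum>i\<in>I - J. c i *\<^sub>R x i)"
    by (intro sum.cong) (auto simp: lift_def)
  also have "(\<Sum>i\<in>J. lift x I J u c i *\<^sub>R x i) =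
      (\<Sum>i\<in>J. bcoord x J i (u - (\<Sum>k\<in>I - J. c k *\<^sub>R x k)) *\<^sub>R x i)"
    using assms(2) by (intro sum.cong) (auto simp: lift_def)
  finally show ?thesis by (simp add: bcoord_expansion[OF assms(3)])
qed

lemma lift_unique:
  assumes "finite I" "J \<subseteq> I" "basis_on x J" "(\<Sum>i\<in>I. w i *\<^sub>R x i) = u"
    "\<And>i. i \<in> I - J \<Longrightarrow> c i = w i" "i \<in> I"
  shows "lift x I J u c i = w i"
proof (cases "i \<in> J")
  case True
  have "u = (\<Sum>i\<in>I - J. w i *\<^sub>R x i) + (\<Sum>i\<in>J. w i *\<^sub>R x i)"
    unfolding assms(4)[symmetric] by (rule sum.subset_diff[OF assms(2,1)])
  moreover have "(\<Sum>i\<in>I - J. w i *\<^sub>R x i) = (\<Sum>i\<in>I - J. c i *\<^sub>R x i)"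
    using assms(5) by (intro sum.cong) auto
  ultimately have "u - (\<Sum>k\<in>I - J. c k *\<^sub>R x k) = (\<Sum>i\<in>J. w i *\<^sub>R x i)" by simp
  with True assms(6) show ?thesis by (simp add: lift_def bcoord_sum[OF assms(3)])
qed (use assms in \<open>auto simp: lift_def\<close>)

lemma indicator_lift:
  assumes "J \<subseteq> I"
  shows "(indicator (orthant I) (lift x I J u c) :: ennreal) =
    indicator (orthant (I - J)) c * indicator (cone_on x J) (u - (\<Sum>i\<in>I - J. c i *\<^sub>R x i))"
  using assms by (auto simp: orthant_def cone_on_def lift_def indicator_def)

lemma fibre_vol_lift:
  "J \<subseteq> I \<Longrightarrow> fibre_vol x I J u = (\<integral>\<^sup>+c. indicator (orthant I) (lift x I J u c) \<partial>PiM (I - J)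
      (\<lambda>_. lborel))"
  by (simp add: fibre_vol_def indicator_lift)

lemma lift_affine:
  assumes "finite I" "basis_on x J" "i \<in> I"
  shows "lift x I J u c i = lift x I J 0 c i + lift x I J u (\<lambda>_. 0) i"
  using assms linear_diff[OF linear_bcoord[OF assms(2)]] linear_neg[OF linear_bcoord[OF assms(2)]]
  by (auto simp: lift_def)

lemma lift_0_sum:
  assumes "finite I" "basis_on x J" "i \<in> I"
  shows "lift x I J 0 c i = (\<Sum>k\<in>I - J. (if i \<in> J then - bcoord x J i (x k) else if i =
      k then 1 else 0) * c k)"
proof (cases "i \<in> J")
  case True
  with assms show ?thesis
    by (simp add: lift_def linear_neg[OF linear_bcoord[OF assms(2)]]
        linear_sum[OF linear_bcoord[OF assms(2)]]
        linear_cmul[OF linear_bcoord[OF assms(2)]] mult.commute flip: sum_negf)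
next
  case False
  have "(\<Sum>k\<in>I - J. (if i = k then 1 else 0) * c k) = (\<Sum>k\<in>I - J. if i = k then c k else 0)"
    by (intro sum.cong) auto
  with False assms show ?thesis by (simp add: lift_def)
qed

text \<open>Both integrals run over the same fibre, parametrised by its coordinates outside
  \<open>J\<close> and outside \<open>J'\<close>. The transition is affine: its linear part is
  \<open>lift\<close> over \<open>0\<close>, restricted to the other coordinates, and its
  translation part \<open>a\<close>, immaterial for Lebesgue measure, is the lift of the zero vector
  over \<open>u\<close>.\<close>

lemma fibre_vol_change_basis:
  assumes fin: "finite I" and J: "J \<subseteq> I" "basis_on x J" and J': "J' \<subseteq> I" "basis_on x J'"
  obtains \<kappa> :: real where "\<kappa> > 0" "\<And>u. fibre_vol x I J u = ennreal \<kappa> * fibre_vol x I J' u"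
proof -
  define M where "M J i k = (if i \<in> J then - bcoord x J i (x k) else if i = k then 1 else 0)"
      for J i k
  have L: "lin_map K (I - J1) (M J1) c = restrict (lift x I J1 0 c) K" if "K \<subseteq> I"
      "basis_on x J1" for K J1 c
    using that lift_0_sum[OF fin that(2)] by (auto simp: lin_map_def M_def fun_eq_iff)
  have LL: "lin_map (I - J1) (I - J2) (M J2) (lin_map (I - J2) (I - J1) (M J1) d) = d"
    if J1: "J1 \<subseteq> I" "basis_on x J1" and J2: "J2 \<subseteq> I" "basis_on x J2" and d:
        "d \<in> (I - J1) \<rightarrow>\<^sub>E UNIV" for J1 J2 d
  proof (rule ext)
    fix i
    let ?w = "lift x I J1 0 d"
    have "lift x I J2 0 (restrict ?w (I - J2)) i = ?w i" if "i \<in> I"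
      by (rule lift_unique[OF fin J2 lift_comb[OF fin J1] _ that]) auto
    then show "lin_map (I - J1) (I - J2) (M J2) (lin_map (I - J2) (I - J1) (M J1) d) i = d i"
      using d by (cases "i \<in> I - J1") (auto simp: L J1 J2 lift_def PiE_iff extensional_def)
  qed
  have finK: "finite (I - J)" "finite (I - J')" using fin by auto
  obtain \<kappa> :: real where \<kappa>: "\<kappa> > 0" "\<And>f. f \<in> borel_measurable (PiM (I - J') (\<lambda>_. lborel)) \<Longrightarrow>
      (\<integral>\<^sup>+c. f (lin_map (I - J') (I - J) (M J) c) \<partial>PiM (I - J) (\<lambda>_. lborel)) =
      ennreal \<kappa> * (\<integral>\<^sup>+d. f d \<partial>PiM (I - J') (\<lambda>_. lborel))"
    using PiM_lborel_linear_image[OF finK LL[OF J' J] LL[OF J J']] by blast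
  show thesis
  proof (rule that[OF \<kappa>(1)])
    fix u
    define f :: "_ \<Rightarrow> ennreal" where "f d = indicator (orthant I) (lift x I J' u d)" for d
    have f_meas: "f \<in> borel_measurable (PiM (I - J') (\<lambda>_. lborel))"
    proof -
      note [measurable] = sets_cone_on[OF J'(2)] borel_measurable_orthant[OF finK(2)]
      show ?thesis unfolding f_def indicator_lift[OF J'(1)] by measurable
    qed
    define a where "a = lift x I J u (\<lambda>_. 0)"
    have tr_meas: "(\<lambda>d. f (\<lambda>i\<in>I - J'. d i + a i)) \<in> borel_measurable (PiM (I - J') (\<lambda>_. lborel))"
      by (rule measurable_compose[OF _ f_meas]) (rule measurable_restrict, simp)
    have "fibre_vol x I J u = (\<integral>\<^sup>+c. f (\<lambda>i\<in>I - J'. lin_map (I - J') (I - J) (M J) c i + a i)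
        \<partial>PiM (I - J) (\<lambda>_. lborel))"
      unfolding fibre_vol_lift[OF J(1)]
    proof (rule nn_integral_cong)
      fix c
      let ?w = "lift x I J u c"
      have "lift x I J' u (\<lambda>i\<in>I - J'. lin_map (I - J') (I - J) (M J) c i + a i) i = ?w i" if
          "i \<in> I" for i
        by (rule lift_unique[OF fin J' lift_comb[OF fin J] _ that])
          (auto simp: L J a_def lift_affine[OF fin J(2), of _ u c])
      then show "indicator (orthant I) ?w = f (\<lambda>i\<in>I - J'. lin_map (I - J') (I - J) (M J) c
          i + a i)"
        by (auto simp: f_def orthant_def indicator_def)
    qed
    also have "\<dots> = ennreal \<kappa> * (\<integral>\<^sup>+d. f (\<lambda>i\<in>I - J'. d i + a i) \<partial>PiM (I - J') (\<lambda>_. lborel))"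
      using \<kappa>(2)[OF tr_meas] by simp
    also have "(\<integral>\<^sup>+d. f (\<lambda>i\<in>I - J'. d i + a i) \<partial>PiM (I - J') (\<lambda>_. lborel)) = fibre_vol x I J' u"
      unfolding PiM_lborel_translate[OF finK(2) f_meas]
          by (simp add: fibre_vol_lift[OF J'(1)] f_def[abs_def])
    finally show "fibre_vol x I J u = ennreal \<kappa> * fibre_vol x I J' u" .
  qed
qed

text \<open>The change of basis multiplies the density by a constant, which is \<open>1\<close> because the
  Laplace transform does not depend on the basis.\<close>

lemma dens_change_basis:
  assumes fin: "finite I" and J: "J \<subseteq> I" "basis_on x J" and J': "J' \<subseteq> I" "basis_on x J'"
    and pos: "\<And>i. i \<in> I \<Longrightarrow> \<sigma> \<bullet> x i > 0"
  shows "dens x I J u = dens x I J' u"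
proof -
  obtain \<kappa> :: real where \<kappa>: "\<kappa> > 0" "\<And>u. fibre_vol x I J u = ennreal \<kappa> * fibre_vol x I J' u"
    using fibre_vol_change_basis[OF fin J J'] by blast
  define \<rho> where "\<rho> = dens_factor x J * \<kappa> / dens_factor x J'"
  have \<rho>: "\<rho> > 0" using dens_factor(1)[OF J(2)] dens_factor(1)[OF J'(2)] \<kappa>(1) by (simp add: \<rho>_def)
  have eq: "dens x I J u = ennreal \<rho> * dens x I J' u" for u
  proof -
    have "dens x I J u = ennreal (dens_factor x J * \<kappa>) * fibre_vol x I J' u"
      using dens_factor(1)[OF J(2)] \<kappa>(1) by (simp add: dens_def \<kappa>(2) ennreal_mult mult.assoc)
    also have "dens_factor x J * \<kappa> = \<rho> * dens_factor x J'"
      using dens_factor(1)[OF J'(2)] by (simp add: \<rho>_def)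
    finally show ?thesis
      using \<rho> dens_factor(1)[OF J'(2)] by (simp add: dens_def ennreal_mult mult.assoc)
  qed
  define P where "P = (\<Prod>i\<in>I. 1 / (\<sigma> \<bullet> x i))"
  have P: "P > 0" "(\<Prod>i\<in>I. ennreal (1 / (\<sigma> \<bullet> x i))) = ennreal P"
    using pos by (auto simp: P_def less_imp_le intro!: prod_pos prod_ennreal)
  note [measurable] = borel_measurable_dens[OF fin J'(2)]
  have "ennreal P = (\<integral>\<^sup>+u. ennreal (exp (- (\<sigma> \<bullet> u))) * (ennreal \<rho> * dens x I J' u) \<partial>lborel)"
    using dens_Laplace[OF fin J pos] by (simp add: P eq)
  also have "\<dots> = ennreal \<rho> * (\<integral>\<^sup>+u. ennreal (exp (- (\<sigma> \<bullet> u))) * dens x I J' u \<partial>lborel)"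
    by (subst nn_integral_cmult[symmetric]) (auto simp: mult_ac)
  also have "\<dots> = ennreal (\<rho> * P)"
    using dens_Laplace[OF fin J' pos] \<rho> P by (simp add: ennreal_mult)
  finally have "\<rho> = 1" using \<rho> P by simp
  with eq show ?thesis by simp
qed

text \<open>Fubini with coordinate \<open>i\<close> outermost. As \<open>J\<close> avoids
  \<open>i\<close>, the same basis and the same factor serve both sides; this is why
  \<open>i\<close> has to be removable without losing the span.\<close>

lemma dens_recursion:
  fixes x :: "'i \<Rightarrow> 'a::euclidean_space"
  assumes fin: "finite I" and i: "i \<in> I" and J: "J \<subseteq> I - {i}" "basis_on x J"
  shows "dens x I J u = (\<integral>\<^sup>+t. indicator {0..} t * dens x (I - {i}) J (u - t *\<^sub>R x i) \<partial>lborel)"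
proof -
  let ?K = "I - {i} - J"
  have K: "I - J = insert i ?K" "finite ?K" "i \<notin> ?K" using fin i J by auto
  note [measurable] = sets_cone_on[OF J(2)] borel_measurable_orthant[OF K(2)]
    borel_measurable_fibre_vol[OF _ J(2), of "I - {i}"]
  have fin': "finite (I - {i})" "finite (I - J)" using fin by auto
  note [measurable] = borel_measurable_orthant[OF fin'(2)]
  have meas: "(\<lambda>c. indicator (orthant (insert i ?K)) c *
     indicator (cone_on x J) (u - (\<Sum>k\<in>insert i ?K. c k *\<^sub>R x k)) :: ennreal) \<in> borel_measurable
         (PiM (insert i ?K) (\<lambda>_. lborel))"
    unfolding K(1)[symmetric] by measurable
  have "fibre_vol x I J u = (\<integral>\<^sup>+t. \<integral>\<^sup>+c. indicator (orthant (insert i ?K)) (c(i := t)) *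
     indicator (cone_on x J) (u - (\<Sum>k\<in>insert i ?K. (c(i := t)) k *\<^sub>R x k)) \<partial>PiM ?K (\<lambda>_. lborel)
         \<partial>lborel)"
    unfolding fibre_vol_def K(1) by (rule PiM_lborel.product_nn_integral_insert_rev[OF
        K(2,3) meas])
  also have "\<dots> = (\<integral>\<^sup>+t. indicator {0..} t * fibre_vol x (I - {i}) J (u - t *\<^sub>R x i) \<partial>lborel)"
  proof (rule nn_integral_cong)
    fix t :: real
    have "(\<Sum>k\<in>insert i ?K. (c(i := t)) k *\<^sub>R x k) = t *\<^sub>R x i + (\<Sum>k\<in>?K. c k *\<^sub>R x k)" for c
      using K by (subst sum.insert) (auto intro!: arg_cong2[of _ _ _ _ "(+)"] sum.cong)
    moreover have "indicator (orthant (insert i ?K)) (c(i := t)) =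
        (indicator {0..} t * indicator (orthant ?K) c :: ennreal)" for c
      using K(3) by (auto simp: orthant_def indicator_def)
    ultimately have "(\<integral>\<^sup>+c. indicator (orthant (insert i ?K)) (c(i := t)) *
     indicator (cone_on x J) (u - (\<Sum>k\<in>insert i ?K. (c(i := t)) k *\<^sub>R x k)) \<partial>PiM ?K (\<lambda>_. lborel)) =
      (\<integral>\<^sup>+c. indicator {0..} t * (indicator (orthant ?K) c * indicator (cone_on x J) (u - t *\<^sub>R
          x i - (\<Sum>k\<in>?K. c k *\<^sub>R x k))) \<partial>PiM ?K (\<lambda>_. lborel))"
      by (simp add: mult.assoc diff_diff_eq)
    also have "\<dots> = indicator {0..} t * fibre_vol x (I - {i}) J (u - t *\<^sub>R x i)"
      unfolding fibre_vol_def by (rule nn_integral_cmult) measurable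
    finally show "(\<integral>\<^sup>+c. indicator (orthant (insert i ?K)) (c(i := t)) *
     indicator (cone_on x J) (u - (\<Sum>k\<in>insert i ?K. (c(i := t)) k *\<^sub>R x k)) \<partial>PiM ?K (\<lambda>_. lborel)) =
      indicator {0..} t * fibre_vol x (I - {i}) J (u - t *\<^sub>R x i)" .
  qed
  finally have "dens x I J u = ennreal (dens_factor x J) *
      (\<integral>\<^sup>+t. indicator {0..} t * fibre_vol x (I - {i}) J (u - t *\<^sub>R x i) \<partial>lborel)"
    by (simp add: dens_def)
  also have "\<dots> = (\<integral>\<^sup>+t. ennreal (dens_factor x J) *
      (indicator {0..} t * fibre_vol x (I - {i}) J (u - t *\<^sub>R x i)) \<partial>lborel)"
    using fin' by (intro nn_integral_cmult[symmetric]) measurable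
  finally show ?thesis
    by (simp add: dens_def mult_ac)
qed

section \<open>Recursion for the spline\<close>

lemma basis_on_functional:
  assumes J: "basis_on x J" and i: "i \<in> J" and "linear \<eta>" "\<eta> (x i) \<noteq> 0"
    and "\<And>k. k \<in> J - {i} \<Longrightarrow> \<eta> (x k) = 0"
  shows "bcoord x J i u = \<eta> u / \<eta> (x i)"
proof -
  have "\<eta> u = (\<Sum>j\<in>J. bcoord x J j u * \<eta> (x j))"
    by (subst bcoord_expansion[OF J, of u, symmetric])
      (simp add: linear_sum[OF assms(3)] linear_cmul[OF assms(3)])
  also have "\<dots> = (\<Sum>j\<in>J. if j = i then bcoord x J i u * \<eta> (x i) else 0)"
    using assms(5) by (intro sum.cong) auto
  also have "\<dots> = bcoord x J i u * \<eta> (x i)"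
    using i J by (simp add: basis_on_def)
  finally show ?thesis using assms(4) by simp
qed

lemma nn_integral_unit_ball:
  "(\<integral>\<^sup>+u. indicator (ball (0::'a::euclidean_space) 1) u \<partial>lborel) \<noteq> 0"
  "(\<integral>\<^sup>+u. indicator (ball (0::'a::euclidean_space) 1) u \<partial>lborel) \<noteq> top"
proof -
  have "(\<integral>\<^sup>+u. indicator (ball (0::'a) 1) u \<partial>lborel) = emeasure lborel (ball (0::'a) 1)"
    by simp
  moreover have "emeasure lborel (ball (0::'a) 1) < top"
    using emeasure_bounded_finite[OF bounded_ball] by (simp add: less_top)
  moreover have "emeasure lborel (ball (0::'a) 1) \<noteq> 0"
  proof
    assume "emeasure lborel (ball (0::'a) 1) = 0"
    then have "negligible (ball (0::'a) 1)"
      by (auto simp: negligible_iff_null_sets null_sets_completionI null_sets_def)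
    then show False by (simp add: open_not_negligible)
  qed
  ultimately show "(\<integral>\<^sup>+u. indicator (ball (0::'a) 1) u \<partial>lborel) \<noteq> 0"
    "(\<integral>\<^sup>+u. indicator (ball (0::'a) 1) u \<partial>lborel) \<noteq> top" by auto
qed

text \<open>The determinants of two bases that differ in one vector have the ratio of the components
  transversal to the common vectors, measured by \<open>\<eta>\<close>. Here \<open>x i\<close> is
  \<open>\<alpha>\<close> times \<open>x j\<close> plus a combination over \<open>J\<close>; the
  combination is absorbed by a translation and \<open>\<alpha>\<close> by rescaling
  \<open>t\<close>.\<close>

lemma dens_factor_exchange:
  fixes x :: "'i \<Rightarrow> 'a::euclidean_space"
  assumes J: "i \<notin> J" "j \<notin> J" "basis_on x (insert i J)" "basis_on x (insert j J)"
    and \<eta>: "linear \<eta>" "\<And>k. k \<in> J \<Longrightarrow> \<eta> (x k) = 0" "\<eta> (x i) \<noteq> 0" "\<eta> (x j) \<noteq> 0"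
  shows "dens_factor x (insert i J) * \<bar>\<eta> (x i)\<bar> = dens_factor x (insert j J) * \<bar>\<eta> (x j)\<bar>"
proof -
  let ?P = "PiM J (\<lambda>_. lborel :: real measure)"
  have fin: "finite J" using J(3) by (simp add: basis_on_def)
  \<comment> \<open>A test function whose integral is neither zero nor infinite, so that it can be
    cancelled at the end.\<close>
  define f :: "'a \<Rightarrow> ennreal" where "f = indicator (ball 0 1)"
  have [measurable]: "f \<in> borel_measurable borel" unfolding f_def
      by (rule borel_measurable_indicator) simp
  define \<alpha> where "\<alpha> = \<eta> (x i) / \<eta> (x j)"
  have \<alpha>: "\<alpha> \<noteq> 0" using \<eta> by (simp add: \<alpha>_def)
  define \<beta> where "\<beta> k = bcoord x (insert j J) k (x i)" for k
  have xi: "x i = \<alpha> *\<^sub>R x j + (\<Sum>k\<in>J. \<beta> k *\<^sub>R x k)"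
  proof -
    have "x i = (\<Sum>k\<in>insert j J. \<beta> k *\<^sub>R x k)"
      unfolding \<beta>_def by (rule bcoord_expansion[OF J(4), symmetric])
    also have "\<dots> = \<beta> j *\<^sub>R x j + (\<Sum>k\<in>J. \<beta> k *\<^sub>R x k)"
      using J(2) fin by simp
    also have "\<beta> j = \<alpha>"
      unfolding \<beta>_def \<alpha>_def using \<eta> by (intro basis_on_functional[OF J(4)]) auto
    finally show ?thesis .
  qed
  have split: "ennreal (dens_factor x (insert k J)) * (\<integral>\<^sup>+u. f u \<partial>lborel) =
      (\<integral>\<^sup>+t. \<integral>\<^sup>+c. f (t *\<^sub>R x k + (\<Sum>l\<in>J. c l *\<^sub>R x l)) \<partial>?P \<partial>lborel)"
    if k: "k \<notin> J" "basis_on x (insert k J)" for k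
  proof -
    have *: "(\<Sum>l\<in>insert k J. (c(k := t)) l *\<^sub>R x l) = t *\<^sub>R x k + (\<Sum>l\<in>J. c l *\<^sub>R x l)" for c t
      using fin k(1) by (subst sum.insert) (auto intro!: arg_cong2[of _ _ _ _ "(+)"] sum.cong)
    have "ennreal (dens_factor x (insert k J)) * (\<integral>\<^sup>+u. f u \<partial>lborel) =
        (\<integral>\<^sup>+c. f (\<Sum>l\<in>insert k J. c l *\<^sub>R x l) \<partial>PiM (insert k J) (\<lambda>_. lborel))"
      by (rule dens_factor(2)[OF k(2), symmetric]) simp
    also have "\<dots> = (\<integral>\<^sup>+t. \<integral>\<^sup>+c. f (\<Sum>l\<in>insert k J. (c(k := t)) l *\<^sub>R x l) \<partial>?P \<partial>lborel)"
      by (rule PiM_lborel.product_nn_integral_insert_rev[OF fin k(1)]) measurable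
    finally show ?thesis unfolding * .
  qed
  have [measurable]: "(\<lambda>t. \<integral>\<^sup>+c. f (t *\<^sub>R x j + (\<Sum>l\<in>J. c l *\<^sub>R x l)) \<partial>?P) \<in>
      borel_measurable borel"
  proof -
    interpret sigma_finite_measure ?P by (rule PiM_lborel.sigma_finite[OF fin])
    show ?thesis by measurable
  qed
  have "ennreal (dens_factor x (insert j J)) * (\<integral>\<^sup>+u. f u \<partial>lborel) =
      \<bar>\<alpha>\<bar> * (\<integral>\<^sup>+t. \<integral>\<^sup>+c. f ((0 + \<alpha> * t) *\<^sub>R x j + (\<Sum>l\<in>J. c l *\<^sub>R x l)) \<partial>?P \<partial>lborel)"
    unfolding split[OF J(2,4)] by (rule nn_integral_real_affine[OF _ \<alpha>]) measurable
  also have "(\<integral>\<^sup>+t. \<integral>\<^sup>+c. f ((0 + \<alpha> * t) *\<^sub>R x j + (\<Sum>l\<in>J. c l *\<^sub>R x l)) \<partial>?P \<partial>lborel) =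
      (\<integral>\<^sup>+t. \<integral>\<^sup>+c. f (t *\<^sub>R x i + (\<Sum>l\<in>J. c l *\<^sub>R x l)) \<partial>?P \<partial>lborel)"
  proof (rule nn_integral_cong)
    fix t :: real
    have *: "(0 + \<alpha> * t) *\<^sub>R x j + (\<Sum>l\<in>J. (\<lambda>l\<in>J. c l + t * \<beta> l) l *\<^sub>R x l) =
        t *\<^sub>R x i + (\<Sum>l\<in>J. c l *\<^sub>R x l)" for c
      by (simp add: xi scaleR_add_right scaleR_add_left sum.distrib scaleR_sum_right
          mult.commute cong: sum.cong)
    have "(\<integral>\<^sup>+c. f ((0 + \<alpha> * t) *\<^sub>R x j + (\<Sum>l\<in>J. c l *\<^sub>R x l)) \<partial>?P) =
        (\<integral>\<^sup>+c. f ((0 + \<alpha> * t) *\<^sub>R x j + (\<Sum>l\<in>J. (\<lambda>l\<in>J. c l + t * \<beta> l) l *\<^sub>R x l)) \<partial>?P)"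
      by (rule PiM_lborel_translate[OF fin, symmetric]) measurable
    then show "(\<integral>\<^sup>+c. f ((0 + \<alpha> * t) *\<^sub>R x j + (\<Sum>l\<in>J. c l *\<^sub>R x l)) \<partial>?P) =
        (\<integral>\<^sup>+c. f (t *\<^sub>R x i + (\<Sum>l\<in>J. c l *\<^sub>R x l)) \<partial>?P)" unfolding * .
  qed
  also have "\<dots> = ennreal (dens_factor x (insert i J)) * (\<integral>\<^sup>+u. f u \<partial>lborel)"
    by (rule split[OF J(1,3), symmetric])
  finally have "(\<integral>\<^sup>+u. f u \<partial>lborel) * ennreal (dens_factor x (insert j J)) =
      (\<integral>\<^sup>+u. f u \<partial>lborel) * ennreal (\<bar>\<alpha>\<bar> * dens_factor x (insert i J))"
    using dens_factor(1)[OF J(3)] by (simp add: ennreal_mult mult_ac)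
  then have "ennreal (dens_factor x (insert j J)) = ennreal (\<bar>\<alpha>\<bar> * dens_factor x (insert i J))"
    using nn_integral_unit_ball[where 'a = 'a] by (simp add: f_def ennreal_mult_cancel_left del:
        nn_integral_indicator)
  then have "dens_factor x (insert j J) = \<bar>\<alpha>\<bar> * dens_factor x (insert i J)"
    using dens_factor(1)[OF J(3)] dens_factor(1)[OF J(4)] by (simp add: less_imp_le)
  then show ?thesis using \<eta>(4) by (simp add: \<alpha>_def abs_divide)
qed

section \<open>Splines of the spanning subfamilies of a pointed family\<close>

locale pointed_family =
  fixes x :: "'i \<Rightarrow> 'a::euclidean_space" and A :: "'i set" and \<sigma> :: 'a
  assumes finite_A: "finite A" and pos: "\<And>i. i \<in> A \<Longrightarrow> 0 < \<sigma> \<bullet> x i"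
begin

definition spans :: "'i set \<Rightarrow> bool" where
  "spans I \<longleftrightarrow> I \<subseteq> A \<and> span (x ` I) = UNIV"

lemma spans_finite: "spans I \<Longrightarrow> finite I"
  using finite_A finite_subset by (auto simp: spans_def)

lemma spans_basis:
  assumes "spans I"
  obtains J where "J \<subseteq> I" "basis_on x J"
  using basis_on_subset_ex[OF spans_finite[OF assms]] assms by (auto simp: spans_def)

definition spl :: "'i set \<Rightarrow> 'a \<Rightarrow> ennreal" where
  "spl I = dens x I (SOME J. J \<subseteq> I \<and> basis_on x J)"

lemma spl_eq_dens:
  assumes "spans I" "J \<subseteq> I" "basis_on x J"
  shows "spl I = dens x I J"
proof -
  let ?J = "SOME J. J \<subseteq> I \<and> basis_on x J"
  have "?J \<subseteq> I \<and> basis_on x ?J"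
    using someI_ex[of "\<lambda>J. J \<subseteq> I \<and> basis_on x J"] assms by blast
  then show ?thesis
    unfolding spl_def using assms spans_finite[OF assms(1)] pos
    by (intro ext dens_change_basis) (auto simp: spans_def)
qed

lemma borel_measurable_spl [measurable]:
  assumes "spans I"
  shows "spl I \<in> borel_measurable borel"
proof -
  obtain J where J: "J \<subseteq> I" "basis_on x J" using spans_basis[OF assms] .
  show ?thesis
    unfolding spl_eq_dens[OF assms J] by (rule borel_measurable_dens[OF spans_finite[OF assms]
        J(2)])
qed

lemma spl_Laplace:
  assumes "spans I" "\<And>i. i \<in> I \<Longrightarrow> 0 < \<tau> \<bullet> x i"
  shows "(\<integral>\<^sup>+u. ennreal (exp (- (\<tau> \<bullet> u))) * spl I u \<partial>lborel) = (\<Prod>i\<in>I. ennreal (1 / (\<tau> \<bullet> x i)))"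
proof -
  obtain J where J: "J \<subseteq> I" "basis_on x J" using spans_basis[OF assms(1)] .
  show ?thesis
    unfolding spl_eq_dens[OF assms(1) J]
    by (rule dens_Laplace[OF spans_finite[OF assms(1)] J assms(2)])
qed

text \<open>Pairing a point of the fibre with \<open>\<sigma>\<close> bounds each coordinate: all
  terms \<open>c i * (\<sigma> \<bullet> x i)\<close> are nonnegative and their sum is at most
  \<open>\<sigma> \<bullet> u\<close>. So the fibre lies in a box.\<close>

lemma spl_finite:
  assumes "spans I"
  shows "spl I u < top"
proof -
  obtain J where J: "J \<subseteq> I" "basis_on x J" using spans_basis[OF assms] .
  have IA: "I \<subseteq> A" and fin: "finite I" "finite J" "finite (I - J)"
    using assms J spans_finite[OF assms] by (auto simp: spans_def intro: finite_subset)
  define r where "r = (\<Sum>i\<in>I. \<bar>\<sigma> \<bullet> u\<bar> / (\<sigma> \<bullet> x i))"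
  have r_nonneg: "r \<ge> 0" unfolding r_def using pos IA by (intro sum_nonneg divide_nonneg_pos) auto
  have "fibre_vol x I J u \<le> (\<integral>\<^sup>+c. indicator ((I - J) \<rightarrow>\<^sub>E {-r..r}) c \<partial>PiM (I - J) (\<lambda>_. lborel))"
    unfolding fibre_vol_def
  proof (rule nn_integral_mono)
    fix c assume c: "c \<in> space (PiM (I - J) (\<lambda>_. lborel :: real measure))"
    have "c i \<in> {-r..r}" if orth: "c \<in> orthant (I - J)"
        and cone: "u - (\<Sum>i\<in>I - J. c i *\<^sub>R x i) \<in> cone_on x J" and i: "i \<in> I - J" for i
    proof -
      let ?v = "u - (\<Sum>i\<in>I - J. c i *\<^sub>R x i)"
      have "\<sigma> \<bullet> ?v = (\<Sum>j\<in>J. bcoord x J j ?v * (\<sigma> \<bullet> x j))"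
        by (subst bcoord_expansion[OF J(2), of ?v, symmetric]) (simp add: inner_sum_right)
      also have "\<dots> \<ge> 0"
        using cone pos J IA by (intro sum_nonneg mult_nonneg_nonneg) (auto simp: cone_on_def
            less_imp_le subset_iff)
      finally have "(\<Sum>i\<in>I - J. c i * (\<sigma> \<bullet> x i)) \<le> \<sigma> \<bullet> u"
        by (simp add: inner_diff_right inner_sum_right)
      moreover have "c i * (\<sigma> \<bullet> x i) \<le> (\<Sum>i\<in>I - J. c i * (\<sigma> \<bullet> x i))"
        using orth pos IA i fin by (intro member_le_sum mult_nonneg_nonneg) (auto simp:
            orthant_def less_imp_le subset_iff)
      ultimately have "c i \<le> \<bar>\<sigma> \<bullet> u\<bar> / (\<sigma> \<bullet> x i)"
        using pos[of i] i IA by (auto simp: field_simps)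
      also have "\<dots> \<le> r"
        unfolding r_def using i IA pos fin by (intro member_le_sum divide_nonneg_pos) auto
      finally show ?thesis using orth i r_nonneg
          by (auto simp: orthant_def intro: order_trans[of _ 0])
    qed
    with c show "indicator (orthant (I - J)) c * indicator (cone_on x J)
        (u - (\<Sum>i\<in>I - J. c i *\<^sub>R x i))
        \<le> (indicator ((I - J) \<rightarrow>\<^sub>E {-r..r}) c :: ennreal)"
      by (auto simp: indicator_def space_PiM PiE_iff)
  qed
  also have "\<dots> = ennreal ((2 * r) ^ card (I - J))"
    using emeasure_PiM_box[OF fin(3) r_nonneg] fin by simp
  finally have "fibre_vol x I J u < top"
    by (auto simp: order.strict_trans1 ennreal_less_top)
  then show ?thesis
    by (simp add: spl_eq_dens[OF assms J] dens_def ennreal_mult_less_top)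
qed

definition W :: "'i set \<Rightarrow> 'a \<Rightarrow> real" where
  "W I u = enn2real (spl I u)"

lemma W_nonneg: "0 \<le> W I u"
  by (simp add: W_def)

lemma ennreal_W: "spans I \<Longrightarrow> ennreal (W I u) = spl I u"
  using spl_finite by (simp add: W_def)

text \<open>The substitution \<open>t = h - s\<close> makes the spline in the integrand independent
  of \<open>h\<close>, which enters only as the upper limit; differences in \<open>h\<close> are
  then integrals over intervals.\<close>

lemma spl_recursion:
  assumes "spans I" "i \<in> I" "spans (I - {i})"
  shows "spl I (u + h *\<^sub>R x i) = (\<integral>\<^sup>+s. indicator {..h} s * spl (I - {i}) (u + s *\<^sub>R x i)
      \<partial>lborel)"
proof -
  obtain J where J: "J \<subseteq> I - {i}" "basis_on x J" using spans_basis[OF assms(3)] .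
  then have JI: "J \<subseteq> I" by auto
  note [measurable] = borel_measurable_spl[OF assms(3)]
  have "spl I (u + h *\<^sub>R x i) = (\<integral>\<^sup>+t. indicator {0..} t * spl (I - {i}) (u + h *\<^sub>R x i - t *\<^sub>R
      x i) \<partial>lborel)"
    unfolding spl_eq_dens[OF assms(1) JI J(2)] spl_eq_dens[OF assms(3) J]
    by (rule dens_recursion[OF spans_finite[OF assms(1)] assms(2) J])
  also have "\<dots> = ennreal \<bar>-1\<bar> * (\<integral>\<^sup>+s. indicator {0..} (h + (-1) * s) * spl (I - {i}) (u + h *\<^sub>R
      x i - (h + (-1) * s) *\<^sub>R x i) \<partial>lborel)"
  proof (rule nn_integral_real_affine)
    have "(\<lambda>t. spl (I - {i}) (u + h *\<^sub>R x i - t *\<^sub>R x i)) \<in> borel_measurable borel"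
      by (rule measurable_compose[OF _ borel_measurable_spl[OF assms(3)]]) measurable
    then show "(\<lambda>t. indicator {0..} t * spl (I - {i}) (u + h *\<^sub>R x i - t *\<^sub>R x i)) \<in>
        borel_measurable borel"
      by (intro borel_measurable_times_ennreal borel_measurable_indicator) auto
  qed simp
  also have "\<dots> = (\<integral>\<^sup>+s. indicator {..h} s * spl (I - {i}) (u + s *\<^sub>R x i) \<partial>lborel)"
    by (simp, intro nn_integral_cong) (auto simp: indicator_def algebra_simps)
  finally show ?thesis .
qed

text \<open>The differential relation between \<open>W I\<close> and \<open>W (I - {i})\<close> in a
  form that requires no differentiability of \<open>W\<close>. Agreement with \<open>g\<close> on
  the open interval suffices, so the end points may lie on walls.\<close>

lemma W_increment:
  assumes I: "spans I" "i \<in> I" "spans (I - {i})" and h: "h1 \<le> h2"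
    and g: "continuous_on UNIV g" and G: "\<And>s. (G has_real_derivative g s) (at s)"
    and W: "\<And>s. \<lbrakk>h1 < s; s < h2\<rbrakk> \<Longrightarrow> W (I - {i}) (u + s *\<^sub>R x i) = g s"
  shows "W I (u + h2 *\<^sub>R x i) - W I (u + h1 *\<^sub>R x i) = G h2 - G h1"
proof (cases "h1 = h2")
  case False
  with h have h: "h1 < h2" by simp
  note [measurable] = borel_measurable_spl[OF I(3)]
  have nonneg: "0 \<le> g s" if "s \<in> {h1..h2}" for s
  proof (rule continuous_ge_on_Ioo[OF _ _ h that])
    show "continuous_on {h1..h2} g" using g continuous_on_subset by blast
    show "0 \<le> g s" if "s \<in> {h1<..<h2}" for s using W[of s] W_nonneg[of "I - {i}"] that
        by (metis greaterThanLessThan_iff)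
  qed
  have "spl I (u + h2 *\<^sub>R x i) = (\<integral>\<^sup>+s. indicator {..h1} s * spl (I - {i}) (u + s *\<^sub>R x i) +
      indicator {h1<..h2} s * spl (I - {i}) (u + s *\<^sub>R x i) \<partial>lborel)"
    unfolding spl_recursion[OF I] using h
    by (intro nn_integral_cong) (auto simp: indicator_def)
  also have "\<dots> = spl I (u + h1 *\<^sub>R x i) + (\<integral>\<^sup>+s. indicator {h1<..h2} s * spl (I - {i})
      (u + s *\<^sub>R x i) \<partial>lborel)"
    unfolding spl_recursion[OF I] by (rule nn_integral_add) measurable
  also have "(\<integral>\<^sup>+s. indicator {h1<..h2} s * spl (I - {i}) (u + s *\<^sub>R x i) \<partial>lborel) =
      (\<integral>\<^sup>+s. ennreal (g s) * indicator {h1..h2} s \<partial>lborel)"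
  proof (rule nn_integral_cong_AE)
    have "AE s in lborel. s \<noteq> h1 \<and> s \<noteq> h2"
      by (intro AE_conjI AE_lborel_singleton)
    then show "AE s in lborel. indicator {h1<..h2} s * spl (I - {i}) (u + s *\<^sub>R x i) =
        ennreal (g s) * indicator {h1..h2} s"
    proof eventually_elim
      case (elim s)
      then show ?case
        using W[of s] ennreal_W[OF I(3), of "u + s *\<^sub>R x i"] by (auto simp: indicator_def)
    qed
  qed
  also have "\<dots> = ennreal (G h2 - G h1)"
    using h nonneg G g by (intro nn_integral_FTC_Icc) (auto intro:
        borel_measurable_continuous_onI)
  finally have "ennreal (W I (u + h2 *\<^sub>R x i)) = ennreal (W I (u + h1 *\<^sub>R x i)) + ennreal
      (G h2 - G h1)"
    using ennreal_W[OF I(1)] by simp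
  moreover have "0 \<le> G h2 - G h1"
    using DERIV_nonneg_imp_nondecreasing[of h1 h2 G] h G nonneg by force
  ultimately have "W I (u + h2 *\<^sub>R x i) = W I (u + h1 *\<^sub>R x i) + (G h2 - G h1)"
    by (simp add: W_nonneg flip: ennreal_plus)
  then show ?thesis by simp
qed simp

section \<open>Families in which one vector alone lies off a hyperplane\<close>

lemma coloop_in_basis:
  fixes \<eta> :: "'a \<Rightarrow> real"
  assumes "spans I" "J \<subseteq> I" "basis_on x J" "linear \<eta>" "\<And>k. k \<in> I - {i} \<Longrightarrow> \<eta> (x k) = 0"
    "\<eta> (x i) \<noteq> 0"
  shows "i \<in> J"
proof (rule ccontr)
  assume "i \<notin> J"
  have "\<eta> v = 0" if "v \<in> span (x ` J)" for v
    using linear_eq_0_on_span[OF assms(4) _ that] assms(2,5) \<open>i \<notin> J\<close> by blast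
  then show False using assms(3,6) by (auto simp: basis_on_def)
qed

text \<open>Over \<open>u\<close> the coordinate of \<open>x i\<close> is forced to be
  \<open>\<eta> u / \<eta> (x i)\<close>; if this is negative, no solution lies in the
  orthant.\<close>

lemma W_coloop_neg:
  fixes \<eta> :: "'a \<Rightarrow> real"
  assumes I: "spans I" "i \<in> I" and \<eta>: "linear \<eta>" "\<And>k. k \<in> I - {i} \<Longrightarrow> \<eta> (x k) = 0" "\<eta> (x i) \<noteq> 0"
    and u: "\<eta> u / \<eta> (x i) < 0"
  shows "W I u = 0"
proof -
  obtain J where J: "J \<subseteq> I" "basis_on x J" using spans_basis[OF I(1)] .
  have i: "i \<in> J" by (rule coloop_in_basis[OF I(1) J \<eta>])
  have *: "\<eta> (x k) = 0" if "k \<in> I - J" for k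
    using \<eta>(2)[of k] i that by auto
  have "u - (\<Sum>k\<in>I - J. c k *\<^sub>R x k) \<notin> cone_on x J" for c
  proof -
    have "bcoord x J i (u - (\<Sum>k\<in>I - J. c k *\<^sub>R x k)) = \<eta> (u - (\<Sum>k\<in>I - J. c k *\<^sub>R x k)) / \<eta> (x i)"
      using \<eta> J by (intro basis_on_functional[OF J(2) i]) auto
    also have "\<eta> (u - (\<Sum>k\<in>I - J. c k *\<^sub>R x k)) = \<eta> u"
      using * by (auto simp: linear_diff[OF \<eta>(1)] linear_sum[OF \<eta>(1)] linear_cmul[OF \<eta>(1)]
          intro!: sum.neutral)
    finally show ?thesis using u i by (auto simp: cone_on_def intro!: bexI[of _ i])
  qed
  then have "fibre_vol x I J u = 0" by (simp add: fibre_vol_def)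
  then show ?thesis by (simp add: W_def spl_eq_dens[OF I(1) J] dens_def)
qed

text \<open>Up to normalisation both sides are the spline of \<open>Y\<close> inside the kernel of
  \<open>\<eta>\<close>, at the common projection of \<open>u\<close> and \<open>v\<close>. Phrasing
  this as an exchange keeps all splines full-dimensional. The absolute values of
  \<open>\<eta>\<close> come from \<open>dens_factor_exchange\<close>; the fibre volumes agree as
  integrals over the same coordinates \<open>Y - J\<close>.\<close>

lemma W_coloop_exchange:
  fixes \<eta> :: "'a \<Rightarrow> real"
  assumes Y: "i \<notin> Y" "j \<notin> Y" "spans (insert i Y)" "spans (insert j Y)"
    and \<eta>: "linear \<eta>" "\<And>k. k \<in> Y \<Longrightarrow> \<eta> (x k) = 0" "\<eta> (x i) \<noteq> 0" "\<eta> (x j) \<noteq> 0"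
    and u: "\<eta> u / \<eta> (x i) \<ge> 0" "\<eta> v / \<eta> (x j) \<ge> 0"
      "u - (\<eta> u / \<eta> (x i)) *\<^sub>R x i = v - (\<eta> v / \<eta> (x j)) *\<^sub>R x j"
  shows "W (insert i Y) u * \<bar>\<eta> (x i)\<bar> = W (insert j Y) v * \<bar>\<eta> (x j)\<bar>"
proof -
  obtain J' where J': "J' \<subseteq> insert i Y" "basis_on x J'" using spans_basis[OF Y(3)] .
  define J where "J = J' - {i}"
  have i: "i \<in> J'"
    using \<eta> by (intro coloop_in_basis[OF Y(3) J' \<eta>(1)]) auto
  have J: "J \<subseteq> Y" "i \<notin> J" "j \<notin> J" "insert i J = J'" using J' i Y by (auto simp: J_def)
  have bi: "basis_on x (insert i J)" using J' J by simp
  have bj: "basis_on x (insert j J)"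
  proof -
    have fin: "finite J" using J'(2) by (simp add: J_def basis_on_def)
    have sub: "J \<subseteq> J'" by (auto simp: J_def)
    have inj: "inj_on x J" using J'(2) sub by (auto simp: basis_on_def intro: inj_on_subset)
    have ind: "independent (x ` J)"
      using J'(2) independent_mono[OF _ image_mono[OF sub]] by (auto simp: basis_on_def)
    have "\<eta> v = 0" if "v \<in> span (x ` J)" for v
      using linear_eq_0_on_span[OF \<eta>(1) _ that] \<eta>(2) J(1) by blast
    then have xj: "x j \<notin> span (x ` J)" using \<eta>(4) by blast
    then have inj': "inj_on x (insert j J)" using inj by (auto simp: span_base)
    have ind': "independent (x ` insert j J)"
      using ind xj by (simp add: independent_insert)
    have "card (x ` insert j J) = card (x ` insert i J)"
      using card_image[OF inj'] card_image[of x "insert i J"] bi J(2,3) fin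
      by (simp only: basis_on_def card_insert_disjoint simp_thms)
    also have "\<dots> = DIM('a)"
      using bi by (metis basis_on_def dim_UNIV dim_eq_card_independent dim_span)
    finally have "span (x ` insert j J) = UNIV"
      using ind' by (metis card_eq_dim dim_UNIV subset_UNIV top.extremum_uniqueI
          independent_imp_finite order_refl)
    with inj' ind' fin show ?thesis by (simp add: basis_on_def)
  qed
  let ?w = "u - (\<eta> u / \<eta> (x i)) *\<^sub>R x i"
  \<comment> \<open>On the kernel of \<open>\<eta>\<close> the exchanged vector has coordinate
    \<open>0\<close>, so both bases give the same coordinates in \<open>J\<close>.\<close>
  have same: "bcoord x (insert i J) l w = bcoord x (insert j J) l w" if "l \<in> J" "\<eta> w = 0" for l w
  proof -
    have "bcoord x (insert i J) i w = 0"
      using \<eta> J that by (subst basis_on_functional[OF bi, of i \<eta>]) auto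
    then have "w = (\<Sum>k\<in>J. bcoord x (insert i J) k w *\<^sub>R x k)"
      using bcoord_expansion[OF bi, of w] J(2) bi by (simp add: basis_on_def)
    also have "\<dots> = (\<Sum>k\<in>insert j J. (if k = j then 0 else bcoord x (insert i J) k w) *\<^sub>R x k)"
      using J bi by (subst sum.insert) (auto simp: basis_on_def intro!: sum.cong)
    finally have "bcoord x (insert j J) l w =
        bcoord x (insert j J) l (\<Sum>k\<in>insert j J. (if k = j then 0 else bcoord x (insert i J) k w)
            *\<^sub>R x k)"
      by simp
    also have "\<dots> = bcoord x (insert i J) l w"
      using that J by (subst bcoord_sum[OF bj]) auto
    finally show ?thesis by simp
  qed
  have cone: "w + t *\<^sub>R x k \<in> cone_on x (insert k J) \<longleftrightarrow> (\<forall>l\<in>J. 0 \<le> bcoord x (insert i J) l w)"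
    if "t \<ge> 0" "\<eta> w = 0" "k = i \<or> k = j" for w t k
  proof -
    have bk: "basis_on x (insert k J)" "k \<notin> J" "\<eta> (x k) \<noteq> 0" using that bi bj J \<eta> by auto
    have "bcoord x (insert k J) k (w + t *\<^sub>R x k) = \<eta> (w + t *\<^sub>R x k) / \<eta> (x k)"
      using \<eta> J bk by (intro basis_on_functional[OF bk(1)]) auto
    also have "\<dots> = t" using that bk by (simp add: linear_add[OF \<eta>(1)] linear_cmul[OF \<eta>(1)])
    finally have "bcoord x (insert k J) k (w + t *\<^sub>R x k) = t" .
    moreover have "bcoord x (insert k J) l (w + t *\<^sub>R x k) = bcoord x (insert i J) l w" if
        "l \<in> J" for l
    proof -
      have "bcoord x (insert k J) l (w + t *\<^sub>R x k) = bcoord x (insert k J) l w"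
        using bcoord_basis[OF bk(1), of k l] that bk
        by (auto simp: linear_add[OF linear_bcoord[OF bk(1)]]
            linear_cmul[OF linear_bcoord[OF bk(1)]])
      then show ?thesis using same[OF that \<open>\<eta> w = 0\<close>] \<open>k = i \<or> k = j\<close> by auto
    qed
    ultimately show ?thesis using that by (auto simp: cone_on_def)
  qed
  have \<eta>w: "\<eta> ?w = 0" using \<eta> by (simp add: linear_diff[OF \<eta>(1)] linear_cmul[OF \<eta>(1)])
  have sets: "insert i Y - insert i J = Y - J" "insert j Y - insert j J = Y - J"
    using Y J by auto
  have fv: "fibre_vol x (insert i Y) (insert i J) u = fibre_vol x (insert j Y) (insert j J) v"
    unfolding fibre_vol_def sets
  proof (rule nn_integral_cong)
    fix c
    let ?s = "\<Sum>k\<in>Y - J. c k *\<^sub>R x k"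
    have "\<eta> (?w - ?s) = 0"
      using \<eta> \<eta>w by (auto simp: linear_diff[OF \<eta>(1)] linear_sum[OF \<eta>(1)] linear_cmul[OF \<eta>(1)]
          intro!: sum.neutral)
    note c = cone[OF u(1) this, of i] cone[OF u(2) this, of j]
    have *: "?w - ?s + (\<eta> u / \<eta> (x i)) *\<^sub>R x i = u - ?s" by simp
    have **: "?w - ?s + (\<eta> v / \<eta> (x j)) *\<^sub>R x j = v - ?s" unfolding u(3) by simp
    have "u - ?s \<in> cone_on x (insert i J) \<longleftrightarrow> v - ?s \<in> cone_on x (insert j J)"
      using c unfolding * ** by simp
    then show "indicator (orthant (Y - J)) c * indicator (cone_on x (insert i J)) (u - ?s) =
        (indicator (orthant (Y - J)) c * indicator (cone_on x (insert j J)) (v - ?s) :: ennreal)"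
      by (simp add: indicator_def)
  qed
  have *: "W (insert k Y) u' = dens_factor x (insert k J) * enn2real (fibre_vol x (insert k Y)
      (insert k J) u')"
    if "k = i \<or> k = j" for k u'
  proof -
    have "spans (insert k Y)" "basis_on x (insert k J)" "insert k J \<subseteq> insert k Y"
      using that Y bi bj J by auto
    then show ?thesis
      using dens_factor(1)[of x "insert k J"]
      by (simp add: W_def spl_eq_dens[of "insert k Y" "insert k J"] dens_def enn2real_mult)
  qed
  have "W (insert i Y) u * \<bar>\<eta> (x i)\<bar> =
      (dens_factor x (insert i J) * \<bar>\<eta> (x i)\<bar>) * enn2real (fibre_vol x (insert i Y)
          (insert i J) u)"
    by (simp add: *)
  also have "\<dots> = (dens_factor x (insert j J) * \<bar>\<eta> (x j)\<bar>) * enn2real (fibre_vol x (insert j Y)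
      (insert j J) v)"
    using dens_factor_exchange[OF J(2,3) bi bj \<eta>(1) _ \<eta>(3,4)] \<eta>(2) J(1) fv by auto
  also have "\<dots> = W (insert j Y) v * \<bar>\<eta> (x j)\<bar>" by (simp add: *)
  finally show ?thesis .
qed

text \<open>The case \<open>j = i\<close> of the exchange: the two points have the same projection
  along \<open>x i\<close>.\<close>

lemma W_coloop_shift:
  fixes \<eta> :: "'a \<Rightarrow> real"
  assumes I: "spans I" "i \<in> I" and \<eta>: "linear \<eta>" "\<And>k. k \<in> I - {i} \<Longrightarrow> \<eta> (x k) = 0" "\<eta> (x i) \<noteq> 0"
    and u: "\<eta> u / \<eta> (x i) \<ge> 0" "\<eta> u / \<eta> (x i) + h \<ge> 0"
  shows "W I (u + h *\<^sub>R x i) = W I u"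
proof -
  have "W (insert i (I - {i})) u * \<bar>\<eta> (x i)\<bar> = W (insert i (I - {i})) (u + h *\<^sub>R x i) * \<bar>\<eta> (x i)\<bar>"
    using assms by (intro W_coloop_exchange[where \<eta> = \<eta>])
      (auto simp: insert_absorb linear_add[OF \<eta>(1)] linear_cmul[OF \<eta>(1)] add_divide_distrib
          algebra_simps)
  then show ?thesis using \<eta> I by (simp add: insert_absorb)
qed

end

section \<open>Piecewise polynomiality and jumps\<close>

lemma hyperplane_normal:
  fixes H :: "'a::euclidean_space set"
  assumes "subspace H" "dim H = DIM('a) - 1"
  obtains a where "a \<noteq> 0" "H = {u. a \<bullet> u = 0}"
proof -
  have "dim H < DIM('a)" using assms(2) DIM_positive[where 'a = 'a] by linarith
  then obtain a where a: "a \<noteq> 0" "span H \<subseteq> {u. a \<bullet> u = 0}"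
    using lowdim_subset_hyperplane by metis
  have "H = {u. a \<bullet> u = 0}"
    using a assms span_superset[of H] by (intro subspace_dim_equal subspace_hyperplane)
      (auto simp: dim_hyperplane)
  with a(1) show thesis by (rule that)
qed

lemma hyperplane_kernel:
  fixes H :: "'a::euclidean_space set"
  assumes "subspace H" "dim H = DIM('a) - 1" "linear \<eta>" "\<eta> \<noteq> (\<lambda>_. 0)" "\<And>h. h \<in> H \<Longrightarrow> \<eta> h =
      (0::real)"
  obtains a where "a \<noteq> 0" "H = {u. a \<bullet> u = 0}" "\<eta> = (\<bullet>) a"
proof -
  define a where "a = (\<Sum>b\<in>Basis. \<eta> b *\<^sub>R b)"
  have eta: "\<eta> u = a \<bullet> u" for u
  proof -
    have "\<eta> u = \<eta> (\<Sum>b\<in>Basis. (u \<bullet> b) *\<^sub>R b)" by (simp add: euclidean_representation)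
    also have "\<dots> = (\<Sum>b\<in>Basis. (u \<bullet> b) * \<eta> b)"
      by (simp add: linear_sum[OF assms(3)] linear_cmul[OF assms(3)])
    also have "\<dots> = a \<bullet> u"
      by (simp add: a_def inner_sum_left inner_commute[of u] mult.commute)
    finally show ?thesis .
  qed
  have "a \<noteq> 0" using assms(4) eta by (auto simp: fun_eq_iff)
  moreover have "H = {u. a \<bullet> u = 0}"
    using \<open>a \<noteq> 0\<close> assms eta by (intro subspace_dim_equal subspace_hyperplane)
      (auto simp: dim_hyperplane)
  moreover have "\<eta> = (\<bullet>) a" using eta by auto
  ultimately show thesis by (rule that)
qed

context pointed_family
begin

definition hyps :: "'i set \<Rightarrow> 'a set set" where
  "hyps I = {H. dim H = DIM('a) - 1 \<and> (\<exists>K\<subseteq>I. H = span (x ` K))}"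

text \<open>Only hyperplanes through the origin are removed. The components are cones, on which
  \<open>W I\<close> turns out to be polynomial; every alcove lies in one component of the set for
  the whole list.\<close>

definition gen :: "'i set \<Rightarrow> 'a set" where
  "gen I = - \<Union>(hyps I)"

lemma finite_hyps: "finite I \<Longrightarrow> finite (hyps I)"
  by (rule finite_subset[of _ "(\<lambda>K. span (x ` K)) ` Pow I"]) (auto simp: hyps_def)

lemma subspace_hyps: "H \<in> hyps I \<Longrightarrow> subspace H"
  by (auto simp: hyps_def)

lemma hyps_normal:
  assumes "H \<in> hyps I"
  obtains a where "a \<noteq> 0" "H = {u. a \<bullet> u = 0}"
  using hyperplane_normal[OF subspace_hyps[OF assms]] assms by (auto simp: hyps_def)

lemma hyps_mono: "I \<subseteq> I' \<Longrightarrow> hyps I \<subseteq> hyps I'"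
  by (auto simp: hyps_def)

lemma gen_mono: "I \<subseteq> I' \<Longrightarrow> gen I' \<subseteq> gen I"
  using hyps_mono[of I I'] by (auto simp: gen_def)

lemma open_gen: "finite I \<Longrightarrow> open (gen I)"
  unfolding gen_def using finite_hyps subspace_hyps
  by (intro open_Compl closed_Union) (auto intro: closed_subspace)

lemma coloop_functional:
  assumes "spans I" "i \<in> I" "\<not> spans (I - {i})"
  obtains a where "a \<noteq> 0" "{u. a \<bullet> u = 0} \<in> hyps I" "\<And>k. k \<in> I - {i} \<Longrightarrow> a \<bullet> x k = 0" "a \<bullet> x i \<noteq> 0"
proof -
  let ?H = "span (x ` (I - {i}))"
  have I: "I \<subseteq> A" "span (x ` I) = UNIV" "insert (x i) (x ` (I - {i})) = x ` I"
    using assms by (auto simp: spans_def)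
  then have "?H \<noteq> UNIV" using assms by (auto simp: spans_def)
  then have "x i \<notin> ?H" using I span_redundant[of "x i" "x ` (I - {i})"] by auto
  then have "dim (insert (x i) (x ` (I - {i}))) = dim (x ` (I - {i})) + 1"
    by (simp add: dim_insert)
  then have dim: "dim ?H = DIM('a) - 1"
    using I by (metis add_diff_cancel_right' dim_span dim_UNIV)
  then obtain a where a: "a \<noteq> 0" "?H = {u. a \<bullet> u = 0}"
    using hyperplane_normal[OF subspace_span] by blast
  show thesis
  proof (rule that[OF a(1)])
    show "{u. a \<bullet> u = 0} \<in> hyps I"
      unfolding a(2)[symmetric] hyps_def using dim by auto
    show "a \<bullet> x k = 0" if "k \<in> I - {i}" for k
    proof -
      have "x k \<in> ?H" using that by (intro span_base) auto
      then show ?thesis unfolding a(2) by simp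
    qed
    show "a \<bullet> x i \<noteq> 0" using \<open>x i \<notin> ?H\<close> unfolding a(2) by simp
  qed
qed

lemma W_increment_convex:
  assumes I: "spans I" "i \<in> I" "spans (I - {i})" and S: "convex S" "\<And>v. v \<in> S \<Longrightarrow>
      W (I - {i}) v = g v"
    and g: "continuous_on UNIV g" and G: "\<And>u t. ((\<lambda>t. G u t) has_real_derivative g (u + t *\<^sub>R x
        i)) (at t)"
    and u: "u \<in> S" "u + t *\<^sub>R x i \<in> S"
  shows "W I (u + t *\<^sub>R x i) - W I u = G u t - G u 0"
proof -
  have seg: "u + s *\<^sub>R x i \<in> S" if "s \<in> closed_segment 0 t" for s
  proof -
    have "\<exists>\<theta>. s = (1 - \<theta>) *\<^sub>R 0 + \<theta> *\<^sub>R t \<and> 0 \<le> \<theta> \<and> \<theta> \<le> 1"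
      using that unfolding closed_segment_def by (rule CollectD)
    then obtain \<theta> where \<theta>: "s = (1 - \<theta>) *\<^sub>R 0 + \<theta> *\<^sub>R t" "0 \<le> \<theta>" "\<theta> \<le> 1"
      by (elim exE conjE)
    have "(1 - \<theta>) *\<^sub>R u + \<theta> *\<^sub>R (u + t *\<^sub>R x i) \<in> S"
      by (rule convexD_alt[OF S(1) u \<theta>(2,3)])
    then show ?thesis using \<theta>(1) by (simp add: algebra_simps)
  qed
  have cont: "continuous_on UNIV (\<lambda>s. g (u + s *\<^sub>R x i))"
    by (intro continuous_on_compose2[OF g]) (auto intro!: continuous_intros)
  show ?thesis
  proof (cases "0 \<le> t")
    case True
    have "W I (u + t *\<^sub>R x i) - W I (u + 0 *\<^sub>R x i) = G u t - G u 0"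
      by (rule W_increment[OF I True cont G]) (auto intro!: S seg simp:
          closed_segment_eq_real_ivl)
    then show ?thesis by simp
  next
    case False
    then have "W I (u + 0 *\<^sub>R x i) - W I (u + t *\<^sub>R x i) = G u 0 - G u t"
      by (intro W_increment[OF I _ cont G]) (auto intro!: S seg simp: closed_segment_eq_real_ivl)
    then show ?thesis by simp
  qed
qed

text \<open>Induction on the number of vectors, moving along a basis \<open>J\<close>. If
  \<open>x i\<close> can be removed, the increment along it is a primitive of a polynomial given by
  induction. Otherwise the remaining vectors span a hyperplane, which avoids \<open>u0\<close>, and
  near \<open>u0\<close> the increment along \<open>x i\<close> vanishes.\<close>

lemma W_locally_rpf:
  assumes "spans I" "u0 \<in> gen I"
  shows "\<exists>g. real_polynomial_function g \<and> (\<forall>\<^sub>F u in nhds u0. W I u = g u)"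
  using assms
proof (induction "card I" arbitrary: I rule: less_induct)
  case less
  note I = less.prems(1)
  have fin: "finite I" by (rule spans_finite[OF I])
  obtain J where J: "J \<subseteq> I" "basis_on x J" using spans_basis[OF I] .
  have "\<exists>G. real_polynomial_function (\<lambda>(u, t). G u t) \<and> (\<forall>\<^sub>F r in at_right 0.
      \<forall>u t. u \<in> ball u0 r \<longrightarrow> u + t *\<^sub>R x i \<in> ball u0 r \<longrightarrow> W I (u + t *\<^sub>R x i) - W I u = G u t)"
    if i: "i \<in> I" for i
  proof (cases "spans (I - {i})")
    case True
    have "card (I - {i}) < card I" using i fin by (intro psubset_card_mono) auto
    moreover have "u0 \<in> gen (I - {i})" using gen_mono[of "I - {i}" I] less.prems by auto
    ultimately obtain g where g: "real_polynomial_function g" "\<forall>\<^sub>F u in nhds u0. W (I - {i}) u =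
        g u"
      using less.hyps True by blast
    then obtain r0 where r0: "r0 > 0" "\<And>u. u \<in> ball u0 r0 \<Longrightarrow> W (I - {i}) u = g u"
      by (auto simp: eventually_nhds_metric dist_commute)
    obtain G where G: "real_polynomial_function (\<lambda>(u, t). G u t)" "\<And>u. G u 0 = 0"
      "\<And>u t. ((\<lambda>t. G u t) has_real_derivative g (u + t *\<^sub>R x i)) (at t)"
      using rpf_primitive'[OF g(1), where x = "x i"] by metis
    have "\<forall>\<^sub>F r in at_right 0. r < r0" using r0(1)
        by (rule eventually_at_right_less[THEN eventually_mono, rotated] | auto simp:
        eventually_at_right_field intro: exI[of _ r0])
    then have "\<forall>\<^sub>F r in at_right 0. \<forall>u t. u \<in> ball u0 r \<longrightarrow> u + t *\<^sub>R x i \<in> ball u0 r \<longrightarrow>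
        W I (u + t *\<^sub>R x i) - W I u = G u t"
    proof eventually_elim
      case (elim r)
      show ?case
      proof (intro allI impI)
        fix u t assume u: "u \<in> ball u0 r" "u + t *\<^sub>R x i \<in> ball u0 r"
        have "W I (u + t *\<^sub>R x i) - W I u = G u t - G u 0"
          by (rule W_increment_convex[OF I i True convex_ball _ rpf_continuous[OF g(1)] G(3) u])
            (use elim r0(2) in auto)
        then show "W I (u + t *\<^sub>R x i) - W I u = G u t" by (simp add: G(2))
      qed
    qed
    with G(1) show ?thesis by blast
  next
    case False
    obtain a where a: "a \<noteq> 0" "{u. a \<bullet> u = 0} \<in> hyps I" "\<And>k. k \<in> I - {i} \<Longrightarrow> a \<bullet> x k = 0"
        "a \<bullet> x i \<noteq> 0"
      using coloop_functional[OF I i False] by metis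
    have lin: "linear ((\<bullet>) a)" by (simp add: bounded_linear.linear bounded_linear_inner_right)
    \<comment> \<open>The coordinate along the coloop \<open>x i\<close>. Its sign is constant near
      \<open>u0\<close>: where it is positive, \<open>W I\<close> is constant along
      \<open>x i\<close>; where it is negative, \<open>W I\<close> is zero.\<close>
    define q where "q u = (a \<bullet> u) / (a \<bullet> x i)" for u
    have q0: "q u0 \<noteq> 0" using less.prems a by (auto simp: gen_def q_def)
    have "open {u. q u * q u0 > 0}"
      unfolding q_def by (intro open_Collect_less continuous_intros) (use a in auto)
    moreover have "u0 \<in> {u. q u * q u0 > 0}" using q0
        by (auto simp: zero_less_mult_iff linorder_neq_iff)
    ultimately obtain r0 where r0: "r0 > 0" "ball u0 r0 \<subseteq> {u. q u * q u0 > 0}"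
      by (meson open_contains_ball)
    have "\<forall>\<^sub>F r in at_right 0. r < r0" using r0(1) by (auto simp: eventually_at_right_field
        intro: exI[of _ r0])
    then have "\<forall>\<^sub>F r in at_right 0. \<forall>u t. u \<in> ball u0 r \<longrightarrow> u + t *\<^sub>R x i \<in> ball u0 r \<longrightarrow>
        W I (u + t *\<^sub>R x i) - W I u = 0"
    proof eventually_elim
      case (elim r)
      show ?case
      proof (intro allI impI)
        fix u t assume "u \<in> ball u0 r" "u + t *\<^sub>R x i \<in> ball u0 r"
        moreover have "ball u0 r \<subseteq> {u. q u * q u0 > 0}"
          using r0(2) subset_ball[of r r0 u0] elim by auto
        ultimately have u: "q u * q u0 > 0" "q (u + t *\<^sub>R x i) * q u0 > 0" by blast+
        have qt: "q (u + t *\<^sub>R x i) = q u + t" using a(4)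
            by (simp add: q_def inner_add_right field_simps)
        show "W I (u + t *\<^sub>R x i) - W I u = 0"
        proof (cases "q u0 > 0")
          case True
          then have "q u > 0" "q u + t > 0" using u qt by (auto simp: zero_less_mult_iff)
          then have "W I (u + t *\<^sub>R x i) = W I u"
            by (intro W_coloop_shift[OF I i lin a(3,4)]) (auto simp: q_def)
          then show ?thesis by simp
        next
          case False
          then have "q u < 0" "q (u + t *\<^sub>R x i) < 0" using u by (auto simp: zero_less_mult_iff)
          then show ?thesis
            using W_coloop_neg[OF I i lin a(3,4), of u] W_coloop_neg[OF I i lin a(3,4), of
                "u + t *\<^sub>R x i"]
            by (simp add: q_def)
        qed
      qed
    qed
    moreover have "real_polynomial_function (\<lambda>(u, t). (0::real) :: real)"
        for u :: 'a and t :: real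
      using rpf_const[of 0] by (simp add: case_prod_unfold)
    ultimately show ?thesis by (intro exI[of _ "\<lambda>_ _. 0"]) (auto simp: case_prod_unfold intro:
        rpf_const)
  qed
  from bchoice[OF ballI[OF this]] obtain G where
    G': "\<forall>i\<in>I. real_polynomial_function (\<lambda>(u, t). G i u t) \<and> (\<forall>\<^sub>F r in at_right 0.
      \<forall>u t. u \<in> ball u0 r \<longrightarrow> u + t *\<^sub>R x i \<in> ball u0 r \<longrightarrow> W I (u + t *\<^sub>R x i) - W I u = G i u t)"
    by (rule exE)
  note G = conjunct1[OF bspec[OF G']] conjunct2[OF bspec[OF G']]
  have finJ: "finite J" using J(1) fin by (rule finite_subset)
  have "\<forall>\<^sub>F r in at_right (0::real). \<forall>i\<in>J. \<forall>u t. u \<in> ball u0 r \<longrightarrow> u + t *\<^sub>R x i \<in> ball u0 r \<longrightarrow>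
        W I (u + t *\<^sub>R x i) - W I u = G i u t"
    using G(2) J(1) by (intro eventually_ball_finite finJ) auto
  then have ev: "\<forall>\<^sub>F r in at_right (0::real). r > 0 \<and> (\<forall>i\<in>J. \<forall>u t. u \<in> ball u0 r \<longrightarrow>
      u + t *\<^sub>R x i \<in> ball u0 r \<longrightarrow>
        W I (u + t *\<^sub>R x i) - W I u = G i u t)"
    by (intro eventually_conj eventually_at_right_less) auto
  obtain r where r: "r > 0 \<and> (\<forall>i\<in>J. \<forall>u t. u \<in> ball u0 r \<longrightarrow> u + t *\<^sub>R x i \<in> ball u0 r \<longrightarrow>
        W I (u + t *\<^sub>R x i) - W I u = G i u t)"
    using eventually_happens'[OF trivial_limit_at_right_real ev] by (rule exE)
  show ?case
    proof (rule locally_rpf_of_increments[OF conjunct1[OF r] finJ bounded_linear_bcoord[OF J(2)]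
        bcoord_expansion[OF J(2)]])
    show "real_polynomial_function (\<lambda>(u, t). G i u t)" if "i \<in> J" for i
      using G(1) J(1) that by auto
    show "W I (u + t *\<^sub>R x i) - W I u = G i u t"
      if "i \<in> J" "u \<in> ball u0 r" "u + t *\<^sub>R x i \<in> ball u0 r" for i u t
      using conjunct2[OF r, rule_format, OF that] .
  qed
qed

section \<open>Local polynomials\<close>

definition lp :: "'i set \<Rightarrow> 'a \<Rightarrow> 'a \<Rightarrow> real" where
  "lp I u = (THE g. real_polynomial_function g \<and> (\<forall>\<^sub>F v in nhds u. W I v = g v))"

lemma lp_unique:
  assumes "real_polynomial_function g" "\<forall>\<^sub>F v in nhds u. W I v = g v"
  shows "lp I u = g"
  unfolding lp_def
proof (rule the_equality)
  fix f assume f: "real_polynomial_function f \<and> (\<forall>\<^sub>F v in nhds u. W I v = f v)"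
  then have "\<forall>\<^sub>F v in nhds u. f v = g v"
    using assms(2) by (auto elim: eventually_elim2)
  then obtain S where "open S" "u \<in> S" "\<And>v. v \<in> S \<Longrightarrow> f v = g v"
    by (auto simp: eventually_nhds)
  then show "f = g" using rpf_eq_open[of f g S] f assms(1) by auto
qed (use assms in simp)

lemma
  assumes "spans I" "u \<in> gen I"
  shows rpf_lp: "real_polynomial_function (lp I u)"
    and lp_eventually: "\<forall>\<^sub>F v in nhds u. W I v = lp I u v"
proof -
  obtain g where g: "real_polynomial_function g" "\<forall>\<^sub>F v in nhds u. W I v = g v"
    using W_locally_rpf[OF assms] by blast
  with lp_unique[OF g] show "real_polynomial_function (lp I u)" "\<forall>\<^sub>F v in nhds u. W I v =
      lp I u v"
    by simp_all
qed

lemma lp_eq: "spans I \<Longrightarrow> u \<in> gen I \<Longrightarrow> lp I u u = W I u"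
  using eventually_nhds_x_imp_x[OF lp_eventually] by simp

lemma lp_connected:
  assumes "spans I" "connected S" "S \<subseteq> gen I" "u \<in> S" "v \<in> S"
  shows "lp I u = lp I v"
proof (rule connected_local_const[OF assms(2,4,5)], rule ballI)
  fix u assume "u \<in> S"
  then have u: "u \<in> gen I" using assms(3) by auto
  obtain T where T: "open T" "u \<in> T" "\<And>v. v \<in> T \<Longrightarrow> W I v = lp I u v"
    using lp_eventually[OF assms(1) u] by (auto simp: eventually_nhds)
  have "lp I v = lp I u" if "v \<in> T" for v
    using T that by (intro lp_unique rpf_lp[OF assms(1) u]) (auto simp: eventually_nhds)
  moreover have "\<forall>\<^sub>F v in at u within S. v \<in> T"
    using T(1,2) by (metis eventually_at_topological)
  ultimately show "\<forall>\<^sub>F v in at u within S. lp I u = lp I v"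
    by (auto elim: eventually_mono)
qed

lemma W_eq_lp:
  assumes "spans I" "connected S" "S \<subseteq> gen I" "u \<in> S" "v \<in> S"
  shows "W I v = lp I u v"
  using lp_connected[OF assms] lp_eq[OF assms(1), of v] assms by auto

text \<open>On a small ball inside \<open>S\<close> the increments of \<open>W I\<close> are
  integrals of \<open>f'\<close>, so \<open>f'\<close> is the derivative of \<open>f\<close> there;
  both being polynomial, the equality spreads from \<open>S\<close> to the whole space.\<close>

lemma lp_derivative:
  assumes I: "spans I" "i \<in> I" "spans (I - {i})" and S: "open S" "S \<noteq> {}"
    and f: "real_polynomial_function f" "\<And>v. v \<in> S \<Longrightarrow> W I v = f v"
    and f': "real_polynomial_function f'" "\<And>v. v \<in> S \<Longrightarrow> W (I - {i}) v = f' v"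
  shows "((\<lambda>t. f (u + t *\<^sub>R x i)) has_real_derivative f' (u + t *\<^sub>R x i)) (at t)"
proof -
  obtain d where d: "real_polynomial_function d"
    "\<And>u t. ((\<lambda>t. f (u + t *\<^sub>R x i)) has_real_derivative d (u + t *\<^sub>R x i)) (at t)"
    using rpf_derivative[OF f(1), where x = "x i"] by metis
  obtain G where G: "real_polynomial_function (\<lambda>(u, t). G u t)" "\<And>u. G u 0 = 0"
    "\<And>u t. ((\<lambda>t. G u t) has_real_derivative f' (u + t *\<^sub>R x i)) (at t)"
    using rpf_primitive'[OF f'(1), where x = "x i"] by metis
  have "d = f'"
  proof (rule rpf_eq_open[OF d(1) f'(1) S])
    fix v assume "v \<in> S"
    then obtain r where r: "r > 0" "ball v r \<subseteq> S" using S(1) open_contains_ball by blast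
    have "((\<lambda>t. v + t *\<^sub>R x i) \<longlongrightarrow> v + 0 *\<^sub>R x i) (nhds 0)"
      by (intro tendsto_intros filterlim_ident)
    then have "\<forall>\<^sub>F t in nhds 0. v + t *\<^sub>R x i \<in> ball v r"
      using r(1) by (intro topological_tendstoD) auto
    then have ev: "\<forall>\<^sub>F t in nhds 0. f (v + t *\<^sub>R x i) = f v + G v t"
    proof eventually_elim
      case (elim t)
      have "W I (v + t *\<^sub>R x i) - W I v = G v t - G v 0"
        by (rule W_increment_convex[OF I convex_ball[of v r] _ rpf_continuous[OF f'(1)] G(3)])
          (use r elim f'(2) in auto)
      moreover have "v + t *\<^sub>R x i \<in> S" using elim r(2) by blast
      ultimately show ?case using f(2) \<open>v \<in> S\<close> by (simp add: G(2))
    qed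
    moreover have "((\<lambda>t. f v + G v t) has_real_derivative f' (v + 0 *\<^sub>R x i)) (at 0)"
      using G(3)[of v 0] by (auto intro!: derivative_eq_intros)
    ultimately have "((\<lambda>t. f (v + t *\<^sub>R x i)) has_real_derivative f' (v + 0 *\<^sub>R x i)) (at 0)"
      using DERIV_cong_ev[OF refl ev refl] by iprover
    with d(2)[of v 0] show "d v = f' v" by (auto dest: DERIV_unique)
  qed
  with d(2) show ?thesis by simp
qed

text \<open>\<open>W I\<close> is continuous on a wall \<open>H\<close>, in the direction of an \<open>x i \<notin> H\<close>, unless \<open>x i\<close> is
    the only
  vector off \<open>H\<close>.\<close>

lemma lp_on_wall:
  assumes I: "spans I" "i \<in> I" "spans (I - {i})" and ai: "a \<bullet> x i \<noteq> 0"
    and r: "a \<bullet> h = 0" "h \<in> ball w r" and e: "e \<noteq> 0"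
    and f: "real_polynomial_function f" "\<And>u. \<lbrakk>u \<in> ball w r; e * (a \<bullet> u) > 0\<rbrakk> \<Longrightarrow> W I u = f u"
    and f': "real_polynomial_function f'" "\<And>u. \<lbrakk>u \<in> ball w r; e * (a \<bullet> u) > 0\<rbrakk> \<Longrightarrow>
        W (I - {i}) u = f' u"
  shows "f h = W I h"
proof -
  obtain G where G: "real_polynomial_function (\<lambda>(u, t). G u t)" "\<And>u. G u 0 = 0"
    "\<And>u t. ((\<lambda>t. G u t) has_real_derivative f' (u + t *\<^sub>R x i)) (at t)"
    using rpf_primitive'[OF f'(1), where x = "x i"] by metis
  \<comment> \<open>The sign that directs \<open>x i\<close> from the wall into the half ball where
    \<open>f\<close> represents \<open>W I\<close>.\<close>
  define \<delta> where "\<delta> = sgn (e * (a \<bullet> x i))"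
  have \<delta>: "\<delta> = 1 \<or> \<delta> = -1" "e * (a \<bullet> x i) * \<delta> > 0"
    using e ai by (auto simp: \<delta>_def sgn_if not_less order.order_iff_strict)
  have "((\<lambda>s. h + (\<delta> * s) *\<^sub>R x i) \<longlongrightarrow> h + (\<delta> * 0) *\<^sub>R x i) (at_right 0)"
    by (intro tendsto_intros)
  then have "\<forall>\<^sub>F s in at_right 0. h + (\<delta> * s) *\<^sub>R x i \<in> ball w r"
    using r(2) by (intro topological_tendstoD) auto
  then obtain \<epsilon> where \<epsilon>: "\<epsilon> > 0" "\<And>s. \<lbrakk>0 < s; s < \<epsilon>\<rbrakk> \<Longrightarrow> h + (\<delta> * s) *\<^sub>R x i \<in> ball w r"
    unfolding eventually_at_right_field by auto
  have side: "e * (a \<bullet> (h + (\<delta> * s) *\<^sub>R x i)) > 0" if "s > 0" for s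
  proof -
    have "e * (a \<bullet> (h + (\<delta> * s) *\<^sub>R x i)) = (e * (a \<bullet> x i) * \<delta>) * s"
      using r(1) by (simp add: inner_add_right algebra_simps)
    then show ?thesis using \<delta>(2) that by (simp only: mult_pos_pos)
  qed
  have cont: "continuous_on UNIV (\<lambda>s. f' (h + s *\<^sub>R x i))"
    by (intro continuous_on_compose2[OF rpf_continuous[OF f'(1), of UNIV]]) (auto intro!:
        continuous_intros)
  have incr: "f (h + (\<delta> * s) *\<^sub>R x i) - W I h - G h (\<delta> * s) = 0" if s: "0 < s" "s < \<epsilon>" for s
  proof -
    have W': "W (I - {i}) (h + (\<delta> * s') *\<^sub>R x i) = f' (h + (\<delta> * s') *\<^sub>R x i)" if "0 < s'"
        "s' < s" for s'
      using that s by (intro f'(2) side \<epsilon>(2)) auto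
    have "W I (h + (\<delta> * s) *\<^sub>R x i) - W I h = G h (\<delta> * s)"
    proof (cases "\<delta> = 1")
      case True
      have "W I (h + s *\<^sub>R x i) - W I (h + 0 *\<^sub>R x i) = G h s - G h 0"
        by (rule W_increment[OF I _ cont G(3)]) (use W' True s in auto)
      with True show ?thesis by (simp add: G(2))
    next
      case False
      then have \<delta>: "\<delta> = -1" using \<delta> by auto
      have "W I (h + 0 *\<^sub>R x i) - W I (h + (- s) *\<^sub>R x i) = G h 0 - G h (- s)"
      proof (rule W_increment[OF I _ cont G(3)])
        fix t assume "- s < t" "t < 0"
        then show "W (I - {i}) (h + t *\<^sub>R x i) = f' (h + t *\<^sub>R x i)" using W'[of "- t"] \<delta> by simp
      qed (use s in auto)
      with \<delta> show ?thesis by (simp add: G(2))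
    qed
    moreover have "W I (h + (\<delta> * s) *\<^sub>R x i) = f (h + (\<delta> * s) *\<^sub>R x i)"
      using s by (intro f(2) side \<epsilon>(2)) auto
    ultimately show ?thesis by simp
  qed
  \<comment> \<open>The increment starting at the wall point \<open>h\<close> itself is exact for
    every small \<open>s\<close>; letting \<open>s\<close> tend to \<open>0\<close> carries
    \<open>f\<close> to the wall.\<close>
  have "((\<lambda>s. f (h + (\<delta> * s) *\<^sub>R x i) - W I h - G h (\<delta> * s)) \<longlongrightarrow>
      f (h + (\<delta> * 0) *\<^sub>R x i) - W I h - G h (\<delta> * 0)) (at_right 0)"
  proof (intro tendsto_diff tendsto_const)
    have "isCont f (h + (\<delta> * 0) *\<^sub>R x i)"
      using rpf_continuous[OF f(1), of UNIV] by (simp add: continuous_on_eq_continuous_at)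
    then show "((\<lambda>s. f (h + (\<delta> * s) *\<^sub>R x i)) \<longlongrightarrow> f (h + (\<delta> * 0) *\<^sub>R x i)) (at_right 0)"
      by (rule isCont_tendsto_compose) (intro tendsto_intros)
    show "((\<lambda>s. G h (\<delta> * s)) \<longlongrightarrow> G h (\<delta> * 0)) (at_right 0)"
      by (rule isCont_tendsto_compose[OF DERIV_isCont[OF G(3)]]) (intro tendsto_intros)
  qed
  moreover have "((\<lambda>s. f (h + (\<delta> * s) *\<^sub>R x i) - W I h - G h (\<delta> * s)) \<longlongrightarrow> 0) (at_right 0)"
    by (rule tendsto_eventually) (use incr \<epsilon>(1) in \<open>auto simp: eventually_at_right_field intro!:
        exI[of _ \<epsilon>]\<close>)
  ultimately have "f (h + (\<delta> * 0) *\<^sub>R x i) - W I h - G h (\<delta> * 0) = 0"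
    by (rule tendsto_unique[OF trivial_limit_at_right_real])
  then show ?thesis by (simp add: G(2))
qed

lemma half_ball:
  fixes a w :: 'a
  assumes "a \<noteq> 0" "a \<bullet> w = 0" "r > 0" "e \<noteq> 0"
  shows "convex {u \<in> ball w r. e * (a \<bullet> u) > 0}" "open {u \<in> ball w r. e * (a \<bullet> u) > 0}"
    "{u \<in> ball w r. e * (a \<bullet> u) > 0} \<noteq> {}"
proof -
  have eq: "{u \<in> ball w r. e * (a \<bullet> u) > 0} = ball w r \<inter> {u. (e *\<^sub>R a) \<bullet> u > 0}" by auto
  show "convex {u \<in> ball w r. e * (a \<bullet> u) > 0}"
    unfolding eq by (intro convex_Int convex_ball convex_halfspace_gt)
  show "open {u \<in> ball w r. e * (a \<bullet> u) > 0}"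
    unfolding eq by (intro open_Int open_ball open_halfspace_gt)
  define s where "s = r / (2 * norm a)"
  have "w + (sgn e * s) *\<^sub>R a \<in> {u \<in> ball w r. e * (a \<bullet> u) > 0}"
    using assms by (auto simp: s_def dist_norm inner_add_right sgn_if abs_mult zero_less_mult_iff)
  then show "{u \<in> ball w r. e * (a \<bullet> u) > 0} \<noteq> {}" by blast
qed

text \<open>\<open>H\<close> is spanned by vectors lying on it, so one vector off \<open>H\<close>
  completes the span and any second one can be removed.\<close>

lemma spans_remove_off:
  assumes "spans I" "H \<in> hyps I" "H = {u. a \<bullet> u = 0}" "i \<in> I" "a \<bullet> x i \<noteq> 0" "i' \<in> I - {i}"
      "a \<bullet> x i' \<noteq> 0"
  shows "spans (I - {i})" "H \<in> hyps (I - {i})"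
proof -
  obtain K where K: "K \<subseteq> I" "H = span (x ` K)" "dim H = DIM('a) - 1" using assms(2)
      by (auto simp: hyps_def)
  have "i \<notin> K"
  proof
    assume "i \<in> K"
    then have "x i \<in> H" unfolding K(2) by (intro span_base) auto
    then show False using assms(3,5) by simp
  qed
  then have K': "K \<subseteq> I - {i}" using K by auto
  then show "H \<in> hyps (I - {i})" using K by (auto simp: hyps_def)
  have "x i' \<notin> span (x ` K)" using assms(3,7) K(2) by auto
  then have "dim (insert (x i') (x ` K)) = dim (x ` K) + 1" by (simp add: dim_insert)
  then have "dim (insert (x i') (x ` K)) = DIM('a)" using K(2,3) DIM_positive[where 'a='a]
      by (simp add: dim_span)
  moreover have "insert (x i') (x ` K) \<subseteq> x ` (I - {i})" using K' assms(6) by auto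
  ultimately have "DIM('a) \<le> dim (x ` (I - {i}))" by (metis dim_subset)
  then have "span (x ` (I - {i})) = UNIV"
    using dim_eq_full by (metis dim_subset_UNIV le_antisym)
  then show "spans (I - {i})" using assms(1) by (auto simp: spans_def)
qed

text \<open>\<open>W I\<close> is \<open>m(H) - 2\<close> times continuously differentiable across \<open>H\<close>.\<close>

lemma jump_divisible:
  fixes a w :: 'a
  assumes "spans I" "H \<in> hyps I" and a: "a \<noteq> 0" "H = {u. a \<bullet> u = 0}" and w: "w \<in> H" "r > 0"
    and "ball w r - H \<subseteq> gen I"
    and "real_polynomial_function fp" "\<And>u. \<lbrakk>u \<in> ball w r; a \<bullet> u > 0\<rbrakk> \<Longrightarrow> W I u = fp u"
    and "real_polynomial_function fm" "\<And>u. \<lbrakk>u \<in> ball w r; a \<bullet> u < 0\<rbrakk> \<Longrightarrow> W I u = fm u"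
  shows "\<exists>g. real_polynomial_function g \<and>
    (\<forall>u. fp u - fm u = (a \<bullet> u) ^ (card {i \<in> I. x i \<notin> H} - 1) * g u)"
  using assms
proof (induction "card {i \<in> I. x i \<notin> H} - 1" arbitrary: I fp fm)
  case 0
  then have "real_polynomial_function (\<lambda>u. fp u - fm u)" by auto
  with 0(1) show ?case by (intro exI[of _ "\<lambda>u. fp u - fm u"]) auto
next
  case (Suc n)
  note I = Suc.prems(1) and HI = Suc.prems(2) and g_en = Suc.prems(7)
  note fp = Suc.prems(8,9) and fm = Suc.prems(10,11)
  have fin: "finite I" by (rule spans_finite[OF I])
  have "2 \<le> card {i \<in> I. x i \<notin> H}" using Suc.hyps(2) by linarith
  then obtain i i' where i: "i \<in> I" "x i \<notin> H" "i' \<in> I - {i}" "x i' \<notin> H"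
    using fin by (auto simp: numeral_2_eq_2 card_le_Suc_iff)
  have ai: "a \<bullet> x i \<noteq> 0" "a \<bullet> x i' \<noteq> 0" using i a by auto
  have sp: "spans (I - {i})" and HI': "H \<in> hyps (I - {i})"
    using spans_remove_off[OF I HI a(2) i(1) ai(1) i(3) ai(2)] by auto
  have gen': "ball w r - H \<subseteq> gen (I - {i})" using g_en gen_mono[of "I - {i}" I] by auto
  have aw: "a \<bullet> w = 0" using w a by auto
  have side: "\<exists>f'. real_polynomial_function f' \<and> (\<forall>u. u \<in> ball w r \<longrightarrow> e * (a \<bullet> u) > 0 \<longrightarrow>
      W (I - {i}) u = f' u)"
    if "e \<noteq> 0" for e
  proof -
    let ?S = "{u \<in> ball w r. e * (a \<bullet> u) > 0}"
    have S: "connected ?S" "?S \<noteq> {}" "?S \<subseteq> gen (I - {i})"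
      using half_ball[OF a(1) aw w(2) that] gen' a(2) by (auto intro: convex_connected)
    then obtain v where v: "v \<in> ?S" by blast
    have "real_polynomial_function (lp (I - {i}) v)"
      using S v by (intro rpf_lp sp) auto
    moreover have "\<forall>u. u \<in> ball w r \<longrightarrow> e * (a \<bullet> u) > 0 \<longrightarrow> W (I - {i}) u = lp (I - {i}) v u"
      using W_eq_lp[OF sp S(1,3) v] by blast
    ultimately show ?thesis by blast
  qed
  obtain fp' where fp': "real_polynomial_function fp'" "\<And>u. \<lbrakk>u \<in> ball w r; a \<bullet> u > 0\<rbrakk> \<Longrightarrow>
      W (I - {i}) u = fp' u"
    using side[of 1] by auto
  obtain fm' where fm': "real_polynomial_function fm'" "\<And>u. \<lbrakk>u \<in> ball w r; a \<bullet> u < 0\<rbrakk> \<Longrightarrow>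
      W (I - {i}) u = fm' u"
    using side[of "-1"] by auto
  have card: "card {k \<in> I - {i}. x k \<notin> H} - 1 = n"
  proof -
    have "{k \<in> I - {i}. x k \<notin> H} = {k \<in> I. x k \<notin> H} - {i}" by auto
    then show ?thesis using Suc.hyps(2) i fin by simp
  qed
  obtain g' where g': "real_polynomial_function g'" "\<And>u. fp' u - fm' u = (a \<bullet> u) ^ n * g' u"
    using Suc.hyps(1)[OF card[symmetric] sp HI' a w gen' fp' fm'] card by auto
  define J where "J u = fp u - fm u" for u
  have J: "real_polynomial_function J" unfolding J_def using fp fm by auto
  \<comment> \<open>With two vectors off \<open>H\<close> both polynomials take the value of
    \<open>W I\<close> on the wall inside the ball; lines through \<open>w\<close> carry the
    equality to all of \<open>H\<close>.\<close>
  have J_H: "J h = 0" if "h \<in> H" for h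
  proof -
    have on_ball: "J h = 0" if h: "h \<in> H" "h \<in> ball w r" for h
    proof -
      have ah: "a \<bullet> h = 0" using h a by auto
      have "fp h = W I h"
        by (rule lp_on_wall[OF I i(1) sp ai(1) ah h(2), of 1]) (use fp fp' in auto)
      moreover have "fm h = W I h"
        by (rule lp_on_wall[OF I i(1) sp ai(1) ah h(2), of "-1"]) (use fm fm' in auto)
      ultimately show ?thesis by (simp add: J_def)
    qed
    obtain \<epsilon> where \<epsilon>: "\<epsilon> > 0" "\<And>t. \<lbrakk>0 < t; t < \<epsilon>\<rbrakk> \<Longrightarrow> w + t *\<^sub>R (h - w) \<in> ball w r"
      by (rule small_line_in_open[where S = "ball w r" and u = w and x = "h - w"])
        (use w(2) in auto)
    have "w + t *\<^sub>R (h - w) \<in> H" for t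
      using w(1) that a(2) by (simp add: inner_add_right inner_diff_right)
    then have "J (w + 1 *\<^sub>R (h - w)) = 0"
      using \<epsilon> on_ball by (intro rpf_line_zero_ball[OF J \<epsilon>(1), of w "h - w" 1]) auto
    then show ?thesis by simp
  qed
  \<comment> \<open>Differentiating the jump along \<open>x i\<close> gives the jump for
    \<open>I - {i}\<close>, which has one vector fewer off \<open>H\<close>.\<close>
  have dJ: "((\<lambda>t. J (u + t *\<^sub>R x i)) has_real_derivative (a \<bullet> (u + t *\<^sub>R x i)) ^ n * g'
      (u + t *\<^sub>R x i)) (at t)" for u t
  proof -
    have "((\<lambda>t. fp (u + t *\<^sub>R x i)) has_real_derivative fp' (u + t *\<^sub>R x i)) (at t)"
      by (rule lp_derivative[OF I i(1) sp half_ball(2,3)[OF a(1) aw w(2), of 1] fp(1) _ fp'(1)])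
        (use fp fp' in auto)
    moreover have "((\<lambda>t. fm (u + t *\<^sub>R x i)) has_real_derivative fm' (u + t *\<^sub>R x i)) (at t)"
      by (rule lp_derivative[OF I i(1) sp half_ball(2,3)[OF a(1) aw w(2), of "-1"] fm(1) _
          fm'(1)])
        (use fm fm' in auto)
    ultimately show ?thesis
      unfolding J_def g'(2)[symmetric] by (rule DERIV_diff)
  qed
  define c where "c = a \<bullet> x i"
  have c: "c \<noteq> 0" using ai by (simp add: c_def)
  have "real_polynomial_function (\<lambda>u. c ^ n * g' u)" by (intro rpf_mult rpf_const g')
  then obtain G where G: "real_polynomial_function (\<lambda>(u, t). G u t)"
    "\<And>u t. ((\<lambda>t. t ^ Suc n * G u t) has_real_derivative t ^ n * (c ^ n * g' (u + t *\<^sub>R x i)))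
        (at t)"
    using rpf_primitive[of "\<lambda>u. c ^ n * g' u" n "x i"] by metis
  \<comment> \<open>Integration from the wall, where the jump vanishes: on
    \<open>h + t *\<^sub>R x i\<close> the form \<open>a\<close> equals \<open>c * t\<close>, so a
    factor of order \<open>n\<close> becomes one of order \<open>Suc n\<close>.\<close>
  have JG: "J (h + t *\<^sub>R x i) = t ^ Suc n * G h t" if "h \<in> H" for h t
  proof -
    have "((\<lambda>t. J (h + t *\<^sub>R x i) - t ^ Suc n * G h t) has_real_derivative 0) (at t)" for t
    proof -
      have "(a \<bullet> (h + t *\<^sub>R x i)) ^ n * g' (h + t *\<^sub>R x i) = t ^ n * (c ^ n * g' (h + t *\<^sub>R x i))"
        using that a(2) by (simp add: inner_add_right c_def power_mult_distrib)
      then show ?thesis using DERIV_diff[OF dJ[of h t] G(2)[of h t]] by (simp only: diff_self)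
    qed
    then have "J (h + t *\<^sub>R x i) - t ^ Suc n * G h t = J (h + 0 *\<^sub>R x i) - 0 ^ Suc n * G h 0"
      using DERIV_isconst_all by blast
    then show ?thesis using J_H[OF that] by simp
  qed
  \<comment> \<open>Every \<open>u\<close> is a point of \<open>H\<close> plus
    \<open>\<theta> u\<close> times \<open>x i\<close>; substituting this turns \<open>t\<close>
    back into \<open>(a \<bullet> u) / c\<close>.\<close>
  define \<theta> where "\<theta> u = (a \<bullet> u) / c" for u
  have bl: "bounded_linear \<theta>"
    unfolding \<theta>_def divide_inverse
    by (intro bounded_linear_mult_left bounded_linear_compose[OF bounded_linear_mult_left
        bounded_linear_inner_right])
  have "polynomial_function (\<lambda>u. (u - \<theta> u *\<^sub>R x i, \<theta> u))"
    by (intro polynomial_function_Pair polynomial_function_diff polynomial_function_bounded_linear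
        bounded_linear_ident bl bounded_linear_scaleR_const[OF bl])
  from rpf_compose[OF G(1) this]
  have "real_polynomial_function (\<lambda>u. G (u - \<theta> u *\<^sub>R x i) (\<theta> u))" by simp
  then have "real_polynomial_function (\<lambda>u. (1 / c ^ Suc n) * G (u - \<theta> u *\<^sub>R x i) (\<theta> u))"
    by (intro rpf_mult rpf_const)
  moreover have "fp u - fm u = (a \<bullet> u) ^ Suc n * ((1 / c ^ Suc n) * G (u - \<theta> u *\<^sub>R x i) (\<theta> u))"
      for u
  proof -
    have "u - \<theta> u *\<^sub>R x i \<in> H" using c by (simp add: a(2) \<theta>_def inner_diff_right flip: c_def)
    from JG[OF this, of "\<theta> u"] show ?thesis
      by (simp add: J_def \<theta>_def power_divide)
  qed
  ultimately show ?case unfolding Suc.hyps(2)[symmetric] by (intro exI conjI) auto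
qed

end

section \<open>Volumes of fibres\<close>

lemma orthonormal_comb:
  assumes "orthonormal N k v" "i < k"
  shows "(\<Sum>l<N. v i l * (\<Sum>j<k. c j * v j l)) = c i"
proof -
  have "(\<Sum>l<N. v i l * (\<Sum>j<k. c j * v j l)) = (\<Sum>j<k. c j * (\<Sum>l<N. v i l * v j l))"
    unfolding sum_distrib_left by (subst sum.swap) (simp add: mult_ac)
  also have "\<dots> = (\<Sum>j<k. if j = i then c i else 0)"
    using assms by (intro sum.cong) (auto simp: orthonormal_def)
  finally show ?thesis using assms(2) by simp
qed

lemma orthonormal_norm_comb:
  assumes "orthonormal N k v"
  shows "(\<Sum>l<N. (\<Sum>j<k. c j * v j l)\<^sup>2) = (\<Sum>j<k. (c j)\<^sup>2)"
proof -
  have "(\<Sum>l<N. (\<Sum>j<k. c j * v j l)\<^sup>2) = (\<Sum>i<k. c i * (\<Sum>l<N. v i l * (\<Sum>j<k. c j * v j l)))"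
    unfolding power2_eq_square sum_distrib_right sum_distrib_left
        by (subst sum.swap) (simp add: mult_ac)
  also have "\<dots> = (\<Sum>j<k. (c j)\<^sup>2)"
    by (intro sum.cong) (auto simp: orthonormal_comb[OF assms] power2_eq_square)
  finally show ?thesis .
qed

text \<open>Both inclusions between the spans are recorded, because a frame obtained from relations
  has to consist of relations and also to generate them.\<close>

lemma gram_schmidt:
  fixes \<kappa> :: "nat \<Rightarrow> nat \<Rightarrow> real"
  assumes "\<And>c j. \<lbrakk>\<And>l. l < N \<Longrightarrow> (\<Sum>j<k. c j * \<kappa> j l) = 0; j < k\<rbrakk> \<Longrightarrow> c j = 0"
  shows "\<exists>v. orthonormal N k v \<and>
    (\<forall>j<k. \<exists>c. \<forall>l<N. \<kappa> j l = (\<Sum>i<k. c i * v i l)) \<and>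
    (\<forall>i<k. \<exists>c. \<forall>l<N. v i l = (\<Sum>j<k. c j * \<kappa> j l))"
  using assms
proof (induction k)
  case 0
  then show ?case by (auto simp: orthonormal_def)
next
  case (Suc k)
  have "c j = 0" if "\<And>l. l < N \<Longrightarrow> (\<Sum>j<k. c j * \<kappa> j l) = 0" "j < k" for c j
    using Suc.prems[of "\<lambda>j. if j < k then c j else 0" j] that by simp
  then obtain v where v: "orthonormal N k v"
    "\<And>j. j < k \<Longrightarrow> \<exists>c. \<forall>l<N. \<kappa> j l = (\<Sum>i<k. c i * v i l)"
    "\<And>i. i < k \<Longrightarrow> \<exists>c. \<forall>l<N. v i l = (\<Sum>j<k. c j * \<kappa> j l)"
    using Suc.IH by blast
  define p where "p i = (\<Sum>l<N. \<kappa> k l * v i l)" for i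
  define y where "y l = \<kappa> k l - (\<Sum>i<k. p i * v i l)" for l
  obtain C where C: "\<And>i l. \<lbrakk>i < k; l < N\<rbrakk> \<Longrightarrow> v i l = (\<Sum>j<k. C i j * \<kappa> j l)"
    using v(3) by metis
  define Q where "Q j = - (\<Sum>i<k. p i * C i j)" for j
  have y_\<kappa>: "y l = \<kappa> k l + (\<Sum>j<k. Q j * \<kappa> j l)" if "l < N" for l
  proof -
    have "(\<Sum>i<k. p i * v i l) = (\<Sum>j<k. (\<Sum>i<k. p i * C i j) * \<kappa> j l)"
      using C that by (simp add: sum_distrib_left sum_distrib_right mult_ac) (rule sum.swap)
    then show ?thesis by (simp add: y_def Q_def sum_negf)
  qed
  have "\<exists>l<N. y l \<noteq> 0"
  proof (rule ccontr)
    assume "\<not> (\<exists>l<N. y l \<noteq> 0)"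
    then have "(\<Sum>j<Suc k. (if j < k then Q j else 1) * \<kappa> j l) = 0" if "l < N" for l
      using y_\<kappa>[OF that] that by simp
    from Suc.prems[of "\<lambda>j. if j < k then Q j else 1" k, OF this] show False
      by simp
  qed
  then obtain l0 where "l0 < N" "y l0 \<noteq> 0" by blast
  then have "(\<Sum>l<N. (y l)\<^sup>2) > 0"
    by (intro sum_pos2[of _ l0]) auto
  define s where "s = sqrt (\<Sum>l<N. (y l)\<^sup>2)"
  have s: "s > 0" "s\<^sup>2 = (\<Sum>l<N. (y l)\<^sup>2)"
    using \<open>(\<Sum>l<N. (y l)\<^sup>2) > 0\<close> by (auto simp: s_def)
  have y_orth: "(\<Sum>l<N. v i l * y l) = 0" if "i < k" for i
  proof -
    have "(\<Sum>l<N. v i l * y l) = (\<Sum>l<N. v i l * \<kappa> k l) - (\<Sum>l<N. v i l * (\<Sum>i<k. p i * v i l))"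
      by (simp add: y_def algebra_simps sum_subtractf)
    then show ?thesis using orthonormal_comb[OF v(1) that, of p] by (simp add: p_def mult.commute)
  qed
  define v' where "v' i = (if i < k then v i else (\<lambda>l. y l / s))" for i
  have "orthonormal N (Suc k) v'"
    unfolding orthonormal_def
  proof (intro allI impI)
    fix i j assume "i < Suc k" "j < Suc k"
    then consider "i < k" "j < k" | "i < k" "j = k" | "i = k" "j < k" | "i = k" "j = k"
        by linarith
    then show "(\<Sum>l<N. v' i l * v' j l) = (if i = j then 1 else 0)"
    proof cases
      case 1
      then show ?thesis using v(1) by (simp add: v'_def orthonormal_def)
    next
      case 2
      then show ?thesis using y_orth[of i] by (simp add: v'_def flip: sum_divide_distrib)
    next
      case 3
      then show ?thesis using y_orth[of j] by (simp add: v'_def mult.commute flip: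
          sum_divide_distrib)
    next
      case 4
      then have "(\<Sum>l<N. v' i l * v' j l) = (\<Sum>l<N. (y l)\<^sup>2) / s\<^sup>2"
        by (simp add: v'_def power2_eq_square sum_divide_distrib)
      also have "\<dots> = 1" using s by (metis divide_self power_not_zero less_irrefl)
      finally show ?thesis using 4 by simp
    qed
  qed
  moreover have "\<exists>c. \<forall>l<N. \<kappa> j l = (\<Sum>i<Suc k. c i * v' i l)" if "j < Suc k" for j
  proof (cases "j < k")
    case True
    then obtain c where "\<forall>l<N. \<kappa> j l = (\<Sum>i<k. c i * v i l)" using v(2) by blast
    then show ?thesis
      by (intro exI[of _ "\<lambda>i. if i < k then c i else 0"]) (simp add: v'_def)
  next
    case False
    with that have "j = k" by simp
    with s show ?thesis
      by (intro exI[of _ "\<lambda>i. if i < k then p i else s"]) (simp add: v'_def y_def)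
  qed
  moreover have "\<exists>c. \<forall>l<N. v' i l = (\<Sum>j<Suc k. c j * \<kappa> j l)" if "i < Suc k" for i
  proof (cases "i < k")
    case True
    then show ?thesis using C[of i]
      by (intro exI[of _ "\<lambda>j. if j < k then C i j else 0"]) (simp add: v'_def)
  next
    case False
    with that have "i = k" by simp
    then show ?thesis
      by (intro exI[of _ "\<lambda>j. if j < k then Q j / s else 1 / s"])
        (simp add: v'_def y_\<kappa> add_divide_distrib sum_divide_distrib)
  qed
  ultimately show ?case by blast
qed

text \<open>Two orthonormal frames of the same size, one in the span of the other, span the same
  space: sum the squared distances of the \<open>v i\<close> from the span of \<open>v'\<close>.\<close>

lemma orthonormal_span_eq:
  assumes v: "orthonormal N k v" and v': "orthonormal N k v'"
    and sub: "\<And>j l. \<lbrakk>j < k; l < N\<rbrakk> \<Longrightarrow> v' j l = (\<Sum>i<k. C j i * v i l)"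
    and "i < k" "l < N"
  shows "v i l = (\<Sum>j<k. C j i * v' j l)"
proof -
  have C: "(\<Sum>l<N. v i l * v' j l) = C j i" if "i < k" "j < k" for i j
    using orthonormal_comb[OF v that(1), of "C j"] sub[OF that(2)] by simp
  have C_norm: "(\<Sum>i<k. (C j i)\<^sup>2) = 1" if "j < k" for j
  proof -
    have "(\<Sum>i<k. (C j i)\<^sup>2) = (\<Sum>l<N. (v' j l)\<^sup>2)"
      using orthonormal_norm_comb[OF v, of "C j"] sub[OF that] by simp
    then show ?thesis using v' that by (simp add: orthonormal_def power2_eq_square)
  qed
  have dist: "(\<Sum>l<N. (v i l - (\<Sum>j<k. C j i * v' j l))\<^sup>2) = 1 - (\<Sum>j<k. (C j i)\<^sup>2)" if "i < k" for i
  proof -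
    have "(\<Sum>l<N. (v i l - (\<Sum>j<k. C j i * v' j l))\<^sup>2) = (\<Sum>l<N. (v i l)\<^sup>2) -
        2 * (\<Sum>j<k. C j i * (\<Sum>l<N. v i l * v' j l)) + (\<Sum>l<N. (\<Sum>j<k. C j i * v' j l)\<^sup>2)"
    proof -
      have "(\<Sum>l<N. v i l * (\<Sum>j<k. C j i * v' j l)) = (\<Sum>j<k. C j i * (\<Sum>l<N. v i l * v' j l))"
        unfolding sum_distrib_left by (subst sum.swap) (simp add: mult_ac)
      then show ?thesis
        by (simp add: power2_diff sum.distrib sum_subtractf mult.assoc flip: sum_distrib_left)
    qed
    also have "(\<Sum>l<N. (v i l)\<^sup>2) = 1" using v that by (simp add: orthonormal_def power2_eq_square)
    also have "(\<Sum>j<k. C j i * (\<Sum>l<N. v i l * v' j l)) = (\<Sum>j<k. (C j i)\<^sup>2)"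
      using C[OF that] by (intro sum.cong) (auto simp: power2_eq_square)
    also have "(\<Sum>l<N. (\<Sum>j<k. C j i * v' j l)\<^sup>2) = (\<Sum>j<k. (C j i)\<^sup>2)"
      by (rule orthonormal_norm_comb[OF v'])
    finally show ?thesis by simp
  qed
  have "(\<Sum>i<k. \<Sum>l<N. (v i l - (\<Sum>j<k. C j i * v' j l))\<^sup>2) = (\<Sum>i<k. 1 - (\<Sum>j<k. (C j i)\<^sup>2))"
    using dist by simp
  also have "\<dots> = real k - (\<Sum>j<k. \<Sum>i<k. (C j i)\<^sup>2)"
    by (simp add: sum_subtractf) (rule sum.swap)
  also have "\<dots> = 0" using C_norm by simp
  finally have "\<forall>i\<in>{..<k}. (\<Sum>l<N. (v i l - (\<Sum>j<k. C j i * v' j l))\<^sup>2) = 0"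
    by (subst (asm) sum_nonneg_eq_0_iff) (auto intro: sum_nonneg)
  then have "(\<Sum>l<N. (v i l - (\<Sum>j<k. C j i * v' j l))\<^sup>2) = 0" using \<open>i < k\<close> by blast
  then have "\<forall>l\<in>{..<N}. (v i l - (\<Sum>j<k. C j i * v' j l))\<^sup>2 = 0"
    by (subst (asm) sum_nonneg_eq_0_iff) auto
  then show ?thesis using \<open>l < N\<close> by auto
qed

lemma small_perturbation:
  fixes w k :: "'i \<Rightarrow> real"
  assumes "finite S" "\<And>l. l \<in> S \<Longrightarrow> w l > 0"
  obtains \<epsilon> where "\<epsilon> > 0" "\<And>l. l \<in> S \<Longrightarrow> w l + \<epsilon> * k l > 0"
proof -
  have "\<forall>\<^sub>F e in at_right 0. \<forall>l\<in>S. w l + e * k l > 0"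
  proof (intro eventually_ball_finite assms(1) ballI)
    fix l assume "l \<in> S"
    have "((\<lambda>e. w l + e * k l) \<longlongrightarrow> w l + 0 * k l) (at_right 0)" by (intro tendsto_intros)
    then show "\<forall>\<^sub>F e in at_right 0. w l + e * k l > 0"
      using assms(2)[OF \<open>l \<in> S\<close>] by (intro order_tendstoD(1)) auto
  qed
  then obtain r where r: "r > 0" "\<And>e. \<lbrakk>0 < e; e < r\<rbrakk> \<Longrightarrow> \<forall>l\<in>S. w l + e * k l > 0"
    unfolding eventually_at_right_field by auto
  have "r / 2 > 0" "\<And>l. l \<in> S \<Longrightarrow> w l + r / 2 * k l > 0" using r(1) r(2)[of "r / 2"] by auto
  then show thesis by (rule that)
qed

context pointed_family
begin

text \<open>A maximal index set that fails to span spans a hyperplane, since any vector outside its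
  span completes it.\<close>

lemma hyps_extend:
  assumes "spans I" "K \<subseteq> I" "span (x ` K) \<noteq> UNIV"
  obtains H where "H \<in> hyps I" "x ` K \<subseteq> H"
proof -
  let ?F = "{K'. K \<subseteq> K' \<and> K' \<subseteq> I \<and> span (x ` K') \<noteq> UNIV}"
  have fin: "finite I" by (rule spans_finite[OF assms(1)])
  have "finite ?F" by (rule finite_subset[of _ "Pow I"]) (use fin in auto)
  moreover have "?F \<noteq> {}" using assms by auto
  ultimately obtain K' where K': "K' \<in> ?F" "\<And>K''. \<lbrakk>K'' \<in> ?F; K' \<subseteq> K''\<rbrakk> \<Longrightarrow> K' = K''"
    using finite_has_maximal[of ?F] by auto
  obtain i where i: "i \<in> I" "x i \<notin> span (x ` K')"
  proof (rule ccontr)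
    assume "\<not> thesis"
    then have "x ` I \<subseteq> span (x ` K')" using that by blast
    then have "span (x ` I) \<subseteq> span (x ` K')" by (rule span_minimal) simp
    then show False using K'(1) assms(1) by (auto simp: spans_def)
  qed
  have "i \<notin> K'" using i(2) by (auto intro: span_base)
  then have "span (x ` insert i K') = UNIV"
    using K'(2)[of "insert i K'"] K'(1) i(1) by blast
  then have "dim (insert (x i) (x ` K')) = DIM('a)" by (metis dim_UNIV dim_span image_insert)
  then have "dim (span (x ` K')) = DIM('a) - 1" using i(2) by (simp add: dim_insert dim_span)
  then have "span (x ` K') \<in> hyps I" using K'(1) by (auto simp: hyps_def)
  moreover have "x ` K \<subseteq> span (x ` K')" using K'(1) by (auto intro: span_base)
  ultimately show thesis by (rule that)
qed

end

section \<open>Fibres, their linear relations and orthonormal frames\<close>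

locale pointed_list = pointed_family x "{..<N}" \<sigma> for x :: "nat \<Rightarrow> 'a::euclidean_space" and N ::
    nat and \<sigma> :: 'a +
  assumes spans_all: "spans {..<N}"
begin

definition fib :: "'a \<Rightarrow> (nat \<Rightarrow> real) set" where
  "fib u = {w \<in> {..<N} \<rightarrow>\<^sub>E {0..}. (\<Sum>j<N. w j *\<^sub>R x j) = u}"

definition rel :: "(nat \<Rightarrow> real) \<Rightarrow> bool" where
  "rel w \<longleftrightarrow> (\<Sum>j<N. w j *\<^sub>R x j) = 0"

text \<open>The support of a point of the fibre spans, since otherwise \<open>u\<close> would lie on
  one of the hyperplanes. A basis \<open>J\<close> inside the support leaves room to raise all other
  coordinates. A positive point can be moved a little along any relation, so a nonempty fibre over a
  generic \<open>u\<close> has full dimension.\<close>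

lemma fib_positive:
  assumes "u \<in> gen {..<N}" "fib u \<noteq> {}"
  obtains w where "w \<in> {..<N} \<rightarrow>\<^sub>E UNIV" "\<And>j. j < N \<Longrightarrow> w j > 0" "(\<Sum>j<N. w j *\<^sub>R x j) = u"
proof -
  obtain w where w: "w \<in> {..<N} \<rightarrow>\<^sub>E {0..}" "(\<Sum>j<N. w j *\<^sub>R x j) = u"
    using assms(2) by (auto simp: fib_def)
  define K where "K = {j. j < N \<and> w j > 0}"
  have w0: "w j = 0" if "j < N" "j \<notin> K" for j
    using w(1) that by (force simp: K_def PiE_iff)
  have uK: "u \<in> span (x ` K)"
    unfolding w(2)[symmetric]
  proof (rule span_sum)
    fix j assume "j \<in> {..<N}"
    then show "w j *\<^sub>R x j \<in> span (x ` K)"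
      using w0[of j] by (cases "j \<in> K") (auto intro: span_scale span_base span_zero)
  qed
  have "span (x ` K) = UNIV"
  proof (rule ccontr)
    assume "span (x ` K) \<noteq> UNIV"
    then obtain H where H: "H \<in> hyps {..<N}" "x ` K \<subseteq> H"
      using hyps_extend[OF spans_all, of K] by (auto simp: K_def)
    then have "u \<in> H" using uK span_minimal[OF H(2) subspace_hyps[OF H(1)]] by blast
    then show False using assms(1) H(1) by (auto simp: gen_def)
  qed
  moreover have "K \<subseteq> {..<N}" by (auto simp: K_def)
  ultimately obtain J where J: "J \<subseteq> K" "basis_on x J"
    using basis_on_subset_ex[of K x] finite_subset[of K "{..<N}"] by auto
  have JN: "J \<subseteq> {..<N}" "finite J" using J by (auto simp: K_def basis_on_def)
  define s where "s j = bcoord x J j (\<Sum>i\<in>{..<N} - J. x i)" for j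
  obtain \<epsilon> where \<epsilon>: "\<epsilon> > 0" "\<And>j. j \<in> J \<Longrightarrow> w j + \<epsilon> * (- s j) > 0"
    using small_perturbation[OF JN(2), of w "\<lambda>j. - s j"] J(1) by (auto simp: K_def)
  \<comment> \<open>All coordinates outside \<open>J\<close> grow by \<open>\<epsilon>\<close>;
    those in \<open>J\<close> compensate by \<open>- \<epsilon> * s j\<close>, and
    \<open>\<epsilon>\<close> was chosen so that they stay positive.\<close>
  define w' where "w' = lift x {..<N} J u (\<lambda>j. w j + \<epsilon>)"
  have lw: "lift x {..<N} J u w j = w j" if "j < N" for j
    using that by (intro lift_unique[OF _ JN(1) J(2) w(2)]) auto
  have "w' j > 0" if "j < N" for j
  proof (cases "j \<in> J")
    case True
    have "(\<Sum>k\<in>{..<N} - J. (w k + \<epsilon>) *\<^sub>R x k) = (\<Sum>k\<in>{..<N} - J. w k *\<^sub>R x k) + \<epsilon> *\<^sub>R (\<Sum>k\<in>{..<N} -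
        J. x k)"
      by (simp add: scaleR_add_left sum.distrib scaleR_sum_right)
    then have "w' j = lift x {..<N} J u w j - \<epsilon> * s j"
      using True that by (simp add: w'_def lift_def s_def linear_diff[OF linear_bcoord[OF J(2)]]
          linear_add[OF linear_bcoord[OF J(2)]] linear_cmul[OF linear_bcoord[OF J(2)]])
    then show ?thesis using lw[OF that] \<epsilon>(2)[OF True] by simp
  next
    case False
    then show ?thesis using that \<epsilon>(1) w(1) by (auto simp: w'_def lift_def PiE_iff intro:
        add_nonneg_pos)
  qed
  moreover have "(\<Sum>j<N. w' j *\<^sub>R x j) = u"
    unfolding w'_def by (rule lift_comb[OF _ JN(1) J(2)]) simp
  moreover have "w' \<in> {..<N} \<rightarrow>\<^sub>E UNIV" by (simp add: w'_def lift_def)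
  ultimately show thesis using that by blast
qed

definition codim :: nat where "codim = N - dim (x ` {..<N})"

lemma codim_eq: "codim = N - DIM('a)"
  using spans_all by (metis codim_def dim_UNIV dim_span spans_def)

lemma card_basis_on: "basis_on x J \<Longrightarrow> card J = DIM('a)"
  by (metis basis_on_def card_image dim_UNIV dim_eq_card_independent dim_span)

lemma frame_ex:
  obtains v where "orthonormal N codim v" "\<And>i. i < codim \<Longrightarrow> rel (v i)"
    "\<And>w. rel w \<Longrightarrow> \<exists>c. \<forall>l<N. w l = (\<Sum>i<codim. c i * v i l)"
proof -
  obtain J where J: "J \<subseteq> {..<N}" "basis_on x J" using spans_basis[OF spans_all] .
  have "card ({..<N} - J) = codim"
    using J by (simp add: card_Diff_subset finite_subset[OF J(1)] card_basis_on codim_eq)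
  then obtain h where h: "bij_betw h {..<codim} ({..<N} - J)"
    by (metis bij_betw_iff_card finite_Diff finite_lessThan card_lessThan)
  \<comment> \<open>The relations dual to the coordinates outside \<open>J\<close>:
    \<open>\<kappa> j\<close> is \<open>1\<close> at \<open>h j\<close> and \<open>0\<close> at the
    other positions outside \<open>J\<close>.\<close>
  define \<kappa> where "\<kappa> j = lift x {..<N} J 0 (\<lambda>l. if l = h j then 1 else 0)" for j
  have \<kappa>_rel: "rel (\<kappa> j)" for j
    unfolding rel_def \<kappa>_def by (rule lift_comb[OF _ J]) simp
  have \<kappa>_h: "\<kappa> j (h i) = (if i = j then 1 else 0)" if "i < codim" "j < codim" for i j
  proof -
    have "h i \<in> {..<N} - J" using h that by (auto simp: bij_betw_def)
    moreover have "h i = h j \<longleftrightarrow> i = j" using h that by (auto simp: bij_betw_def inj_on_def)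
    ultimately show ?thesis by (auto simp: \<kappa>_def lift_def)
  qed
  have comb_h: "(\<Sum>j<codim. c j * \<kappa> j (h i)) = c i" if "i < codim" for c i
  proof -
    have "(\<Sum>j<codim. c j * \<kappa> j (h i)) = (\<Sum>j<codim. if j = i then c i else 0)"
      using \<kappa>_h that by (intro sum.cong) auto
    then show ?thesis using that by simp
  qed
  have rel_comb: "rel (\<lambda>l. \<Sum>j<codim. c j * f j l)" if "\<And>j. j < codim \<Longrightarrow> rel (f j)" for c f
  proof -
    have "(\<Sum>l<N. (\<Sum>j<codim. c j * f j l) *\<^sub>R x l) = (\<Sum>j<codim. c j *\<^sub>R (\<Sum>l<N. f j l *\<^sub>R x l))"
      unfolding scaleR_sum_left scaleR_sum_right by (subst sum.swap) simp
    also have "\<dots> = 0" using that by (intro sum.neutral) (auto simp: rel_def)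
    finally show ?thesis by (simp add: rel_def)
  qed
  have span\<kappa>: "w l = (\<Sum>j<codim. w (h j) * \<kappa> j l)" if "rel w" "l < N" for w l
  proof -
    define w' where "w' l = (\<Sum>j<codim. w (h j) * \<kappa> j l)" for l
    have "lift x {..<N} J 0 w l = w l"
      using that by (intro lift_unique[OF _ J]) (auto simp: rel_def)
    moreover have "lift x {..<N} J 0 w l = w' l"
    proof (rule lift_unique[OF _ J])
      show "(\<Sum>i<N. w' i *\<^sub>R x i) = 0" using rel_comb[OF \<kappa>_rel] by (simp add: rel_def w'_def)
      fix i assume "i \<in> {..<N} - J"
      then obtain i' where "i' < codim" "i = h i'" using h by (auto simp: bij_betw_def)
      then show "w i = w' i" using comb_h by (simp add: w'_def)
    qed (use that in auto)
    ultimately show ?thesis by (simp add: w'_def)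
  qed
  have indep: "c j = 0" if c: "\<And>l. l < N \<Longrightarrow> (\<Sum>j<codim. c j * \<kappa> j l) = 0" and j: "j < codim" for c j
  proof -
    have "h j < N" using h j by (auto simp: bij_betw_def)
    then show ?thesis using c[of "h j"] comb_h[OF j, of c] by simp
  qed
  have "\<exists>v. orthonormal N codim v \<and>
    (\<forall>j<codim. \<exists>c. \<forall>l<N. \<kappa> j l = (\<Sum>i<codim. c i * v i l)) \<and>
    (\<forall>i<codim. \<exists>c. \<forall>l<N. v i l = (\<Sum>j<codim. c j * \<kappa> j l))"
    by (rule gram_schmidt) (rule indep)
  then obtain v where v: "orthonormal N codim v"
    "\<And>j. j < codim \<Longrightarrow> \<exists>c. \<forall>l<N. \<kappa> j l = (\<Sum>i<codim. c i * v i l)"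
    "\<And>i. i < codim \<Longrightarrow> \<exists>c. \<forall>l<N. v i l = (\<Sum>j<codim. c j * \<kappa> j l)"
    by blast
  obtain C where C: "\<And>j l. \<lbrakk>j < codim; l < N\<rbrakk> \<Longrightarrow> \<kappa> j l = (\<Sum>i<codim. C j i * v i l)"
    using v(2) by metis
  show thesis
  proof (rule that[OF v(1)])
    fix i assume "i < codim"
    then obtain c where c: "\<forall>l<N. v i l = (\<Sum>j<codim. c j * \<kappa> j l)" using v(3) by blast
    then have "(\<Sum>l<N. v i l *\<^sub>R x l) = (\<Sum>l<N. (\<Sum>j<codim. c j * \<kappa> j l) *\<^sub>R x l)"
        by (intro sum.cong) auto
    also have "\<dots> = 0" using rel_comb[OF \<kappa>_rel, of c] by (simp add: rel_def)
    finally show "rel (v i)" by (simp add: rel_def)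
  next
    fix w assume w: "rel w"
    have "w l = (\<Sum>i<codim. (\<Sum>j<codim. w (h j) * C j i) * v i l)" if "l < N" for l
      using span\<kappa>[OF w that] C that
      by (simp add: sum_distrib_left sum_distrib_right mult_ac) (rule sum.swap)
    then show "\<exists>c. \<forall>l<N. w l = (\<Sum>i<codim. c i * v i l)"
        by (intro exI[of _ "\<lambda>i. \<Sum>j<codim. w (h j) * C j i"]) blast
  qed
qed

text \<open>An orthonormal frame of the relations parametrises the fibres with the same volume as the
  coordinates outside of a basis, up to a factor that does not depend on the frame, since
  it can be computed from a ball.\<close>

definition frame_ball :: "nat set \<Rightarrow> ennreal" where
  "frame_ball J = (\<integral>\<^sup>+d. indicator {d. (\<Sum>l<N. (lift x {..<N} J 0 d l)\<^sup>2) \<le> 1} d \<partial>PiM ({..<N} -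
      J) (\<lambda>_. lborel))"

text \<open>The volume of the Euclidean unit ball of dimension \<open>codim\<close>.\<close>

definition frame_const :: ennreal where
  "frame_const = (\<integral>\<^sup>+c. indicator {c. (\<Sum>i<codim. (c i)\<^sup>2) \<le> 1} c \<partial>PiM {..<codim} (\<lambda>_. lborel ::
      real measure))"

lemma frame_const: "frame_const \<noteq> 0" "frame_const \<noteq> top"
proof -
  let ?P = "PiM {..<codim} (\<lambda>_. lborel :: real measure)"
  define r where "r = 1 / (real codim + 1)"
  have r: "0 < r" "r \<le> 1" "real codim * r \<le> 1" by (auto simp: r_def field_simps)
  have "(\<Sum>i<codim. (c i)\<^sup>2) \<le> 1" if "c \<in> {..<codim} \<rightarrow>\<^sub>E {-r..r}" for c
  proof -
    have "(c i)\<^sup>2 \<le> r" if "i < codim" for i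
    proof -
      have "c i \<in> {-r..r}" using \<open>c \<in> {..<codim} \<rightarrow>\<^sub>E {-r..r}\<close> that by blast
      then have "\<bar>c i\<bar> \<le> r" by auto
      then have "\<bar>c i\<bar> * \<bar>c i\<bar> \<le> r * 1" using r by (intro mult_mono) auto
      then show ?thesis by (simp add: power2_eq_square)
    qed
    then have "(\<Sum>i<codim. (c i)\<^sup>2) \<le> (\<Sum>i<codim. r)" by (intro sum_mono) auto
    then show ?thesis using r by simp
  qed
  then have "(\<integral>\<^sup>+c. indicator ({..<codim} \<rightarrow>\<^sub>E {-r..r}) c \<partial>?P) \<le> frame_const"
    unfolding frame_const_def by (intro nn_integral_mono) (auto simp: indicator_def)
  then have "ennreal ((2 * r) ^ codim) \<le> frame_const"
    using emeasure_PiM_box[of "{..<codim}" r] r by simp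
  moreover have "(2 * r) ^ codim > 0" using r by simp
  ultimately show "frame_const \<noteq> 0" by (metis ennreal_le_iff2 ennreal_0 linorder_not_less
      le_zero_eq)
  have "\<bar>c i\<bar> \<le> 1" if "(\<Sum>i<codim. (c i)\<^sup>2) \<le> 1" "i < codim" for c :: "nat \<Rightarrow> real" and i
  proof -
    have "(c i)\<^sup>2 \<le> (\<Sum>i<codim. (c i)\<^sup>2)" using that by (intro member_le_sum) auto
    with that(1) have "(c i)\<^sup>2 \<le> 1" by linarith
    then show ?thesis by (simp add: abs_square_le_1)
  qed
  then have "frame_const \<le> (\<integral>\<^sup>+c. indicator ({..<codim} \<rightarrow>\<^sub>E {-1..1}) c \<partial>?P)"
    unfolding frame_const_def
    by (intro nn_integral_mono) (auto simp: indicator_def space_PiM PiE_iff abs_le_iff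
        minus_le_iff)
  also have "\<dots> = ennreal (2 ^ codim)" using emeasure_PiM_box[of "{..<codim}" 1] by simp
  finally show "frame_const \<noteq> top" by (auto simp: top_unique)
qed

text \<open>Frame coordinates and coordinates outside \<open>J\<close> are linear coordinates on the
  same space of relations, so one factor \<open>\<kappa>\<close> serves every \<open>u\<close>. As
  an orthonormal frame preserves norms, the ball of relations yields the equation with
  \<open>frame_const\<close>, in which the frame no longer occurs and which later determines
  \<open>\<kappa>\<close>.\<close>

lemma frame_volume:
  assumes J: "J \<subseteq> {..<N}" "basis_on x J" and v: "orthonormal N codim v"
    and rel: "\<And>i. i < codim \<Longrightarrow> rel (v i)"
    and span: "\<And>w. rel w \<Longrightarrow> \<exists>c. \<forall>l<N. w l = (\<Sum>i<codim. c i * v i l)"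
  obtains \<kappa> :: real where "\<kappa> > 0" "frame_const = ennreal \<kappa> * frame_ball J"
    "\<And>a u. (\<Sum>j<N. a j *\<^sub>R x j) = u \<Longrightarrow>
      (\<integral>\<^sup>+c. indicator (orthant {..<N}) (affine_emb N codim a v c) \<partial>PiM {..<codim} (\<lambda>_. lborel)) =
      ennreal \<kappa> * fibre_vol x {..<N} J u"
proof -
  let ?K = "{..<N} - J"
  define M where "M l i = v i l" for l i
  \<comment> \<open>The inverse map: complete \<open>d\<close> to a relation and read off its frame
    coordinates as inner products with the \<open>v i\<close>.\<close>
  define M' where "M' i k = (\<Sum>l<N. v i l * (if l \<in> J then - bcoord x J l (x k) else if l =
      k then 1 else 0))" for i k
  have rel_comb: "rel (\<lambda>l. \<Sum>i<codim. c i * v i l)" for c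
  proof -
    have "(\<Sum>l<N. (\<Sum>j<codim. c j * v j l) *\<^sub>R x l) = (\<Sum>j<codim. c j *\<^sub>R (\<Sum>l<N. v j l *\<^sub>R x l))"
      unfolding scaleR_sum_left scaleR_sum_right by (subst sum.swap) simp
    also have "\<dots> = 0" using rel by (intro sum.neutral) (auto simp: rel_def)
    finally show ?thesis by (simp add: rel_def)
  qed
  have L': "lin_map {..<codim} ?K M' d i = (\<Sum>l<N. v i l * lift x {..<N} J 0 d l)" if
      "i < codim" for d i
  proof -
    have "(\<Sum>l<N. v i l * lift x {..<N} J 0 d l) =
        (\<Sum>l<N. v i l * (\<Sum>k\<in>?K. (if l \<in> J then - bcoord x J l (x k) else if l =
            k then 1 else 0) * d k))"
      using lift_0_sum[OF _ J(2), of "{..<N}"] by (intro sum.cong) auto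
    also have "\<dots> = (\<Sum>k\<in>?K. M' i k * d k)"
      unfolding M'_def sum_distrib_left sum_distrib_right
          by (subst sum.swap) (simp add: mult.assoc)
    finally show ?thesis using that by (simp add: lin_map_def)
  qed
  have L: "lin_map ?K {..<codim} M c l = (\<Sum>i<codim. c i * v i l)" if "l \<in> ?K" for c l
    using that by (simp add: lin_map_def M_def mult.commute)
  have lift_L: "lift x {..<N} J 0 (lin_map ?K {..<codim} M c) l = (\<Sum>i<codim. c i * v i l)" if
      "l < N" for c l
    using that rel_comb[of c] by (intro lift_unique[OF _ J]) (auto simp: L rel_def)
  have L'L: "lin_map {..<codim} ?K M' (lin_map ?K {..<codim} M c) = c" if
      "c \<in> {..<codim} \<rightarrow>\<^sub>E UNIV" for c
  proof (rule ext)
    fix i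
    show "lin_map {..<codim} ?K M' (lin_map ?K {..<codim} M c) i = c i"
    proof (cases "i < codim")
      case True
      then show ?thesis by (simp add: L' lift_L orthonormal_comb[OF v])
    qed (use that in \<open>auto simp: lin_map_def PiE_iff extensional_def\<close>)
  qed
  have LL': "lin_map ?K {..<codim} M (lin_map {..<codim} ?K M' d) = d" if "d \<in> ?K \<rightarrow>\<^sub>E UNIV" for d
  proof (rule ext)
    fix l
    let ?w = "lift x {..<N} J 0 d"
    have "rel ?w" unfolding rel_def by (rule lift_comb[OF _ J]) simp
    then obtain c where c: "\<And>l. l < N \<Longrightarrow> ?w l = (\<Sum>i<codim. c i * v i l)" using span by blast
    have ci: "lin_map {..<codim} ?K M' d i = c i" if "i < codim" for i
      using orthonormal_comb[OF v that, of c] c by (simp add: L' that)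
    show "lin_map ?K {..<codim} M (lin_map {..<codim} ?K M' d) l = d l"
    proof (cases "l \<in> ?K")
      case True
      then have "lin_map ?K {..<codim} M (lin_map {..<codim} ?K M' d) l = ?w l"
        using c[of l] by (simp add: L ci)
      then show ?thesis using True by (simp add: lift_def)
    qed (use that in \<open>auto simp: lin_map_def PiE_iff extensional_def\<close>)
  qed
  obtain \<kappa> :: real where \<kappa>: "\<kappa> > 0" "\<And>f. f \<in> borel_measurable (PiM ?K (\<lambda>_. lborel)) \<Longrightarrow>
      (\<integral>\<^sup>+c. f (lin_map ?K {..<codim} M c) \<partial>PiM {..<codim} (\<lambda>_. lborel)) =
          ennreal \<kappa> * (\<integral>\<^sup>+d. f d \<partial>PiM ?K (\<lambda>_. lborel))"
    using PiM_lborel_linear_image[OF _ _ LL' L'L] by (metis finite_Diff finite_lessThan)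
  have lift_meas: "(\<lambda>d. lift x {..<N} J u d l) \<in> borel_measurable (PiM ?K (\<lambda>_. lborel))" if
      "l < N" for u l
    using borel_measurable_bcoord[OF J(2), measurable] that
    by (cases "l \<in> J") (simp_all add: lift_def, measurable)
  show thesis
  proof (rule that[OF \<kappa>(1)])
    have "(\<lambda>d. indicator {d. (\<Sum>l<N. (lift x {..<N} J 0 d l)\<^sup>2) \<le> 1} d :: ennreal) \<in>
        borel_measurable (PiM ?K (\<lambda>_. lborel))"
    proof -
      have [measurable]: "(\<lambda>d. \<Sum>l<N. (lift x {..<N} J 0 d l)\<^sup>2) \<in> borel_measurable
          (PiM ?K (\<lambda>_. lborel))"
        by (intro borel_measurable_sum borel_measurable_power lift_meas) auto
      have "(\<lambda>d. indicator {..1} (\<Sum>l<N. (lift x {..<N} J 0 d l)\<^sup>2) :: ennreal) \<in>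
          borel_measurable (PiM ?K (\<lambda>_. lborel))"
        by measurable
      then show ?thesis by (simp add: indicator_def)
    qed
    from \<kappa>(2)[OF this] show "frame_const = ennreal \<kappa> * frame_ball J"
      by (simp add: frame_const_def frame_ball_def lift_L orthonormal_norm_comb[OF v]
          indicator_def)
  next
    fix a u assume a: "(\<Sum>j<N. a j *\<^sub>R x j) = u"
    define f :: "_ \<Rightarrow> ennreal" where "f d = indicator (orthant {..<N}) (lift x {..<N} J u d)" for d
    have f_meas: "f \<in> borel_measurable (PiM ?K (\<lambda>_. lborel))"
    proof -
      note [measurable] = sets_cone_on[OF J(2)] borel_measurable_orthant[of ?K]
      show ?thesis unfolding f_def indicator_lift[OF J(1)] by measurable
    qed
    have tr_meas: "(\<lambda>d. f (\<lambda>i\<in>?K. d i + a i)) \<in> borel_measurable (PiM ?K (\<lambda>_. lborel))"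
      by (rule measurable_compose[OF _ f_meas]) (rule measurable_restrict, simp)
    have "(\<integral>\<^sup>+c. indicator (orthant {..<N}) (affine_emb N codim a v c) \<partial>PiM {..<codim}
        (\<lambda>_. lborel)) =
        (\<integral>\<^sup>+c. f (\<lambda>i\<in>?K. lin_map ?K {..<codim} M c i + a i) \<partial>PiM {..<codim} (\<lambda>_. lborel))"
    proof (rule nn_integral_cong)
      fix c
      have "lift x {..<N} J u (\<lambda>i\<in>?K. lin_map ?K {..<codim} M c i + a i) l =
          affine_emb N codim a v c l" if "l < N" for l
      proof (rule lift_unique[OF _ J])
        have "(\<Sum>i<N. affine_emb N codim a v c i *\<^sub>R x i) =
            (\<Sum>i<N. a i *\<^sub>R x i) + (\<Sum>l<N. (\<Sum>i<codim. c i * v i l) *\<^sub>R x l)"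
          by (simp add: affine_emb_def scaleR_add_left sum.distrib)
        then show "(\<Sum>i<N. affine_emb N codim a v c i *\<^sub>R x i) = u"
          using a rel_comb[of c] by (simp add: rel_def)
      qed (use that in \<open>auto simp: L affine_emb_def\<close>)
      then show "indicator (orthant {..<N}) (affine_emb N codim a v c) =
          f (\<lambda>i\<in>?K. lin_map ?K {..<codim} M c i + a i)"
        by (auto simp: f_def orthant_def indicator_def)
    qed
    also have "\<dots> = ennreal \<kappa> * (\<integral>\<^sup>+d. f (\<lambda>i\<in>?K. d i + a i) \<partial>PiM ?K (\<lambda>_. lborel))"
      using \<kappa>(2)[OF tr_meas] by simp
    also have "(\<integral>\<^sup>+d. f (\<lambda>i\<in>?K. d i + a i) \<partial>PiM ?K (\<lambda>_. lborel)) = fibre_vol x {..<N} J u"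
      unfolding PiM_lborel_translate[OF finite_Diff[OF finite_lessThan] f_meas]
      by (simp add: fibre_vol_lift[OF J(1)] f_def[abs_def])
    finally show "(\<integral>\<^sup>+c. indicator (orthant {..<N}) (affine_emb N codim a v c) \<partial>PiM {..<codim}
        (\<lambda>_. lborel)) =
      ennreal \<kappa> * fibre_vol x {..<N} J u" .
  qed
qed

text \<open>The embedding inside \<open>affine_vol\<close> is an arbitrary choice. At a generic
  \<open>u\<close> with nonempty fibre its directions contain all relations, and by counting equal
  them; then \<open>frame_volume\<close> applies with the factor already found for
  \<open>v0\<close>. An empty fibre has volume zero whatever is chosen.\<close>

lemma affine_vol_fib:
  obtains \<kappa> :: real where "\<kappa> > 0" "\<And>u. u \<in> gen {..<N} \<Longrightarrow> affine_vol N codim (fib u) =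
      \<kappa> * W {..<N} u"
proof -
  obtain J where J: "J \<subseteq> {..<N}" "basis_on x J" using spans_basis[OF spans_all] .
  obtain v0 where v0: "orthonormal N codim v0" "\<And>i. i < codim \<Longrightarrow> rel (v0 i)"
    "\<And>w. rel w \<Longrightarrow> \<exists>c. \<forall>l<N. w l = (\<Sum>i<codim. c i * v0 i l)"
    using frame_ex by blast
  obtain \<kappa>0 :: real where \<kappa>0: "\<kappa>0 > 0" "frame_const = ennreal \<kappa>0 * frame_ball J"
    using frame_volume[OF J v0] by metis
  have fb: "frame_ball J \<noteq> 0" "frame_ball J \<noteq> top"
    using \<kappa>0 frame_const by (auto simp: ennreal_mult_eq_top_iff)
  have uniq: "\<kappa> = \<kappa>0" if "\<kappa> > 0" "frame_const = ennreal \<kappa> * frame_ball J" for \<kappa>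
  proof -
    have "frame_ball J * ennreal \<kappa> = frame_ball J * ennreal \<kappa>0" using that \<kappa>0
        by (simp add: mult.commute)
    then show ?thesis using fb that \<kappa>0 by (simp add: ennreal_mult_cancel_left)
  qed
  show thesis
  proof (rule that[of "\<kappa>0 / dens_factor x J"])
    show "\<kappa>0 / dens_factor x J > 0" using \<kappa>0 dens_factor(1)[OF J(2)] by simp
    fix u assume u: "u \<in> gen {..<N}"
    have W: "W {..<N} u = dens_factor x J * enn2real (fibre_vol x {..<N} J u)"
      using dens_factor(1)[OF J(2)] by (simp add: W_def spl_eq_dens[OF spans_all J] dens_def
          enn2real_mult)
    have "affine_vol N codim (fib u) = \<kappa>0 * enn2real (fibre_vol x {..<N} J u)"
    proof (cases "fib u = {}")
      case True
      have "lift x {..<N} J u c \<notin> orthant {..<N}" for c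
      proof
        assume "lift x {..<N} J u c \<in> orthant {..<N}"
        moreover have "(\<Sum>i<N. lift x {..<N} J u c i *\<^sub>R x i) = u" by (rule lift_comb[OF _ J]) simp
        moreover have "lift x {..<N} J u c \<in> extensional {..<N}" by (simp add: lift_def)
        ultimately have "lift x {..<N} J u c \<in> fib u" by (auto simp: fib_def orthant_def PiE_iff)
        with True show False by simp
      qed
      then have "fibre_vol x {..<N} J u = 0" by (simp add: fibre_vol_lift[OF J(1)])
      with True show ?thesis by (simp add: affine_vol_def case_prod_beta Let_def)
    next
      case False
      define P where "P av = (case av of (a, v) \<Rightarrow> orthonormal N codim v \<and>
          fib u \<subseteq> range (affine_emb N codim a v))" for av
      obtain w0 where w0: "w0 \<in> fib u" using False by auto
      have "P (w0, v0)"
        unfolding P_def prod.case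
      proof (intro conjI v0 subsetI)
        fix w assume w: "w \<in> fib u"
        have "rel (\<lambda>l. w l - w0 l)"
          using w w0 by (simp add: rel_def fib_def scaleR_diff_left sum_subtractf)
        then obtain c where c: "\<And>l. l < N \<Longrightarrow> w l - w0 l = (\<Sum>i<codim. c i * v0 i l)" using v0(3)
            by blast
        have "w = affine_emb N codim w0 v0 c"
        proof
          fix l
          show "w l = affine_emb N codim w0 v0 c l"
            using c[of l] w by (cases "l < N") (auto simp: affine_emb_def fib_def PiE_iff
                extensional_def)
        qed
        then show "w \<in> range (affine_emb N codim w0 v0)" by blast
      qed
      then have Psome: "P (SOME av. P av)" by (rule someI)
      obtain a v where av: "(SOME av. P av) = (a, v)" by (cases "SOME av. P av")
      have v: "orthonormal N codim v" and sub: "fib u \<subseteq> range (affine_emb N codim a v)"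
        using Psome[unfolded av] by (auto simp: P_def)
      obtain wp where wp: "wp \<in> {..<N} \<rightarrow>\<^sub>E UNIV" "\<And>j. j < N \<Longrightarrow> wp j > 0" "(\<Sum>j<N. wp j *\<^sub>R x j) = u"
        using fib_positive[OF u False] by blast
      have wp_fib: "wp \<in> fib u" using wp by (auto simp: fib_def PiE_iff less_imp_le)
      \<comment> \<open>A small multiple of a relation can be added to the positive point
        \<open>wp\<close> without leaving the fibre; both points lie in the image of the embedding,
        so their difference is a combination of the \<open>v i\<close>.\<close>
      have rel_span: "\<exists>c. \<forall>l<N. w l = (\<Sum>i<codim. c i * v i l)" if w: "rel w" for w
      proof -
        obtain \<epsilon> where \<epsilon>: "\<epsilon> > 0" "\<And>l. l \<in> {..<N} \<Longrightarrow> wp l + \<epsilon> * w l > 0"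
          using small_perturbation[of "{..<N}" wp w] wp(2) by auto
        have "(\<Sum>l<N. (wp l + \<epsilon> * w l) *\<^sub>R x l) = (\<Sum>l<N. wp l *\<^sub>R x l) + \<epsilon> *\<^sub>R (\<Sum>l<N. w l *\<^sub>R x l)"
          by (simp add: scaleR_add_left sum.distrib scaleR_sum_right)
        then have "(\<lambda>l\<in>{..<N}. wp l + \<epsilon> * w l) \<in> fib u"
          using wp(3) w \<epsilon>(2) by (auto simp: fib_def rel_def less_imp_le)
        then obtain c where c: "(\<lambda>l\<in>{..<N}. wp l + \<epsilon> * w l) = affine_emb N codim a v c" using
            sub by blast
        obtain d where d: "wp = affine_emb N codim a v d" using sub wp_fib by blast
        have "w l = (\<Sum>i<codim. ((c i - d i) / \<epsilon>) * v i l)" if "l < N" for l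
        proof -
          have "\<epsilon> * w l = affine_emb N codim a v c l - affine_emb N codim a v d l"
            using fun_cong[OF c, of l] fun_cong[OF d, of l] that by simp
          also have "\<dots> = (\<Sum>i<codim. (c i - d i) * v i l)"
            using that by (simp add: affine_emb_def sum_subtractf left_diff_distrib)
          finally have "w l = (\<Sum>i<codim. (c i - d i) * v i l) / \<epsilon>" using \<epsilon>(1)
              by (simp add: field_simps)
          then show ?thesis by (simp add: sum_divide_distrib)
        qed
        then show ?thesis by (intro exI[of _ "\<lambda>i. (c i - d i) / \<epsilon>"]) blast
      qed
      have "\<forall>j\<in>{..<codim}. \<exists>c. \<forall>l<N. v0 j l = (\<Sum>i<codim. c i * v i l)"
        using rel_span v0(2) by blast
      from bchoice[OF this] obtain C where C: "\<And>j l. \<lbrakk>j < codim; l < N\<rbrakk> \<Longrightarrow> v0 j l =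
          (\<Sum>i<codim. C j i * v i l)"
        by blast
      \<comment> \<open>The relations \<open>v0\<close> lie in the span of \<open>v\<close> and are
        equally many, so conversely each \<open>v i\<close> is a combination of them.\<close>
      have v_rel: "rel (v i)" if "i < codim" for i
      proof -
        have "(\<Sum>l<N. v i l *\<^sub>R x l) = (\<Sum>l<N. (\<Sum>j<codim. C j i * v0 j l) *\<^sub>R x l)"
          using orthonormal_span_eq[OF v v0(1) C that] by (intro sum.cong) auto
        also have "\<dots> = (\<Sum>j<codim. C j i *\<^sub>R (\<Sum>l<N. v0 j l *\<^sub>R x l))"
          unfolding scaleR_sum_left scaleR_sum_right by (subst sum.swap) simp
        also have "\<dots> = 0" using v0(2) by (intro sum.neutral) (auto simp: rel_def)
        finally show ?thesis by (simp add: rel_def)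
      qed
      obtain \<kappa> :: real where \<kappa>: "\<kappa> > 0" "frame_const = ennreal \<kappa> * frame_ball J"
        "\<And>a u. (\<Sum>j<N. a j *\<^sub>R x j) = u \<Longrightarrow>
          (\<integral>\<^sup>+c. indicator (orthant {..<N}) (affine_emb N codim a v c) \<partial>PiM {..<codim}
              (\<lambda>_. lborel)) =
          ennreal \<kappa> * fibre_vol x {..<N} J u"
        using frame_volume[OF J v v_rel rel_span] by blast
      obtain d where d: "wp = affine_emb N codim a v d" using sub wp_fib by blast
      have emb_sum: "(\<Sum>l<N. affine_emb N codim a v c l *\<^sub>R x l) = (\<Sum>l<N. a l *\<^sub>R x l)" for c
      proof -
        have "(\<Sum>l<N. affine_emb N codim a v c l *\<^sub>R x l) =
            (\<Sum>l<N. a l *\<^sub>R x l) + (\<Sum>i<codim. c i *\<^sub>R (\<Sum>l<N. v i l *\<^sub>R x l))"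
        proof -
          have "(\<Sum>l<N. (\<Sum>i<codim. c i * v i l) *\<^sub>R x l) =
              (\<Sum>i<codim. c i *\<^sub>R (\<Sum>l<N. v i l *\<^sub>R x l))"
            unfolding scaleR_sum_left scaleR_sum_right by (subst sum.swap) simp
          then show ?thesis by (simp add: affine_emb_def scaleR_add_left sum.distrib)
        qed
        also have "(\<Sum>i<codim. c i *\<^sub>R (\<Sum>l<N. v i l *\<^sub>R x l)) = 0"
          using v_rel by (intro sum.neutral) (auto simp: rel_def)
        finally show ?thesis by simp
      qed
      have a_sum: "(\<Sum>l<N. a l *\<^sub>R x l) = u" using emb_sum[of d] wp(3) d by simp
      let ?D = "{c \<in> {..<codim} \<rightarrow>\<^sub>E UNIV. affine_emb N codim a v c \<in> fib u}"
      have D_eq: "affine_emb N codim a v c \<in> fib u \<longleftrightarrow> affine_emb N codim a v c \<in> orthant {..<N}"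
          for c
        using emb_sum[of c] a_sum by (auto simp: fib_def orthant_def affine_emb_def PiE_iff)
      have D_sets: "?D \<in> sets (PiM {..<codim} (\<lambda>_. lborel))"
      proof -
        have "?D = {c \<in> space (PiM {..<codim} (\<lambda>_. lborel)). \<forall>l\<in>{..<N}. 0 \<le> a l + (\<Sum>i<codim. c
            i * v i l)}"
          unfolding D_eq by (auto simp: space_PiM orthant_def affine_emb_def)
        also have "\<dots> \<in> sets (PiM {..<codim} (\<lambda>_. lborel))" by measurable
        finally show ?thesis .
      qed
      have "affine_vol N codim (fib u) = measure (PiM {..<codim} (\<lambda>_. lborel)) ?D"
        using av unfolding affine_vol_def P_def[abs_def] by simp
      also have "\<dots> = enn2real (\<integral>\<^sup>+c. indicator ?D c \<partial>PiM {..<codim} (\<lambda>_. lborel))"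
        using D_sets by (simp add: measure_def)
      also have "(\<integral>\<^sup>+c. indicator ?D c \<partial>PiM {..<codim} (\<lambda>_. lborel)) =
          (\<integral>\<^sup>+c. indicator (orthant {..<N}) (affine_emb N codim a v c) \<partial>PiM {..<codim}
              (\<lambda>_. lborel))"
        by (intro nn_integral_cong) (auto simp: indicator_def D_eq space_PiM)
      also have "\<dots> = ennreal \<kappa> * fibre_vol x {..<N} J u" by (rule \<kappa>(3)[OF a_sum])
      finally show ?thesis using \<kappa>(1) uniq[OF \<kappa>(1,2)] by (simp add: enn2real_mult)
    qed
    then show "affine_vol N codim (fib u) = \<kappa>0 / dens_factor x J * W {..<N} u"
      using dens_factor(1)[OF J(2)] by (simp add: W)
  qed
qed

end

section \<open>Lattice points, alcoves and local splines\<close>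

context based_lattice
begin

lemma lattice_coord_Ints: "u \<in> \<Lambda> \<longleftrightarrow> (\<forall>i. coord b u i \<in> \<int>)"
proof
  assume "u \<in> \<Lambda>"
  then obtain z where "u = (\<Sum>i\<in>UNIV. of_int (z i) *\<^sub>R b i)" by (auto simp: lattice_eq)
  then show "\<forall>i. coord b u i \<in> \<int>" by (simp add: coord_sum_basis)
next
  assume *: "\<forall>i. coord b u i \<in> \<int>"
  have "u = (\<Sum>i\<in>UNIV. of_int \<lfloor>coord b u i\<rfloor> *\<^sub>R b i)"
    by (subst basis_expansion[of u, symmetric]) (use * in \<open>simp add: of_int_floor\<close>)
  then show "u \<in> \<Lambda>" by (auto simp: lattice_eq)
qed

lemma lattice_add: "u \<in> \<Lambda> \<Longrightarrow> v \<in> \<Lambda> \<Longrightarrow> u + v \<in> \<Lambda>"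
  by (simp add: lattice_coord_Ints coord_add)

lemma lattice_scale: "u \<in> \<Lambda> \<Longrightarrow> c \<in> \<int> \<Longrightarrow> c *\<^sub>R u \<in> \<Lambda>"
  by (simp add: lattice_coord_Ints coord_scaleR)

lemma lattice_diff: "u \<in> \<Lambda> \<Longrightarrow> v \<in> \<Lambda> \<Longrightarrow> u - v \<in> \<Lambda>"
  using lattice_add[of u "(-1) *\<^sub>R v"] lattice_scale[of v "-1"] by simp

lemma lattice_0: "0 \<in> \<Lambda>"
  using coord_scaleR[of 0 0] by (simp add: lattice_coord_Ints)

lemma lattice_sum: "(\<And>i. i \<in> S \<Longrightarrow> f i \<in> \<Lambda>) \<Longrightarrow> sum f S \<in> \<Lambda>"
  by (induction S rule: infinite_finite_induct) (auto simp: lattice_0 lattice_add)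

lemma coord_basis: "coord b (b i) j = (if j = i then 1 else 0)"
  using coord_sum_basis[of "\<lambda>j. if j = i then 1 else 0" j]
  by (simp add: if_distrib[of "\<lambda>c. c *\<^sub>R _"] cong: if_cong)

lemma basis_in_lattice: "b i \<in> \<Lambda>"
  by (simp add: lattice_coord_Ints coord_basis)

lemma finite_lattice_bounded:
  assumes "bounded S"
  shows "finite (\<Lambda> \<inter> S)"
proof -
  have "\<exists>R::int. \<forall>u\<in>S. \<bar>coord b u i\<bar> \<le> of_int R" for i
  proof -
    have "bounded ((\<lambda>u. coord b u i) ` S)"
      by (rule bounded_linear_image[OF assms bounded_linear_coord])
    then obtain r where "\<forall>u\<in>S. \<bar>coord b u i\<bar> \<le> r" by (auto simp: bounded_iff)
    then show ?thesis by (intro exI[of _ "\<lceil>r\<rceil>"]) (force intro: order_trans)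
  qed
  then obtain R :: "'n \<Rightarrow> int" where R: "\<And>i u. u \<in> S \<Longrightarrow> \<bar>coord b u i\<bar> \<le> of_int (R i)" by metis
  have "\<Lambda> \<inter> S \<subseteq> (\<lambda>z. \<Sum>i\<in>UNIV. of_int (z i) *\<^sub>R b i) ` (PiE UNIV (\<lambda>i. {- R i..R i}))"
  proof
    fix u assume u: "u \<in> \<Lambda> \<inter> S"
    then obtain z where z: "u = (\<Sum>i\<in>UNIV. of_int (z i) *\<^sub>R b i)" by (auto simp: lattice_eq)
    have "\<bar>z i\<bar> \<le> R i" for i
    proof -
      have "\<bar>of_int (z i) :: real\<bar> \<le> of_int (R i)" using R[of u i] u z
          by (simp add: coord_sum_basis)
      then show ?thesis by linarith
    qed
    then have "z \<in> PiE UNIV (\<lambda>i. {- R i..R i})" by (auto simp: abs_le_iff minus_le_iff)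
    with z show "u \<in> (\<lambda>z. \<Sum>i\<in>UNIV. of_int (z i) *\<^sub>R b i) ` (PiE UNIV (\<lambda>i. {- R i..R i}))" by blast
  qed
  moreover have "finite (PiE UNIV (\<lambda>i. {- R i..R i}))" by (intro finite_PiE) auto
  ultimately show ?thesis using finite_surj by blast
qed

text \<open>The multiples \<open>k \<mu>\<close> are congruent modulo the sublattice spanned by \<open>B\<close> to points of the
  bounded set \<open>\<Sum> [0,1] v\<close>, which contains only finitely many lattice points.\<close>

lemma multiple_in_sublattice:
  assumes B: "B \<subseteq> \<Lambda>" "independent B" "span B = UNIV" and \<mu>: "\<mu> \<in> \<Lambda>"
  shows "\<exists>k::nat. k > 0 \<and> (\<forall>v\<in>B. real k * representation B \<mu> v \<in> \<int>)"
proof -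
  have fin: "finite B" using B(2) by (rule independent_imp_finite)
  let ?c = "representation B \<mu>"
  have exp: "(\<Sum>v\<in>B. ?c v *\<^sub>R v) = \<mu>"
    using real_vector.sum_representation_eq[OF B(2) _ fin subset_refl] B(3) by simp
  define r where "r k = (\<Sum>v\<in>B. frac (real k * ?c v) *\<^sub>R v)" for k :: nat
  have r_eq: "r k = real k *\<^sub>R \<mu> - (\<Sum>v\<in>B. of_int \<lfloor>real k * ?c v\<rfloor> *\<^sub>R v)" for k
    by (subst exp[symmetric]) (simp add: r_def frac_def scaleR_diff_left sum_subtractf
        scaleR_sum_right)
  have "r k \<in> \<Lambda>" for k
    unfolding r_eq using B(1) \<mu> by (intro lattice_diff lattice_scale lattice_sum) auto
  moreover have "norm (r k) \<le> (\<Sum>v\<in>B. norm v)" for k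
    unfolding r_def
    by (intro order_trans[OF norm_sum] sum_mono) (simp add: frac_lt_1 less_imp_le
        mult_left_le_one_le)
  then have "r k \<in> cball 0 (\<Sum>v\<in>B. norm v)" for k by simp
  ultimately have "range r \<subseteq> \<Lambda> \<inter> cball 0 (\<Sum>v\<in>B. norm v)" by auto
  then have "finite (range r)" using finite_lattice_bounded[OF bounded_cball] finite_subset
      by blast
  then have "\<not> inj r" using finite_imageD by (auto simp: infinite_UNIV_nat)
  then obtain k l where kl: "k < l" "r k = r l" by (metis injI linorder_neqE_nat)
  have "real (l - k) * ?c v \<in> \<int>" if v: "v \<in> B" for v
  proof -
    have rep: "representation B (\<Sum>v\<in>B. f v *\<^sub>R v) v = f v" for f
    proof -
      have "(\<Sum>w\<in>B. f w *\<^sub>R w) = (\<Sum>w | (if w \<in> B then f w else 0) \<noteq> 0. (if w \<in> B then f w else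
          0) *\<^sub>R w)"
        by (rule sum.mono_neutral_cong_right[OF fin]) auto
      then have "representation B (\<Sum>w\<in>B. f w *\<^sub>R w) = (\<lambda>w. if w \<in> B then f w else 0)"
        using fin B by (intro representation_eqI[OF B(2)]) (auto split: if_splits intro:
            finite_subset[OF _ fin])
      with v show ?thesis by simp
    qed
    have "frac (real k * ?c v) = frac (real l * ?c v)"
      using arg_cong[OF kl(2), of "\<lambda>u. representation B u v"] by (simp add: r_def rep)
    then have "real l * ?c v - real k * ?c v = of_int (\<lfloor>real l * ?c v\<rfloor> - \<lfloor>real k * ?c v\<rfloor>)"
      by (simp add: frac_def)
    then have "real l * ?c v - real k * ?c v \<in> \<int>" by (metis Ints_of_int)
    then show ?thesis using kl(1) by (simp add: of_nat_diff left_diff_distrib)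
  qed
  with kl(1) show ?thesis by (intro exI[of _ "l - k"]) auto
qed

lemma lattice_exponent:
  assumes B: "B \<subseteq> \<Lambda>" "independent B" "span B = UNIV"
  obtains M :: nat where "M > 0" "\<And>\<mu> v. \<mu> \<in> \<Lambda> \<Longrightarrow> v \<in> B \<Longrightarrow> real M * representation B \<mu> v \<in> \<int>"
proof -
  have "\<exists>k::nat. k > 0 \<and> (\<forall>v\<in>B. real k * representation B (b i) v \<in> \<int>)" for i
    by (rule multiple_in_sublattice[OF B basis_in_lattice])
  then obtain k :: "'n \<Rightarrow> nat" where k: "\<And>i. k i > 0" "\<And>i v. v \<in> B \<Longrightarrow> real (k i) * representation
      B (b i) v \<in> \<int>"
    by metis
  define M where "M = (\<Prod>i\<in>UNIV. k i)"
  have M: "real M * representation B (b i) v \<in> \<int>" if "v \<in> B" for i v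
  proof -
    have "M = k i * (\<Prod>j\<in>UNIV - {i}. k j)" unfolding M_def by (rule prod.remove) auto
    then have "real M * representation B (b i) v =
        real (\<Prod>j\<in>UNIV - {i}. k j) * (real (k i) * representation B (b i) v)"
      by (simp add: mult_ac)
    then show ?thesis using k(2)[OF that] by (metis Ints_mult Ints_of_nat)
  qed
  have "M > 0" using k(1) by (simp add: M_def prod_pos)
  moreover have "real M * representation B \<mu> v \<in> \<int>" if "\<mu> \<in> \<Lambda>" "v \<in> B" for \<mu> v
  proof -
    have "representation B \<mu> v = (\<Sum>i\<in>UNIV. coord b \<mu> i * representation B (b i) v)"
      by (subst basis_expansion[of \<mu>, symmetric])
        (simp add: real_vector.representation_sum[OF B(2)] real_vector.representation_scale[OF
            B(2)] B(3))
    then have "real M * representation B \<mu> v = (\<Sum>i\<in>UNIV. coord b \<mu> i * (real M * representation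
        B (b i) v))"
      by (simp add: sum_distrib_left mult_ac)
    also have "\<dots> \<in> \<int>"
      by (rule Ints_sum, rule Ints_mult) (use M that lattice_coord_Ints in auto)
    finally show ?thesis .
  qed
  ultimately show thesis by (rule that)
qed

section \<open>Characters of finite order and periodicity of local parts\<close>

lemma torus_kernel:
  assumes e: "e \<in> torus \<Lambda>"
  shows "e 0 = 1"
    and "u \<in> \<Lambda> \<Longrightarrow> e u = 1 \<Longrightarrow> e (of_int z *\<^sub>R u) = 1"
    and "(\<And>i. i \<in> S \<Longrightarrow> f i \<in> \<Lambda>) \<Longrightarrow> (\<And>i. i \<in> S \<Longrightarrow> e (f i) = 1) \<Longrightarrow> e (sum f S) = 1"
proof -
  have add: "e (u + v) = e u * e v" if "u \<in> \<Lambda>" "v \<in> \<Lambda>" for u v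
    using e that by (auto simp: torus_def)
  have "norm (e 0) = 1" using e lattice_0 by (auto simp: torus_def PiE_iff)
  then have "e 0 \<noteq> 0" by auto
  then show e0: "e 0 = 1" using add[OF lattice_0 lattice_0] by simp
  show "e (of_int z *\<^sub>R u) = 1" if u: "u \<in> \<Lambda>" "e u = 1"
  proof (induction z rule: int_induct[of _ 0])
    case base
    then show ?case by (simp add: e0)
  next
    case (step1 i)
    then show ?case
      using add[of "of_int i *\<^sub>R u" u] u lattice_scale by (simp add: scaleR_add_left)
  next
    case (step2 i)
    have "e (of_int i *\<^sub>R u) = e (of_int (i - 1) *\<^sub>R u) * e u"
      using add[of "of_int (i - 1) *\<^sub>R u" u] u lattice_scale[OF u(1), of "of_int (i - 1)"]
      by (simp add: scaleR_diff_left)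
    with step2 u show ?case by simp
  qed
  show "e (sum f S) = 1" if "\<And>i. i \<in> S \<Longrightarrow> f i \<in> \<Lambda>" "\<And>i. i \<in> S \<Longrightarrow> e (f i) = 1"
    using that
    by (induction S rule: infinite_finite_induct) (auto simp: e0 add lattice_sum)
qed

text \<open>The character is trivial on the sublattice generated by \<open>B\<close>, and this
  contains \<open>M\<close> times the lattice because \<open>B\<close> is a basis of the
  space.\<close>

lemma toric_vertex_torsion:
  assumes "e \<in> toric_vertices \<Lambda> X" "set X \<subseteq> \<Lambda>"
  obtains M :: nat where "M > 0" "\<And>\<mu>. \<mu> \<in> \<Lambda> \<Longrightarrow> e (real M *\<^sub>R \<mu>) = 1"
proof -
  obtain B where e: "e \<in> torus \<Lambda>" and B: "B \<subseteq> set X" "independent B" "span B = UNIV"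
      "\<And>v. v \<in> B \<Longrightarrow> e v = 1"
    using assms(1) by (auto simp: toric_vertices_def)
  have BL: "B \<subseteq> \<Lambda>" using B assms(2) by auto
  obtain M :: nat where M: "M > 0" "\<And>\<mu> v. \<mu> \<in> \<Lambda> \<Longrightarrow> v \<in> B \<Longrightarrow> real M * representation B \<mu> v \<in> \<int>"
    using lattice_exponent[OF BL B(2,3)] by blast
  have "e (real M *\<^sub>R \<mu>) = 1" if \<mu>: "\<mu> \<in> \<Lambda>" for \<mu>
  proof -
    have "\<mu> = (\<Sum>v\<in>B. representation B \<mu> v *\<^sub>R v)"
      using real_vector.sum_representation_eq[OF B(2) _ independent_imp_finite[OF B(2)]
          subset_refl] B(3) by simp
    then have "real M *\<^sub>R \<mu> = (\<Sum>v\<in>B. (real M * representation B \<mu> v) *\<^sub>R v)"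
      by (metis (no_types, lifting) scaleR_scaleR scaleR_sum_right sum.cong)
    also have "e \<dots> = 1"
    proof (rule torus_kernel(3)[OF e])
      fix v assume v: "v \<in> B"
      obtain z where z: "real M * representation B \<mu> v = of_int z"
        using M(2)[OF \<mu> v] by (auto elim: Ints_cases)
      show "(real M * representation B \<mu> v) *\<^sub>R v \<in> \<Lambda>" using v BL z by (auto intro: lattice_scale)
      show "e ((real M * representation B \<mu> v) *\<^sub>R v) = 1"
        unfolding z using v BL B(4) by (intro torus_kernel(2)[OF e]) auto
    qed
    finally show ?thesis .
  qed
  with M(1) show thesis by (rule that)
qed

lemma local_part_periodic:
  assumes p: "p \<in> periodic_P \<Lambda> b X" and X: "set X \<subseteq> \<Lambda>"
  obtains M :: nat where "M > 0"
    "\<And>\<nu> \<mu>. \<nu> \<in> \<Lambda> \<Longrightarrow> \<mu> \<in> \<Lambda> \<Longrightarrow> local_part p (\<nu> + real M *\<^sub>R \<mu>) = local_part p \<nu>"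
proof -
  let ?K = "Poly_Mapping.keys p"
  have K: "?K \<subseteq> toric_vertices \<Lambda> X" using p by (auto simp: periodic_P_def)
  have "\<forall>e\<in>?K. \<exists>M::nat. M > 0 \<and> (\<forall>\<mu>\<in>\<Lambda>. e (real M *\<^sub>R \<mu>) = 1)"
    using toric_vertex_torsion[OF _ X] K by (metis subsetD)
  from bchoice[OF this] obtain m :: "_ \<Rightarrow> nat" where
    m: "\<And>e. e \<in> ?K \<Longrightarrow> m e > 0" "\<And>e \<mu>. e \<in> ?K \<Longrightarrow> \<mu> \<in> \<Lambda> \<Longrightarrow> e (real (m e) *\<^sub>R \<mu>) = 1"
    by blast
  define M where "M = (\<Prod>e\<in>?K. m e)"
  have "M > 0" using m(1) by (simp add: M_def prod_pos)
  moreover have "local_part p (\<nu> + real M *\<^sub>R \<mu>) = local_part p \<nu>" if "\<nu> \<in> \<Lambda>" "\<mu> \<in> \<Lambda>" for \<nu> \<mu>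
  proof -
    have *: "e (\<nu> + real M *\<^sub>R \<mu>) = e \<nu>" if e: "e \<in> ?K" for e
    proof -
      have "M = m e * (\<Prod>e\<in>?K - {e}. m e)" unfolding M_def using e by (intro prod.remove) auto
      then have "real M *\<^sub>R \<mu> = real (m e) *\<^sub>R (real (\<Prod>e\<in>?K - {e}. m e) *\<^sub>R \<mu>)" by simp
      then have "e (real M *\<^sub>R \<mu>) = 1"
        using m(2)[OF e] lattice_scale[OF \<open>\<mu> \<in> \<Lambda>\<close>] by (metis Ints_of_nat)
      moreover have "e (\<nu> + real M *\<^sub>R \<mu>) = e \<nu> * e (real M *\<^sub>R \<mu>)"
        using e K \<open>\<nu> \<in> \<Lambda>\<close> lattice_scale[OF \<open>\<mu> \<in> \<Lambda>\<close>, of "real M"]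
        by (auto simp: toric_vertices_def torus_def)
      ultimately show ?thesis by simp
    qed
    show ?thesis
      unfolding local_part_def by (intro sum.cong refl arg_cong2[of _ _ _ _
          "(*)"] arg_cong[of _ _ const] *)
  qed
  ultimately show thesis by (rule that)
qed

end

section \<open>The list as a pointed family, and its spline as a density\<close>

locale spline_setting = based_lattice \<Lambda> b for \<Lambda> :: "'a::euclidean_space set" and b ::
    "'n::finite \<Rightarrow> 'a" +
  fixes X :: "'a list"
  assumes X_lattice: "set X \<subseteq> \<Lambda>" and X_span: "span (set X) = UNIV" and X_pointed:
      "0 \<notin> convex hull (set X)"
begin

definition dir :: 'a where
  "dir = (SOME s. \<forall>j<length X. 0 < s \<bullet> X ! j)"

lemma dir: "j < length X \<Longrightarrow> 0 < dir \<bullet> X ! j"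
proof -
  have "\<exists>s. \<forall>j<length X. 0 < s \<bullet> X ! j"
  proof -
    have "closed (convex hull (set X))"
      by (intro compact_imp_closed compact_convex_hull finite_imp_compact) auto
    then obtain s r where s: "0 < r" "\<And>v. v \<in> convex hull (set X) \<Longrightarrow> s \<bullet> v > r"
      using separating_hyperplane_closed_0[OF convex_convex_hull _ X_pointed] by blast
    have "0 < s \<bullet> X ! j" if "j < length X" for j
      using s(1) s(2)[OF hull_inc[of "X ! j"]] that by force
    then show ?thesis by blast
  qed
  then have "\<forall>j<length X. 0 < dir \<bullet> X ! j" unfolding dir_def by (rule someI_ex)
  then show "j < length X \<Longrightarrow> 0 < dir \<bullet> X ! j" by blast
qed

lemma image_nth_lessThan: "(!) X ` {..<length X} = set X"
  by (metis atLeast_upt list.set_map map_nth)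

sublocale pointed_family "(!) X" "{..<length X}" dir
  by unfold_locales (auto simp: dir)

sublocale pointed_list "(!) X" "length X" dir
  by unfold_locales (auto simp: spans_def image_nth_lessThan X_span)

abbreviation A :: "nat set" where "A \<equiv> {..<length X}"

lemma hyperplanes_eq: "hyperplanes X = hyps A"
proof -
  have "(\<exists>Y\<subseteq>set X. H = span Y) \<longleftrightarrow> (\<exists>K\<subseteq>A. H = span ((!) X ` K))" for H
  proof
    assume "\<exists>Y\<subseteq>set X. H = span Y"
    then obtain Y where Y: "Y \<subseteq> (!) X ` A" "H = span Y" unfolding image_nth_lessThan by blast
    then obtain K where "K \<subseteq> A" "Y = (!) X ` K" by (meson subset_image_iff)
    with Y show "\<exists>K\<subseteq>A. H = span ((!) X ` K)" by blast
  next
    assume "\<exists>K\<subseteq>A. H = span ((!) X ` K)"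
    then obtain K where K: "K \<subseteq> A" "H = span ((!) X ` K)" by blast
    have "(!) X ` K \<subseteq> set X" unfolding image_nth_lessThan[symmetric] using K(1)
        by (rule image_mono)
    with K(2) show "\<exists>Y\<subseteq>set X. H = span Y" by blast
  qed
  then show ?thesis by (simp add: hyperplanes_def hyps_def)
qed

text \<open>The quadratic form of \<open>gram b X\<close> at \<open>v\<close> is a sum of squares,
  the values on the \<open>X ! j\<close> of the functional with components \<open>v\<close>; since
  \<open>X\<close> spans, the kernel is trivial.\<close>

lemma det_gram: "det (gram b X) \<noteq> 0"
proof -
  have "v = 0" if v: "gram b X *v v = 0" for v
  proof -
    define s where "s j = (\<Sum>i\<in>UNIV. coord b (X ! j) i * v $ i)" for j
    have "(\<Sum>j<length X. (s j)\<^sup>2) = (\<Sum>i\<in>UNIV. v $ i * (gram b X *v v) $ i)"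
    proof -
      have "(\<Sum>i\<in>UNIV. v $ i * (gram b X *v v) $ i) =
          (\<Sum>i\<in>UNIV. \<Sum>k\<in>UNIV. \<Sum>j<length X. (coord b (X ! j) i * v $ i) * (coord b (X ! j) k *
              v $ k))"
        by (simp add: gram_def matrix_vector_mult_def sum_distrib_left sum_distrib_right mult_ac)
      also have "\<dots> = (\<Sum>i\<in>UNIV. \<Sum>j<length X. \<Sum>k\<in>UNIV. (coord b (X ! j) i * v $ i) *
          (coord b (X ! j) k * v $ k))"
        by (intro sum.cong refl sum.swap)
      also have "\<dots> = (\<Sum>j<length X. \<Sum>i\<in>UNIV. \<Sum>k\<in>UNIV. (coord b (X ! j) i * v $ i) *
          (coord b (X ! j) k * v $ k))"
        by (rule sum.swap)
      finally show ?thesis by (simp add: s_def power2_eq_square sum_product)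
    qed
    then have "(\<Sum>j<length X. (s j)\<^sup>2) = 0" using v by simp
    then have s0: "s j = 0" if "j < length X" for j
      using that by (subst (asm) sum_nonneg_eq_0_iff) auto
    define \<eta> where "\<eta> u = (\<Sum>i\<in>UNIV. coord b u i * v $ i)" for u
    have lin: "linear \<eta>"
      by (rule linearI) (simp_all add: \<eta>_def coord_add coord_scaleR algebra_simps sum.distrib
          sum_distrib_left)
    have "\<eta> u = 0" if "u \<in> set X" for u
      using s0 that by (auto simp: \<eta>_def s_def in_set_conv_nth)
    then have "\<eta> u = 0" for u
      using linear_eq_0_on_span[OF lin, of "set X" u] X_span by blast
    moreover have "\<eta> (b i) = v $ i" for i
      by (simp add: \<eta>_def coord_basis if_distrib[of "\<lambda>c. c * _"] cong: if_cong)
    ultimately show ?thesis by (simp add: vec_eq_iff)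
  qed
  then have "invertible (gram b X)"
    using matrix_left_invertible_ker invertible_left_inverse by blast
  then show ?thesis by (simp add: invertible_det_nz)
qed

text \<open>The value of \<open>\<kappa>\<close> is irrelevant, since continuity is unaffected by a
  nonzero factor. Equality on \<open>gen A\<close> is enough, as every alcove lies in that
  set.\<close>

lemma spline_eq_W:
  obtains \<kappa> where "\<kappa> \<noteq> 0" "\<And>u. u \<in> gen A \<Longrightarrow> spline b X u = \<kappa> * W A u"
proof -
  obtain \<kappa> where \<kappa>: "\<kappa> > 0" "\<And>u. u \<in> gen A \<Longrightarrow> affine_vol (length X) codim (fib u) = \<kappa> * W A u"
    using affine_vol_fib by blast
  show thesis
  proof (rule that[of "\<kappa> / sqrt (det (gram b X))"])
    show "\<kappa> / sqrt (det (gram b X)) \<noteq> 0" using \<kappa>(1) det_gram by simp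
    show "spline b X u = \<kappa> / sqrt (det (gram b X)) * W A u" if "u \<in> gen A" for u
      using \<kappa>(2)[OF that] by (simp add: spline_def fib_def codim_eq)
  qed
qed

definition plp :: "nat set \<Rightarrow> 'a \<Rightarrow> 'n cpoly" where
  "plp I u = (SOME f. \<forall>v. peval b f v = of_real (lp I u v))"

lemma peval_plp:
  assumes "spans I" "u \<in> gen I"
  shows "peval b (plp I u) v = of_real (lp I u v)"
proof -
  obtain f where "\<And>v. peval b f v = of_real (lp I u v)"
    using rpf_imp_peval[OF rpf_lp[OF assms]] by metis
  then have "\<exists>f. \<forall>v. peval b f v = of_real (lp I u v)" by blast
  from someI_ex[OF this] show ?thesis unfolding plp_def by blast
qed

text \<open>Complete a basis of \<open>H\<close> taken from \<open>X\<close> by one more vector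
  \<open>v\<close> of \<open>X\<close>; the coordinate along \<open>v\<close> vanishes on
  \<open>H\<close>, and \<open>M\<close> times it is integral on the lattice. Lattice translates of
  \<open>H\<close> thus become level sets at integers, which gives closedness of the walls and room
  near lattice points.\<close>

lemma hyps_integral_normal:
  assumes "H \<in> hyps A"
  obtains a where "a \<noteq> 0" "H = {u. a \<bullet> u = 0}" "\<And>\<mu>. \<mu> \<in> \<Lambda> \<Longrightarrow> a \<bullet> \<mu> \<in> \<int>"
proof -
  obtain K where K: "K \<subseteq> A" "H = span ((!) X ` K)" and dim: "dim H = DIM('a) - 1"
    using assms by (auto simp: hyps_def)
  obtain C where C: "C \<subseteq> (!) X ` K" "independent C" "(!) X ` K \<subseteq> span C"
    using maximal_independent_subset by blast
  have spC: "span C = H"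
    unfolding K(2) using C by (metis span_mono span_span subset_antisym)
  have "H \<noteq> UNIV" using dim DIM_positive[where 'a = 'a]
      by (metis dim_UNIV diff_less less_one nat_neq_iff)
  then obtain v where v: "v \<in> set X" "v \<notin> H"
    using X_span span_minimal[of "set X" H] K(2) by auto
  let ?B = "insert v C"
  have ind: "independent ?B" using C(2) v(2) spC by (simp add: independent_insert)
  have "dim ?B = dim C + 1" using v(2) spC by (simp add: dim_insert)
  also have "dim C = DIM('a) - 1" using spC dim by (metis dim_span)
  finally have "dim ?B = DIM('a)" using DIM_positive[where 'a = 'a] by simp
  then have sp: "span ?B = UNIV" by (simp add: dim_eq_full)
  have "(!) X ` K \<subseteq> set X" using K(1) image_nth_lessThan by blast
  then have "C \<subseteq> \<Lambda>" using C(1) X_lattice by (meson order_trans)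
  then have BL: "?B \<subseteq> \<Lambda>" using v(1) X_lattice by auto
  obtain M :: nat where M: "M > 0" "\<And>\<mu> v. \<mu> \<in> \<Lambda> \<Longrightarrow> v \<in> ?B \<Longrightarrow> real M * representation ?B \<mu> v \<in> \<int>"
    using lattice_exponent[OF BL ind sp] by blast
  define \<eta> where "\<eta> u = real M * representation ?B u v" for u
  have lin: "linear \<eta>"
    unfolding \<eta>_def by (rule linearI)
      (simp_all add: real_vector.representation_add[OF ind] real_vector.representation_scale[OF
          ind] sp algebra_simps)
  have "v \<notin> C" using v(2) spC span_base by auto
  have "\<eta> v = real M" by (simp add: \<eta>_def real_vector.representation_basis[OF ind])
  then have nz: "\<eta> \<noteq> (\<lambda>_. 0)" using M(1) by (metis of_nat_0_eq_iff less_irrefl)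
  have "\<eta> u = 0" if "u \<in> C" for u
    using that \<open>v \<notin> C\<close> by (auto simp: \<eta>_def real_vector.representation_basis[OF ind])
  then have zero: "\<eta> h = 0" if "h \<in> H" for h
    using linear_eq_0_on_span[OF lin, of C h] that spC by blast
  obtain a where a: "a \<noteq> 0" "H = {u. a \<bullet> u = 0}" "\<eta> = (\<bullet>) a"
    using hyperplane_kernel[OF subspace_hyps[OF assms] dim lin nz zero] by metis
  have "a \<bullet> \<mu> \<in> \<int>" if "\<mu> \<in> \<Lambda>" for \<mu>
    using M(2)[OF that, of v] fun_cong[OF a(3), of \<mu>] by (simp add: \<eta>_def)
  with a(1,2) show thesis by (rule that)
qed

section \<open>Walls, alcoves and the polynomial on an alcove\<close>

definition walls :: "'a set" where
  "walls = (\<Union>H\<in>hyperplanes X. \<Union>y\<in>\<Lambda>. (+) y ` H)"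

lemma in_translate: "u \<in> (+) y ` {v. a \<bullet> v = 0} \<longleftrightarrow> a \<bullet> u = a \<bullet> y"
proof
  assume "a \<bullet> u = a \<bullet> y"
  then show "u \<in> (+) y ` {v. a \<bullet> v = 0}"
    by (intro image_eqI[of _ _ "u - y"]) (auto simp: inner_diff_right)
qed (auto simp: inner_add_right)

lemma closed_walls: "closed walls"
  unfolding walls_def hyperplanes_eq
proof (rule closed_UN[OF finite_hyps[OF finite_lessThan]], rule ballI)
  fix H assume "H \<in> hyps A"
  then obtain a where a: "H = {u. a \<bullet> u = 0}" "\<And>\<mu>. \<mu> \<in> \<Lambda> \<Longrightarrow> a \<bullet> \<mu> \<in> \<int>"
    using hyps_integral_normal by metis
  have "(\<Union>y\<in>\<Lambda>. (+) y ` H) = (\<lambda>u. a \<bullet> u) -` ((\<bullet>) a ` \<Lambda>)"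
    unfolding a(1) by (rule set_eqI) (simp only: UN_iff vimage_eq in_translate
        image_iff[where f = "(\<bullet>) a"])
  moreover have "closed ((\<bullet>) a ` \<Lambda>)" by (rule closed_subset_Ints) (use a(2) in auto)
  ultimately show "closed (\<Union>y\<in>\<Lambda>. (+) y ` H)"
    by (simp add: closed_vimage continuous_on_inner)
qed

lemma alcoves_eq: "alcoves \<Lambda> X = components (- walls)"
  by (simp add: alcoves_def walls_def)

lemma walls_gen: "- walls \<subseteq> gen A"
proof -
  have "\<Union>(hyps A) \<subseteq> walls"
    unfolding walls_def hyperplanes_eq using lattice_0 by force
  then show ?thesis by (auto simp: gen_def)
qed

lemma alcove:
  assumes "C \<in> alcoves \<Lambda> X"
  shows "open C" "connected C" "C \<noteq> {}" "C \<subseteq> gen A"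
  using assms walls_gen closed_walls open_components[of "- walls" C]
  by (auto simp: alcoves_eq in_components_connected in_components_nonempty dest:
      in_components_subset)

lemma local_spline_eq:
  assumes \<kappa>: "\<And>u. u \<in> gen A \<Longrightarrow> spline b X u = \<kappa> * W A u"
    and C: "C \<in> alcoves \<Lambda> X" and u: "u \<in> C"
  shows "local_spline b X C = const (of_real \<kappa>) * plp A u"
proof -
  note C' = alcove[OF C]
  have eq: "peval b (const (of_real \<kappa>) * plp A u) v = of_real (spline b X v)" if "v \<in> C" for v
    using W_eq_lp[OF spans_all C'(2,4) u that] peval_plp[OF spans_all subsetD[OF C'(4) u], of v]
      \<kappa>[OF subsetD[OF C'(4) that]]
    by (simp add: peval_mult)
  show ?thesis
    unfolding local_spline_def
  proof (rule the_equality)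
    fix f assume f: "\<forall>v\<in>C. peval b f v = of_real (spline b X v)"
    show "f = const (of_real \<kappa>) * plp A u"
      by (rule peval_inj_open[OF C'(1,3)]) (use f eq in auto)
  qed (use eq in blast)
qed

text \<open>Along the start of the ray an integral normal of each hyperplane differs from its
  integer value at \<open>\<nu>\<close> by a nonzero amount less than \<open>1\<close>, so no
  translate is met and the connected piece of the ray lies in a single alcove.\<close>

lemma alcove_near:
  assumes \<nu>: "\<nu> \<in> \<Lambda>" and v: "v \<in> gen A"
  obtains r C where "r > 0" "C \<in> alcoves \<Lambda> X" "\<nu> \<in> closure C" "\<And>s. \<lbrakk>0 < s; s < r\<rbrakk> \<Longrightarrow>
      \<nu> + s *\<^sub>R v \<in> C"
proof -
  have "\<exists>r>0. \<forall>s. 0 < s \<longrightarrow> s < r \<longrightarrow> (\<forall>y\<in>\<Lambda>. \<nu> + s *\<^sub>R v \<notin> (+) y ` H)" if H: "H \<in> hyps A" for H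
  proof -
    obtain a where a: "H = {u. a \<bullet> u = 0}" "\<And>\<mu>. \<mu> \<in> \<Lambda> \<Longrightarrow> a \<bullet> \<mu> \<in> \<int>"
      using hyps_integral_normal[OF H] by metis
    have av: "a \<bullet> v \<noteq> 0" using v H a(1) by (auto simp: gen_def)
    show ?thesis
    proof (intro exI[of _ "1 / \<bar>a \<bullet> v\<bar>"] conjI allI impI ballI notI)
      fix s y assume s: "0 < s" "s < 1 / \<bar>a \<bullet> v\<bar>" and y: "y \<in> \<Lambda>" "\<nu> + s *\<^sub>R v \<in> (+) y ` H"
      have "s * (a \<bullet> v) = a \<bullet> y - a \<bullet> \<nu>"
        using y(2) by (simp add: a(1) in_translate inner_add_right)
      then have "s * (a \<bullet> v) \<in> \<int>" using a(2)[OF y(1)] a(2)[OF \<nu>] by simp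
      moreover have "\<bar>s * (a \<bullet> v)\<bar> < 1" using s av by (simp add: abs_mult field_simps)
      ultimately have "s * (a \<bullet> v) = 0" using Ints_nonzero_abs_less1 by blast
      then show False using s av by simp
    qed (use av in simp)
  qed
  from bchoice[OF ballI[OF this]] obtain r where
    r: "\<forall>H\<in>hyps A. r H > 0 \<and> (\<forall>s. 0 < s \<longrightarrow> s < r H \<longrightarrow> (\<forall>y\<in>\<Lambda>. \<nu> + s *\<^sub>R v \<notin> (+) y ` H))"
    by (rule exE)
  define r0 where "r0 = Min (insert 1 (r ` hyps A))"
  have fin: "finite (hyps A)" by (rule finite_hyps) simp
  have r0: "r0 > 0" using fin r by (simp add: r0_def)
  have r0_le: "r0 \<le> r H" if "H \<in> hyps A" for H
    unfolding r0_def using fin that by (intro Min_le) auto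
  have free: "\<nu> + s *\<^sub>R v \<in> - walls" if "0 < s" "s < r0" for s
    using r r0_le that unfolding walls_def hyperplanes_eq by force
  define S where "S = (\<lambda>s. \<nu> + s *\<^sub>R v) ` {0<..<r0}"
  have "connected S"
    unfolding S_def by (intro connected_continuous_image continuous_intros) auto
  moreover have "S \<subseteq> - walls" unfolding S_def using free by auto
  moreover have "S \<noteq> {}" unfolding S_def using r0 by auto
  ultimately obtain C where C: "C \<in> components (- walls)" "S \<subseteq> C"
    using exists_component_superset[of S "- walls"] r0 by (metis subset_empty)
  have mem: "\<nu> + s *\<^sub>R v \<in> C" if "0 < s" "s < r0" for s
    using that by (intro subsetD[OF C(2)]) (auto simp: S_def)
  have lim: "((\<lambda>s. \<nu> + s *\<^sub>R v) \<longlongrightarrow> \<nu> + 0 *\<^sub>R v) (at_right 0)" by (intro tendsto_intros)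
  have "\<forall>\<^sub>F s in at_right 0. \<nu> + s *\<^sub>R v \<in> closure C"
    using r0 mem closure_subset[of C] by (auto simp: eventually_at_right_field intro!:
        exI[of _ r0])
  from Lim_in_closed_set[OF closed_closure this trivial_limit_at_right_real lim]
  have "\<nu> \<in> closure C" by simp
  with r0 C(1) mem show thesis
    by (intro that[of r0 C]) (auto simp: alcoves_eq)
qed

end

section \<open>Crossing the walls near a lattice point\<close>

lemma avoid_subspaces:
  fixes S :: "'a::euclidean_space set"
  assumes "finite T" "\<And>V. V \<in> T \<Longrightarrow> dim V < DIM('a)" "open S" "S \<noteq> {}"
  obtains u where "u \<in> S" "\<And>V. V \<in> T \<Longrightarrow> u \<notin> V"
proof -
  have "negligible (\<Union>T)" using assms(1,2) by (intro negligible_Union) (auto intro: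
      negligible_lowdim)
  moreover have "\<not> negligible S" using assms(3,4) by (rule open_not_negligible)
  ultimately have "\<not> S \<subseteq> \<Union>T" using negligible_subset by blast
  then show thesis using that by blast
qed

context spline_setting
begin

lemma plp_cong: "lp I u = lp I v \<Longrightarrow> plp I u = plp I v"
  by (simp add: plp_def)

lemma dim_hyps: "H \<in> hyps I \<Longrightarrow> dim H < DIM('a)"
  using DIM_positive[where 'a = 'a] by (auto simp: hyps_def)

lemma gen_dense:
  assumes "open S" "S \<noteq> {}"
  obtains u where "u \<in> S" "u \<in> gen A"
proof -
  obtain u where "u \<in> S" "\<And>V. V \<in> hyps A \<Longrightarrow> u \<notin> V"
    by (rule avoid_subspaces[of "hyps A" S]) (use assms dim_hyps finite_hyps in auto)
  then show thesis using that by (auto simp: gen_def)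
qed

lemma avoid_hyps:
  assumes "w \<in> S" "open S" "T \<subseteq> hyps A" "\<And>H. H \<in> T \<Longrightarrow> w \<notin> H"
  obtains r where "r > 0" "ball w r \<subseteq> S" "\<And>H. H \<in> T \<Longrightarrow> ball w r \<inter> H = {}"
proof -
  have "finite T" using assms(3) finite_hyps[OF finite_lessThan] by (rule finite_subset)
  then have "open (S - \<Union>T)"
    using assms subspace_hyps by (intro open_Diff closed_Union) (auto intro!: closed_subspace)
  moreover have "w \<in> S - \<Union>T" using assms by auto
  ultimately obtain r where "r > 0" "ball w r \<subseteq> S - \<Union>T" by (meson open_contains_ball)
  then show thesis by (intro that[of r]) auto
qed

lemma mult_off_eq: "mult_off X H = card {i \<in> A. X ! i \<notin> H}"
  by (simp add: mult_off_def)

lemma linear_inner_left': "linear ((\<bullet>) a)"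
  by (simp add: bounded_linear.linear bounded_linear_inner_right)

lemma plp_jump:
  assumes H: "H \<in> hyps A" "a \<noteq> 0" "H = {u. a \<bullet> u = 0}" and w: "w \<in> H" "r > 0"
    and g: "ball w r - H \<subseteq> gen A"
    and u: "u \<in> ball w r" "a \<bullet> u > 0" and v: "v \<in> ball w r" "a \<bullet> v < 0"
  obtains g where "plp A u - plp A v = functional_poly b ((\<bullet>) a) ^ (mult_off X H - 1) * g"
proof -
  have aw: "a \<bullet> w = 0" using w H by auto
  have side: "W A y = lp A z y"
    if "z \<in> ball w r" "y \<in> ball w r" "e * (a \<bullet> z) > 0" "e * (a \<bullet> y) > 0" "e \<noteq> 0" for y z e
  proof (rule W_eq_lp[OF spans_all])
    show "connected {u \<in> ball w r. e * (a \<bullet> u) > 0}"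
      by (rule convex_connected[OF half_ball(1)[OF H(2) aw w(2) \<open>e \<noteq> 0\<close>]])
    show "{u \<in> ball w r. e * (a \<bullet> u) > 0} \<subseteq> gen A" using g H(3) by auto
  qed (use that in auto)
  have gen: "u \<in> gen A" "v \<in> gen A" using g u v H(3) by auto
  have "\<exists>g. real_polynomial_function g \<and>
      (\<forall>y. lp A u y - lp A v y = (a \<bullet> y) ^ (card {i \<in> A. X ! i \<notin> H} - 1) * g y)"
  proof (rule jump_divisible[OF spans_all H w g])
    show "real_polynomial_function (lp A u)" "real_polynomial_function (lp A v)"
      using gen by (auto intro: rpf_lp spans_all)
    show "W A y = lp A u y" if "y \<in> ball w r" "a \<bullet> y > 0" for y
      using side[of u y 1] that u by simp
    show "W A y = lp A v y" if "y \<in> ball w r" "a \<bullet> y < 0" for y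
      using side[of v y "-1"] that v by simp
  qed
  then obtain g where g: "real_polynomial_function g"
    "\<And>y. lp A u y - lp A v y = (a \<bullet> y) ^ (mult_off X H - 1) * g y"
    unfolding mult_off_eq by blast
  obtain f where f: "\<And>y. peval b f y = of_real (g y)" using rpf_imp_peval[OF g(1)] by metis
  have "plp A u - plp A v = functional_poly b ((\<bullet>) a) ^ (mult_off X H - 1) * f"
  proof (rule peval_inj_open[of UNIV])
    fix y
    show "peval b (plp A u - plp A v) y = peval b (functional_poly b ((\<bullet>) a) ^ (mult_off X H -
        1) * f) y"
      using g(2)[of y] peval_plp[OF spans_all gen(1), of y] peval_plp[OF spans_all gen(2), of y]
      by (simp add: peval_diff peval_mult peval_power peval_functional_poly[OF
          linear_inner_left'] f flip: of_real_diff)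
  qed auto
  then show thesis by (rule that)
qed

text \<open>\<open>u\<close> only selects the component of \<open>gen A\<close>, hence the
  polynomial; the evaluation is at \<open>\<nu>\<close>, wherever \<open>u\<close> lies.\<close>

definition val :: "'n cpoly \<Rightarrow> 'a \<Rightarrow> 'a \<Rightarrow> complex" where
  "val q \<nu> u = peval b (diff_op q (plp A u)) \<nu>"

text \<open>At most one wall passes through \<open>w\<close>, and it contains \<open>\<nu>\<close>.
  Across it the local polynomial changes by a multiple of the power of the normal form that matches
  \<open>cond\<close>, and by adjunction the operator does not see this change at
  \<open>\<nu>\<close>.\<close>

lemma val_local:
  assumes cond: "\<And>H a. \<lbrakk>H \<in> hyps A; \<nu> \<in> H; a \<noteq> 0; H = {u. a \<bullet> u = 0}\<rbrakk> \<Longrightarrow>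
      (dir_deriv b ((\<bullet>) a) ^^ (mult_off X H - 1)) q = 0"
    and w: "\<And>H. H \<in> hyps A \<Longrightarrow> w \<in> H \<Longrightarrow> \<nu> \<in> H"
      "\<And>H H'. \<lbrakk>H \<in> hyps A; H' \<in> hyps A; w \<in> H; w \<in> H'\<rbrakk> \<Longrightarrow> H = H'"
  shows "\<exists>c. \<forall>\<^sub>F u in nhds w. u \<in> gen A \<longrightarrow> val q \<nu> u = c"
proof (cases "w \<in> gen A")
  case True
  obtain r where r: "r > 0" "ball w r \<subseteq> gen A"
    using True open_gen[OF finite_lessThan] by (meson open_contains_ball)
  have "val q \<nu> u = val q \<nu> w" if "u \<in> ball w r" for u
    using plp_cong[OF lp_connected[OF spans_all _ r(2), of u w]] that r(1) by (simp add: val_def)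
  moreover have "\<forall>\<^sub>F u in nhds w. u \<in> ball w r" using r(1) by (intro eventually_nhds_in_open) auto
  ultimately show ?thesis by (intro exI[of _ "val q \<nu> w"]) (auto elim: eventually_mono)
next
  case False
  then obtain H where H: "H \<in> hyps A" "w \<in> H" by (auto simp: gen_def)
  obtain a where a: "a \<noteq> 0" "H = {u. a \<bullet> u = 0}" using hyps_normal[OF H(1)] by metis
  obtain r where r: "r > 0" "\<And>H'. H' \<in> hyps A - {H} \<Longrightarrow> ball w r \<inter> H' = {}"
    by (rule avoid_hyps[of w UNIV "hyps A - {H}"]) (use w(2) H in auto)
  have g: "ball w r - H \<subseteq> gen A" using r(2) by (auto simp: gen_def)
  have aw: "a \<bullet> w = 0" and a\<nu>: "a \<bullet> \<nu> = 0" using H w(1) a by auto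
  have opp: "val q \<nu> u = val q \<nu> v" if u: "u \<in> ball w r" "a \<bullet> u > 0" and v: "v \<in> ball w r"
      "a \<bullet> v < 0" for u v
  proof -
    obtain g where *: "plp A u - plp A v = functional_poly b ((\<bullet>) a) ^ (mult_off X H - 1) * g"
      using plp_jump[OF H(1) a H(2) r(1) g u v] by blast
    have "val q \<nu> u - val q \<nu> v = peval b (diff_op q (plp A u - plp A v)) \<nu>"
      by (simp add: val_def diff_op_diff_right peval_diff)
    also have "\<dots> = peval b (diff_op ((dir_deriv b ((\<bullet>) a) ^^ (mult_off X H - 1)) q) g) \<nu>"
      unfolding * by (rule peval_diff_op_functional_power[OF linear_inner_left' a\<nu>])
    also have "\<dots> = 0" by (simp only: cond[OF H(1) w(1)[OF H] a] diff_op_0_left peval_0)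
    finally show ?thesis by simp
  qed
  obtain v0 where v0: "v0 \<in> ball w r" "a \<bullet> v0 < 0"
    using half_ball(3)[OF a(1) aw r(1), of "-1"] by auto
  obtain u0 where u0: "u0 \<in> ball w r" "a \<bullet> u0 > 0"
    using half_ball(3)[OF a(1) aw r(1), of 1] by auto
  have "val q \<nu> u = val q \<nu> u0" if "u \<in> ball w r" "u \<in> gen A" for u
  proof -
    have "a \<bullet> u \<noteq> 0" using that H a by (auto simp: gen_def)
    then show ?thesis using opp[OF _ _ v0, of u] opp[OF _ _ v0, of u0] opp[OF u0, of u] u0 that
        by force
  qed
  moreover have "\<forall>\<^sub>F u in nhds w. u \<in> ball w r" using r(1) by (intro eventually_nhds_in_open) auto
  ultimately show ?thesis by (intro exI[of _ "val q \<nu> u0"]) (auto elim: eventually_mono)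
qed

text \<open>Two generic points near \<open>\<nu>\<close> are connected by a segment that meets the walls one at a
  time.\<close>

lemma val_const_near:
  assumes cond: "\<And>H a. \<lbrakk>H \<in> hyps A; \<nu> \<in> H; a \<noteq> 0; H = {u. a \<bullet> u = 0}\<rbrakk> \<Longrightarrow>
      (dir_deriv b ((\<bullet>) a) ^^ (mult_off X H - 1)) q = 0"
  obtains \<rho> c where "\<rho> > 0" "\<And>u. \<lbrakk>u \<in> ball \<nu> \<rho>; u \<in> gen A\<rbrakk> \<Longrightarrow> val q \<nu> u = c"
proof -
  \<comment> \<open>Every wall that meets the ball passes through \<open>\<nu>\<close>, so
    \<open>cond\<close> covers it.\<close>
  obtain \<rho> where \<rho>: "\<rho> > 0" "\<And>H. H \<in> hyps A \<Longrightarrow> \<nu> \<notin> H \<Longrightarrow> ball \<nu> \<rho> \<inter> H = {}"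
    by (rule avoid_hyps[of \<nu> UNIV "{H \<in> hyps A. \<nu> \<notin> H}"]) auto
  have eq: "val q \<nu> u1 = val q \<nu> u2" if u1: "u1 \<in> ball \<nu> \<rho>" "u1 \<in> gen A" and u2: "u2 \<in> ball \<nu> \<rho>"
      "u2 \<in> gen A" for u1 u2
  proof -
    have "open (ball \<nu> \<rho> \<inter> gen A)" by (intro open_Int open_ball open_gen finite_lessThan)
    moreover have "u2 \<in> ball \<nu> \<rho> \<inter> gen A" using u2 by simp
    ultimately obtain r where r: "r > 0" "ball u2 r \<subseteq> ball \<nu> \<rho> \<inter> gen A"
      by (rule openE)
    \<comment> \<open>The span of \<open>u1\<close> and the intersection of two different walls is a
      proper subspace. If \<open>v\<close> avoids all of these, the segment from \<open>u1\<close>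
      to \<open>v\<close> never meets two walls at once; \<open>v\<close> is taken in a ball around
      \<open>u2\<close> that meets no wall.\<close>
    define T where "T = (\<lambda>(H, H'). span (insert u1 (H \<inter> H'))) ` {(H, H'). H \<in> hyps A \<and>
        H' \<in> hyps A \<and> H \<noteq> H'}"
    have "finite T"
      unfolding T_def
      by (intro finite_imageI finite_subset[OF _ finite_cartesian_product[OF finite_hyps
          finite_hyps], of _ A A]) auto
    moreover have "dim V < DIM('a)" if V: "V \<in> T" for V
    proof -
      obtain H H' where H: "H \<in> hyps A" "H' \<in> hyps A" "H \<noteq> H'" "V = span (insert u1 (H \<inter> H'))"
      proof -
        from V obtain P where P: "V = (case P of (H, H') \<Rightarrow> span (insert u1 (H \<inter> H')))"
          "P \<in> {(H, H'). H \<in> hyps A \<and> H' \<in> hyps A \<and> H \<noteq> H'}"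
          unfolding T_def by (rule imageE)
        then show thesis by (cases P) (use that in auto)
      qed
      have "dim (H \<inter> H') \<noteq> DIM('a) - 1"
      proof
        assume *: "dim (H \<inter> H') = DIM('a) - 1"
        have sub: "subspace (H \<inter> H')" using H subspace_hyps by (intro subspace_inter) auto
        have "H \<inter> H' = H" "H \<inter> H' = H'"
          using H * by (intro subspace_dim_equal sub subspace_hyps; force simp: hyps_def)+
        with H(3) show False by simp
      qed
      moreover have "dim (H \<inter> H') \<le> DIM('a) - 1" using H(1) dim_subset[of "H \<inter> H'" H]
          by (auto simp: hyps_def)
      ultimately show ?thesis unfolding H(4) dim_span dim_insert by auto
    qed
    ultimately obtain v where v: "v \<in> ball u2 r" "\<And>V. V \<in> T \<Longrightarrow> v \<notin> V"
      by (rule avoid_subspaces[of T "ball u2 r"]) (use r(1) in auto)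
    have v_gen: "v \<in> ball \<nu> \<rho>" "v \<in> gen A" using v(1) r(2) by auto
    have "val q \<nu> v = val q \<nu> u2"
      using plp_cong[OF lp_connected[OF spans_all connected_ball, of u2 r v u2]] r v(1)
          by (auto simp: val_def)
    moreover have "val q \<nu> u1 = val q \<nu> v"
    proof -
      let ?S = "closed_segment u1 v"
      have S_ball: "?S \<subseteq> ball \<nu> \<rho>" by (rule closed_segment_subset[OF u1(1) v_gen(1) convex_ball])
      have single: "H = H'" if H: "H \<in> hyps A" "H' \<in> hyps A" "w \<in> H" "w \<in> H'" and w: "w \<in> ?S"
          for w H H'
      proof (rule ccontr)
        assume "H \<noteq> H'"
        obtain t where t: "0 \<le> t" "t \<le> 1" "w = (1 - t) *\<^sub>R u1 + t *\<^sub>R v" using w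
            by (auto simp: in_segment)
        have "t \<noteq> 0" using t(3) H u1(2) by (auto simp: gen_def)
        then have "v = (1 / t) *\<^sub>R (w - (1 - t) *\<^sub>R u1)" using t(3) by simp
        also have "\<dots> \<in> span (insert u1 (H \<inter> H'))"
          using H by (intro span_scale span_diff span_base) auto
        finally show False using v(2) H \<open>H \<noteq> H'\<close> by (auto simp: T_def)
      qed
      \<comment> \<open>The common value at generic points near \<open>w\<close>, unique since
        generic points are dense; it is locally constant along the segment.\<close>
      define c where "c w = (SOME c. \<forall>\<^sub>F u in nhds w. u \<in> gen A \<longrightarrow> val q \<nu> u = c)" for w
      have c: "\<forall>\<^sub>F u in nhds w. u \<in> gen A \<longrightarrow> val q \<nu> u = c w" if "w \<in> ?S" for w
      proof -
        have "\<exists>c. \<forall>\<^sub>F u in nhds w. u \<in> gen A \<longrightarrow> val q \<nu> u = c"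
        proof (rule val_local[OF cond])
          show "\<nu> \<in> H" if "H \<in> hyps A" "w \<in> H" for H using \<rho>(2)[of H] that S_ball \<open>w \<in> ?S\<close>
              by blast
          show "H = H'" if "H \<in> hyps A" "H' \<in> hyps A" "w \<in> H" "w \<in> H'" for H H'
            using single that \<open>w \<in> ?S\<close> by blast
        qed
        from someI_ex[OF this] show ?thesis unfolding c_def .
      qed
      have c_eq: "c w = d" if "w \<in> ?S" "\<forall>\<^sub>F u in nhds w. u \<in> gen A \<longrightarrow> val q \<nu> u = d" for w d
      proof -
        have "\<forall>\<^sub>F u in nhds w. u \<in> gen A \<longrightarrow> d = c w"
          using c[OF that(1)] that(2) by eventually_elim auto
        then obtain T where T: "open T" "w \<in> T" "\<forall>u\<in>T. u \<in> gen A \<longrightarrow> d = c w"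
          unfolding eventually_nhds by blast
        obtain u where "u \<in> T" "u \<in> gen A" by (rule gen_dense[of T]) (use T in auto)
        with T(3) show ?thesis by auto
      qed
      have "c u1 = c v"
      proof (rule connected_local_const[of ?S], rule connected_segment; (simp; fail)?)
        show "\<forall>w\<in>?S. \<forall>\<^sub>F w' in at w within ?S. c w = c w'"
        proof
          fix w assume w: "w \<in> ?S"
          obtain T where T: "open T" "w \<in> T" "\<forall>u\<in>T. u \<in> gen A \<longrightarrow> val q \<nu> u = c w"
            using c[OF w] unfolding eventually_nhds by blast
          have "c w = c w'" if "w' \<in> ?S" "w' \<in> T" for w'
          proof -
            have "\<forall>\<^sub>F u in nhds w'. u \<in> gen A \<longrightarrow> val q \<nu> u = c w"
              unfolding eventually_nhds using T that(2) by blast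
            from c_eq[OF that(1) this] show ?thesis by simp
          qed
          then show "\<forall>\<^sub>F w' in at w within ?S. c w = c w'"
            using T(1,2) by (auto simp: eventually_at_topological)
        qed
      qed
      moreover have "c u1 = val q \<nu> u1" "c v = val q \<nu> v"
        using eventually_nhds_x_imp_x[OF c[of u1]] eventually_nhds_x_imp_x[OF c[of v]] u1(2)
            v_gen(2) by auto
      ultimately show ?thesis by simp
    qed
    ultimately show ?thesis by simp
  qed
  show thesis
  proof (cases "\<exists>u0. u0 \<in> ball \<nu> \<rho> \<and> u0 \<in> gen A")
    case True
    then obtain u0 where "u0 \<in> ball \<nu> \<rho>" "u0 \<in> gen A" by blast
    then show ?thesis using that[OF \<rho>(1), of "val q \<nu> u0"] eq by blast
  next
    case False
    then show ?thesis using that[OF \<rho>(1), of 0] by blast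
  qed
qed

text \<open>An alcove with \<open>\<nu>\<close> in its closure meets the ball from
  \<open>val_const_near\<close>, and any of its points there selects the polynomial of the
  alcove.\<close>

lemma internal_imp_continuous:
  assumes p: "p \<in> internal_periodic_P \<Lambda> b X" and \<nu>: "\<nu> \<in> \<Lambda>"
  shows "spline_continuous_at \<Lambda> b X p \<nu>"
proof -
  obtain \<kappa> where \<kappa>: "\<kappa> \<noteq> 0" "\<And>u. u \<in> gen A \<Longrightarrow> spline b X u = \<kappa> * W A u"
    using spline_eq_W by blast
  let ?q = "local_part p \<nu>"
  have "(dir_deriv b ((\<bullet>) a) ^^ (mult_off X H - 1)) ?q = 0"
    if "H \<in> hyps A" "\<nu> \<in> H" "a \<noteq> 0" "H = {u. a \<bullet> u = 0}" for H a
  proof -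
    have "(\<bullet>) a \<noteq> (\<lambda>_. 0)" using that(3) by (metis inner_eq_zero_iff)
    moreover have "\<forall>h\<in>H. a \<bullet> h = 0" using that(4) by simp
    ultimately show ?thesis
      using p that(1,2) \<nu> linear_inner_left'[of a]
      unfolding internal_periodic_P_def hyperplanes_eq by (simp del: dir_deriv_pow_0)
  qed
  from val_const_near[OF this] obtain \<rho> c where \<rho>: "\<rho> > 0"
    "\<And>u. \<lbrakk>u \<in> ball \<nu> \<rho>; u \<in> gen A\<rbrakk> \<Longrightarrow> val ?q \<nu> u = c" by blast
  show ?thesis
    unfolding spline_continuous_at_def
  proof (intro exI[of _ "of_real \<kappa> * c"] ballI impI)
    fix C assume C: "C \<in> alcoves \<Lambda> X" "\<nu> \<in> closure C"
    have "\<nu> \<in> ball \<nu> \<rho>" using \<rho>(1) by simp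
    then have "ball \<nu> \<rho> \<inter> closure C \<noteq> {}" using C(2) by blast
    then have "ball \<nu> \<rho> \<inter> C \<noteq> {}" by (simp add: open_Int_closure_eq_empty)
    then obtain u where u: "u \<in> ball \<nu> \<rho>" "u \<in> C" by blast
    have "u \<in> gen A" using alcove(4)[OF C(1)] u by auto
    then show "peval b (diff_op ?q (local_spline b X C)) \<nu> = of_real \<kappa> * c"
      using \<rho>(2)[OF u(1)]
      by (simp add: local_spline_eq[OF \<kappa>(2) C(1) u(2)] diff_op_const_mult_right peval_mult
          val_def)
  qed
qed

end

section \<open>Jumps across a single wall\<close>

context based_lattice
begin

lemma peval_line_zero:
  assumes "infinite {t. peval b f (u + t *\<^sub>R x) = 0}"
  shows "peval b f (u + t *\<^sub>R x) = 0"
proof -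
  have "infinite {t. Re (peval b f (u + t *\<^sub>R x)) = 0}"
      "infinite {t. Im (peval b f (u + t *\<^sub>R x)) = 0}"
    by (rule infinite_super[OF _ assms]; auto)+
  then have "Re (peval b f (u + t *\<^sub>R x)) = 0" "Im (peval b f (u + t *\<^sub>R x)) = 0"
    using rpf_line_zero[OF conjunct1[OF rpf_peval_Re[of f]], of u x t]
      rpf_line_zero[OF conjunct2[OF rpf_peval_Re[of f]], of u x t] by blast+
  then show ?thesis by (simp add: complex_eq_iff)
qed

lemma peval_line_zero_ball:
  assumes "\<epsilon> > 0" "\<And>t. \<lbrakk>0 < t; t < \<epsilon>\<rbrakk> \<Longrightarrow> peval b f (u + t *\<^sub>R x) = 0"
  shows "peval b f (u + t *\<^sub>R x) = 0"
proof (rule peval_line_zero)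
  have "{0<..<\<epsilon>} \<subseteq> {t. peval b f (u + t *\<^sub>R x) = 0}" using assms(2) by auto
  then show "infinite {t. peval b f (u + t *\<^sub>R x) = 0}"
    using infinite_Ioo[OF assms(1)] by (rule infinite_super)
qed

lemma isCont_peval: "isCont (peval b f) u"
proof -
  have "isCont (\<lambda>u. Re (peval b f u)) u" "isCont (\<lambda>u. Im (peval b f u)) u"
    using rpf_continuous[OF conjunct1[OF rpf_peval_Re[of f]], of UNIV]
      rpf_continuous[OF conjunct2[OF rpf_peval_Re[of f]], of UNIV]
    by (simp_all add: continuous_on_eq_continuous_at)
  then have "isCont (\<lambda>u. Complex (Re (peval b f u)) (Im (peval b f u))) u"
    unfolding isCont_def by (rule tendsto_Complex)
  then show ?thesis by simp
qed

text \<open>Elements of \<open>Sym U\<close> are functions on \<open>V\<close>, whereas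
  \<open>peval\<close> takes points of \<open>U\<close>. The functional given by inner product with
  \<open>\<tau>\<close> is therefore encoded as the point with coordinates
  \<open>\<tau> \<bullet> b i\<close>.\<close>

lemma peval_lin_form_dual:
  "peval b (lin_form b x) (\<Sum>i\<in>UNIV. (\<tau> \<bullet> b i) *\<^sub>R b i) = of_real (\<tau> \<bullet> x)"
proof -
  have "\<tau> \<bullet> x = (\<Sum>i\<in>UNIV. coord b x i * (\<tau> \<bullet> b i))"
    by (subst basis_expansion[of x, symmetric]) (simp add: inner_sum_right)
  then show ?thesis
    by (simp add: lin_form_def peval_sum peval_mult coord_sum_basis)
qed

lemma dual_surj:
  obtains \<tau> where "u = (\<Sum>i\<in>UNIV. (\<tau> \<bullet> b i) *\<^sub>R b i)"
proof -
  define L where "L \<tau> = (\<Sum>i\<in>UNIV. (\<tau> \<bullet> b i) *\<^sub>R b i)" for \<tau>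
  have lin: "linear L"
    by (rule linearI) (simp_all add: L_def inner_add_left scaleR_add_left sum.distrib
        scaleR_sum_right)
  have "\<tau> = 0" if "L \<tau> = 0" for \<tau>
  proof -
    have "\<tau> \<bullet> b i = coord b (L \<tau>) i" for i by (simp add: L_def coord_sum_basis)
    then have "\<tau> \<bullet> b i = 0" for i using that coord_scaleR[of 0 0 i] by simp
    then have "\<tau> \<bullet> u = 0" for u
      by (subst basis_expansion[of u, symmetric]) (simp add: inner_sum_right)
    then show ?thesis by (metis inner_eq_zero_iff)
  qed
  then have "inj L" using linear_injective_0[OF lin] by blast
  then have "surj L" by (intro linear_injective_imp_surjective[OF lin]) auto
  then show thesis using that by (auto simp: L_def surj_def)
qed

end

context spline_setting
begin

section \<open>Local parts as combinations of products with spanning complement\<close>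

definition ZZ :: "nat set set" where
  "ZZ = {Z. Z \<subseteq> A \<and> spans (A - Z)}"

lemma finite_ZZ: "finite ZZ"
  by (rule finite_subset[of _ "Pow A"]) (auto simp: ZZ_def)

definition combs :: "nat set set \<Rightarrow> 'n cpoly set" where
  "combs \<Z> = {q. \<exists>c. q = (\<Sum>Z\<in>\<Z>. const (c Z) * prod_form b X Z)}"

lemma combsI: "q = (\<Sum>Z\<in>\<Z>. const (c Z) * prod_form b X Z) \<Longrightarrow> q \<in> combs \<Z>"
  by (auto simp: combs_def)

lemma combs_add: "p \<in> combs \<Z> \<Longrightarrow> q \<in> combs \<Z> \<Longrightarrow> p + q \<in> combs \<Z>"
proof -
  assume "p \<in> combs \<Z>" "q \<in> combs \<Z>"
  then obtain c d where "p = (\<Sum>Z\<in>\<Z>. const (c Z) * prod_form b X Z)" "q =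
      (\<Sum>Z\<in>\<Z>. const (d Z) * prod_form b X Z)"
    by (auto simp: combs_def)
  then have "p + q = (\<Sum>Z\<in>\<Z>. const (c Z + d Z) * prod_form b X Z)"
    by (simp add: const_add distrib_right sum.distrib)
  then show ?thesis by (rule combsI)
qed

lemma combs_0: "0 \<in> combs \<Z>"
  by (rule combsI[of _ "\<lambda>_. 0"]) simp

lemma combs_const_mult: "p \<in> combs \<Z> \<Longrightarrow> const c * p \<in> combs \<Z>"
proof -
  assume "p \<in> combs \<Z>"
  then obtain d where "p = (\<Sum>Z\<in>\<Z>. const (d Z) * prod_form b X Z)" by (auto simp: combs_def)
  then have "const c * p = (\<Sum>Z\<in>\<Z>. const (c * d Z) * prod_form b X Z)"
    by (simp add: const_mult sum_distrib_left mult.assoc)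
  then show ?thesis by (rule combsI)
qed

lemma combs_sum: "(\<And>i. i \<in> S \<Longrightarrow> f i \<in> combs \<Z>) \<Longrightarrow> sum f S \<in> combs \<Z>"
  by (induction S rule: infinite_finite_induct) (auto simp: combs_0 combs_add)

lemma combs_base:
  assumes "finite \<Z>" "Z \<in> \<Z>"
  shows "prod_form b X Z \<in> combs \<Z>"
proof -
  have "(\<Sum>Z'\<in>\<Z>. const (if Z' = Z then 1 else 0) * prod_form b X Z') = (\<Sum>Z'\<in>\<Z>. if Z' =
      Z then prod_form b X Z else 0)"
    by (intro sum.cong) auto
  also have "\<dots> = prod_form b X Z" using assms by simp
  finally have "prod_form b X Z = (\<Sum>Z'\<in>\<Z>. const (if Z' = Z then 1 else 0) * prod_form b X Z')"
      by simp
  then show ?thesis by (rule combsI)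
qed

lemma central_P_combs:
  assumes "finite I" "q \<in> central_P b X I"
  shows "q \<in> combs {Z. Z \<subseteq> I \<and> span (entries X (I - Z)) = UNIV}"
proof -
  let ?\<Z> = "{Z. Z \<subseteq> I \<and> span (entries X (I - Z)) = UNIV}"
  interpret vs: vector_space "\<lambda>c (q :: 'n cpoly). const c * q" by (rule vector_space_cpoly)
  have fin: "finite ?\<Z>" by (rule finite_subset[of _ "Pow I"]) (use assms in auto)
  have "vs.subspace (combs ?\<Z>)"
    by (rule vs.subspaceI) (auto intro: combs_0 combs_add combs_const_mult)
  moreover have "{prod_form b X Z | Z. Z \<subseteq> I \<and> span (entries X (I - Z)) = UNIV} \<subseteq> combs ?\<Z>"
    using combs_base[OF fin] by auto
  ultimately have "vs.span {prod_form b X Z | Z. Z \<subseteq> I \<and> span (entries X (I - Z)) =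
      UNIV} \<subseteq> combs ?\<Z>"
    by (intro vs.span_minimal)
  then show ?thesis using assms(2) by (auto simp: central_P_def)
qed

text \<open>For each character the product over the entries it does not fix merges with a generator
  over the fixed ones; the positions left over are those left over within the fixed ones, and they
  span. The characters then enter only through the coefficients.\<close>

lemma local_part_combs:
  assumes p: "p \<in> periodic_P \<Lambda> b X"
  shows "local_part p u \<in> combs ZZ"
  unfolding local_part_def
proof (intro combs_sum combs_const_mult)
  fix e assume e: "e \<in> Poly_Mapping.keys p"
  let ?F = "fixed_positions X e"
  have F: "?F \<subseteq> A" "finite ?F" by (auto simp: fixed_positions_def)
  have "e \<in> toric_vertices \<Lambda> X" using p e by (auto simp: periodic_P_def)
  then obtain q where q: "Poly_Mapping.lookup p e = prod_form b X (A - ?F) * q"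
      "q \<in> central_P b X ?F"
    using p by (auto simp: periodic_P_def)
  let ?\<Z> = "{Z. Z \<subseteq> ?F \<and> span (entries X (?F - Z)) = UNIV}"
  obtain c where c: "q = (\<Sum>Z\<in>?\<Z>. const (c Z) * prod_form b X Z)"
    using central_P_combs[OF F(2) q(2)] by (auto simp: combs_def)
  have "prod_form b X (A - ?F) * q = (\<Sum>Z\<in>?\<Z>. const (c Z) * (prod_form b X (A - ?F) * prod_form
      b X Z))"
    unfolding c by (simp add: sum_distrib_left mult_ac)
  also have "\<dots> \<in> combs ZZ"
  proof (intro combs_sum combs_const_mult)
    fix Z assume Z: "Z \<in> ?\<Z>"
    have "prod_form b X (A - ?F) * prod_form b X Z = prod_form b X ((A - ?F) \<union> Z)"
      unfolding prod_form_def using Z F by (intro prod.union_disjoint[symmetric]) (auto intro: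
          finite_subset)
    moreover have "A - ((A - ?F) \<union> Z) = ?F - Z" using F by auto
    then have "(A - ?F) \<union> Z \<in> ZZ" using Z F by (auto simp: ZZ_def spans_def entries_def)
    ultimately show "prod_form b X (A - ?F) * prod_form b X Z \<in> combs ZZ"
      using combs_base[OF finite_ZZ] by simp
  qed
  finally show "Poly_Mapping.lookup p e \<in> combs ZZ" using q(1) by simp
qed

text \<open>Both sides are the derivative along \<open>X ! i\<close> of the same function, computed
  once formally and once from the increments of \<open>W\<close>.\<close>

lemma diff_op_lin_form_plp:
  assumes I: "spans I" "i \<in> I" "spans (I - {i})" and u: "u \<in> gen I"
  shows "diff_op (lin_form b (X ! i)) (plp I u) = plp (I - {i}) u"
proof (rule peval_inj_open[of UNIV])
  fix v
  have u': "u \<in> gen (I - {i})" using gen_mono[of "I - {i}" I] u by auto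
  have "\<forall>\<^sub>F v in nhds u. W I v = lp I u v \<and> W (I - {i}) v = lp (I - {i}) u v"
    by (intro eventually_conj lp_eventually I u u')
  then obtain S where S: "open S" "u \<in> S" "\<forall>v\<in>S. W I v = lp I u v \<and> W (I - {i}) v =
      lp (I - {i}) u v"
    unfolding eventually_nhds by blast
  have "((\<lambda>t. lp I u (v + t *\<^sub>R X ! i)) has_real_derivative lp (I - {i}) u (v + 0 *\<^sub>R X ! i))
      (at 0)"
    by (rule lp_derivative[OF I S(1) _ rpf_lp[OF I(1) u] _ rpf_lp[OF I(3) u']]) (use S in auto)
  then have "((\<lambda>t. complex_of_real (lp I u (v + t *\<^sub>R X ! i))) has_vector_derivative
      of_real (lp (I - {i}) u (v + 0 *\<^sub>R X ! i))) (at 0)"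
    by (intro has_vector_derivative_of_real) (simp add:
        has_real_derivative_iff_has_vector_derivative)
  then have "((\<lambda>t. peval b (plp I u) (v + t *\<^sub>R X ! i)) has_vector_derivative
      peval b (plp (I - {i}) u) v) (at 0)"
    by (simp add: peval_plp[OF I(1) u] peval_plp[OF I(3) u'])
  moreover have "((\<lambda>t. peval b (plp I u) (v + t *\<^sub>R X ! i)) has_vector_derivative
      peval b (diff_op (lin_form b (X ! i)) (plp I u)) v) (at 0)"
    using peval_has_vector_derivative[of "plp I u" v "X ! i" 0] by simp
  ultimately show "peval b (diff_op (lin_form b (X ! i)) (plp I u)) v =
      peval b (plp (I - {i}) u) v"
    using vector_derivative_unique_at by blast
qed auto

lemma diff_op_prod_form_plp:
  assumes "finite Z" "Z \<subseteq> A" "spans (A - Z)" "u \<in> gen A"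
  shows "diff_op (prod_form b X Z) (plp A u) = plp (A - Z) u"
  using assms
proof (induction Z)
  case empty
  then show ?case using diff_op_const[of 1 "plp A u"] by (simp add: prod_form_def)
next
  case (insert z Z)
  have sub: "A - insert z Z = A - Z - {z}" by auto
  have sp: "spans (A - Z)"
    using insert.prems(2) span_mono[of "(!) X ` (A - insert z Z)" "(!) X ` (A - Z)"]
    by (auto simp: spans_def)
  have "prod_form b X (insert z Z) = lin_form b (X ! z) * prod_form b X Z"
    using insert.hyps by (simp add: prod_form_def)
  then have "diff_op (prod_form b X (insert z Z)) (plp A u) = diff_op (lin_form b (X ! z))
      (plp (A - Z) u)"
    using insert sp by (simp add: diff_op_mult)
  also have "\<dots> = plp (A - Z - {z}) u"
    using insert sp gen_mono[of "A - Z" A] by (intro diff_op_lin_form_plp) (auto simp: sub)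
  finally show ?case unfolding sub .
qed

section \<open>Vanishing of the jump on a whole wall\<close>

definition wall_point :: "'a set \<Rightarrow> 'a \<Rightarrow> real \<Rightarrow> bool" where
  "wall_point H w r \<longleftrightarrow> w \<in> H \<and> r > 0 \<and> (\<forall>H'\<in>hyps A. H' \<noteq> H \<longrightarrow> ball w r \<inter> H' = {})"

lemma wall_point_gen: "wall_point H w r \<Longrightarrow> ball w r - H \<subseteq> gen A"
  by (auto simp: wall_point_def gen_def)

lemma lp_half_ball:
  assumes wp: "wall_point H w r" and H: "H \<in> hyps A" "a \<noteq> 0" "H = {u. a \<bullet> u = 0}"
    and I: "spans I"
    and z: "z \<in> ball w r" "y \<in> ball w r" "e * (a \<bullet> z) > 0" "e * (a \<bullet> y) > 0" "e \<noteq> 0"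
  shows "lp I z = lp I y" "W I y = lp I z y"
proof -
  let ?S = "{u \<in> ball w r. e * (a \<bullet> u) > 0}"
  have "a \<bullet> w = 0" "r > 0" using wp H by (auto simp: wall_point_def)
  then have conn: "connected ?S"
    using half_ball(1)[OF H(2)] z(5) convex_connected by blast
  have "I \<subseteq> A" using I by (simp add: spans_def)
  then have sub: "?S \<subseteq> gen I" using wall_point_gen[OF wp] H(3) gen_mono[of I A] by auto
  show "lp I z = lp I y" by (rule lp_connected[OF I conn sub]) (use z in auto)
  show "W I y = lp I z y" by (rule W_eq_lp[OF I conn sub]) (use z in auto)
qed

text \<open>The open ray through \<open>u\<close> stays in \<open>gen A\<close>. Through this, the
  regions next to a lattice point far out on a wall carry the same polynomials as their rescalings
  near \<open>w\<close>.\<close>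

lemma lp_scale:
  assumes "u \<in> gen A" "c > 0"
  shows "lp A (c *\<^sub>R u) = lp A u"
proof -
  let ?S = "(\<lambda>t. t *\<^sub>R u) ` {0<..}"
  have "connected ?S" by (intro connected_continuous_image continuous_intros) auto
  moreover have "?S \<subseteq> gen A"
  proof
    fix v assume "v \<in> ?S"
    then obtain t where t: "t > 0" "v = t *\<^sub>R u" by auto
    have "v \<notin> H" if "H \<in> hyps A" for H
    proof
      assume "v \<in> H"
      then have "(1 / t) *\<^sub>R v \<in> H" using subspace_scale[OF subspace_hyps[OF that]] by blast
      then show False using t assms(1) that by (auto simp: gen_def)
    qed
    then show "v \<in> gen A" by (auto simp: gen_def)
  qed
  moreover have "c *\<^sub>R u \<in> ?S" "u \<in> ?S" using assms(2) by (auto intro: image_eqI[of _ _ 1])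
  ultimately show ?thesis by (rule lp_connected[OF spans_all])
qed

lemma gen_uminus: "u \<in> gen A \<Longrightarrow> - u \<in> gen A"
  using subspace_neg[OF subspace_hyps] by (fastforce simp: gen_def)

text \<open>Near the lattice points \<open>\<nu> + n D w\<close> with \<open>n\<close> large, \<open>p(\<nu>,\<cdot>)(D) T\<close> takes the polynomial
  values found on the two sides of the wall at \<open>w\<close>.\<close>

lemma jump_zero_lattice_ray:
  assumes p: "p \<in> periodic_P \<Lambda> b X" and cont: "\<And>u. u \<in> \<Lambda> \<Longrightarrow> spline_continuous_at \<Lambda> b X p u"
    and H: "H \<in> hyps A" "a \<noteq> 0" "H = {u. a \<bullet> u = 0}" and \<nu>: "\<nu> \<in> H" "\<nu> \<in> \<Lambda>"
    and M: "\<And>\<mu>. \<mu> \<in> \<Lambda> \<Longrightarrow> local_part p (\<nu> + real M *\<^sub>R \<mu>) = local_part p \<nu>"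
    and wp: "wall_point H w r"
    and up: "up \<in> ball w r" "a \<bullet> up > 0" and um: "um \<in> ball w r" "a \<bullet> um < 0"
    and w': "w' \<in> H" "w' \<in> ball w r" and D: "D > 0" "real D *\<^sub>R w' = real M *\<^sub>R \<mu>" "\<mu> \<in> \<Lambda>"
  shows "peval b (diff_op (local_part p \<nu>) (plp A up - plp A um)) (\<nu> + t *\<^sub>R w') = 0"
proof (rule peval_line_zero)
  let ?q = "local_part p \<nu>"
  obtain \<kappa> where \<kappa>: "\<kappa> \<noteq> 0" "\<And>u. u \<in> gen A \<Longrightarrow> spline b X u = \<kappa> * W A u"
    using spline_eq_W by blast
  have "open {u. a \<bullet> u > 0}" by (rule open_halfspace_gt)
  moreover have "{u. a \<bullet> u > 0} \<noteq> {}" using H(2) by (auto intro: exI[of _ a])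
  ultimately obtain v where v: "a \<bullet> v > 0" "v \<in> gen A"
    by (metis (mono_tags) gen_dense mem_Collect_eq)
  \<comment> \<open>The points \<open>\<nu> + (real n * real D) *\<^sub>R w'\<close>, divided by
    \<open>real n * real D\<close>, tend to \<open>w'\<close> and so enter the ball.\<close>
  have tend: "(\<lambda>n. w' + (1 / (real n * real D)) *\<^sub>R \<nu>) \<longlonglongrightarrow> w' + 0 *\<^sub>R \<nu>"
  proof (intro tendsto_intros)
    have "(\<lambda>n. (1 / real D) * (1 / real n)) \<longlonglongrightarrow> (1 / real D) * 0"
      by (intro tendsto_intros lim_1_over_n)
    then show "(\<lambda>n. 1 / (real n * real D)) \<longlonglongrightarrow> 0" by (simp add: mult.commute)
  qed
  then have "\<forall>\<^sub>F n in sequentially. w' + (1 / (real n * real D)) *\<^sub>R \<nu> \<in> ball w r"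
    using w'(2) by (intro topological_tendstoD[OF tend]) auto
  then obtain n0 where n0: "\<And>n. n \<ge> n0 \<Longrightarrow> w' + (1 / (real n * real D)) *\<^sub>R \<nu> \<in> ball w r"
    by (auto simp: eventually_sequentially)
  have zero: "peval b (diff_op ?q (plp A up - plp A um)) (\<nu> + (real n * real D) *\<^sub>R w') = 0"
    if n: "n \<ge> n0" "n > 0" for n
  proof -
    define y where "y = \<nu> + (real n * real D) *\<^sub>R w'"
    define k where "k = real n * real D"
    have k: "k > 0" using n D by (simp add: k_def)
    have y_eq: "y = \<nu> + real M *\<^sub>R (real n *\<^sub>R \<mu>)"
    proof -
      have "(real n * real D) *\<^sub>R w' = real n *\<^sub>R (real D *\<^sub>R w')" by simp
      then show ?thesis unfolding y_def D(2) by (simp add: mult.commute)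
    qed
    have y\<Lambda>: "y \<in> \<Lambda>" unfolding y_eq using \<nu> D by (intro lattice_add lattice_scale) auto
    have yq: "local_part p y = ?q" unfolding y_eq using D by (intro M lattice_scale) auto
    have ay: "a \<bullet> y = 0" using \<nu>(1) w'(1) H(3) by (simp add: y_def inner_add_right)
    have yk: "(1 / k) *\<^sub>R y \<in> ball w r"
    proof -
      have "(1 / k) *\<^sub>R y = (1 / k) *\<^sub>R \<nu> + w'"
        using k unfolding y_def k_def[symmetric] by (simp add: scaleR_add_right)
      then show ?thesis using n0[OF n(1)] by (simp only: k_def add.commute)
    qed
    \<comment> \<open>On either side of the wall some alcove at \<open>y\<close> carries the
      polynomial of the given \<open>z\<close>: step from \<open>y\<close> in a generic direction to
      that side and rescale by \<open>1 / k\<close> into the half ball of \<open>z\<close>.\<close>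
    have side: "\<exists>C. C \<in> alcoves \<Lambda> X \<and> y \<in> closure C \<and> local_spline b X C =
        const (of_real \<kappa>) * plp A z"
      if v': "v' \<in> gen A" and e: "e * (a \<bullet> v') > 0" and z: "z \<in> ball w r" "e * (a \<bullet> z) > 0"
          for v' e z
    proof -
      obtain s0 C where C: "s0 > 0" "C \<in> alcoves \<Lambda> X" "y \<in> closure C" "\<And>s. \<lbrakk>0 < s; s < s0\<rbrakk> \<Longrightarrow>
          y + s *\<^sub>R v' \<in> C"
        using alcove_near[OF y\<Lambda> v'] by blast
      have "((\<lambda>s. (1 / k) *\<^sub>R y + (s / k) *\<^sub>R v') \<longlongrightarrow> (1 / k) *\<^sub>R y + (0 / k) *\<^sub>R v') (at_right 0)"
        using k by (intro tendsto_intros) auto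
      then have "\<forall>\<^sub>F s in at_right 0. (1 / k) *\<^sub>R y + (s / k) *\<^sub>R v' \<in> ball w r"
        using yk by (intro topological_tendstoD) auto
      moreover have "\<forall>\<^sub>F s in at_right 0. s < s0"
        using C(1) by (auto simp: eventually_at_right_field intro: exI[of _ s0])
      ultimately have "\<forall>\<^sub>F s in at_right 0. (1 / k) *\<^sub>R y + (s / k) *\<^sub>R v' \<in> ball w r \<and>
          s < s0 \<and> 0 < s"
        by (intro eventually_conj eventually_at_right_less)
      from eventually_happens'[OF trivial_limit_at_right_real this]
      obtain s where s: "(1 / k) *\<^sub>R y + (s / k) *\<^sub>R v' \<in> ball w r" "s < s0" "0 < s" by blast
      define z' where "z' = y + s *\<^sub>R v'"
      have z'C: "z' \<in> C" unfolding z'_def by (rule C(4)[OF s(3,2)])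
      have z'gen: "z' \<in> gen A" using z'C alcove(4)[OF C(2)] by auto
      have z'k: "(1 / k) *\<^sub>R z' \<in> ball w r" using s(1) by (simp add: z'_def scaleR_add_right)
      have "e \<noteq> 0" using e by auto
      have "e * (a \<bullet> ((1 / k) *\<^sub>R z')) = (s / k) * (e * (a \<bullet> v'))"
        using ay by (simp add: z'_def inner_add_right)
      then have ez': "e * (a \<bullet> ((1 / k) *\<^sub>R z')) > 0" using s k e
          by (simp only: mult_pos_pos divide_pos_pos)
      have "lp A z' = lp A ((1 / k) *\<^sub>R z')" by (rule lp_scale[symmetric]) (use z'gen k in auto)
      also have "\<dots> = lp A z" by (rule lp_half_ball(1)[OF wp H spans_all z'k z(1) ez' z(2)
          \<open>e \<noteq> 0\<close>])
      finally show ?thesis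
        using local_spline_eq[OF \<kappa>(2) C(2) z'C] plp_cong[of A z' z] C(2,3) by auto
    qed
    obtain Cp where Cp: "Cp \<in> alcoves \<Lambda> X" "y \<in> closure Cp" "local_spline b X Cp =
        const (of_real \<kappa>) * plp A up"
      using side[of v 1 up] v up by auto
    obtain Cm where Cm: "Cm \<in> alcoves \<Lambda> X" "y \<in> closure Cm" "local_spline b X Cm =
        const (of_real \<kappa>) * plp A um"
      using side[of "- v" "-1" um] v um gen_uminus by auto
    obtain c where c: "\<And>C. \<lbrakk>C \<in> alcoves \<Lambda> X; y \<in> closure C\<rbrakk> \<Longrightarrow>
        peval b (diff_op (local_part p y) (local_spline b X C)) y = c"
      using cont[OF y\<Lambda>] unfolding spline_continuous_at_def by blast
    have "of_real \<kappa> * peval b (diff_op ?q (plp A up)) y =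
        of_real \<kappa> * peval b (diff_op ?q (plp A um)) y"
      using c[OF Cp(1,2)] c[OF Cm(1,2)] unfolding Cp(3) Cm(3) yq
      by (simp add: diff_op_const_mult_right peval_mult)
    then show ?thesis using \<kappa>(1) by (simp add: diff_op_diff_right peval_diff flip: y_def)
  qed
  have "(\<lambda>n. real n * real D) ` {Suc n0..} \<subseteq> {t. peval b (diff_op ?q (plp A up - plp A um))
      (\<nu> + t *\<^sub>R w') = 0}"
    using zero by auto
  moreover have "infinite ((\<lambda>n. real n * real D) ` {Suc n0..})"
    using D(1) infinite_Ici by (subst finite_image_iff) (auto intro!: inj_onI)
  ultimately show "infinite {t. peval b (diff_op ?q (plp A up - plp A um)) (\<nu> + t *\<^sub>R w') = 0}"
    by (rule infinite_super)
qed

text \<open>Points of \<open>H\<close> near \<open>w\<close> are limits of rational combinations of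
  vectors of \<open>X\<close>, to which \<open>jump_zero_lattice_ray\<close> applies. Continuity
  extends the vanishing to all \<open>\<nu> + w'\<close> with \<open>w'\<close> in \<open>H\<close>
  near \<open>w\<close>, and polynomiality along lines extends it to all of
  \<open>H\<close>.\<close>

lemma jump_zero_on_wall:
  assumes p: "p \<in> periodic_P \<Lambda> b X" and cont: "\<And>u. u \<in> \<Lambda> \<Longrightarrow> spline_continuous_at \<Lambda> b X p u"
    and H: "H \<in> hyps A" "a \<noteq> 0" "H = {u. a \<bullet> u = 0}" and \<nu>: "\<nu> \<in> H" "\<nu> \<in> \<Lambda>"
    and wp: "wall_point H w r"
    and up: "up \<in> ball w r" "a \<bullet> up > 0" and um: "um \<in> ball w r" "a \<bullet> um < 0" and h: "h \<in> H"
  shows "peval b (diff_op (local_part p \<nu>) (plp A up - plp A um)) h = 0"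
proof -
  let ?G = "diff_op (local_part p \<nu>) (plp A up - plp A um)"
  obtain M :: nat where M: "M > 0"
    "\<And>\<nu> \<mu>. \<nu> \<in> \<Lambda> \<Longrightarrow> \<mu> \<in> \<Lambda> \<Longrightarrow> local_part p (\<nu> + real M *\<^sub>R \<mu>) = local_part p \<nu>"
    using local_part_periodic[OF p X_lattice] by blast
  have w: "w \<in> H" "r > 0" using wp by (auto simp: wall_point_def)
  obtain K where K: "K \<subseteq> A" "H = span ((!) X ` K)" using H(1) by (auto simp: hyps_def)
  have finK: "finite K" using K(1) by (rule finite_subset) simp
  have XK: "X ! j \<in> \<Lambda>" "X ! j \<in> H" if "j \<in> K" for j
    using that K X_lattice by (auto intro: span_base nth_mem)
  have on_ball: "peval b ?G (\<nu> + w') = 0" if w': "w' \<in> H" "w' \<in> ball w r" for w'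
  proof -
    have "\<exists>c. w' = (\<Sum>v\<in>(!) X ` K. c v *\<^sub>R v)"
      using w'(1) unfolding K(2) span_finite[OF finite_imageI[OF finK]] by auto
    then obtain c where c: "w' = (\<Sum>v\<in>(!) X ` K. c v *\<^sub>R v)" by blast
    let ?V = "(!) X ` K"
    \<comment> \<open>Coefficients rounded down to multiples of \<open>1 / n\<close>; then
      \<open>M * n\<close> times \<open>wn n\<close> is \<open>M\<close> times a lattice vector, a
      period of \<open>local_part p\<close>.\<close>
    define wn where "wn n = (\<Sum>v\<in>?V. (of_int \<lfloor>real n * c v\<rfloor> / real n) *\<^sub>R v)" for n
    have "wn \<longlonglongrightarrow> w'"
      unfolding wn_def[abs_def] c
    proof (intro tendsto_intros)
      fix v
      have "(\<lambda>n. c v - 1 / real n) \<longlonglongrightarrow> c v - 0" by (intro tendsto_intros lim_1_over_n)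
      then have lower: "(\<lambda>n. c v - 1 / real n) \<longlonglongrightarrow> c v" by simp
      show "(\<lambda>n. of_int \<lfloor>real n * c v\<rfloor> / real n) \<longlonglongrightarrow> c v"
      proof (rule tendsto_sandwich[OF _ _ lower tendsto_const])
        show "\<forall>\<^sub>F n in sequentially. c v - 1 / real n \<le> of_int \<lfloor>real n * c v\<rfloor> / real n"
          using eventually_gt_at_top[of 0]
        proof eventually_elim
          case (elim n)
          have "real n * c v - 1 \<le> of_int \<lfloor>real n * c v\<rfloor>" by linarith
          then have "(real n * c v - 1) / real n \<le> of_int \<lfloor>real n * c v\<rfloor> / real n"
            using elim by (intro divide_right_mono) auto
          then show ?case using elim by (simp add: diff_divide_distrib)
        qed
        show "\<forall>\<^sub>F n in sequentially. of_int \<lfloor>real n * c v\<rfloor> / real n \<le> c v"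
          using eventually_gt_at_top[of 0]
        proof eventually_elim
          case (elim n)
          have "of_int \<lfloor>real n * c v\<rfloor> / real n \<le> (real n * c v) / real n"
            using elim by (intro divide_right_mono) auto
          then show ?case using elim by simp
        qed
      qed
    qed
    then have lim: "(\<lambda>n. \<nu> + wn n) \<longlonglongrightarrow> \<nu> + w'" by (intro tendsto_intros)
    have ev: "\<forall>\<^sub>F n in sequentially. peval b ?G (\<nu> + wn n) = 0"
      using topological_tendstoD[OF \<open>wn \<longlonglongrightarrow> w'\<close> open_ball w'(2)] eventually_gt_at_top[of 0]
    proof eventually_elim
      case (elim n)
      define \<mu> where "\<mu> = (\<Sum>v\<in>?V. of_int \<lfloor>real n * c v\<rfloor> *\<^sub>R v)"
      have \<mu>: "\<mu> \<in> \<Lambda>" unfolding \<mu>_def using XK by (intro lattice_sum lattice_scale) auto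
      have wnH: "wn n \<in> H" unfolding wn_def K(2) by (intro span_sum span_scale span_base) auto
      have nw: "real n *\<^sub>R wn n = \<mu>" using elim(2) by (simp add: wn_def \<mu>_def scaleR_sum_right)
      have "real (M * n) *\<^sub>R wn n = real M *\<^sub>R (real n *\<^sub>R wn n)" by simp
      then have Dw: "real (M * n) *\<^sub>R wn n = real M *\<^sub>R \<mu>" unfolding nw .
      have Dpos: "M * n > 0" using M(1) elim(2) by simp
      have "peval b ?G (\<nu> + 1 *\<^sub>R wn n) = 0"
        by (rule jump_zero_lattice_ray[OF p cont H \<nu> M(2)[OF \<nu>(2)] wp up um wnH elim(1)
            Dpos Dw \<mu>])
      then show ?case by simp
    qed
    have "(\<lambda>n. peval b ?G (\<nu> + wn n)) \<longlonglongrightarrow> peval b ?G (\<nu> + w')"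
      by (rule isCont_tendsto_compose[OF isCont_peval lim])
    moreover have "(\<lambda>n. peval b ?G (\<nu> + wn n)) \<longlonglongrightarrow> 0"
      by (rule tendsto_eventually[OF ev])
    ultimately show ?thesis by (rule LIMSEQ_unique)
  qed
  obtain \<epsilon> where \<epsilon>: "\<epsilon> > 0" "\<And>t. \<lbrakk>0 < t; t < \<epsilon>\<rbrakk> \<Longrightarrow> w + t *\<^sub>R (h - \<nu> - w) \<in> ball w r"
    by (rule small_line_in_open[where S = "ball w r" and u = w and x = "h - \<nu> - w"])
        (use w(2) in auto)
  have "peval b ?G ((\<nu> + w) + 1 *\<^sub>R (h - \<nu> - w)) = 0"
  proof (rule peval_line_zero_ball[OF \<epsilon>(1)])
    fix t assume t: "0 < t" "t < \<epsilon>"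
    have "w + t *\<^sub>R (h - \<nu> - w) \<in> H"
      using w(1) h \<nu>(1) H(3) by (simp add: inner_add_right inner_diff_right)
    from on_ball[OF this \<epsilon>(2)[OF t]] show "peval b ?G ((\<nu> + w) + t *\<^sub>R (h - \<nu> - w)) = 0"
      by (simp add: add.assoc)
  qed
  then show ?thesis by simp
qed

end

section \<open>Laplace transforms of the jumps\<close>

context based_lattice
begin

text \<open>Leibniz rule in which the linear form can be differentiated only once. For
  \<open>k = 0\<close> the truncated exponent is harmless, as its coefficient is zero.\<close>

lemma dir_deriv_pow_lin_form_mult:
  assumes "linear \<eta>"
  shows "(dir_deriv b \<eta> ^^ k) (lin_form b x * f) =
    lin_form b x * (dir_deriv b \<eta> ^^ k) f + const (of_nat k * of_real (\<eta> x)) * (dir_deriv b \<eta> ^^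
        (k - 1)) f"
proof (induction k)
  case (Suc k)
  let ?D = "dir_deriv b \<eta>"
  have "(?D ^^ Suc k) (lin_form b x * f) =
      lin_form b x * (?D ^^ Suc k) f + const (of_real (\<eta> x)) * (?D ^^ k) f +
      const (of_nat k * of_real (\<eta> x)) * ?D ((?D ^^ (k - 1)) f)"
    by (simp add: Suc dir_deriv_add dir_deriv_mult dir_deriv_const dir_deriv_lin_form[OF
        lattice_basis assms] add_ac)
  also have "const (of_nat k * of_real (\<eta> x)) * ?D ((?D ^^ (k - 1)) f) =
      const (of_nat k * of_real (\<eta> x)) * (?D ^^ k) f"
    by (cases k) auto
  finally show ?case
    by (simp add: const_add distrib_right add_ac)
qed simp

text \<open>The product has degree \<open>card Z\<close>, so more derivations annihilate it; with
  exactly as many, each of the \<open>fact k\<close> ways to match derivations with factors gives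
  the same product.\<close>

lemma dir_deriv_pow_prod_form:
  assumes "linear \<eta>" "finite Z" "card Z \<le> k"
  shows "(dir_deriv b \<eta> ^^ k) (prod_form b X Z) =
    (if k = card Z then const (fact k * (\<Prod>z\<in>Z. of_real (\<eta> (X ! z)))) else 0)"
  using assms(2,3)
proof (induction Z arbitrary: k)
  case empty
  have "(dir_deriv b \<eta> ^^ Suc n) 1 = 0" for n
    using dir_deriv_const[of b \<eta> 1] by (simp only: funpow_Suc_right o_def const_1 dir_deriv_pow_0)
  then have "(dir_deriv b \<eta> ^^ k) 1 = (if k = 0 then 1 else 0)"
    by (cases k) simp_all
  then show ?case by (simp add: prod_form_def)
next
  case (insert z Z)
  obtain k' where k: "k = Suc k'" using insert by (cases k) auto
  have "prod_form b X (insert z Z) = lin_form b (X ! z) * prod_form b X Z"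
    using insert.hyps by (simp add: prod_form_def)
  then have "(dir_deriv b \<eta> ^^ k) (prod_form b X (insert z Z)) =
      lin_form b (X ! z) * (dir_deriv b \<eta> ^^ k) (prod_form b X Z) +
      const (of_nat k * of_real (\<eta> (X ! z))) * (dir_deriv b \<eta> ^^ k') (prod_form b X Z)"
    by (simp only: dir_deriv_pow_lin_form_mult[OF assms(1)] k diff_Suc_1)
  also have "(dir_deriv b \<eta> ^^ k) (prod_form b X Z) = 0"
    using insert.IH[of k] insert.prems insert.hyps by simp
  also have "(dir_deriv b \<eta> ^^ k') (prod_form b X Z) =
      (if k' = card Z then const (fact k' * (\<Prod>z\<in>Z. of_real (\<eta> (X ! z)))) else 0)"
    using insert.prems insert.hyps k by (intro insert.IH) auto
  finally show ?case
    using insert.hyps k by (simp add: const_mult[symmetric] mult_ac)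
qed

lemma dir_deriv_pow_kernel_mult:
  assumes "linear \<eta>" "finite Z" "\<And>z. z \<in> Z \<Longrightarrow> \<eta> (X ! z) = 0"
  shows "(dir_deriv b \<eta> ^^ k) (prod_form b X Z * f) = prod_form b X Z * (dir_deriv b \<eta> ^^ k) f"
  using assms(2,3)
proof (induction Z)
  case empty
  then show ?case by (simp add: prod_form_def)
next
  case (insert z Z)
  have "prod_form b X (insert z Z) = lin_form b (X ! z) * prod_form b X Z"
    using insert.hyps by (simp add: prod_form_def)
  then show ?case
    using insert by (simp add: mult.assoc dir_deriv_pow_lin_form_mult[OF assms(1)])
qed

end

context pointed_family
begin

text \<open>The real form of \<open>spl_Laplace\<close>, including integrability, so that complex
  linear combinations can be integrated.\<close>

lemma W_Laplace:
  assumes "spans I" "\<And>i. i \<in> I \<Longrightarrow> 0 < \<tau> \<bullet> x i"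
  shows "has_bochner_integral lborel (\<lambda>u. exp (- (\<tau> \<bullet> u)) * W I u) (\<Prod>i\<in>I. 1 / (\<tau> \<bullet> x i))"
proof (rule has_bochner_integral_nn_integral)
  note [measurable] = borel_measurable_spl[OF assms(1)]
  have [measurable]: "W I \<in> borel_measurable borel" unfolding W_def[abs_def] by measurable
  show "(\<lambda>u. exp (- (\<tau> \<bullet> u)) * W I u) \<in> borel_measurable lborel" by measurable
  show "0 \<le> (\<Prod>i\<in>I. 1 / (\<tau> \<bullet> x i))" using assms(2) by (intro prod_nonneg) (auto simp: less_imp_le)
  have "(\<integral>\<^sup>+u. ennreal (exp (- (\<tau> \<bullet> u)) * W I u) \<partial>lborel) = (\<integral>\<^sup>+u. ennreal (exp (- (\<tau> \<bullet> u))) *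
      spl I u \<partial>lborel)"
    by (intro nn_integral_cong) (simp add: ennreal_mult W_nonneg ennreal_W[OF assms(1)])
  also have "\<dots> = (\<Prod>i\<in>I. ennreal (1 / (\<tau> \<bullet> x i)))" by (rule spl_Laplace[OF assms])
  also have "\<dots> = ennreal (\<Prod>i\<in>I. 1 / (\<tau> \<bullet> x i))"
    using assms(2) by (intro prod_ennreal) (auto simp: less_imp_le)
  finally show "(\<integral>\<^sup>+u. ennreal (exp (- (\<tau> \<bullet> u)) * W I u) \<partial>lborel) =
      ennreal (\<Prod>i\<in>I. 1 / (\<tau> \<bullet> x i))" .
qed (simp add: W_nonneg)

end

context spline_setting
begin

text \<open>Since \<open>I\<close> spans, at least two of its vectors lie off \<open>H\<close>.
  Either \<open>H\<close> is no wall of \<open>I\<close>, or the jump is divisible by a positive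
  power of a form vanishing at \<open>w\<close>.\<close>

lemma lp_jump_zero:
  assumes wp: "wall_point H w r" and H: "H \<in> hyps A" "a \<noteq> 0" "H = {u. a \<bullet> u = 0}"
    and I: "spans I" "card {i \<in> I. X ! i \<notin> H} \<noteq> 1"
    and up: "up \<in> ball w r" "a \<bullet> up > 0" and um: "um \<in> ball w r" "a \<bullet> um < 0"
  shows "lp I up w = lp I um w"
proof (cases "H \<in> hyps I")
  case False
  have "I \<subseteq> A" using I by (simp add: spans_def)
  then have "ball w r \<inter> H' = {}" if "H' \<in> hyps I" for H'
    using hyps_mono[of I A] that False wp by (auto simp: wall_point_def)
  then have "ball w r \<subseteq> gen I" by (auto simp: gen_def)
  then have "lp I up = lp I um" by (rule lp_connected[OF I(1) connected_ball _ up(1) um(1)])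
  then show ?thesis by simp
next
  case True
  have w: "w \<in> H" "r > 0" using wp by (auto simp: wall_point_def)
  have IA: "I \<subseteq> A" using I by (simp add: spans_def)
  have g: "ball w r - H \<subseteq> gen I" using wall_point_gen[OF wp] gen_mono[OF IA] by auto
  have fin: "finite I" by (rule spans_finite[OF I(1)])
  have "\<not> (\<forall>i\<in>I. X ! i \<in> H)"
  proof
    assume "\<forall>i\<in>I. X ! i \<in> H"
    then have "span ((!) X ` I) \<subseteq> H" using subspace_hyps[OF H(1)] by (intro span_minimal) auto
    then have "a \<in> H" using I(1) by (auto simp: spans_def)
    then show False using H by simp
  qed
  then have "card {i \<in> I. X ! i \<notin> H} \<noteq> 0" using fin by auto
  then have card: "card {i \<in> I. X ! i \<notin> H} - 1 > 0" using I(2) by linarith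
  have gen: "up \<in> gen I" "um \<in> gen I" using g up um H(3) by auto
  have "\<exists>g. real_polynomial_function g \<and>
      (\<forall>y. lp I up y - lp I um y = (a \<bullet> y) ^ (card {i \<in> I. X ! i \<notin> H} - 1) * g y)"
  proof (rule jump_divisible[OF I(1) True H(2,3) w g])
    show "real_polynomial_function (lp I up)" "real_polynomial_function (lp I um)"
      using gen by (auto intro: rpf_lp I)
    show "W I y = lp I up y" if "y \<in> ball w r" "a \<bullet> y > 0" for y
      using lp_half_ball(2)[OF wp H I(1) up(1) that(1), of 1] up that by simp
    show "W I y = lp I um y" if "y \<in> ball w r" "a \<bullet> y < 0" for y
      using lp_half_ball(2)[OF wp H I(1) um(1) that(1), of "-1"] um that by simp
  qed
  then obtain g where "lp I up w - lp I um w = (a \<bullet> w) ^ (card {i \<in> I. X ! i \<notin> H} - 1) * g w"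
      by blast
  moreover have "a \<bullet> w = 0" using w H by auto
  ultimately show ?thesis using card by (simp add: zero_power)
qed

text \<open>On the side away from \<open>X ! i\<close> the spline is zero; on the other side it is
  constant along \<open>X ! i\<close> down to the wall, so its polynomial has the value
  \<open>W I w\<close> there. The sign records on which side \<open>up\<close> lies.\<close>

lemma lp_jump_single:
  assumes wp: "wall_point H w r" and H: "H \<in> hyps A" "a \<noteq> 0" "H = {u. a \<bullet> u = 0}"
    and I: "spans I" "{i \<in> I. X ! i \<notin> H} = {i}"
    and up: "up \<in> ball w r" "a \<bullet> up > 0" and um: "um \<in> ball w r" "a \<bullet> um < 0"
  shows "lp I up w - lp I um w = sgn (a \<bullet> X ! i) * W I w"
proof -
  let ?x = "X ! i"
  have i: "i \<in> I" "a \<bullet> ?x \<noteq> 0" and k0: "\<And>k. k \<in> I - {i} \<Longrightarrow> a \<bullet> X ! k = 0"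
    using I(2) H(3) by auto
  have IA: "I \<subseteq> A" using I by (simp add: spans_def)
  have w: "w \<in> H" "r > 0" "a \<bullet> w = 0" using wp H by (auto simp: wall_point_def)
  have g: "ball w r - H \<subseteq> gen I" using wall_point_gen[OF wp] gen_mono[OF IA] by auto
  have lin: "linear ((\<bullet>) a)" by (rule linear_inner_left')
  have inside: "lp I z w = W I w" if z: "z \<in> ball w r" "(a \<bullet> z) * (a \<bullet> ?x) > 0" for z
  proof -
    have "z \<in> gen I" using z g H(3) by auto
    then have "real_polynomial_function (lp I z)" by (rule rpf_lp[OF I(1)])
    then have rp: "real_polynomial_function (\<lambda>u. lp I z u - W I w)"
        by (intro real_polynomial_function_diff rpf_const)
    obtain \<epsilon> where \<epsilon>: "\<epsilon> > 0" "\<And>t. \<lbrakk>0 < t; t < \<epsilon>\<rbrakk> \<Longrightarrow> w + t *\<^sub>R ?x \<in> ball w r"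
      by (rule small_line_in_open[where S = "ball w r" and u = w and x = "?x"])
        (use w(2) in auto)
    have "lp I z (w + 0 *\<^sub>R ?x) - W I w = 0"
    proof (rule rpf_line_zero_ball[OF rp \<epsilon>(1)])
      fix t assume t: "0 < t" "t < \<epsilon>"
      have "(a \<bullet> ?x) * (a \<bullet> (w + t *\<^sub>R ?x)) = t * (a \<bullet> ?x)\<^sup>2"
        using w(3) by (simp add: inner_add_right power2_eq_square)
      then have "(a \<bullet> ?x) * (a \<bullet> (w + t *\<^sub>R ?x)) > 0" using t i(2) by simp
      then have "W I (w + t *\<^sub>R ?x) = lp I z (w + t *\<^sub>R ?x)"
        using z i(2) by (intro lp_half_ball(2)[OF wp H I(1) z(1) \<epsilon>(2)[OF t], of "a \<bullet> ?x"])
            (auto simp: mult.commute)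
      moreover have "W I (w + t *\<^sub>R ?x) = W I w"
        using t w(3) by (intro W_coloop_shift[OF I(1) i(1) lin k0 i(2)]) auto
      ultimately show "lp I z (w + t *\<^sub>R ?x) - W I w = 0" by simp
    qed
    then show ?thesis by simp
  qed
  have outside: "lp I z w = 0" if z: "z \<in> ball w r" "(a \<bullet> z) * (a \<bullet> ?x) < 0" for z
  proof -
    let ?e = "- (a \<bullet> ?x)"
    have ez: "?e * (a \<bullet> z) > 0" "?e \<noteq> 0" using z i(2) by (auto simp: mult.commute)
    have zg: "z \<in> gen I" using z g H(3) by auto
    have "lp I z = (\<lambda>_. 0)"
    proof (rule rpf_eq_open[OF rpf_lp[OF I(1) zg] rpf_const half_ball(2,3)[OF H(2) w(3,2) ez(2)]])
      fix v assume v: "v \<in> {u \<in> ball w r. ?e * (a \<bullet> u) > 0}"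
      have "W I v = lp I z v" by (rule lp_half_ball(2)[OF wp H I(1) z(1) _ ez(1) _ ez(2)])
          (use v in auto)
      moreover have neg: "(a \<bullet> v) / (a \<bullet> ?x) < 0" using v i(2)
        by (auto simp: divide_less_0_iff mult_less_0_iff)
      have "W I v = 0" by (rule W_coloop_neg[OF I(1) i(1) lin k0 i(2) neg])
      ultimately show "lp I z v = 0" by simp
    qed
    then show ?thesis by simp
  qed
  show ?thesis
  proof (cases "a \<bullet> ?x > 0")
    case True
    then show ?thesis using inside[OF up(1)] outside[OF um(1)] up um
        by (simp add: mult_less_0_iff)
  next
    case False
    then have "a \<bullet> ?x < 0" using i(2) by simp
    then show ?thesis using inside[OF um(1)] outside[OF up(1)] up um
      by (simp add: mult_less_0_iff zero_less_mult_iff)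
  qed
qed

text \<open>The index sets that contribute to the jump at \<open>H\<close>; all other members of
  \<open>ZZ\<close> drop out by \<open>lp_jump_zero\<close>.\<close>

definition single_off :: "'a set \<Rightarrow> nat set set" where
  "single_off H = {Z \<in> ZZ. card {i \<in> A - Z. X ! i \<notin> H} = 1}"

definition off :: "'a set \<Rightarrow> nat set \<Rightarrow> nat" where
  "off H Z = (THE i. {i \<in> A - Z. X ! i \<notin> H} = {i})"

lemma single_off:
  assumes "Z \<in> single_off H"
  shows "{i \<in> A - Z. X ! i \<notin> H} = {off H Z}" "Z \<subseteq> A" "spans (A - Z)" "off H Z \<in> A - Z"
      "X ! off H Z \<notin> H"
proof -
  have "card {i \<in> A - Z. X ! i \<notin> H} = 1" using assms by (simp add: single_off_def)
  then obtain i where i: "{i \<in> A - Z. X ! i \<notin> H} = {i}" by (rule card_1_singletonE)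
  then have "off H Z = i" unfolding off_def by (intro the_equality) auto
  with i show *: "{i \<in> A - Z. X ! i \<notin> H} = {off H Z}" by simp
  then show "off H Z \<in> A - Z" "X ! off H Z \<notin> H" by auto
  show "Z \<subseteq> A" "spans (A - Z)" using assms by (auto simp: single_off_def ZZ_def)
qed

definition rest :: "'a set \<Rightarrow> nat set \<Rightarrow> nat set" where
  "rest H Z = A - Z - {off H Z}"

text \<open>Steinitz exchange: as \<open>X ! i0\<close> is off \<open>H\<close> while
  \<open>rest H Z\<close> lies on it, \<open>X ! i0\<close> can take the place of the vector that
  depends on \<open>Z\<close>. One transversal vector then serves for all \<open>Z\<close>.\<close>

lemma rest:
  assumes Z: "Z \<in> single_off H" and H: "H \<in> hyps A" "a \<noteq> 0" "H = {u. a \<bullet> u = 0}"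
    and i0: "i0 \<in> A" "a \<bullet> X ! i0 \<noteq> 0"
  shows "insert (off H Z) (rest H Z) = A - Z" "off H Z \<notin> rest H Z" "i0 \<notin> rest H Z"
    "\<And>k. k \<in> rest H Z \<Longrightarrow> a \<bullet> X ! k = 0" "spans (insert i0 (rest H Z))"
proof -
  note Z' = single_off[OF Z]
  show ins: "insert (off H Z) (rest H Z) = A - Z" "off H Z \<notin> rest H Z"
    using Z'(4) by (auto simp: rest_def)
  show k0: "a \<bullet> X ! k = 0" if "k \<in> rest H Z" for k
    using Z'(1) that H(3) by (auto simp: rest_def)
  then show "i0 \<notin> rest H Z" using i0 by auto
  let ?S = "(!) X ` rest H Z"
  have "\<And>y. y \<in> span ?S \<Longrightarrow> a \<bullet> y = 0"
    using linear_eq_0_on_span[OF linear_inner_left'] k0 by blast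
  then have "X ! i0 \<notin> span ?S" using i0 by blast
  moreover have "X ! i0 \<in> span (insert (X ! off H Z) ?S)"
    using Z'(3) unfolding ins(1)[symmetric] by (simp add: spans_def)
  ultimately have "X ! off H Z \<in> span (insert (X ! i0) ?S)" by (rule in_span_insert[rotated])
  then have "insert (X ! off H Z) ?S \<subseteq> span (insert (X ! i0) ?S)"
    by (auto intro: span_base)
  then have "span (insert (X ! off H Z) ?S) \<subseteq> span (insert (X ! i0) ?S)"
      by (rule span_minimal) simp
  moreover have "span (insert (X ! off H Z) ?S) = UNIV"
    using Z'(3) unfolding ins(1)[symmetric] by (simp add: spans_def)
  moreover have "rest H Z \<subseteq> A" by (auto simp: rest_def)
  ultimately show "spans (insert i0 (rest H Z))"
    using i0(1) by (auto simp: spans_def)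
qed

text \<open>The jump at \<open>w\<close> is evaluated summand by summand.
  \<open>W_coloop_exchange\<close> rewrites each contribution in terms of \<open>X ! i0\<close> and
  lets the point move along it, so a relation on the wall becomes one on a half-space, after
  cancelling the common factor \<open>\<bar>a \<bullet> X ! i0\<bar>\<close>.\<close>

lemma single_off_relation:
  assumes p: "p \<in> periodic_P \<Lambda> b X" and cont: "\<And>u. u \<in> \<Lambda> \<Longrightarrow> spline_continuous_at \<Lambda> b X p u"
    and H: "H \<in> hyps A" "a \<noteq> 0" "H = {u. a \<bullet> u = 0}" and \<nu>: "\<nu> \<in> H" "\<nu> \<in> \<Lambda>"
    and q: "local_part p \<nu> = (\<Sum>Z\<in>ZZ. const (c Z) * prod_form b X Z)"
    and wp: "wall_point H w r" and i0: "i0 \<in> A" "a \<bullet> X ! i0 \<noteq> 0" and t: "t \<ge> 0"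
  shows "(\<Sum>Z\<in>single_off H. c Z / of_real (a \<bullet> X ! off H Z) * of_real (W (insert i0 (rest H Z))
      (w + t *\<^sub>R X ! i0))) = 0"
proof -
  have w: "w \<in> H" "r > 0" "a \<bullet> w = 0" using wp H by (auto simp: wall_point_def)
  obtain up where up: "up \<in> ball w r" "a \<bullet> up > 0"
    using half_ball(3)[OF H(2) w(3,2), of 1] by auto
  obtain um where um: "um \<in> ball w r" "a \<bullet> um < 0"
    using half_ball(3)[OF H(2) w(3,2), of "-1"] by auto
  have gen: "up \<in> gen A" "um \<in> gen A" using wall_point_gen[OF wp] up um H(3) by auto
  have ZZ: "finite Z" "Z \<subseteq> A" "spans (A - Z)" if "Z \<in> ZZ" for Z
    using that finite_subset[of Z A] by (auto simp: ZZ_def)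
  have gen': "up \<in> gen (A - Z)" "um \<in> gen (A - Z)" for Z using gen gen_mono[of "A - Z" A] by auto
  have "0 = peval b (diff_op (local_part p \<nu>) (plp A up - plp A um)) w"
    by (rule jump_zero_on_wall[OF p cont H \<nu> wp up um w(1), symmetric])
  also have "\<dots> = (\<Sum>Z\<in>ZZ. c Z * (peval b (diff_op (prod_form b X Z) (plp A up)) w -
      peval b (diff_op (prod_form b X Z) (plp A um)) w))"
    unfolding q by (simp add: diff_op_sum_left diff_op_mult diff_op_diff_right peval_sum
        peval_mult
        peval_diff right_diff_distrib sum_subtractf)
  also have "\<dots> = (\<Sum>Z\<in>ZZ. c Z * of_real (lp (A - Z) up w - lp (A - Z) um w))"
    using ZZ gen gen' by (intro sum.cong refl) (simp add: diff_op_prod_form_plp peval_plp)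
  also have "\<dots> = (\<Sum>Z\<in>single_off H. c Z * of_real (lp (A - Z) up w - lp (A - Z) um w))"
  proof (rule sum.mono_neutral_right[OF finite_ZZ])
    show "single_off H \<subseteq> ZZ" by (auto simp: single_off_def)
    show "\<forall>Z\<in>ZZ - single_off H. c Z * of_real (lp (A - Z) up w - lp (A - Z) um w) = 0"
    proof
      fix Z assume "Z \<in> ZZ - single_off H"
      then have Z: "Z \<in> ZZ" "card {i \<in> A - Z. X ! i \<notin> H} \<noteq> 1" by (auto simp: single_off_def)
      have "lp (A - Z) up w = lp (A - Z) um w"
        by (rule lp_jump_zero[OF wp H ZZ(3)[OF Z(1)] Z(2) up um])
      then show "c Z * of_real (lp (A - Z) up w - lp (A - Z) um w) = 0" by simp
    qed
  qed
  also have "\<dots> = (\<Sum>Z\<in>single_off H. of_real \<bar>a \<bullet> X ! i0\<bar> *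
      (c Z / of_real (a \<bullet> X ! off H Z) * of_real (W (insert i0 (rest H Z)) (w + t *\<^sub>R X ! i0))))"
  proof (rule sum.cong[OF refl])
    fix Z assume Z: "Z \<in> single_off H"
    note Z' = single_off[OF Z] and R = rest[OF Z H i0]
    let ?s = "a \<bullet> X ! off H Z" and ?W = "W (insert i0 (rest H Z)) (w + t *\<^sub>R X ! i0)"
    have s: "?s \<noteq> 0" using Z'(5) H(3) by simp
    have "W (insert (off H Z) (rest H Z)) w * \<bar>?s\<bar> = ?W * \<bar>a \<bullet> X ! i0\<bar>"
    proof (rule W_coloop_exchange[OF R(2,3) _ R(5) linear_inner_left' R(4) s i0(2)])
      show "spans (insert (off H Z) (rest H Z))" unfolding R(1) by (rule Z'(3))
    qed (use w(3) t i0(2) in \<open>auto simp: inner_add_right\<close>)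
    then have "W (A - Z) w * \<bar>?s\<bar> = ?W * \<bar>a \<bullet> X ! i0\<bar>" unfolding R(1) .
    moreover have "sgn ?s = \<bar>?s\<bar> / ?s" using s by (simp add: sgn_if)
    ultimately have "sgn ?s * W (A - Z) w = ?W * \<bar>a \<bullet> X ! i0\<bar> / ?s" by (simp add: mult.commute)
    then have "lp (A - Z) up w - lp (A - Z) um w = ?W * \<bar>a \<bullet> X ! i0\<bar> / ?s"
      using lp_jump_single[OF wp H Z'(3,1) up um] by simp
    then show "c Z * of_real (lp (A - Z) up w - lp (A - Z) um w) =
        of_real \<bar>a \<bullet> X ! i0\<bar> * (c Z / of_real ?s * of_real ?W)"
      by simp
  qed
  finally have "of_real \<bar>a \<bullet> X ! i0\<bar> * (\<Sum>Z\<in>single_off H. c Z / of_real (a \<bullet> X ! off H Z) *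
      of_real (W (insert i0 (rest H Z)) (w + t *\<^sub>R X ! i0))) = (0::complex)"
    by (simp add: sum_distrib_left)
  then show ?thesis using i0(2) by simp
qed

lemma AE_not_hyperplane:
  fixes n :: 'a
  assumes "n \<noteq> 0"
  shows "AE u in lborel. n \<bullet> u \<noteq> 0"
proof -
  have "negligible {u. n \<bullet> u = 0}" using assms by (intro negligible_hyperplane) auto
  moreover have "{u. n \<bullet> u = 0} \<in> sets lborel" by (simp add: closed_hyperplane borel_closed)
  ultimately have "{u. n \<bullet> u = 0} \<in> null_sets lborel"
    by (simp add: negligible_iff_null_sets null_sets_completion_iff)
  from AE_not_in[OF this] show ?thesis by simp
qed

text \<open>The combination of splines vanishes almost everywhere: on the side of
  \<open>X ! i0\<close> because almost every \<open>u\<close> projects along it to a point of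
  \<open>H\<close> on no other wall, and on the other side because each spline is zero there. Its
  integral against the exponential is then zero.\<close>

lemma single_off_Laplace:
  assumes p: "p \<in> periodic_P \<Lambda> b X" and cont: "\<And>u. u \<in> \<Lambda> \<Longrightarrow> spline_continuous_at \<Lambda> b X p u"
    and H: "H \<in> hyps A" "a \<noteq> 0" "H = {u. a \<bullet> u = 0}" and \<nu>: "\<nu> \<in> H" "\<nu> \<in> \<Lambda>"
    and q: "local_part p \<nu> = (\<Sum>Z\<in>ZZ. const (c Z) * prod_form b X Z)"
    and i0: "i0 \<in> A" "a \<bullet> X ! i0 \<noteq> 0" and \<tau>: "\<And>j. j \<in> A \<Longrightarrow> \<tau> \<bullet> X ! j > 0"
  shows "(\<Sum>Z\<in>single_off H. c Z / of_real (a \<bullet> X ! off H Z) *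
    of_real (\<Prod>i\<in>insert i0 (rest H Z). 1 / (\<tau> \<bullet> X ! i))) = 0"
proof -
  let ?x = "X ! i0"
  let ?F = "\<lambda>u. \<Sum>Z\<in>single_off H. (exp (- (\<tau> \<bullet> u)) * W (insert i0 (rest H Z)) u) *\<^sub>R
      (c Z / of_real (a \<bullet> X ! off H Z))"
  have F: "has_bochner_integral lborel ?F
      (\<Sum>Z\<in>single_off H. (\<Prod>i\<in>insert i0 (rest H Z). 1 / (\<tau> \<bullet> X ! i)) *\<^sub>R (c Z / of_real
          (a \<bullet> X ! off H Z)))"
  proof (intro has_bochner_integral_sum has_bochner_integral_scaleR_left)
    fix Z assume Z: "Z \<in> single_off H"
    note R = rest[OF Z H i0]
    show "has_bochner_integral lborel (\<lambda>u. exp (- (\<tau> \<bullet> u)) * W (insert i0 (rest H Z)) u)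
        (\<Prod>i\<in>insert i0 (rest H Z). 1 / (\<tau> \<bullet> X ! i))"
      using R(5) \<tau> by (intro W_Laplace) (auto simp: spans_def)
  qed
  define P where "P u = u - ((a \<bullet> u) / (a \<bullet> ?x)) *\<^sub>R ?x" for u
  have "\<forall>H'\<in>hyps A - {H}. AE u in lborel. P u \<notin> H'"
  proof
    fix H' assume H': "H' \<in> hyps A - {H}"
    then obtain a' where a': "a' \<noteq> 0" "H' = {u. a' \<bullet> u = 0}" using hyps_normal by blast
    \<comment> \<open>The pullback of the normal \<open>a'\<close> under the projection
      \<open>P\<close>; if it were zero, \<open>a'\<close> would be parallel to \<open>a\<close> and
      \<open>H'\<close> equal to \<open>H\<close>.\<close>
    define n where "n = a' - ((a' \<bullet> ?x) / (a \<bullet> ?x)) *\<^sub>R a"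
    have "n \<noteq> 0"
    proof
      assume "n = 0"
      then have *: "a' = ((a' \<bullet> ?x) / (a \<bullet> ?x)) *\<^sub>R a" by (simp add: n_def)
      then have "(a' \<bullet> ?x) / (a \<bullet> ?x) \<noteq> 0" using a'(1) by (metis scaleR_zero_left)
      then have "a' \<bullet> u = 0 \<longleftrightarrow> a \<bullet> u = 0" for u by (subst *) simp
      then show False using H' a'(2) H(3) by auto
    qed
    moreover have "a' \<bullet> P u = n \<bullet> u" for u
      by (simp add: P_def n_def inner_diff_right inner_diff_left)
    ultimately show "AE u in lborel. P u \<notin> H'"
      using AE_not_hyperplane[of n] by (simp add: a'(2))
  qed
  then have "AE u in lborel. \<forall>H'\<in>hyps A - {H}. P u \<notin> H'"
    using finite_hyps[OF finite_lessThan, of "length X"] by (subst AE_finite_all) auto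
  then have zero: "AE u in lborel. ?F u = 0"
  proof eventually_elim
    case (elim u)
    let ?t = "(a \<bullet> u) / (a \<bullet> ?x)"
    have "(\<Sum>Z\<in>single_off H. c Z / of_real (a \<bullet> X ! off H Z) * of_real (W (insert i0 (rest H Z))
        u)) = 0"
    proof (cases "?t \<ge> 0")
      case True
      have PH: "P u \<in> H" using i0(2) by (simp add: P_def H(3) inner_diff_right)
      obtain r where r: "r > 0" "\<And>H'. H' \<in> hyps A - {H} \<Longrightarrow> ball (P u) r \<inter> H' = {}"
        by (rule avoid_hyps[of "P u" UNIV "hyps A - {H}"]) (use elim in auto)
      then have "wall_point H (P u) r" using PH by (auto simp: wall_point_def)
      from single_off_relation[OF p cont H \<nu> q this i0 True] show ?thesis by (simp add: P_def)
    next
      case False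
      have "W (insert i0 (rest H Z)) u = 0" if Z: "Z \<in> single_off H" for Z
        using rest[OF Z H i0] i0(2) False
        by (intro W_coloop_neg[where \<eta> = "(\<bullet>) a" and i = i0] linear_inner_left') auto
      then show ?thesis by simp
    qed
    then have "of_real (exp (- (\<tau> \<bullet> u))) * (\<Sum>Z\<in>single_off H. c Z / of_real (a \<bullet> X ! off H Z) *
        of_real (W (insert i0 (rest H Z)) u)) = 0"
      by simp
    then show ?case
      by (simp add: sum_distrib_left scaleR_conv_of_real mult_ac)
  qed
  have "integral\<^sup>L lborel ?F = 0" by (rule integral_eq_zero_AE[OF zero])
  with has_bochner_integral_integral_eq[OF F] show ?thesis
    by (simp add: scaleR_conv_of_real mult.commute)
qed

text \<open>Factors on \<open>H\<close> are constants for the derivation, and a \<open>Z\<close> in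
  \<open>ZZ\<close> outside \<open>single_off H\<close> has fewer than \<open>k\<close> factors off
  \<open>H\<close>, so only \<open>single_off H\<close> survives \<open>k\<close> derivations. At a
  functional \<open>\<tau>\<close> positive on \<open>X\<close>, what remains is the sum in
  \<open>single_off_Laplace\<close> with denominators cleared. It vanishes for all such
  \<open>\<tau>\<close>, and therefore identically.\<close>

lemma continuous_imp_internal:
  assumes p: "p \<in> periodic_P \<Lambda> b X" and cont: "\<And>u. u \<in> \<Lambda> \<Longrightarrow> spline_continuous_at \<Lambda> b X p u"
    and H: "H \<in> hyps A" "a \<noteq> 0" "H = {u. a \<bullet> u = 0}" and \<nu>: "\<nu> \<in> H" "\<nu> \<in> \<Lambda>"
  shows "(dir_deriv b ((\<bullet>) a) ^^ (mult_off X H - 1)) (local_part p \<nu>) = 0"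
proof -
  let ?D = "dir_deriv b ((\<bullet>) a)"
  let ?off = "{i \<in> A. X ! i \<notin> H}" and ?on = "{i \<in> A. X ! i \<in> H}"
  obtain c where q: "local_part p \<nu> = (\<Sum>Z\<in>ZZ. const (c Z) * prod_form b X Z)"
    using local_part_combs[OF p] by (auto simp: combs_def)
  have "\<exists>i0\<in>A. X ! i0 \<notin> H"
  proof (rule ccontr)
    assume "\<not> ?thesis"
    then have "span ((!) X ` A) \<subseteq> H" using subspace_hyps[OF H(1)] by (intro span_minimal) auto
    then have "a \<in> H" using spans_all by (auto simp: spans_def)
    then show False using H by simp
  qed
  then obtain i0 where i0: "i0 \<in> A" "a \<bullet> X ! i0 \<noteq> 0" using H(3) by auto
  \<comment> \<open>Of the \<open>Suc k\<close> positions off \<open>H\<close>, a \<open>Z\<close>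
    in \<open>single_off H\<close> contains exactly \<open>k\<close>.\<close>
  define k where "k = mult_off X H - 1"
  have card_off: "card ?off = Suc k"
  proof -
    have "i0 \<in> ?off" using i0 H(3) by simp
    then have "card ?off > 0" by (subst card_gt_0_iff) auto
    then show ?thesis by (simp add: k_def mult_off_eq)
  qed
  have split: "(?D ^^ k) (prod_form b X Z) = prod_form b X (Z \<inter> ?on) * (?D ^^ k) (prod_form b X
      (Z \<inter> ?off))"
    if "Z \<subseteq> A" for Z
  proof -
    have fin: "finite Z" using that by (rule finite_subset) simp
    have "Z = (Z \<inter> ?on) \<union> (Z \<inter> ?off)" using that by auto
    then have *: "prod_form b X Z = prod_form b X (Z \<inter> ?on) * prod_form b X (Z \<inter> ?off)"
      unfolding prod_form_def using fin by (subst prod.union_disjoint[symmetric]) auto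
    show ?thesis
      unfolding * by (rule dir_deriv_pow_kernel_mult[OF linear_inner_left']) (use fin H(3)
          in auto)
  qed
  have card_Z: "card (Z \<inter> ?off) + card {i \<in> A - Z. X ! i \<notin> H} = Suc k" if "Z \<subseteq> A" for Z
  proof -
    have "card (Z \<inter> ?off) + card {i \<in> A - Z. X ! i \<notin> H} = card ((Z \<inter> ?off) \<union> {i \<in> A - Z. X !
        i \<notin> H})"
      using finite_subset[OF that] by (intro card_Un_disjoint[symmetric]) auto
    also have "(Z \<inter> ?off) \<union> {i \<in> A - Z. X ! i \<notin> H} = ?off" using that by auto
    finally show ?thesis using card_off by simp
  qed
  have D_zero: "(?D ^^ k) (prod_form b X Z) = 0" if Z: "Z \<in> ZZ - single_off H" for Z
  proof -
    have Z': "Z \<subseteq> A" "spans (A - Z)" "card {i \<in> A - Z. X ! i \<notin> H} \<noteq> 1" using Z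
        by (auto simp: ZZ_def single_off_def)
    have "card {i \<in> A - Z. X ! i \<notin> H} \<noteq> 0"
    proof
      assume "card {i \<in> A - Z. X ! i \<notin> H} = 0"
      then have "(!) X ` (A - Z) \<subseteq> H" by auto
      then have "span ((!) X ` (A - Z)) \<subseteq> H" using subspace_hyps[OF H(1)] by (rule span_minimal)
      then have "a \<in> H" using Z'(2) by (auto simp: spans_def)
      then show False using H by simp
    qed
    then have "card (Z \<inter> ?off) < k" using card_Z[OF Z'(1)] Z'(3) by linarith
    then show ?thesis
      using dir_deriv_pow_prod_form[OF linear_inner_left', of "Z \<inter> ?off" k a X]
          finite_subset[OF Z'(1)]
      by (simp add: split[OF Z'(1)])
  qed
  have D_single: "(?D ^^ k) (prod_form b X Z) = prod_form b X (Z \<inter> ?on) *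
      const (fact k * (\<Prod>z\<in>?off. of_real (a \<bullet> X ! z)) / of_real (a \<bullet> X ! off H Z))"
    if Z: "Z \<in> single_off H" for Z
  proof -
    note Z' = single_off[OF Z]
    have s: "a \<bullet> X ! off H Z \<noteq> 0" using Z'(5) H(3) by simp
    have card: "card (Z \<inter> ?off) = k" using card_Z[OF Z'(2)] Z'(1) by simp
    have "?off = insert (off H Z) (Z \<inter> ?off)" "off H Z \<notin> Z \<inter> ?off" using Z'(1,2,4) by auto
    moreover have "finite (Z \<inter> ?off)" using finite_subset[OF Z'(2)] by simp
    ultimately have "(\<Prod>z\<in>?off. of_real (a \<bullet> X ! z)) =
        of_real (a \<bullet> X ! off H Z) * (\<Prod>z\<in>Z \<inter> ?off. of_real (a \<bullet> X ! z) :: complex)"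
      by (metis (no_types, lifting) prod.insert)
    then have "(\<Prod>z\<in>?off. of_real (a \<bullet> X ! z)) / of_real (a \<bullet> X ! off H Z) =
        (\<Prod>z\<in>Z \<inter> ?off. of_real (a \<bullet> X ! z) :: complex)" using s by simp
    then show ?thesis
      using dir_deriv_pow_prod_form[OF linear_inner_left', of "Z \<inter> ?off" k a X] card \<open>finite
          (Z \<inter> ?off)\<close>
      by (simp add: split[OF Z'(2)] flip: times_divide_eq_right)
  qed
  define f where "f = (?D ^^ k) (local_part p \<nu>)"
  have f: "f = (\<Sum>Z\<in>single_off H. const (c Z) * (prod_form b X (Z \<inter> ?on) *
      const (fact k * (\<Prod>z\<in>?off. of_real (a \<bullet> X ! z)) / of_real (a \<bullet> X ! off H Z))))"
  proof -
    have "f = (\<Sum>Z\<in>ZZ. const (c Z) * (?D ^^ k) (prod_form b X Z))"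
      unfolding f_def q by (simp add: dir_deriv_pow_sum dir_deriv_pow_const_mult)
    also have "\<dots> = (\<Sum>Z\<in>single_off H. const (c Z) * (?D ^^ k) (prod_form b X Z))"
      using D_zero by (intro sum.mono_neutral_right finite_ZZ) (auto simp: single_off_def)
    finally show ?thesis using D_single by simp
  qed
  define dual where "dual \<tau> = (\<Sum>i\<in>UNIV. (\<tau> \<bullet> b i) *\<^sub>R b i)" for \<tau>
  have pos_zero: "peval b f (dual \<tau>) = 0" if \<tau>: "\<And>j. j \<in> A \<Longrightarrow> \<tau> \<bullet> X ! j > 0" for \<tau>
  proof -
    \<comment> \<open>The constants of \<open>f\<close> times a common denominator: the product over
      \<open>?on\<close> divided by that over \<open>rest H Z\<close> leaves the product over
      \<open>Z \<inter> ?on\<close>, and the factor at \<open>i0\<close> cancels the vector adjoined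
      for the Laplace transform.\<close>
    define C where "C = fact k * (\<Prod>z\<in>?off. of_real (a \<bullet> X ! z) :: complex) *
      of_real (\<Prod>z\<in>?on. \<tau> \<bullet> X ! z) * of_real (\<tau> \<bullet> X ! i0)"
    have "peval b f (dual \<tau>) = (\<Sum>Z\<in>single_off H. C * (c Z / of_real (a \<bullet> X ! off H Z) *
        of_real (\<Prod>i\<in>insert i0 (rest H Z). 1 / (\<tau> \<bullet> X ! i))))"
      unfolding f peval_sum
    proof (rule sum.cong[OF refl])
      fix Z assume Z: "Z \<in> single_off H"
      note Z' = single_off[OF Z] and R = rest[OF Z H i0]
      have finR: "finite (rest H Z)" by (simp add: rest_def)
      have on: "?on = (Z \<inter> ?on) \<union> rest H Z" "(Z \<inter> ?on) \<inter> rest H Z = {}"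
        using Z'(1,2,5) by (auto simp: rest_def)
      have nz: "(\<Prod>i\<in>rest H Z. \<tau> \<bullet> X ! i) \<noteq> 0"
        using \<tau> finR by (force simp: rest_def)
      have "(\<Prod>z\<in>?on. \<tau> \<bullet> X ! z) = (\<Prod>z\<in>Z \<inter> ?on. \<tau> \<bullet> X ! z) * (\<Prod>i\<in>rest H Z. \<tau> \<bullet> X ! i)"
        by (subst on(1), subst prod.union_disjoint) (use on(2) finR finite_subset[OF Z'(2)]
            in auto)
      moreover have "(\<Prod>i\<in>insert i0 (rest H Z). 1 / (\<tau> \<bullet> X ! i)) =
          1 / (\<tau> \<bullet> X ! i0) * (1 / (\<Prod>i\<in>rest H Z. \<tau> \<bullet> X ! i))"
        using R(3) finR by (simp add: prod_dividef)
      ultimately have prod: "(\<Prod>z\<in>?on. \<tau> \<bullet> X ! z) * (\<tau> \<bullet> X ! i0) * (\<Prod>i\<in>insert i0 (rest H Z). 1 /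
          (\<tau> \<bullet> X ! i)) =
          (\<Prod>z\<in>Z \<inter> ?on. \<tau> \<bullet> X ! z)"
        using nz \<tau>[OF i0(1)] by simp
      have "peval b (prod_form b X (Z \<inter> ?on)) (dual \<tau>) = of_real (\<Prod>z\<in>Z \<inter> ?on. \<tau> \<bullet> X ! z)"
        by (simp add: prod_form_def peval_prod dual_def peval_lin_form_dual)
      then show "peval b (const (c Z) * (prod_form b X (Z \<inter> ?on) *
          const (fact k * (\<Prod>z\<in>?off. of_real (a \<bullet> X ! z)) / of_real (a \<bullet> X ! off H Z)))) (dual \<tau>) =
          C * (c Z / of_real (a \<bullet> X ! off H Z) * of_real (\<Prod>i\<in>insert i0 (rest H Z). 1 /
              (\<tau> \<bullet> X ! i)))"
        unfolding peval_mult peval_const prod[symmetric] C_def of_real_mult by simp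
    qed
    also have "\<dots> = C * (\<Sum>Z\<in>single_off H. c Z / of_real (a \<bullet> X ! off H Z) *
        of_real (\<Prod>i\<in>insert i0 (rest H Z). 1 / (\<tau> \<bullet> X ! i)))"
      by (simp add: sum_distrib_left)
    finally show ?thesis using single_off_Laplace[OF p cont H \<nu> q i0 \<tau>] by simp
  qed
  have "f = 0"
  proof (rule peval_zero_imp_zero)
    fix u
    obtain \<tau> where \<tau>: "u = dual \<tau>" using dual_surj unfolding dual_def by blast
    \<comment> \<open>Starting from \<open>dir\<close>, where all pairings are positive, the line
      towards an arbitrary \<open>\<tau>\<close> stays in the positive cone for a while; a
      polynomial that vanishes there also vanishes at \<open>\<tau>\<close>.\<close>
    obtain \<epsilon> where \<epsilon>: "\<epsilon> > 0" "\<And>j. j \<in> A \<Longrightarrow> dir \<bullet> X ! j + \<epsilon> * ((\<tau> - dir) \<bullet> X ! j) > 0"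
      using small_perturbation[of A "\<lambda>j. dir \<bullet> X ! j" "\<lambda>j. (\<tau> - dir) \<bullet> X ! j"] pos by auto
    have dual_lin: "dual (dir + t *\<^sub>R (\<tau> - dir)) = dual dir + t *\<^sub>R (dual \<tau> - dual dir)" for t
      by (simp add: dual_def inner_add_left inner_diff_left algebra_simps sum.distrib
          sum_subtractf scaleR_sum_right)
    have "peval b f (dual dir + 1 *\<^sub>R (dual \<tau> - dual dir)) = 0"
    proof (rule peval_line_zero_ball[OF \<epsilon>(1)])
      fix t assume t: "0 < t" "t < \<epsilon>"
      have "(dir + t *\<^sub>R (\<tau> - dir)) \<bullet> X ! j > 0" if j: "j \<in> A" for j
      proof -
        have "(dir + t *\<^sub>R (\<tau> - dir)) \<bullet> X ! j =
            (1 - t / \<epsilon>) * (dir \<bullet> X ! j) + (t / \<epsilon>) * (dir \<bullet> X ! j + \<epsilon> * ((\<tau> - dir) \<bullet> X ! j))"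
          using \<epsilon>(1) by (simp add: inner_add_left algebra_simps)
        also have "\<dots> > 0"
        proof -
          have "0 < 1 - t / \<epsilon>" "0 < t / \<epsilon>" using t \<epsilon>(1) by auto
          then show ?thesis by (metis add_pos_pos mult_pos_pos pos \<epsilon>(2) j)
        qed
        finally show ?thesis .
      qed
      then have "peval b f (dual (dir + t *\<^sub>R (\<tau> - dir))) = 0" by (rule pos_zero)
      then show "peval b f (dual dir + t *\<^sub>R (dual \<tau> - dual dir)) = 0" unfolding dual_lin .
    qed
    then show "peval b f u = 0" by (simp add: \<tau>)
  qed
  then show ?thesis by (simp add: f_def k_def)
qed

lemma internal_periodic_P_eq:
  "internal_periodic_P \<Lambda> b X = {p \<in> periodic_P \<Lambda> b X. \<forall>u\<in>\<Lambda>. spline_continuous_at \<Lambda> b X p u}"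
proof (intro equalityI subsetI)
  fix p assume p: "p \<in> internal_periodic_P \<Lambda> b X"
  then have "p \<in> periodic_P \<Lambda> b X" by (simp add: internal_periodic_P_def)
  then show "p \<in> {p \<in> periodic_P \<Lambda> b X. \<forall>u\<in>\<Lambda>. spline_continuous_at \<Lambda> b X p u}"
    using internal_imp_continuous[OF p] by simp
next
  fix p assume "p \<in> {p \<in> periodic_P \<Lambda> b X. \<forall>u\<in>\<Lambda>. spline_continuous_at \<Lambda> b X p u}"
  then have p: "p \<in> periodic_P \<Lambda> b X" and cont: "\<And>u. u \<in> \<Lambda> \<Longrightarrow> spline_continuous_at \<Lambda> b X p u"
      by auto
  have "(dir_deriv b \<eta> ^^ (mult_off X H - 1)) (local_part p u) = 0"
    if H: "H \<in> hyperplanes X" and \<eta>: "linear \<eta>" "\<eta> \<noteq> (\<lambda>_. 0)" "\<forall>h\<in>H. \<eta> h = 0" and u: "u \<in> H"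
        "u \<in> \<Lambda>" for H \<eta> u
  proof -
    have H': "H \<in> hyps A" using H by (simp add: hyperplanes_eq)
    then have dim: "dim H = DIM('a) - 1" by (simp add: hyps_def)
    \<comment> \<open>Any normal functional is the inner product with some \<open>a\<close> whose
      kernel is \<open>H\<close>, the form in which the converse was proved.\<close>
    obtain a where a: "a \<noteq> 0" "H = {u. a \<bullet> u = 0}" "\<eta> = (\<bullet>) a"
      by (rule hyperplane_kernel[OF subspace_hyps[OF H'] dim \<eta>(1,2)]) (use \<eta>(3) in auto)
    show ?thesis unfolding a(3) by (rule continuous_imp_internal[OF p cont H' a(1,2) u])
  qed
  with p show "p \<in> internal_periodic_P \<Lambda> b X" by (simp add: internal_periodic_P_def)
qed

end

theorem theorem6p11:
  fixes \<Lambda> :: "'a::euclidean_space set"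
    and b :: "'n::finite \<Rightarrow> 'a"
    and X :: "'a list"
  assumes "lattice_basis \<Lambda> b"
    and "set X \<subseteq> \<Lambda>"
    and "span (set X) = UNIV"
    and "0 \<notin> convex hull (set X)"
  shows "internal_periodic_P \<Lambda> b X =
           {p \<in> periodic_P \<Lambda> b X. \<forall>u\<in>\<Lambda>. spline_continuous_at \<Lambda> b X p u}"
proof -
  interpret spline_setting \<Lambda> b X
    using assms by unfold_locales
  show ?thesis by (rule internal_periodic_P_eq)
qed

end
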